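(* Let $R$ be a commutative Noetherian ring with nonzero identity, $\mathfrak{a},\mathfrak{b}$ two ideals of $R$ and $X\in\mathcal{D}^f_{\Box}(R)$. Assume that $R$ possesses a normalized dualizing complex $D$, and set $X^\dagger:=\mathbf{R}\mathrm{Hom}_R(X,D)$. Then, in $\mathcal{D}(R)$, $$\mathfrak{F}_{\mathfrak{a},\mathfrak{b}}(X)\simeq \mathbf{R}\mathrm{Hom}_R(\mathbf{R}\Gamma_{\mathfrak{a}}(X^\dagger),\mathbf{R}\Gamma_{\mathfrak{b}}(D)).$$
   Context: $\mathcal{D}(R)$ is the derived category of $R$-modules, with homological grading; $\sup X=\sup\{i:H_i(X)\neq0\}$. $\mathcal{D}_{\Box}(R)$ is the full subcategory of homologically bounded complexes, and $\mathcal{D}^f_{\Box}(R)$ that of homologically bounded complexes with all homology modules finitely generated. For an ideal $\mathfrak{a}$: $\mathbf{R}\Gamma_{\mathfrak{a}}(X):=\Gamma_{\mathfrak{a}}(I)$ for $I$ a $K$-injective resolution of $X$, where $\Gamma_{\mathfrak{a}}(-)=\varinjlim_n\mathrm{Hom}_R(R/\mathfrak{a}^n,-)$; $\mathbf{L}\Lambda^{\mathfrak{a}}(X):=\Lambda^{\mathfrak{a}}(P)$ for $P$ a $K$-projective resolution of $X$, where $\Lambda^{\mathfrak{a}}(-)=\varprojlim_n(R/\mathfrak{a}^n\otimes_R-)$. The formal local complex is $\mathfrak{F}_{\mathfrak{a},\mathfrak{b}}(X):=\mathbf{L}\Lambda^{\mathfrak{a}}(\mathbf{R}\Gamma_{\mathfrak{b}}(X))$.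 A dualizing complex of $R$ is a complex $D\in\mathcal{D}^f_{\Box}(R)$ of finite injective dimension (isomorphic in $\mathcal{D}(R)$ to a bounded complex of injective modules) such that the homothety morphism $R\to\mathbf{R}\mathrm{Hom}_R(D,D)$ is an isomorphism in $\mathcal{D}(R)$. It is normalized if $\sup D=\dim R$ (a ring with a dualizing complex has finite dimension). *)

theory Defs
  imports "HOL-Library.Extended_Real" "HOL-Algebra.Module" "HOL-Algebra.Ideal_Product"
    "HOL-Algebra.Ring_Divisibility"
begin

section \<open>Modules\<close>

text \<open>Modules are HOL-Algebra modules. The ring fields \<open>mult\<close> and \<open>one\<close> of a module record
  are never used.\<close>

definition ring_module :: "('r, 'm) ring_scheme \<Rightarrow> ('r, 'r) module" where
  "ring_module R = \<lparr>carrier = carrier R, monoid.mult = monoid.mult R, one = \<one>\<^bsub>R\<^esub>, ring.zero = \<zero>\<^bsub>R\<^esub>,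
     ring.add = ring.add R, smult = monoid.mult R\<rparr>"

definition mod_hom :: "('r, 'm) ring_scheme \<Rightarrow> ('r, 'a) module \<Rightarrow> ('r, 'b) module \<Rightarrow> ('a \<Rightarrow> 'b) set" where
  "mod_hom R M N = {f. f \<in> carrier M \<rightarrow> carrier N \<and>
     (\<forall>x\<in>carrier M. \<forall>y\<in>carrier M. f (x \<oplus>\<^bsub>M\<^esub> y) = f x \<oplus>\<^bsub>N\<^esub> f y) \<and>
     (\<forall>r\<in>carrier R. \<forall>x\<in>carrier M. f (r \<odot>\<^bsub>M\<^esub> x) = r \<odot>\<^bsub>N\<^esub> f x)}"

definition hom_module :: "('r, 'm) ring_scheme \<Rightarrow> ('r, 'a) module \<Rightarrow> ('r, 'b) module \<Rightarrow> ('r, 'a \<Rightarrow> 'b) module" where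
  "hom_module R M N = \<lparr>carrier = mod_hom R M N \<inter> extensional (carrier M),
     monoid.mult = undefined, one = undefined,
     ring.zero = (\<lambda>x\<in>carrier M. \<zero>\<^bsub>N\<^esub>),
     ring.add = (\<lambda>f g. \<lambda>x\<in>carrier M. f x \<oplus>\<^bsub>N\<^esub> g x),
     smult = (\<lambda>r f. \<lambda>x\<in>carrier M. r \<odot>\<^bsub>N\<^esub> f x)\<rparr>"

definition prod_module :: "('i \<Rightarrow> ('r, 'a) module) \<Rightarrow> ('r, 'i \<Rightarrow> 'a) module" where
  "prod_module M = \<lparr>carrier = {f. \<forall>i. f i \<in> carrier (M i)},
     monoid.mult = undefined, one = undefined,
     ring.zero = (\<lambda>i. \<zero>\<^bsub>M i\<^esub>),
     ring.add = (\<lambda>f g i. f i \<oplus>\<^bsub>M i\<^esub> g i),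
     smult = (\<lambda>r f i. r \<odot>\<^bsub>M i\<^esub> f i)\<rparr>"

definition mod_span :: "('r, 'm) ring_scheme \<Rightarrow> ('r, 'a) module \<Rightarrow> 'a set \<Rightarrow> 'a set" where
  "mod_span R M S = \<Inter>{N. submodule N R M \<and> S \<subseteq> N}"

definition finitely_generated :: "('r, 'm) ring_scheme \<Rightarrow> ('r, 'a) module \<Rightarrow> bool" where
  "finitely_generated R M \<longleftrightarrow> (\<exists>S. finite S \<and> S \<subseteq> carrier M \<and> mod_span R M S = carrier M)"

definition quot_module :: "('r, 'a) module \<Rightarrow> 'a set \<Rightarrow> ('r, 'a set) module" where
  "quot_module M N = \<lparr>carrier = a_rcosets\<^bsub>M\<^esub> N,
     monoid.mult = undefined, one = undefined,
     ring.zero = N,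
     ring.add = set_add M,
     smult = (\<lambda>r A. \<Union>x\<in>A. N +>\<^bsub>M\<^esub> (r \<odot>\<^bsub>M\<^esub> x))\<rparr>"

text \<open>The map into \<open>quot_module M N\<close> induced by \<open>f\<close> on a quotient module: all cosets in the
  union coincide when \<open>f\<close> is compatible with the submodules.\<close>

definition quot_map :: "('r, 'b) module \<Rightarrow> 'b set \<Rightarrow> ('a \<Rightarrow> 'b) \<Rightarrow> 'a set \<Rightarrow> 'b set" where
  "quot_map M N f A = (\<Union>x\<in>A. N +>\<^bsub>M\<^esub> f x)"


subsection \<open>Tensor products\<close>

definition free_module :: "('r, 'm) ring_scheme \<Rightarrow> 's set \<Rightarrow> ('r, 's \<Rightarrow> 'r) module" where
  "free_module R S = \<lparr>carrier = {\<phi>. (\<forall>s. \<phi> s \<in> carrier R) \<and> finite {s. \<phi> s \<noteq> \<zero>\<^bsub>R\<^esub>} \<and> {s. \<phi> s \<noteq> \<zero>\<^bsub>R\<^esub>} \<subseteq> S},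
     monoid.mult = undefined, one = undefined,
     ring.zero = (\<lambda>s. \<zero>\<^bsub>R\<^esub>),
     ring.add = (\<lambda>\<phi> \<psi> s. \<phi> s \<oplus>\<^bsub>R\<^esub> \<psi> s),
     smult = (\<lambda>r \<phi> s. r \<otimes>\<^bsub>R\<^esub> \<phi> s)\<rparr>"

definition free_gen :: "('r, 'm) ring_scheme \<Rightarrow> 's \<Rightarrow> 's \<Rightarrow> 'r" where
  "free_gen R s = (\<lambda>t. if t = s then \<one>\<^bsub>R\<^esub> else \<zero>\<^bsub>R\<^esub>)"

abbreviation free_pairs :: "('r, 'm) ring_scheme \<Rightarrow> ('r, 'a) module \<Rightarrow> ('r, 'b) module \<Rightarrow> ('r, 'a \<times> 'b \<Rightarrow> 'r) module" where
  "free_pairs R M N \<equiv> free_module R (carrier M \<times> carrier N)"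

definition bilinear_relations :: "('r, 'm) ring_scheme \<Rightarrow> ('r, 'a) module \<Rightarrow> ('r, 'b) module \<Rightarrow> ('a \<times> 'b \<Rightarrow> 'r) set" where
  "bilinear_relations R M N =
     {free_gen R (x \<oplus>\<^bsub>M\<^esub> x', y) \<ominus>\<^bsub>free_pairs R M N\<^esub> (free_gen R (x, y) \<oplus>\<^bsub>free_pairs R M N\<^esub> free_gen R (x', y))
       | x x' y. x \<in> carrier M \<and> x' \<in> carrier M \<and> y \<in> carrier N} \<union>
     {free_gen R (x, y \<oplus>\<^bsub>N\<^esub> y') \<ominus>\<^bsub>free_pairs R M N\<^esub> (free_gen R (x, y) \<oplus>\<^bsub>free_pairs R M N\<^esub> free_gen R (x, y'))
       | x y y'. x \<in> carrier M \<and> y \<in> carrier N \<and> y' \<in> carrier N} \<union>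
     {free_gen R (r \<odot>\<^bsub>M\<^esub> x, y) \<ominus>\<^bsub>free_pairs R M N\<^esub> (r \<odot>\<^bsub>free_pairs R M N\<^esub> free_gen R (x, y))
       | r x y. r \<in> carrier R \<and> x \<in> carrier M \<and> y \<in> carrier N} \<union>
     {free_gen R (x, r \<odot>\<^bsub>N\<^esub> y) \<ominus>\<^bsub>free_pairs R M N\<^esub> (r \<odot>\<^bsub>free_pairs R M N\<^esub> free_gen R (x, y))
       | r x y. r \<in> carrier R \<and> x \<in> carrier M \<and> y \<in> carrier N}"

definition tensor_kernel :: "('r, 'm) ring_scheme \<Rightarrow> ('r, 'a) module \<Rightarrow> ('r, 'b) module \<Rightarrow> ('a \<times> 'b \<Rightarrow> 'r) set" where
  "tensor_kernel R M N = mod_span R (free_pairs R M N) (bilinear_relations R M N)"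

definition tensor :: "('r, 'm) ring_scheme \<Rightarrow> ('r, 'a) module \<Rightarrow> ('r, 'b) module \<Rightarrow> ('r, ('a \<times> 'b \<Rightarrow> 'r) set) module" where
  "tensor R M N = quot_module (free_pairs R M N) (tensor_kernel R M N)"

text \<open>\<open>tensor_map R M' N' f g\<close> is the map \<open>f \<otimes> g\<close> into \<open>M' \<otimes> N'\<close>, induced by the map of free
  modules that sends the generator \<open>(x, y)\<close> to the generator \<open>(f x, g y)\<close>.\<close>

definition tensor_map :: "('r, 'm) ring_scheme \<Rightarrow> ('r, 'c) module \<Rightarrow> ('r, 'd) module \<Rightarrow>
    ('a \<Rightarrow> 'c) \<Rightarrow> ('b \<Rightarrow> 'd) \<Rightarrow> ('a \<times> 'b \<Rightarrow> 'r) set \<Rightarrow> ('c \<times> 'd \<Rightarrow> 'r) set" where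
  "tensor_map R M' N' f g = quot_map (free_pairs R M' N') (tensor_kernel R M' N')
     (\<lambda>\<phi> t. finsum R \<phi> {p. \<phi> p \<noteq> \<zero>\<^bsub>R\<^esub> \<and> map_prod f g p = t})"


subsection \<open>Sequential limits\<close>

text \<open>Direct limit of \<open>F 0 \<rightarrow> F 1 \<rightarrow> \<dots>\<close> with transition maps \<open>t m n\<close> from \<open>F m\<close> to \<open>F n\<close> for
  \<open>m \<le> n\<close>, as a quotient of the disjoint union. Each union below is over equal classes.\<close>

definition dirlim_class :: "(nat \<Rightarrow> ('r, 'a) module) \<Rightarrow> (nat \<Rightarrow> nat \<Rightarrow> 'a \<Rightarrow> 'a) \<Rightarrow> nat \<Rightarrow> 'a \<Rightarrow> (nat \<times> 'a) set" where
  "dirlim_class F t m x = {(n, y). y \<in> carrier (F n) \<and> (\<exists>k. m \<le> k \<and> n \<le> k \<and> t m k x = t n k y)}"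

definition dirlim :: "(nat \<Rightarrow> ('r, 'a) module) \<Rightarrow> (nat \<Rightarrow> nat \<Rightarrow> 'a \<Rightarrow> 'a) \<Rightarrow> ('r, (nat \<times> 'a) set) module" where
  "dirlim F t = \<lparr>carrier = {dirlim_class F t m x | m x. x \<in> carrier (F m)},
     monoid.mult = undefined, one = undefined,
     ring.zero = dirlim_class F t 0 \<zero>\<^bsub>F 0\<^esub>,
     ring.add = (\<lambda>A B. \<Union>(m, x)\<in>A. \<Union>(n, y)\<in>B.
              dirlim_class F t (max m n) (t m (max m n) x \<oplus>\<^bsub>F (max m n)\<^esub> t n (max m n) y)),
     smult = (\<lambda>r A. \<Union>(m, x)\<in>A. dirlim_class F t m (r \<odot>\<^bsub>F m\<^esub> x))\<rparr>"

text \<open>Inverse limit of \<open>F 0 \<leftarrow> F 1 \<leftarrow> \<dots>\<close> with transition maps \<open>t n m\<close> from \<open>F n\<close> to \<open>F m\<close> for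
  \<open>m \<le> n\<close>.\<close>

definition invlim :: "(nat \<Rightarrow> ('r, 'a) module) \<Rightarrow> (nat \<Rightarrow> nat \<Rightarrow> 'a \<Rightarrow> 'a) \<Rightarrow> ('r, nat \<Rightarrow> 'a) module" where
  "invlim F t = (prod_module F)\<lparr>carrier := {s \<in> carrier (prod_module F). \<forall>m n. m \<le> n \<longrightarrow> t n m (s n) = s m}\<rparr>"


subsection \<open>Torsion and completion functors\<close>

primrec ideal_power :: "('r, 'm) ring_scheme \<Rightarrow> 'r set \<Rightarrow> nat \<Rightarrow> 'r set" where
  "ideal_power R I 0 = carrier R"
| "ideal_power R I (Suc n) = ideal_prod R I (ideal_power R I n)"

abbreviation quot_power :: "('r, 'm) ring_scheme \<Rightarrow> 'r set \<Rightarrow> nat \<Rightarrow> ('r, 'r set) module" where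
  "quot_power R I n \<equiv> quot_module (ring_module R) (ideal_power R I n)"

text \<open>The canonical surjection onto \<open>R/I\<^sup>m\<close> from \<open>R/I\<^sup>n\<close>, for \<open>m \<le> n\<close>.\<close>

abbreviation quot_power_proj :: "('r, 'm) ring_scheme \<Rightarrow> 'r set \<Rightarrow> nat \<Rightarrow> 'r set \<Rightarrow> 'r set" where
  "quot_power_proj R I m \<equiv> quot_map (ring_module R) (ideal_power R I m) (\<lambda>x. x)"

definition Gamma_sys :: "('r, 'm) ring_scheme \<Rightarrow> 'r set \<Rightarrow> ('r, 'a) module \<Rightarrow> nat \<Rightarrow> ('r, 'r set \<Rightarrow> 'a) module" where
  "Gamma_sys R I M n = hom_module R (quot_power R I n) M"

definition Gamma_trans :: "('r, 'm) ring_scheme \<Rightarrow> 'r set \<Rightarrow> nat \<Rightarrow> nat \<Rightarrow> ('r set \<Rightarrow> 'a) \<Rightarrow> 'r set \<Rightarrow> 'a" where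
  "Gamma_trans R I m n f = (\<lambda>A\<in>carrier (quot_power R I n). f (quot_power_proj R I m A))"

definition Gamma_module :: "('r, 'm) ring_scheme \<Rightarrow> 'r set \<Rightarrow> ('r, 'a) module \<Rightarrow> ('r, (nat \<times> ('r set \<Rightarrow> 'a)) set) module" where
  "Gamma_module R I M = dirlim (Gamma_sys R I M) (Gamma_trans R I)"

definition Gamma_map :: "('r, 'm) ring_scheme \<Rightarrow> 'r set \<Rightarrow> ('r, 'b) module \<Rightarrow> ('a \<Rightarrow> 'b) \<Rightarrow>
    (nat \<times> ('r set \<Rightarrow> 'a)) set \<Rightarrow> (nat \<times> ('r set \<Rightarrow> 'b)) set" where
  "Gamma_map R I M' g \<xi> = (\<Union>(n, f)\<in>\<xi>.
     dirlim_class (Gamma_sys R I M') (Gamma_trans R I) n (\<lambda>A\<in>carrier (quot_power R I n). g (f A)))"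

definition Lambda_module :: "('r, 'm) ring_scheme \<Rightarrow> 'r set \<Rightarrow> ('r, 'a) module \<Rightarrow> ('r, nat \<Rightarrow> ('r set \<times> 'a \<Rightarrow> 'r) set) module" where
  "Lambda_module R I M = invlim (\<lambda>n. tensor R (quot_power R I n) M)
     (\<lambda>n m. tensor_map R (quot_power R I m) M (quot_power_proj R I m) (\<lambda>x. x))"

definition Lambda_map :: "('r, 'm) ring_scheme \<Rightarrow> 'r set \<Rightarrow> ('r, 'b) module \<Rightarrow> ('a \<Rightarrow> 'b) \<Rightarrow>
    (nat \<Rightarrow> ('r set \<times> 'a \<Rightarrow> 'r) set) \<Rightarrow> nat \<Rightarrow> ('r set \<times> 'b \<Rightarrow> 'r) set" where
  "Lambda_map R I M' g s = (\<lambda>n. tensor_map R (quot_power R I n) M' (\<lambda>A. A) g (s n))"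


section \<open>Complexes\<close>

text \<open>Homological grading: \<open>dif X i\<close> maps \<open>obj X i\<close> to \<open>obj X (i - 1)\<close>.\<close>

record ('r, 'a) cpx =
  obj :: "int \<Rightarrow> ('r, 'a) module"
  dif :: "int \<Rightarrow> 'a \<Rightarrow> 'a"

definition chain_complex :: "('r, 'm) ring_scheme \<Rightarrow> ('r, 'a) cpx \<Rightarrow> bool" where
  "chain_complex R X \<longleftrightarrow>
     (\<forall>i. Module.module R (obj X i)) \<and>
     (\<forall>i. dif X i \<in> mod_hom R (obj X i) (obj X (i - 1))) \<and>
     (\<forall>i. \<forall>x\<in>carrier (obj X i). dif X (i - 1) (dif X i x) = \<zero>\<^bsub>obj X (i - 1 - 1)\<^esub>)"

definition cycles :: "('r, 'a) cpx \<Rightarrow> int \<Rightarrow> ('r, 'a) module" where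
  "cycles X i = (obj X i)\<lparr>carrier := {x \<in> carrier (obj X i). dif X i x = \<zero>\<^bsub>obj X (i - 1)\<^esub>}\<rparr>"

definition boundaries :: "('r, 'a) cpx \<Rightarrow> int \<Rightarrow> 'a set" where
  "boundaries X i = dif X (i + 1) ` carrier (obj X (i + 1))"

definition homology :: "('r, 'a) cpx \<Rightarrow> int \<Rightarrow> ('r, 'a set) module" where
  "homology X i = quot_module (cycles X i) (boundaries X i)"

definition zero_homology :: "('r, 'a) cpx \<Rightarrow> int \<Rightarrow> bool" where
  "zero_homology X i \<longleftrightarrow> carrier (homology X i) = {\<zero>\<^bsub>homology X i\<^esub>}"

definition acyclic_cpx :: "('r, 'a) cpx \<Rightarrow> bool" where
  "acyclic_cpx X \<longleftrightarrow> (\<forall>i. zero_homology X i)"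

definition homologically_bounded :: "('r, 'a) cpx \<Rightarrow> bool" where
  "homologically_bounded X \<longleftrightarrow> (\<exists>n. \<forall>i. n < \<bar>i\<bar> \<longrightarrow> zero_homology X i)"

text \<open>The objects of the category of homologically bounded complexes with finitely generated
  homology.\<close>

definition Dfb :: "('r, 'm) ring_scheme \<Rightarrow> ('r, 'a) cpx \<Rightarrow> bool" where
  "Dfb R X \<longleftrightarrow> chain_complex R X \<and> homologically_bounded X \<and> (\<forall>i. finitely_generated R (homology X i))"

definition hsup :: "('r, 'a) cpx \<Rightarrow> ereal" where
  "hsup X = Sup {ereal (of_int i) | i. \<not> zero_homology X i}"

definition chain_map :: "('r, 'm) ring_scheme \<Rightarrow> ('r, 'a) cpx \<Rightarrow> ('r, 'b) cpx \<Rightarrow> (int \<Rightarrow> 'a \<Rightarrow> 'b) \<Rightarrow> bool" where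
  "chain_map R X Y f \<longleftrightarrow> chain_complex R X \<and> chain_complex R Y \<and>
     (\<forall>i. f i \<in> mod_hom R (obj X i) (obj Y i)) \<and>
     (\<forall>i. \<forall>x\<in>carrier (obj X i). dif Y i (f i x) = f (i - 1) (dif X i x))"

definition quasi_iso :: "('r, 'm) ring_scheme \<Rightarrow> ('r, 'a) cpx \<Rightarrow> ('r, 'b) cpx \<Rightarrow> (int \<Rightarrow> 'a \<Rightarrow> 'b) \<Rightarrow> bool" where
  "quasi_iso R X Y f \<longleftrightarrow> chain_map R X Y f \<and>
     (\<forall>i. bij_betw (quot_map (cycles Y i) (boundaries Y i) (f i))
            (carrier (homology X i)) (carrier (homology Y i)))"

text \<open>\<open>X\<close> and \<open>Y\<close> are isomorphic in the derived category iff there is a roof of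
  quasi-isomorphisms from some \<open>Z\<close> to both. The carrier type of \<open>Z\<close> is no restriction: if there is
  any roof, then one can take for \<open>Z\<close> a resolution of \<open>X\<close> by free modules, which has at most
  as many elements as there are finite lists over \<open>'r + 'a + nat\<close>.\<close>

definition derived_iso :: "('r, 'm) ring_scheme \<Rightarrow> ('r, 'a) cpx \<Rightarrow> ('r, 'b) cpx \<Rightarrow> bool" where
  "derived_iso R X Y \<longleftrightarrow>
     (\<exists>(Z :: ('r, ('r + 'a + 'b + nat) list) cpx) f g. quasi_iso R Z X f \<and> quasi_iso R Z Y g)"

definition hom_cpx :: "('r, 'm) ring_scheme \<Rightarrow> ('r, 'a) cpx \<Rightarrow> ('r, 'b) cpx \<Rightarrow> ('r, int \<Rightarrow> 'a \<Rightarrow> 'b) cpx" where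
  "hom_cpx R X Y = \<lparr>
     obj = (\<lambda>n. prod_module (\<lambda>i. hom_module R (obj X i) (obj Y (i + n)))),
     dif = (\<lambda>n f i. \<lambda>x\<in>carrier (obj X i).
        (if even n
         then dif Y (i + n) (f i x) \<ominus>\<^bsub>obj Y (i + n - 1)\<^esub> f (i - 1) (dif X i x)
         else dif Y (i + n) (f i x) \<oplus>\<^bsub>obj Y (i + n - 1)\<^esub> f (i - 1) (dif X i x)))\<rparr>"

definition Gamma_cpx :: "('r, 'm) ring_scheme \<Rightarrow> 'r set \<Rightarrow> ('r, 'a) cpx \<Rightarrow> ('r, (nat \<times> ('r set \<Rightarrow> 'a)) set) cpx" where
  "Gamma_cpx R I X = \<lparr>obj = (\<lambda>i. Gamma_module R I (obj X i)),
     dif = (\<lambda>i. Gamma_map R I (obj X (i - 1)) (dif X i))\<rparr>"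

definition Lambda_cpx :: "('r, 'm) ring_scheme \<Rightarrow> 'r set \<Rightarrow> ('r, 'a) cpx \<Rightarrow> ('r, nat \<Rightarrow> ('r set \<times> 'a \<Rightarrow> 'r) set) cpx" where
  "Lambda_cpx R I X = \<lparr>obj = (\<lambda>i. Lambda_module R I (obj X i)),
     dif = (\<lambda>i. Lambda_map R I (obj X (i - 1)) (dif X i))\<rparr>"


section \<open>Resolutions and derived functors\<close>

text \<open>HOL cannot quantify over all modules at once, so the defining properties of injective
  modules and of K-injective and K-projective complexes are tested on modules carried by subsets
  of a universe \<open>('r, 'v) univ\<close>, in which the object under test lives as well; \<open>'v\<close> is arbitrary.
  The function type makes the universe (for nontrivial \<open>'v\<close>) closed under powers indexed by
  \<open>'r + nat\<close>. By Baer's criterion and cardinality, every module or complex in the universe then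
  has injective, K-injective (with injective terms) and K-projective resolutions inside the
  universe. Hence the tests decide the unrestricted notions: the mapping cone of such a
  resolution of a complex is itself a test object, and the complex is K-injective (K-projective)
  iff that cone is contractible. Every module is isomorphic to one in a universe, via constant
  functions.\<close>

type_synonym ('r, 'v) univ = "'r + nat \<Rightarrow> 'v"
type_synonym ('r, 'v) ucpx = "('r, ('r, 'v) univ) cpx"

definition injective_module :: "('r, 'm) ring_scheme \<Rightarrow> ('r, ('r, 'v) univ) module \<Rightarrow> bool" where
  "injective_module R E \<longleftrightarrow> Module.module R E \<and>
     (\<forall>(M :: ('r, ('r, 'v) univ) module) (N :: ('r, ('r, 'v) univ) module) i f.
        Module.module R M \<and> Module.module R N \<and> i \<in> mod_hom R M N \<and> inj_on i (carrier M) \<and>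
        f \<in> mod_hom R M E \<longrightarrow> (\<exists>g\<in>mod_hom R N E. \<forall>x\<in>carrier M. g (i x) = f x))"

definition K_injective :: "('r, 'm) ring_scheme \<Rightarrow> ('r, 'v) ucpx \<Rightarrow> bool" where
  "K_injective R I \<longleftrightarrow> chain_complex R I \<and>
     (\<forall>A :: ('r, 'v) ucpx. chain_complex R A \<and> acyclic_cpx A \<longrightarrow> acyclic_cpx (hom_cpx R A I))"

definition K_projective :: "('r, 'm) ring_scheme \<Rightarrow> ('r, 'v) ucpx \<Rightarrow> bool" where
  "K_projective R P \<longleftrightarrow> chain_complex R P \<and>
     (\<forall>A :: ('r, 'v) ucpx. chain_complex R A \<and> acyclic_cpx A \<longrightarrow> acyclic_cpx (hom_cpx R P A))"

definition K_injective_resolution ::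
    "('r, 'm) ring_scheme \<Rightarrow> ('r, 'a) cpx \<Rightarrow> ('r, 'v) ucpx \<Rightarrow> (int \<Rightarrow> 'a \<Rightarrow> ('r, 'v) univ) \<Rightarrow> bool" where
  "K_injective_resolution R X I \<eta> \<longleftrightarrow> K_injective R I \<and> quasi_iso R X I \<eta>"

definition K_projective_resolution ::
    "('r, 'm) ring_scheme \<Rightarrow> ('r, 'a) cpx \<Rightarrow> ('r, 'v) ucpx \<Rightarrow> (int \<Rightarrow> ('r, 'v) univ \<Rightarrow> 'a) \<Rightarrow> bool" where
  "K_projective_resolution R X P \<pi> \<longleftrightarrow> K_projective R P \<and> quasi_iso R P X \<pi>"

text \<open>A derived functor is determined only up to isomorphism in the derived category; the
  predicates below say that their last argument is its value as computed from some choice of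
  resolution.\<close>

definition RHom :: "('r, 'm) ring_scheme \<Rightarrow> ('r, 'a) cpx \<Rightarrow> ('r, 'b) cpx \<Rightarrow>
    ('r, int \<Rightarrow> 'a \<Rightarrow> ('r, 'v) univ) cpx \<Rightarrow> bool" where
  "RHom R X Y H \<longleftrightarrow> (\<exists>I \<eta>. K_injective_resolution R Y I \<eta> \<and> H = hom_cpx R X I)"

definition RGamma :: "('r, 'm) ring_scheme \<Rightarrow> 'r set \<Rightarrow> ('r, 'a) cpx \<Rightarrow>
    ('r, (nat \<times> ('r set \<Rightarrow> ('r, 'v) univ)) set) cpx \<Rightarrow> bool" where
  "RGamma R \<aa> X G \<longleftrightarrow> (\<exists>I \<eta>. K_injective_resolution R X I \<eta> \<and> G = Gamma_cpx R \<aa> I)"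

definition LLambda :: "('r, 'm) ring_scheme \<Rightarrow> 'r set \<Rightarrow> ('r, 'a) cpx \<Rightarrow>
    ('r, nat \<Rightarrow> ('r set \<times> ('r, 'v) univ \<Rightarrow> 'r) set) cpx \<Rightarrow> bool" where
  "LLambda R \<aa> X L \<longleftrightarrow> (\<exists>P \<pi>. K_projective_resolution R X P \<pi> \<and> L = Lambda_cpx R \<aa> P)"

definition formal_local :: "('r, 'm) ring_scheme \<Rightarrow> 'r set \<Rightarrow> 'r set \<Rightarrow> ('r, 'v) ucpx \<Rightarrow>
    ('r, nat \<Rightarrow> ('r set \<times> ('r, 'v) univ \<Rightarrow> 'r) set) cpx \<Rightarrow> bool" where
  "formal_local R \<aa> \<bb> X F \<longleftrightarrow>
     (\<exists>G :: ('r, (nat \<times> ('r set \<Rightarrow> ('r, 'v) univ)) set) cpx. RGamma R \<bb> X G \<and> LLambda R \<aa> G F)"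


section \<open>Dualizing complexes\<close>

definition ring_cpx :: "('r, 'm) ring_scheme \<Rightarrow> ('r, 'r) cpx" where
  "ring_cpx R = \<lparr>
     obj = (\<lambda>i. if i = 0 then ring_module R else (ring_module R)\<lparr>carrier := {\<zero>\<^bsub>R\<^esub>}\<rparr>),
     dif = (\<lambda>i x. \<zero>\<^bsub>R\<^esub>)\<rparr>"

text \<open>The homothety morphism from \<open>R\<close> to \<open>RHom(D, D) = Hom(D, I)\<close>, for a K-injective resolution
  \<open>\<eta>\<close> from \<open>D\<close> to \<open>I\<close>: it sends \<open>r\<close> to \<open>r \<eta>\<close>.\<close>

definition homothety :: "('r, 'm) ring_scheme \<Rightarrow> ('r, 'a) cpx \<Rightarrow> ('r, 'b) cpx \<Rightarrow> (int \<Rightarrow> 'a \<Rightarrow> 'b) \<Rightarrow>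
    int \<Rightarrow> 'r \<Rightarrow> int \<Rightarrow> 'a \<Rightarrow> 'b" where
  "homothety R D I \<eta> n r = (if n = 0 then (\<lambda>i. \<lambda>x\<in>carrier (obj D i). r \<odot>\<^bsub>obj I i\<^esub> \<eta> i x)
     else \<zero>\<^bsub>obj (hom_cpx R D I) n\<^esub>)"

definition finite_injective_dimension :: "('r, 'm) ring_scheme \<Rightarrow> ('r, 'v) ucpx \<Rightarrow> bool" where
  "finite_injective_dimension R X \<longleftrightarrow> (\<exists>J :: ('r, 'v) ucpx. chain_complex R J \<and>
     (\<forall>i. injective_module R (obj J i)) \<and>
     (\<exists>n. \<forall>i. n < \<bar>i\<bar> \<longrightarrow> carrier (obj J i) = {\<zero>\<^bsub>obj J i\<^esub>}) \<and>
     derived_iso R X J)"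

definition dualizing_complex :: "('r, 'm) ring_scheme \<Rightarrow> ('r, 'v) ucpx \<Rightarrow> bool" where
  "dualizing_complex R D \<longleftrightarrow> Dfb R D \<and> finite_injective_dimension R D \<and>
     (\<exists>(I :: ('r, 'v) ucpx) \<eta>. K_injective_resolution R D I \<eta> \<and>
        quasi_iso R (ring_cpx R) (hom_cpx R D I) (homothety R D I \<eta>))"

definition krull_dim :: "('r, 'm) ring_scheme \<Rightarrow> ereal" where
  "krull_dim R = Sup {ereal (of_nat n) | n. \<exists>\<pp>. (\<forall>i\<le>n. primeideal (\<pp> i) R) \<and> (\<forall>i<n. \<pp> i \<subset> \<pp> (Suc i))}"

definition normalized_dualizing_complex :: "('r, 'm) ring_scheme \<Rightarrow> ('r, 'v) ucpx \<Rightarrow> bool" where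
  "normalized_dualizing_complex R D \<longleftrightarrow> dualizing_complex R D \<and> hsup D = krull_dim R"

end

(*
Write X as a bounded below complex L of finitely generated free modules and D as a bounded complex K
of injectives, so that X-dagger is M = Hom(L, K), with a free resolution T -> M by finitely generated
modules (K has finitely generated homology). By biduality L -> Hom(M, K) is a quasi-isomorphism, whence
RGamma_b(X) is Gamma_b Hom(T, K) = Hom(T, U), i.e. Hom(M, U), where U = Gamma_b(K) is again a bounded
complex of injectives. For injective modules M_i and U_j the module Hom(M_i, U_j) is flat, and for a
bounded below complex of flat modules Lambda^a computes LLambda^a. Finally
Lambda^a Hom(M, U) = Hom(Gamma_a M, U), since a homomorphism on the a-torsion is a coherent family of
homomorphisms on the submodules killed by a^n.
*)
theory Submission
 imports Defs
begin

text \<open>The derived functors in the statement come from six freely chosen resolutions, and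
  K-injectivity and K-projectivity are tested inside one universe only. Exchanging a resolution for
  a better one therefore needs complexes whose terms embed in that universe. This is why the finite
  free resolutions have bases in \<open>nat\<close>: a map out of such a complex is a sequence in
  the universe. It also explains the passage from \<open>M\<close> to \<open>T\<close>: a basis
  provides both the embedding and the commutation of torsion with Hom(T, -).

  \<open>L\<close> may be unbounded above. But \<open>K\<close> is bounded, so an element of Hom(L,
  K) has finitely many nonzero values on generators, and a map out of Hom(L, K) can be corrected one
  generator at a time. The homothety property of \<open>K\<close> supplies each correction; this
  yields biduality.

  Flatness and completion are treated by elements: flatness is an identity of colon ideals, R/I^n
  \<otimes> A is A / I^n A, a point of the completion is a sequence of representatives. The place of
  a lim^1 argument is taken by purity: J X_n \<inter> Z_n = J Z_n for the cycles Z_n and all ideals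
  J.\<close>

abbreviation (input) El where "El X i \<equiv> carrier (obj X i)"
abbreviation (input) madd ("(_ +[_]/ _)" [65, 0, 66] 65) where "x +[M] y \<equiv> ring.add M x y"
abbreviation (input) mminus ("(_ -[_]/ _)" [65, 0, 66] 65) where "x -[M] y \<equiv> a_minus M x y"
abbreviation (input) mneg ("(~[_]/ _)" [0, 81] 80) where "~[M] x \<equiv> a_inv M x"
abbreviation (input) msmult ("(_ *[_]/ _)" [70, 0, 71] 70) where "r *[M] x \<equiv> smult M r x"
abbreviation (input) mzero ("0[_]") where "0[M] \<equiv> ring.zero M"

context cring begin

abbreviation (input) "Md \<equiv> Module.module R"
abbreviation (input) "Hom \<equiv> mod_hom R"
abbreviation (input) "Span \<equiv> mod_span R"
abbreviation (input) "FM \<equiv> free_module R"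
abbreviation (input) "gen1 \<equiv> free_gen R"
abbreviation (input) "CC \<equiv> chain_complex R"
abbreviation (input) "CM \<equiv> chain_map R"
abbreviation (input) "QI \<equiv> quasi_iso R"
abbreviation (input) "HC \<equiv> hom_cpx R"

end

context cring begin

section \<open>Arithmetic in modules\<close>

lemma module_abelian_group: "Md M ==> abelian_group M"
 by (simp add: module_def)

lemma m_add: "Md M ==> x:carrier M ==> y:carrier M ==> x +[M] y:carrier M"
 by (meson module_abelian_group abelian_groupE(1))
lemma m_zero: "Md M ==> 0[M]:carrier M"
 by (meson module_abelian_group abelian_groupE(2))
lemma m_neg: "Md M ==> x:carrier M ==> ~[M] x:carrier M"
 by (meson module_abelian_group abelian_group.a_inv_closed)
lemma m_minus: "Md M ==> x:carrier M ==> y:carrier M ==> x -[M] y:carrier M"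
 by (simp add: a_minus_def m_add m_neg)
lemma m_smult: "Md M ==> r:carrier R ==> x:carrier M ==> r *[M] x:carrier M"
 by (rule module.smult_closed)

lemma m_assoc': "Md M ==> x:carrier M ==> y:carrier M ==> z:carrier M ==>
  (x +[M] y) +[M] z = x +[M] (y +[M] z)"
 by (meson module_abelian_group abelian_groupE(3))
lemma m_comm': "Md M ==> x:carrier M ==> y:carrier M ==> x +[M] y = y +[M] x"
 by (meson module_abelian_group abelian_groupE(4))
lemma m_lcomm': "Md M ==> x:carrier M ==> y:carrier M ==> z:carrier M ==>
  x +[M] (y +[M] z) = y +[M] (x +[M] z)"
 by (metis m_assoc' m_comm')
lemma m_l_zero: "Md M ==> x:carrier M ==> 0[M] +[M] x = x"
 by (meson module_abelian_group abelian_groupE(5))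
lemma m_r_zero: "Md M ==> x:carrier M ==> x +[M] 0[M] = x"
 by (metis m_l_zero m_comm' m_zero)
lemma m_r_neg: "Md M ==> x:carrier M ==> x +[M] ~[M] x = 0[M]"
 by (meson module_abelian_group abelian_group.r_neg)
lemma m_l_neg: "Md M ==> x:carrier M ==> ~[M] x +[M] x = 0[M]"
 by (metis m_r_neg m_neg m_comm')
lemma m_r_neg1: "Md M ==> x:carrier M ==> y:carrier M ==> ~[M] x +[M] (x +[M] y) = y"
 by (metis m_l_neg m_neg m_assoc' m_l_zero)
lemma m_r_neg2: "Md M ==> x:carrier M ==> y:carrier M ==> x +[M] (~[M] x +[M] y) = y"
 by (metis m_r_neg m_neg m_assoc' m_l_zero)
lemma m_neg_add: "Md M ==> x:carrier M ==> y:carrier M ==>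
  ~[M] (x +[M] y) = ~[M] x +[M] ~[M] y"
 by (meson module_abelian_group abelian_group.minus_add)
lemma m_neg_neg: "Md M ==> x:carrier M ==> ~[M] (~[M] x) = x"
 by (meson module_abelian_group abelian_group.minus_minus)
lemma m_neg_zero: "Md M ==> ~[M] 0[M] = 0[M]"
 by (metis m_l_zero m_neg m_r_neg m_zero)
lemma m_minus_eq: "Md M ==> x -[M] y = x +[M] ~[M] y"
 by (rule a_minus_def)
lemma m_smult_add: "Md M ==> r:carrier R ==> x:carrier M ==> y:carrier M ==>
  r *[M] (x +[M] y) = r *[M] x +[M] r *[M] y"
 by (rule module.smult_r_distr)
lemma m_smult_neg: "Md M ==> r:carrier R ==> x:carrier M ==>
  r *[M] (~[M] x) = ~[M] (r *[M] x)"
 by (rule module.smult_r_minus)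
lemma m_smult_zero: "Md M ==> r:carrier R ==> r *[M] 0[M] = 0[M]"
 by (rule module.smult_r_null)
lemma m_zero_smult: "Md M ==> x:carrier M ==> \<zero> *[M] x = 0[M]"
 by (rule module.smult_l_null)
lemma m_one_smult: "Md M ==> x:carrier M ==> \<one> *[M] x = x"
 by (rule module.smult_one)
lemma m_mult_smult: "Md M ==> r:carrier R ==> s:carrier R ==> x:carrier M ==>
  (r \<otimes> s) *[M] x = r *[M] (s *[M] x)"
 by (rule module.smult_assoc1)
lemma m_add_smult: "Md M ==> r:carrier R ==> s:carrier R ==> x:carrier M ==>
  (r \<oplus> s) *[M] x = r *[M] x +[M] s *[M] x"
 by (rule module.smult_l_distr)
lemma m_neg_smult: "Md M ==> r:carrier R ==> x:carrier M ==>
  (\<ominus> r) *[M] x = ~[M] (r *[M] x)"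
 by (rule module.smult_l_minus)

end

lemmas (in cring) module_closed = m_add m_zero m_neg m_minus m_smult

lemmas (in cring) module_simprules
 [algebra module "ring.zero M" "ring.add M" "a_inv M" "a_minus M" "module.smult M"] =
 m_add m_zero m_neg m_minus m_smult m_assoc' m_comm' m_lcomm' m_l_zero m_r_zero m_r_neg m_l_neg
 m_r_neg1 m_r_neg2 m_neg_add m_neg_neg m_neg_zero m_minus_eq m_smult_add m_smult_neg m_smult_zero

context cring begin

declare module_closed [simp] m_l_zero [simp] m_r_zero [simp] m_neg_zero [simp] m_smult_zero [simp]
 m_zero_smult [simp] m_one_smult [simp] m_neg_neg [simp] m_r_neg [simp] m_l_neg [simp]

lemma m_add_eq_zero: "Md M ==> x:carrier M ==> y:carrier M ==> x +[M] y = 0[M] ==> x = ~[M] y"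
 by (metis m_assoc' m_l_zero m_neg m_r_neg m_r_zero)

lemma m_minus_zero_iff: "Md M ==> x:carrier M ==> y:carrier M ==> x -[M] y = 0[M] \<longleftrightarrow> x = y"
 by (metis m_add_eq_zero m_minus_eq m_neg m_neg_neg m_r_neg)

lemma m_minus_add_cancel: "Md M ==> x:carrier M ==> y:carrier M ==> (x -[M] y) +[M] y = x"
 by algebra

lemma m_minus_cancel: "Md M ==> x:carrier M ==> x -[M] x = 0[M]"
 by (simp add: m_minus_eq)

section \<open>Constructions: submodules, products, Hom, direct sums, free modules\<close>

text \<open>Laws are checked after applying the injection \<open>e\<close>. Additive inverses are
  multiples by -1, so closure under zero, sums and scalars is enough.\<close>

lemma module_by_inj:
 assumes M: "Md M" and inj: "inj_on e (carrier B)"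
  and e: "!!x. x:carrier B ==> e x:carrier M"
  and B: "!!x y. x:carrier B ==> y:carrier B ==> x +[B] y:carrier B" "0[B]:carrier B"
   "!!r x. r:carrier R ==> x:carrier B ==> r *[B] x:carrier B"
  and ops: "!!x y. x:carrier B ==> y:carrier B ==> e (x +[B] y) = e x +[M] e y" "e 0[B] = 0[M]"
   "!!r x. r:carrier R ==> x:carrier B ==> e (r *[B] x) = r *[M] e x"
 shows "Md B"
proof (rule moduleI[OF is_cring abelian_groupI])
 note [simp] = M e B ops
 have eq: "x = y" if "x:carrier B" "y:carrier B" "e x = e y" for x y
  using inj that by (auto dest: inj_onD)
 fix x assume x: "x:carrier B"
 show "EX y:carrier B. y +[B] x = 0[B]"
  by (rule bexI[of _ "(\<ominus> \<one>) *[B] x"], rule eq) (simp_all add: x m_neg_smult)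
 show "0[B] +[B] x = x" by (rule eq) (simp_all add: x)
 show "\<one> *[B] x = x" by (rule eq) (simp_all add: x)
 fix y assume y: "y:carrier B"
 show "x +[B] y = y +[B] x" by (rule eq) (simp_all add: x y m_comm'[OF M])
 show "x +[B] y:carrier B" by (simp add: x y)
 fix z assume z: "z:carrier B"
 show "x +[B] y +[B] z = x +[B] (y +[B] z)" by (rule eq) (simp_all add: x y z m_assoc'[OF M])
next
 note [simp] = M e B ops
 have eq: "x = y" if "x:carrier B" "y:carrier B" "e x = e y" for x y
  using inj that by (auto dest: inj_onD)
 fix a b x y assume a: "a:carrier R" and x: "x:carrier B" and y: "y:carrier B"
 show "a *[B] x:carrier B" by (simp add: a x)
 show "a *[B] (x +[B] y) = a *[B] x +[B] a *[B] y"
  by (rule eq) (simp_all add: a x y m_smult_add)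
 assume b: "b:carrier R"
 show "(a \<oplus> b) *[B] x = a *[B] x +[B] b *[B] x"
  by (rule eq) (simp_all add: a b x m_add_smult)
 show "a \<otimes> b *[B] x = a *[B] (b *[B] x)"
  by (rule eq) (simp_all add: a b x m_mult_smult)
qed (use B in auto)

lemma module_by_surj:
 assumes M: "Md M" and q: "q ` carrier M = carrier B"
  and ops: "!!x y. x:carrier M ==> y:carrier M ==> q (x +[M] y) = q x +[B] q y" "q 0[M] = 0[B]"
   "!!r x. r:carrier R ==> x:carrier M ==> q (r *[M] x) = r *[B] q x"
 shows "Md B"
proof -
 note [simp] = M
 note ops' = ops[symmetric]
 have q': "q x:carrier B" if "x:carrier M" for x using q that by blast
 have ex: "EX x. x:carrier M & b = q x" if "b:carrier B" for b using q that by blast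
 show ?thesis
 proof (rule moduleI[OF is_cring abelian_groupI])
  show "0[B]:carrier B" by (metis M m_zero ops(2) q')
  fix x assume "x:carrier B" then obtain x' where x: "x':carrier M" "x = q x'" using ex by blast
  show "EX y:carrier B. y +[B] x = 0[B]"
   by (rule bexI[of _ "q (~[M] x')"]) (simp_all add: x q' ops')
  show "0[B] +[B] x = x" "\<one> *[B] x = x" by (simp_all add: x q' ops')
  fix y assume "y:carrier B" then obtain y' where y: "y':carrier M" "y = q y'" using ex by blast
  show "x +[B] y = y +[B] x" "x +[B] y:carrier B" by (simp_all add: x y q' ops' m_comm'[of M x' y'])
  fix z assume "z:carrier B" then obtain z' where z: "z':carrier M" "z = q z'" using ex by blast
  show "x +[B] y +[B] z = x +[B] (y +[B] z)" by (simp add: x y z ops' m_assoc')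
 next
  fix a b x y assume a: "a:carrier R" and "x:carrier B" and "y:carrier B"
  then obtain x' y' where x: "x':carrier M" "x = q x'" and y: "y':carrier M" "y = q y'" using ex by blast
  show "a *[B] x:carrier B" "a *[B] (x +[B] y) = a *[B] x +[B] a *[B] y"
   by (simp_all add: a x y q' ops' m_smult_add)
  assume b: "b:carrier R"
  show "(a \<oplus> b) *[B] x = a *[B] x +[B] b *[B] x" "a \<otimes> b *[B] x = a *[B] (b *[B] x)"
   by (simp_all add: a b x ops' m_add_smult m_mult_smult)
 qed
qed

lemma ring_module_simps [simp]:
 "carrier (ring_module R) = carrier R" "0[ring_module R] = \<zero>"
 "x +[ring_module R] y = x \<oplus> y" "r *[ring_module R] x = r \<otimes> x"
 by (simp_all add: ring_module_def)

lemma module_ring_module [simp]: "Md (ring_module R)"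
 by (rule moduleI[OF is_cring abelian_groupI])
  (auto simp: ring_module_def a_ac m_assoc l_distr r_distr intro: bexI[of _ "\<ominus> _"] l_neg)

lemma prod_module_simps [simp]:
 "f:carrier (prod_module M) \<longleftrightarrow> (ALL i. f i:carrier (M i))"
 "0[prod_module M] = (%i. 0[M i])"
 "f +[prod_module M] g = (%i. f i +[M i] g i)" "r *[prod_module M] f = (%i. r *[M i] f i)"
 by (simp_all add: prod_module_def)

lemma module_prod_module [simp]:
 assumes [simp]: "!!i. Md (M i)" shows "Md (prod_module M)"
proof (rule moduleI[OF is_cring abelian_groupI])
 fix x assume "x:carrier (prod_module M)"
 thus "EX y:carrier (prod_module M). y +[prod_module M] x = 0[prod_module M]"
  by (intro bexI[of _ "%i. ~[M i] x i"]) simp_all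
qed (simp_all add: fun_eq_iff m_assoc' m_comm' m_lcomm' m_mult_smult m_add_smult m_smult_add)

lemma mod_homI:
 assumes "!!x. x:carrier M ==> f x:carrier N"
  "!!x y. x:carrier M ==> y:carrier M ==> f (x +[M] y) = f x +[N] f y"
  "!!r x. r:carrier R ==> x:carrier M ==> f (r *[M] x) = r *[N] f x"
 shows "f:Hom M N"
 using assms by (auto simp: mod_hom_def)

lemma hom_closed: "f:Hom M N ==> x:carrier M ==> f x:carrier N"
 by (auto simp: mod_hom_def)
lemma hom_add: "f:Hom M N ==> x:carrier M ==> y:carrier M ==> f (x +[M] y) = f x +[N] f y"
 by (auto simp: mod_hom_def)
lemma hom_smult: "f:Hom M N ==> r:carrier R ==> x:carrier M ==> f (r *[M] x) = r *[N] f x"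
 by (auto simp: mod_hom_def)
lemma hom_zero: "f:Hom M N ==> Md M ==> Md N ==> f 0[M] = 0[N]"
 by (metis hom_closed hom_smult m_zero m_zero_smult zero_closed)
lemma hom_neg: "f:Hom M N ==> Md M ==> Md N ==> x:carrier M ==> f (~[M] x) = ~[N] f x"
 using hom_add[of f M N "~[M] x" x] hom_zero[of f M N] m_add_eq_zero[of N "f (~[M] x)" "f x"]
 by (simp add: hom_closed)
lemma hom_minus: "f:Hom M N ==> Md M ==> Md N ==> x:carrier M ==> y:carrier M ==>
  f (x -[M] y) = f x -[N] f y"
 by (simp add: m_minus_eq hom_add hom_neg)
lemmas hom_simps = hom_closed hom_add hom_smult hom_zero hom_neg hom_minus

lemma mod_hom_cong: "f:Hom M N ==> Md M ==> (!!x. x:carrier M ==> g x = f x) ==> g:Hom M N"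
 by (rule mod_homI) (simp_all add: hom_simps)
lemma hom_id [simp]: "(%x. x):Hom M M"
 by (rule mod_homI) simp_all
lemma hom_const_zero [simp]: "Md N ==> (%x. 0[N]):Hom M N"
 by (rule mod_homI) simp_all
lemma hom_comp: "f:Hom M N ==> g:Hom N P ==> (%x. g (f x)):Hom M P"
 by (rule mod_homI) (simp_all add: hom_closed hom_add hom_smult)
lemma hom_plus: "f:Hom M N ==> g:Hom M N ==> Md N ==> (%x. f x +[N] g x):Hom M N"
 by (rule mod_homI) (simp_all add: hom_closed hom_add hom_smult m_smult_add m_assoc' m_comm' m_lcomm')
lemma hom_uminus: "f:Hom M N ==> Md N ==> (%x. ~[N] f x):Hom M N"
 by (rule mod_homI) (simp_all add: hom_closed hom_add hom_smult m_smult_neg m_neg_add)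
lemma hom_diff: "f:Hom M N ==> g:Hom M N ==> Md N ==> (%x. f x -[N] g x):Hom M N"
 by (simp add: m_minus_eq hom_plus hom_uminus)
lemma hom_scale: "f:Hom M N ==> Md N ==> r:carrier R ==> (%x. r *[N] f x):Hom M N"
 by (rule mod_homI) (simp_all add: hom_closed hom_add hom_smult m_smult_add m_mult_smult[symmetric] m_comm)
lemma hom_mult: "Md M ==> x:carrier M ==> (%r. r *[M] x):Hom (ring_module R) M"
 by (rule mod_homI) (simp_all add: m_add_smult m_mult_smult)

lemma hom_module_simps [simp]:
 "f:carrier (hom_module R M N) \<longleftrightarrow> f:Hom M N & f:extensional (carrier M)"
 "0[hom_module R M N] = (\<lambda>x\<in>carrier M. 0[N])"
 "f +[hom_module R M N] g = (\<lambda>x\<in>carrier M. f x +[N] g x)"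
 "r *[hom_module R M N] f = (\<lambda>x\<in>carrier M. r *[N] f x)"
 by (auto simp: hom_module_def)

lemma restrict_mod_hom [simp]: "Md M ==> f:Hom M N ==> restrict f (carrier M):Hom M N"
 by (rule mod_hom_cong) auto

text \<open>Extension by zero outside \<open>carrier M\<close> embeds Hom(M, N) into a power of
  \<open>N\<close>.\<close>

lemma module_hom_module [simp]:
 assumes M: "Md M" and N: "Md N" shows "Md (hom_module R M N)"
proof (rule module_by_inj[where M = "prod_module (%_. N)" and e = "%f x. if x:carrier M then f x else 0[N]"])
 show "inj_on (%f x. if x:carrier M then f x else 0[N]) (carrier (hom_module R M N))"
  by (rule inj_onI, rule extensionalityI[of _ "carrier M"]) (auto simp: fun_eq_iff split: if_splits)
qed (use M N in \<open>auto simp: fun_eq_iff hom_closed hom_plus hom_scale\<close>)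

lemma module_sub:
 assumes "Md M" "N <= carrier M" "0[M]:N" "!!x y. x:N ==> y:N ==> x +[M] y:N"
  "!!r x. r:carrier R ==> x:N ==> r *[M] x:N"
 shows "Md (M\<lparr>carrier := N\<rparr>)"
 by (rule module_by_inj[where M = M and e = "%x. x"]) (use assms in auto)

lemma submoduleI':
 assumes M: "Md M" and N: "N <= carrier M" "0[M]:N" "!!x y. x:N ==> y:N ==> x +[M] y:N"
  "!!r x. r:carrier R ==> x:N ==> r *[M] x:N"
 shows "submodule N R M"
 by (rule module.module_incl_imp_submodule[OF M N(1) module_sub[OF M N]])

lemma submoduleD:
 assumes M: "Md M" and N: "submodule N R M"
 shows "N <= carrier M" "0[M]:N" "!!x y. x:N ==> y:N ==> x +[M] y:N"
  "!!r x. r:carrier R ==> x:N ==> r *[M] x:N" "!!x. x:N ==> ~[M] x:N"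
  "!!x y. x:N ==> y:N ==> x -[M] y:N"
proof -
 note E = module.submoduleE[OF M N]
 show 1: "N <= carrier M" "!!x y. x:N ==> y:N ==> x +[M] y:N"
  "!!r x. r:carrier R ==> x:N ==> r *[M] x:N" "!!x. x:N ==> ~[M] x:N" using E by auto
 show "0[M]:N" by (metis E(2) 1(1,3) M all_not_in_conv in_mono m_zero_smult zero_closed)
 show "!!x y. x:N ==> y:N ==> x -[M] y:N" using 1 M by (simp add: m_minus_eq)
qed

text \<open>\<open>a_inv\<close> is defined through the carrier, so its value in a submodule needs
  an argument: the inclusion is linear. This matters when the signs of a Hom complex are compared
  for a target and its torsion part.\<close>

lemma neg_sub:
 fixes M :: "('a, 'c) module"
 assumes "Md M" "Md (M\<lparr>carrier := N\<rparr>)" "N <= carrier M" "x:N"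
 shows "~[M\<lparr>carrier := N\<rparr>] x = ~[M] x"
proof -
 have "(%x. x):Hom (M\<lparr>carrier := N\<rparr>) M" by (rule mod_homI) (use assms in auto)
 from hom_neg[OF this] show ?thesis using assms by simp
qed

definition dsum :: "('a, 'c) module => ('a, 'd) module => ('a, 'c \<times> 'd) module" where
 "dsum M N = \<lparr>carrier = carrier M \<times> carrier N, monoid.mult = undefined, one = undefined,
  ring.zero = (0[M], 0[N]), ring.add = (%x y. (fst x +[M] fst y, snd x +[N] snd y)),
  smult = (%r x. (r *[M] fst x, r *[N] snd x))\<rparr>"

lemma dsum_simps [simp]:
 "carrier (dsum M N) = carrier M \<times> carrier N" "0[dsum M N] = (0[M], 0[N])"
 "x +[dsum M N] y = (fst x +[M] fst y, snd x +[N] snd y)"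
 "r *[dsum M N] x = (r *[M] fst x, r *[N] snd x)"
 by (simp_all add: dsum_def)

lemma module_dsum [simp]: assumes [simp]: "Md M" "Md N" shows "Md (dsum M N)"
proof (rule moduleI[OF is_cring abelian_groupI])
 fix x assume "x:carrier (dsum M N)"
 thus "EX y:carrier (dsum M N). y +[dsum M N] x = 0[dsum M N]"
  by (intro bexI[of _ "(~[M] fst x, ~[N] snd x)"]) auto
qed (auto simp: m_assoc' m_comm' m_lcomm' m_mult_smult m_add_smult m_smult_add)

lemma hom_fst [simp]: "fst:Hom (dsum M N) M" and hom_snd [simp]: "snd:Hom (dsum M N) N"
 by (rule mod_homI; auto)+

lemma dsum_neg: assumes "Md M" "Md N" "x:carrier (dsum M N)"
 shows "~[dsum M N] x = (~[M] fst x, ~[N] snd x)"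
 using hom_neg[OF hom_fst _ _ assms(3)] hom_neg[OF hom_snd _ _ assms(3)] assms(1,2) by (simp add: prod_eq_iff)

lemma free_module_simps [simp]:
 "x:carrier (FM S) \<longleftrightarrow> (ALL s. x s:carrier R) & finite {s. x s ~= \<zero>} & {s. x s ~= \<zero>} <= S"
 "0[FM S] = (%s. \<zero>)" "x +[FM S] y = (%s. x s \<oplus> y s)"
 "r *[FM S] x = (%s. r \<otimes> x s)"
 by (auto simp: free_module_def)

lemma module_free_module [simp]: "Md (FM S)"
proof (rule module_by_inj[where M = "prod_module (%_. ring_module R)" and e = "%x. x"])
 show "Md (prod_module (%_. ring_module R))" by (rule module_prod_module) simp
next
 fix x y assume xy: "x:carrier (FM S)" "y:carrier (FM S)"
 hence "{s. x s \<oplus> y s ~= \<zero>} <= {s. x s ~= \<zero>} \<union> {s. y s ~= \<zero>}" by auto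
 moreover have "finite ({s. x s ~= \<zero>} \<union> {s. y s ~= \<zero>})" "{s. x s ~= \<zero>} \<union> {s. y s ~= \<zero>} <= S" using xy by auto
 ultimately have "finite {s. x s \<oplus> y s ~= \<zero>} & {s. x s \<oplus> y s ~= \<zero>} <= S"
  by (meson finite_subset subset_trans)
 with xy show "x +[FM S] y:carrier (FM S)" by simp
next
 fix r x assume rx: "r:carrier R" "x:carrier (FM S)"
 hence "{s. r \<otimes> x s ~= \<zero>} <= {s. x s ~= \<zero>}" by auto
 moreover have "finite {s. x s ~= \<zero>}" "{s. x s ~= \<zero>} <= S" using rx by auto
 ultimately have "finite {s. r \<otimes> x s ~= \<zero>} & {s. r \<otimes> x s ~= \<zero>} <= S"
  by (meson finite_subset subset_trans)
 with rx show "r *[FM S] x:carrier (FM S)" by simp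
qed simp_all

end

lemma image_eq_singleton_iff: "A ~= {} ==> f ` A = {b} \<longleftrightarrow> (ALL x:A. f x = b)"
 by auto

context cring begin

section \<open>Cosets and quotient modules\<close>

lemma cos_mem: "y:N +>\<^bsub>M\<^esub> x \<longleftrightarrow> (EX n:N. y = n +[M] x)"
 by (auto simp: a_r_coset_def r_coset_def)

lemma cos_eq:
 fixes M :: "('a, 'c) module"
 assumes M: "Md M" and N: "submodule N R M" and x: "x:carrier M" and y: "y:carrier M"
 shows "N +>\<^bsub>M\<^esub> x = N +>\<^bsub>M\<^esub> y \<longleftrightarrow> (EX n:N. x = n +[M] y)"
proof
 assume "N +>\<^bsub>M\<^esub> x = N +>\<^bsub>M\<^esub> y"
 moreover have "x:N +>\<^bsub>M\<^esub> x" unfolding cos_mem using M x submoduleD(2)[OF M N] by (metis m_l_zero)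
 ultimately show "EX n:N. x = n +[M] y" by (auto simp: cos_mem)
next
 note S = submoduleD[OF M N]
 assume "EX n:N. x = n +[M] y"
 then obtain n where n: "n:N" "x = n +[M] y" by blast
 hence y': "y = (~[M] n) +[M] x" using M S(1) y by (auto simp: m_r_neg1 subset_iff)
 show "N +>\<^bsub>M\<^esub> x = N +>\<^bsub>M\<^esub> y"
 proof (intro equalityI subsetI)
  fix z assume "z:N +>\<^bsub>M\<^esub> x"
  then obtain m where m: "m:N" "z = m +[M] x" by (auto simp: cos_mem)
  hence "z = (m +[M] n) +[M] y" unfolding n using M n(1) S(1) y by (auto simp: m_assoc' subset_iff)
  with m n S(3) show "z:N +>\<^bsub>M\<^esub> y" unfolding cos_mem by blast
 next
  fix z assume "z:N +>\<^bsub>M\<^esub> y"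
  then obtain m where m: "m:N" "z = m +[M] y" by (auto simp: cos_mem)
  hence "z = (m +[M] (~[M] n)) +[M] x" using y' M n(1) S(1) x S(5)[OF n(1)]
   by (auto simp: m_assoc' subset_iff)
  with m n S show "z:N +>\<^bsub>M\<^esub> x" unfolding cos_mem by blast
 qed
qed

lemma cos_self:
 assumes M: "Md M" and N: "submodule N R M" and x: "x:carrier M" shows "x:N +>\<^bsub>M\<^esub> x"
 unfolding cos_mem using M x submoduleD(2)[OF M N] by (metis m_l_zero)

lemma cos_zero:
 assumes M: "Md M" and N: "submodule N R M" shows "N +>\<^bsub>M\<^esub> 0[M] = N"
proof -
 note S = submoduleD[OF M N]
 have "!!n. n:N ==> n +[M] 0[M] = n" using S(1) M by (auto simp: subset_iff)
 thus ?thesis by (auto simp: cos_mem set_eq_iff)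
qed

lemma quot_map_cos:
 fixes M :: "('a, 'c) module" and M' :: "('a, 'd) module"
 assumes M: "Md M" "submodule N R M" and M': "Md M'" "submodule N' R M'"
  and f: "!!x. x:carrier M ==> f x:carrier M'"
   "!!n x. n:N ==> x:carrier M ==> EX n':N'. f (n +[M] x) = n' +[M'] f x"
  and x: "x:carrier M"
 shows "quot_map M' N' f (N +>\<^bsub>M\<^esub> x) = N' +>\<^bsub>M'\<^esub> f x"
proof -
 have "N' +>\<^bsub>M'\<^esub> f y = N' +>\<^bsub>M'\<^esub> f x" if "y:N +>\<^bsub>M\<^esub> x" for y
 proof -
  from that obtain n where n: "n:N" "y = n +[M] x" by (auto simp: cos_mem)
  have "y:carrier M" unfolding n using M(1) submoduleD(1)[OF M] n(1) x by auto
  thus ?thesis using n f(2)[OF n(1) x] cos_eq[OF M' f(1) f(1)[OF x]] by auto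
 qed
 moreover have "x:N +>\<^bsub>M\<^esub> x" by (rule cos_self[OF M x])
 ultimately show ?thesis unfolding quot_map_def by blast
qed

lemma quot_map_hom:
 fixes M :: "('a, 'c) module" and M' :: "('a, 'd) module"
 assumes M: "Md M" "submodule N R M" and M': "Md M'" "submodule N' R M'"
  and f: "f:Hom M M'" "f ` N <= N'" and x: "x:carrier M"
 shows "quot_map M' N' f (N +>\<^bsub>M\<^esub> x) = N' +>\<^bsub>M'\<^esub> f x"
 by (rule quot_map_cos[OF M M' _ _ x])
  (use f submoduleD(1)[OF M] in \<open>auto simp: hom_closed hom_add subset_iff intro!: bexI[of _ "f _"]\<close>)

lemma quot_carrier: "carrier (quot_module M N) = (%x. N +>\<^bsub>M\<^esub> x) ` carrier M"
 by (auto simp: quot_module_def A_RCOSETS_def RCOSETS_def a_r_coset_def)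

lemma quot_zero: "0[quot_module M N] = N" by (simp add: quot_module_def)

lemma quot_add:
 fixes M :: "('a, 'c) module"
 assumes M: "Md M" and N: "submodule N R M" and x: "x:carrier M" and y: "y:carrier M"
 shows "(N +>\<^bsub>M\<^esub> x) +[quot_module M N] (N +>\<^bsub>M\<^esub> y) = N +>\<^bsub>M\<^esub> (x +[M] y)"
proof -
 note S = submoduleD[OF M N]
 have 1: "(a +[M] x) +[M] (b +[M] y) = (a +[M] b) +[M] (x +[M] y)" if "a:N" "b:N" for a b
  using subsetD[OF S(1) that(1)] subsetD[OF S(1) that(2)] x y M by algebra
 have "set_add M (N +>\<^bsub>M\<^esub> x) (N +>\<^bsub>M\<^esub> y) = N +>\<^bsub>M\<^esub> (x +[M] y)" (is "?A = ?B")
 proof (intro equalityI subsetI)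
  fix z assume "z:?A"
  then obtain a b where "a:N" "b:N" "z = (a +[M] x) +[M] (b +[M] y)"
   by (auto simp: set_add_def set_mult_def cos_mem)
  thus "z:?B" using 1 S(3) by (auto simp: cos_mem)
 next
  fix z assume "z:?B"
  then obtain a where a: "a:N" "z = a +[M] (x +[M] y)" by (auto simp: cos_mem)
  hence "z = (a +[M] x) +[M] (0[M] +[M] y)" using 1[OF a(1) S(2)] subsetD[OF S(1) a(1)] M by simp
  moreover have "a +[M] x:N +>\<^bsub>M\<^esub> x" "0[M] +[M] y:N +>\<^bsub>M\<^esub> y" using a(1) S(2) unfolding cos_mem by blast+
  ultimately show "z:?A" by (auto simp: set_add_def set_mult_def)
 qed
 thus ?thesis by (simp add: quot_module_def)
qed

lemma quot_smult:
 fixes M :: "('a, 'c) module"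
 assumes M: "Md M" and N: "submodule N R M" and x: "x:carrier M" and r: "r:carrier R"
 shows "r *[quot_module M N] (N +>\<^bsub>M\<^esub> x) = N +>\<^bsub>M\<^esub> (r *[M] x)"
proof -
 have "(%x. r *[M] x):Hom M M" using hom_scale[OF hom_id M r] by simp
 moreover have "(%x. r *[M] x) ` N <= N" using submoduleD(4)[OF M N r] by blast
 ultimately show ?thesis using quot_map_hom[OF M N M N _ _ x] by (simp add: quot_module_def quot_map_def)
qed

lemma module_quot [simp]:
 fixes M :: "('a, 'c) module"
 assumes M: "Md M" and N: "submodule N R M" shows "Md (quot_module M N)"
 by (rule module_by_surj[OF M, where q = "%x. N +>\<^bsub>M\<^esub> x"])
  (use M N in \<open>simp_all add: quot_carrier quot_zero quot_add quot_smult cos_zero\<close>)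

lemma quot_hom:
 fixes M :: "('a, 'c) module"
 assumes M: "Md M" and N: "submodule N R M" shows "(%x. N +>\<^bsub>M\<^esub> x):Hom M (quot_module M N)"
 by (rule mod_homI) (use M N in \<open>simp_all add: quot_carrier quot_add quot_smult\<close>)

section \<open>Chain complexes, homology and quasi-isomorphisms\<close>

lemma cc_module [simp]: "CC X ==> Md (obj X i)"
 by (simp add: chain_complex_def)
lemma cc_dif: "CC X ==> dif X i:Hom (obj X i) (obj X (i - 1))"
 by (simp add: chain_complex_def)
lemma cc_dif': "CC X ==> dif X (i + 1):Hom (obj X (i + 1)) (obj X i)"
 using cc_dif[of X "i + 1"] by simp
lemma d_closed [simp]: "CC X ==> x:El X i ==> dif X i x:El X (i - 1)"
 by (rule hom_closed[OF cc_dif])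
lemma d_closed' [simp]: "CC X ==> x:El X (i + 1) ==> dif X (i + 1) x:El X i"
 by (rule hom_closed[OF cc_dif'])
lemma d_d [simp]: "CC X ==> x:El X i ==> dif X (i - 1) (dif X i x) = 0[obj X (i - 1 - 1)]"
 by (simp add: chain_complex_def)
lemma d_d' [simp]: "CC X ==> x:El X (i + 1) ==> dif X i (dif X (i + 1) x) = 0[obj X (i - 1)]"
 using d_d[of X x "i + 1"] by simp
lemma d_zero [simp]: "CC X ==> dif X i 0[obj X i] = 0[obj X (i - 1)]"
 by (rule hom_zero[OF cc_dif]) simp_all
lemma d_add: "CC X ==> x:El X i ==> y:El X i ==>
  dif X i (x +[obj X i] y) = dif X i x +[obj X (i - 1)] dif X i y"
 by (rule hom_add[OF cc_dif])
lemma d_smult: "CC X ==> r:carrier R ==> x:El X i ==>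
  dif X i (r *[obj X i] x) = r *[obj X (i - 1)] dif X i x"
 by (rule hom_smult[OF cc_dif])
lemma d_neg: "CC X ==> x:El X i ==> dif X i (~[obj X i] x) = ~[obj X (i - 1)] dif X i x"
 by (rule hom_neg[OF cc_dif]) simp_all
lemma d_minus: "CC X ==> x:El X i ==> y:El X i ==>
  dif X i (x -[obj X i] y) = dif X i x -[obj X (i - 1)] dif X i y"
 by (rule hom_minus[OF cc_dif]) simp_all
lemmas d_simps = d_add d_smult d_neg d_minus

lemma chain_complexI:
 assumes "!!i. Md (obj X i)" "!!i. dif X i:Hom (obj X i) (obj X (i - 1))"
  "!!i x. x:El X i ==> dif X (i - 1) (dif X i x) = 0[obj X (i - 1 - 1)]"
 shows "CC X"
 unfolding chain_complex_def using assms by blast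

lemma cycles_simps [simp]:
 "x:carrier (cycles X i) \<longleftrightarrow> x:El X i & dif X i x = 0[obj X (i - 1)]"
 "0[cycles X i] = 0[obj X i]" "x +[cycles X i] y = x +[obj X i] y" "r *[cycles X i] x = r *[obj X i] x"
 by (auto simp: cycles_def)

lemma module_cycles [simp]: "CC X ==> Md (cycles X i)"
 by (rule module_by_inj[where M = "obj X i" and e = "%x. x"]) (simp_all add: d_simps)

lemma bd_iff: "x:boundaries X i \<longleftrightarrow> (EX w:El X (i + 1). x = dif X (i + 1) w)"
 by (auto simp: boundaries_def)

lemma bd_closed: "CC X ==> x:boundaries X i ==> x:El X i"
 and bd_d: "CC X ==> x:boundaries X i ==> dif X i x = 0[obj X (i - 1)]"
 by (auto simp: bd_iff)

lemma image_submodule: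
 assumes f: "f:Hom M N" and M: "Md M" "Md N" and S: "submodule S R M"
 shows "submodule (f ` S) R N"
proof -
 note D = submoduleD[OF M(1) S]
 have D1: "x:S ==> x:carrier M" for x using D(1) by blast
 show ?thesis
 proof (rule submoduleI'[OF M(2)])
  show "0[N]:f ` S" using hom_zero[OF f M] D(2) by (metis image_eqI)
  fix x y assume "x:f ` S" "y:f ` S"
  then obtain a b where "a:S" "b:S" "x = f a" "y = f b" by auto
  thus "x +[N] y:f ` S" using hom_add[OF f D1 D1] D(3) by (metis image_eqI)
 next
  fix r x assume "r:carrier R" "x:f ` S"
  thus "r *[N] x:f ` S" using hom_smult[OF f] D(4) D1 by (auto intro!: image_eqI[of _ _ "r *[M] _"])
 qed (use hom_closed[OF f] D1 in auto)
qed

lemma carrier_submodule: "Md M ==> submodule (carrier M) R M"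
 by (rule submoduleI') simp_all

lemma submodule_boundaries_obj: "CC X ==> submodule (boundaries X i) R (obj X i)"
 unfolding boundaries_def by (rule image_submodule[OF cc_dif']) (simp_all add: carrier_submodule)

lemma submodule_boundaries [simp]:
 assumes "CC X" shows "submodule (boundaries X i) R (cycles X i)"
proof -
 note S = submoduleD[OF _ submodule_boundaries_obj[OF assms]]
 show ?thesis using S assms by (intro submoduleI') (auto simp: subset_iff bd_d)
qed

text \<open>A coset is the zero class iff its representative is a boundary. From here on exactness
  is argued with elements instead of cosets.\<close>

lemma zero_homology_iff:
 assumes X: "CC X"
 shows "zero_homology X i \<longleftrightarrow> (ALL x. x:El X i --> dif X i x = 0[obj X (i - 1)] --> x:boundaries X i)"
proof -
 note S = submodule_boundaries[OF X, of i] and D = submoduleD[OF _ submodule_boundaries[OF X, of i]]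
 have Z: "boundaries X i +>\<^bsub>cycles X i\<^esub> 0[cycles X i] = boundaries X i" using X by (simp only: cos_zero[OF _ S] module_cycles)
 have *: "boundaries X i +>\<^bsub>cycles X i\<^esub> x = boundaries X i \<longleftrightarrow> x:boundaries X i" if "x:carrier (cycles X i)" for x
  by (subst Z[symmetric], subst cos_eq[OF module_cycles[OF X] S that])
   (use X that in \<open>auto simp: bd_closed\<close>)
 have "carrier (homology X i) = {boundaries X i} \<longleftrightarrow>
  (ALL x:carrier (cycles X i). boundaries X i +>\<^bsub>cycles X i\<^esub> x = boundaries X i)"
  unfolding homology_def quot_carrier by (rule image_eq_singleton_iff) (use m_zero[OF module_cycles[OF X]] in blast)
 also have "... \<longleftrightarrow> (ALL x:carrier (cycles X i). x:boundaries X i)"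
  by (rule ball_cong[OF refl *])
 finally show ?thesis by (auto simp: zero_homology_def homology_def quot_zero)
qed

lemma cm_complex: "CM X Y f ==> CC X" "CM X Y f ==> CC Y"
 by (simp_all add: chain_map_def)
lemma cm_hom: "CM X Y f ==> f i:Hom (obj X i) (obj Y i)"
 by (simp add: chain_map_def)
lemma cm_closed: "CM X Y f ==> x:El X i ==> f i x:El Y i"
 by (rule hom_closed[OF cm_hom])
lemma cm_d: "CM X Y f ==> x:El X i ==> dif Y i (f i x) = f (i - 1) (dif X i x)"
 by (simp add: chain_map_def)
lemma cm_d': "CM X Y f ==> x:El X (i + 1) ==> dif Y (i + 1) (f (i + 1) x) = f i (dif X (i + 1) x)"
 using cm_d[of X Y f x "i + 1"] by simp
lemma cm_zero: "CM X Y f ==> f i 0[obj X i] = 0[obj Y i]"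
 by (rule hom_zero[OF cm_hom]) (simp_all add: cm_complex)
lemma cm_add: "CM X Y f ==> x:El X i ==> y:El X i ==>
  f i (x +[obj X i] y) = f i x +[obj Y i] f i y"
 by (rule hom_add[OF cm_hom])
lemma cm_smult: "CM X Y f ==> r:carrier R ==> x:El X i ==>
  f i (r *[obj X i] x) = r *[obj Y i] f i x"
 by (rule hom_smult[OF cm_hom])
lemma cm_neg: "CM X Y f ==> x:El X i ==> f i (~[obj X i] x) = ~[obj Y i] f i x"
 by (rule hom_neg[OF cm_hom]) (simp_all add: cm_complex)
lemma cm_minus: "CM X Y f ==> x:El X i ==> y:El X i ==>
  f i (x -[obj X i] y) = f i x -[obj Y i] f i y"
 by (rule hom_minus[OF cm_hom]) (simp_all add: cm_complex)

lemma chain_mapI: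
 assumes "CC X" "CC Y" "!!i. f i:Hom (obj X i) (obj Y i)"
  "!!i x. x:El X i ==> dif Y i (f i x) = f (i - 1) (dif X i x)"
 shows "CM X Y f"
 unfolding chain_map_def using assms by blast

lemma cm_cycle: assumes f: "CM X Y f" and x: "x:carrier (cycles X i)" shows "f i x:carrier (cycles Y i)"
 using x cm_closed[OF f, of x i] cm_d[OF f, of x i] cm_zero[OF f, of "i - 1"] by simp

lemma cm_bd: assumes f: "CM X Y f" and x: "x:boundaries X i" shows "f i x:boundaries Y i"
proof -
 from x obtain w where w: "w:El X (i + 1)" "x = dif X (i + 1) w" by (auto simp: bd_iff)
 show ?thesis unfolding bd_iff w(2) cm_d'[OF f w(1), symmetric] using cm_closed[OF f w(1)] by blast
qed

lemma chain_map_comp: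
 assumes f: "CM X Y f" and g: "CM Y Z g" shows "CM X Z (%i x. g i (f i x))"
 by (rule chain_mapI)
  (simp_all add: cm_complex[OF f] cm_complex[OF g] hom_comp[OF cm_hom[OF f] cm_hom[OF g]] cm_d[OF f] cm_d[OF g] cm_closed[OF f])

lemma chain_map_id: "CC X ==> CM X X (%i x. x)"
 by (rule chain_mapI) simp_all

lemma quot_map_inj_iff:
 fixes M :: "('a, 'c) module" and M' :: "('a, 'd) module"
 assumes M: "Md M" "submodule N R M" and M': "Md M'" "submodule N' R M'"
  and f: "f:Hom M M'" "f ` N <= N'"
 shows "inj_on (quot_map M' N' f) (carrier (quot_module M N)) \<longleftrightarrow> (ALL x. x:carrier M --> f x:N' --> x:N)"
proof
 note q = quot_map_hom[OF M M' f] and C = cos_eq[OF M] and C' = cos_eq[OF M']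
 note F = hom_closed[OF f(1)]
 assume inj: "inj_on (quot_map M' N' f) (carrier (quot_module M N))"
 show "ALL x. x:carrier M --> f x:N' --> x:N"
 proof (intro allI impI)
  fix x assume x: "x:carrier M" "f x:N'"
  have z: "0[M]:carrier M" using M by simp
  have "EX n:N'. f x = n +[M'] f 0[M]" using x M M' F by (intro bexI[of _ "f x"]) (simp_all add: hom_zero[OF f(1)])
  hence "quot_map M' N' f (N +>\<^bsub>M\<^esub> x) = quot_map M' N' f (N +>\<^bsub>M\<^esub> 0[M])"
   unfolding q[OF x(1)] q[OF z] C'[OF F[OF x(1)] F[OF z]] .
  hence "N +>\<^bsub>M\<^esub> x = N +>\<^bsub>M\<^esub> 0[M]"
   by (rule inj_onD[OF inj]) (use x z in \<open>simp_all add: quot_carrier\<close>)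
  then obtain n where "n:N" "x = n +[M] 0[M]" unfolding C[OF x(1) z] by blast
  thus "x:N" using M submoduleD(1)[OF M] by auto
 qed
next
 note q = quot_map_hom[OF M M' f] and C = cos_eq[OF M] and C' = cos_eq[OF M']
 note F = hom_closed[OF f(1)]
 assume I: "ALL x. x:carrier M --> f x:N' --> x:N"
 show "inj_on (quot_map M' N' f) (carrier (quot_module M N))"
 proof (rule inj_onI)
  fix A B assume "A:carrier (quot_module M N)" "B:carrier (quot_module M N)"
   and E: "quot_map M' N' f A = quot_map M' N' f B"
  then obtain a b where a: "a:carrier M" "A = N +>\<^bsub>M\<^esub> a" and b: "b:carrier M" "B = N +>\<^bsub>M\<^esub> b"
   by (auto simp: quot_carrier)
  from E obtain n where n: "n:N'" "f a = n +[M'] f b"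
   unfolding a(2) b(2) q[OF a(1)] q[OF b(1)] C'[OF F[OF a(1)] F[OF b(1)]] by blast
  have "n:carrier M'" using n(1) submoduleD(1)[OF M'] by blast
  hence "f a -[M'] f b = n" unfolding n(2) using F[OF b(1)] M'(1) by algebra
  hence "f (a -[M] b):N'" using n(1) hom_minus[OF f(1) M(1) M'(1) a(1) b(1)] by simp
  hence "a -[M] b:N" using I a(1) b(1) M(1) by simp
  moreover have "a = (a -[M] b) +[M] b" using M a(1) b(1) by (simp add: m_minus_add_cancel)
  ultimately show "A = B" unfolding a(2) b(2) C[OF a(1) b(1)] by blast
 qed
qed

lemma quot_map_surj_iff:
 fixes M :: "('a, 'c) module" and M' :: "('a, 'd) module"
 assumes M: "Md M" "submodule N R M" and M': "Md M'" "submodule N' R M'"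
  and f: "f:Hom M M'" "f ` N <= N'"
 shows "quot_map M' N' f ` carrier (quot_module M N) = carrier (quot_module M' N') \<longleftrightarrow>
  (ALL y. y:carrier M' --> (EX x:carrier M. EX n:N'. y = n +[M'] f x))"
proof -
 note F = hom_closed[OF f(1)]
 have 1: "quot_map M' N' f ` carrier (quot_module M N) = (%x. N' +>\<^bsub>M'\<^esub> f x) ` carrier M"
  unfolding quot_carrier image_image by (rule image_cong[OF refl quot_map_hom[OF M M' f]])
 have "(%x. N' +>\<^bsub>M'\<^esub> f x) ` carrier M <= carrier (quot_module M' N')" using F by (auto simp: quot_carrier)
 hence "quot_map M' N' f ` carrier (quot_module M N) = carrier (quot_module M' N') \<longleftrightarrow>
  (ALL y:carrier M'. N' +>\<^bsub>M'\<^esub> y:(%x. N' +>\<^bsub>M'\<^esub> f x) ` carrier M)"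
  unfolding 1 by (subst set_eq_subset) (simp add: quot_carrier image_subset_iff)
 also have "... \<longleftrightarrow> (ALL y:carrier M'. EX x:carrier M. N' +>\<^bsub>M'\<^esub> y = N' +>\<^bsub>M'\<^esub> f x)" by (simp only: image_iff)
 also have "... \<longleftrightarrow> (ALL y:carrier M'. EX x:carrier M. EX n:N'. y = n +[M'] f x)"
  by (intro ball_cong bex_cong refl cos_eq[OF M'] F)
 finally show ?thesis by blast
qed

text \<open>The two clauses are injectivity and surjectivity on homology, stated for
  representatives.\<close>

lemma quasi_iso_iff:
 assumes f: "CM X Y f"
 shows "QI X Y f \<longleftrightarrow>
  (ALL i x. x:carrier (cycles X i) --> f i x:boundaries Y i --> x:boundaries X i) &
  (ALL i y. y:carrier (cycles Y i) --> (EX x:carrier (cycles X i). EX n:boundaries Y i. y = n +[obj Y i] f i x))"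
proof -
 note X = cm_complex(1)[OF f] and Y = cm_complex(2)[OF f]
 have hom: "f i:Hom (cycles X i) (cycles Y i)" for i
  by (rule mod_homI, erule cm_cycle[OF f]) (simp_all add: cm_add[OF f] cm_smult[OF f])
 have bd: "f i ` boundaries X i <= boundaries Y i" for i using cm_bd[OF f] by blast
 note rules = quot_map_inj_iff quot_map_surj_iff
 note rules' = rules[OF module_cycles[OF X] submodule_boundaries[OF X] module_cycles[OF Y] submodule_boundaries[OF Y] hom bd]
 show ?thesis
  by (simp only: quasi_iso_def bij_betw_def homology_def rules' cycles_simps(3)[of Y] f all_conj_distrib simp_thms)
qed



text \<open>The induced map that occurs in \<open>quasi_iso\<close>, named so that functoriality and
  two-out-of-three can be stated for it.\<close>

definition hmap :: "(int => 'c => 'd) => ('a, 'd) cpx => int => 'c set => 'd set" where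
 "hmap f Y i = quot_map (cycles Y i) (boundaries Y i) (f i)"

lemma hmap_cos:
 assumes f: "CM X Y f" and x: "x:carrier (cycles X i)"
 shows "hmap f Y i (boundaries X i +>\<^bsub>cycles X i\<^esub> x) = boundaries Y i +>\<^bsub>cycles Y i\<^esub> f i x"
proof -
 note X = cm_complex(1)[OF f] and Y = cm_complex(2)[OF f]
 have hom: "f i:Hom (cycles X i) (cycles Y i)"
  by (rule mod_homI, erule cm_cycle[OF f]) (simp_all add: cm_add[OF f] cm_smult[OF f])
 have bd: "f i ` boundaries X i <= boundaries Y i" using cm_bd[OF f] by blast
 show ?thesis unfolding hmap_def
  by (rule quot_map_hom[OF module_cycles[OF X] submodule_boundaries[OF X] module_cycles[OF Y] submodule_boundaries[OF Y] hom bd x])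
qed

lemma homology_cos: "A:carrier (homology X i) \<longleftrightarrow> (EX x:carrier (cycles X i). A = boundaries X i +>\<^bsub>cycles X i\<^esub> x)"
 unfolding homology_def quot_carrier by blast

lemma hmap_closed: assumes f: "CM X Y f" and A: "A:carrier (homology X i)"
 shows "hmap f Y i A:carrier (homology Y i)"
proof -
 from A obtain x where x: "x:carrier (cycles X i)" "A = boundaries X i +>\<^bsub>cycles X i\<^esub> x" unfolding homology_cos by blast
 show ?thesis unfolding x(2) hmap_cos[OF f x(1)] homology_cos using cm_cycle[OF f x(1)] by blast
qed

lemma hmap_comp: assumes f: "CM X Y f" and g: "CM Y Z g" and A: "A:carrier (homology X i)"
 shows "hmap (%i x. g i (f i x)) Z i A = hmap g Z i (hmap f Y i A)"
proof -
 from A obtain x where x: "x:carrier (cycles X i)" "A = boundaries X i +>\<^bsub>cycles X i\<^esub> x" unfolding homology_cos by blast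
 show ?thesis unfolding x(2) hmap_cos[OF f x(1)] hmap_cos[OF chain_map_comp[OF f g] x(1)] hmap_cos[OF g cm_cycle[OF f x(1)]] ..
qed

lemma qi_def: "QI X Y f \<longleftrightarrow> CM X Y f & (ALL i. bij_betw (hmap f Y i) (carrier (homology X i)) (carrier (homology Y i)))"
 by (simp add: quasi_iso_def hmap_def)

lemma qi_cm: "QI X Y f ==> CM X Y f" by (simp add: quasi_iso_def)

lemma qi_bij: "QI X Y f ==> bij_betw (hmap f Y i) (carrier (homology X i)) (carrier (homology Y i))"
 by (simp add: qi_def)

lemma qiI: "CM X Y f ==> (!!i. bij_betw (hmap f Y i) (carrier (homology X i)) (carrier (homology Y i))) ==> QI X Y f"
 by (simp add: qi_def)

lemma hmap_comp_bij:
 assumes f: "CM X Y f" and g: "CM Y Z g"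
 shows "bij_betw (hmap (%i x. g i (f i x)) Z i) (carrier (homology X i)) C \<longleftrightarrow>
  bij_betw (hmap g Z i \<circ> hmap f Y i) (carrier (homology X i)) C"
 by (rule bij_betw_cong) (simp add: hmap_comp[OF f g])

lemma qi_comp: assumes f: "QI X Y f" and g: "QI Y Z g" shows "QI X Z (%i x. g i (f i x))"
 by (rule qiI[OF chain_map_comp[OF qi_cm[OF f] qi_cm[OF g]]])
  (simp only: hmap_comp_bij[OF qi_cm[OF f] qi_cm[OF g]] bij_betw_trans[OF qi_bij[OF f] qi_bij[OF g]])

text \<open>Two out of three, read off from bijections on homology.\<close>

lemma qi_cancel_right: assumes f: "QI X Y f" and g: "CM Y Z g"
 and gf: "QI X Z (%i x. g i (f i x))" shows "QI Y Z g"
 by (rule qiI[OF g]) (simp only: bij_betw_comp_iff[OF qi_bij[OF f]] hmap_comp_bij[OF qi_cm[OF f] g, symmetric] qi_bij[OF gf])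

lemma qi_cancel_left: assumes f: "CM X Y f" and g: "QI Y Z g"
 and gf: "QI X Z (%i x. g i (f i x))" shows "QI X Y f"
proof (rule qiI[OF f])
 fix i
 have "hmap f Y i ` carrier (homology X i) <= carrier (homology Y i)" using hmap_closed[OF f] by blast
 from bij_betw_comp_iff2[OF qi_bij[OF g] this] qi_bij[OF gf, of i]
 show "bij_betw (hmap f Y i) (carrier (homology X i)) (carrier (homology Y i))"
  by (simp only: hmap_comp_bij[OF f qi_cm[OF g]])
qed

section \<open>Chain homotopies and homotopy equivalences\<close>

definition homotopy :: "('a, 'c) cpx => ('a, 'd) cpx => (int => 'c => 'd) => bool" where
 "homotopy X Y s \<longleftrightarrow> (ALL i. s i:Hom (obj X i) (obj Y (i + 1)))"

definition hbd :: "('a, 'c) cpx => ('a, 'd) cpx => (int => 'c => 'd) => int => 'c => 'd" where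
 "hbd X Y s i x = dif Y (i + 1) (s i x) +[obj Y i] s (i - 1) (dif X i x)"

definition htp :: "('a, 'c) cpx => ('a, 'd) cpx => (int => 'c => 'd) => (int => 'c => 'd) => bool" where
 "htp X Y f g \<longleftrightarrow> (EX s. homotopy X Y s & (ALL i. ALL x:El X i. f i x = g i x +[obj Y i] hbd X Y s i x))"

definition null :: "('a, 'c) cpx => ('a, 'd) cpx => (int => 'c => 'd) => bool" where
 "null X Y f \<longleftrightarrow> (EX s. homotopy X Y s & (ALL i. ALL x:El X i. f i x = hbd X Y s i x))"

lemma homotopy_hom: "homotopy X Y s ==> s i:Hom (obj X i) (obj Y (i + 1))"
 by (simp add: homotopy_def)
lemma homotopy_hom': "homotopy X Y s ==> s (i - 1):Hom (obj X (i - 1)) (obj Y i)"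
 using homotopy_hom[of X Y s "i - 1"] by simp
lemma homotopy_closed: "homotopy X Y s ==> x:El X i ==> s i x:El Y (i + 1)"
 by (rule hom_closed[OF homotopy_hom])
lemma homotopy_closed': "homotopy X Y s ==> x:El X (i - 1) ==> s (i - 1) x:El Y i"
 by (rule hom_closed[OF homotopy_hom'])
lemma homotopy_zero: "homotopy X Y s ==> CC X ==> CC Y ==> s i 0[obj X i] = 0[obj Y (i + 1)]"
 by (rule hom_zero[OF homotopy_hom]) simp_all

lemma hbd_hom:
 assumes s: "homotopy X Y s" and X: "CC X" and Y: "CC Y"
 shows "hbd X Y s i:Hom (obj X i) (obj Y i)"
 unfolding hbd_def
 by (rule hom_plus[OF hom_comp[OF homotopy_hom[OF s] cc_dif'[OF Y]] hom_comp[OF cc_dif[OF X] homotopy_hom'[OF s]]]) (simp add: Y)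

lemmas hbd_closed = hom_closed[OF hbd_hom]

lemma hbd_cycle: "homotopy X Y s ==> CC X ==> CC Y ==> x:carrier (cycles X i) ==> hbd X Y s i x:boundaries Y i"
 using homotopy_zero[of X Y s "i - 1"] homotopy_closed[of X Y s x i] by (auto simp: hbd_def bd_iff intro!: bexI[of _ "s i x"])

lemma homotopy_plus: "homotopy X Y s ==> homotopy X Y t ==> CC Y ==> homotopy X Y (%i x. s i x +[obj Y (i + 1)] t i x)"
 unfolding homotopy_def by (intro allI hom_plus) simp_all
lemma homotopy_neg: "homotopy X Y s ==> CC Y ==> homotopy X Y (%i x. ~[obj Y (i + 1)] s i x)"
 unfolding homotopy_def by (intro allI hom_uminus) simp_all

lemma hbd_plus:
 assumes s: "homotopy X Y s" and t: "homotopy X Y t" and X: "CC X" and Y: "CC Y" and x: "x:El X i"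
 shows "hbd X Y (%i x. s i x +[obj Y (i + 1)] t i x) i x = hbd X Y s i x +[obj Y i] hbd X Y t i x"
proof -
 note c = homotopy_closed[OF s x] homotopy_closed[OF t x] homotopy_closed'[OF s d_closed[OF X x]] homotopy_closed'[OF t d_closed[OF X x]]
 have "dif Y (i + 1) (s i x +[obj Y (i + 1)] t i x) = dif Y (i + 1) (s i x) +[obj Y i] dif Y (i + 1) (t i x)"
  using d_add[OF Y c(1,2)] by simp
 thus ?thesis unfolding hbd_def using c(3,4) d_closed'[OF Y c(1)] d_closed'[OF Y c(2)] cc_module[OF Y, of i] by simp algebra
qed

lemma hbd_neg:
 assumes s: "homotopy X Y s" and X: "CC X" and Y: "CC Y" and x: "x:El X i"
 shows "hbd X Y (%i x. ~[obj Y (i + 1)] s i x) i x = ~[obj Y i] hbd X Y s i x"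
proof -
 note c = homotopy_closed[OF s x] homotopy_closed'[OF s d_closed[OF X x]]
 have "dif Y (i + 1) (~[obj Y (i + 1)] s i x) = ~[obj Y i] dif Y (i + 1) (s i x)"
  using d_neg[OF Y c(1)] by simp
 thus ?thesis unfolding hbd_def using c(2) d_closed'[OF Y c(1)] cc_module[OF Y, of i] by simp algebra
qed

lemma homotopy_cm_left: assumes s: "homotopy X Y s" and g: "CM Y Z g" shows "homotopy X Z (%i x. g (i + 1) (s i x))"
 unfolding homotopy_def using hom_comp[OF homotopy_hom[OF s] cm_hom[OF g]] by blast
lemma homotopy_cm_right: assumes s: "homotopy Y Z s" and f: "CM X Y f" shows "homotopy X Z (%i x. s i (f i x))"
 unfolding homotopy_def using hom_comp[OF cm_hom[OF f] homotopy_hom[OF s]] by blast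

lemma hbd_cm_left:
 assumes s: "homotopy X Y s" and g: "CM Y Z g" and X: "CC X" and x: "x:El X i"
 shows "hbd X Z (%i x. g (i + 1) (s i x)) i x = g i (hbd X Y s i x)"
 unfolding hbd_def using homotopy_closed[OF s x] homotopy_closed'[OF s d_closed[OF X x]] cm_complex(2)[OF g]
 by (simp add: cm_add[OF g] cm_d'[OF g] d_closed'[OF cm_complex(1)[OF g]])

lemma hbd_cm_right:
 assumes f: "CM X Y f" and x: "x:El X i"
 shows "hbd X Z (%i x. s i (f i x)) i x = hbd Y Z s i (f i x)"
 unfolding hbd_def by (simp add: cm_d[OF f x])

lemma htpI: "homotopy X Y s ==> (!!i x. x:El X i ==> f i x = g i x +[obj Y i] hbd X Y s i x) ==> htp X Y f g"
 unfolding htp_def by blast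
lemma htpE: assumes "htp X Y f g" obtains s where "homotopy X Y s" "!!i x. x:El X i ==> f i x = g i x +[obj Y i] hbd X Y s i x"
 using assms unfolding htp_def by blast
lemma nullI: "homotopy X Y s ==> (!!i x. x:El X i ==> f i x = hbd X Y s i x) ==> null X Y f"
 unfolding null_def by blast
lemma nullE: assumes "null X Y f" obtains s where "homotopy X Y s" "!!i x. x:El X i ==> f i x = hbd X Y s i x"
 using assms unfolding null_def by blast

lemma homotopy_zero_map: "CC Y ==> homotopy X Y (%i x. 0[obj Y (i + 1)])"
 unfolding homotopy_def by simp
lemma hbd_zero_map: "CC Y ==> hbd X Y (%i x. 0[obj Y (i + 1)]) i x = 0[obj Y i]"
 unfolding hbd_def using d_zero[of Y "i + 1"] by simp

lemma htp_sym: assumes h: "htp X Y f g" and g: "CM X Y g" shows "htp X Y g f"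
proof -
 note X = cm_complex(1)[OF g] and Y = cm_complex(2)[OF g]
 from h obtain s where s: "homotopy X Y s" "!!i x. x:El X i ==> f i x = g i x +[obj Y i] hbd X Y s i x" by (rule htpE) blast
 show ?thesis
 proof (rule htpI[OF homotopy_neg[OF s(1) Y]])
  fix i x assume x: "x:El X i"
  show "g i x = f i x +[obj Y i] hbd X Y (%i x. ~[obj Y (i + 1)] s i x) i x"
   unfolding s(2)[OF x] hbd_neg[OF s(1) X Y x] using cm_closed[OF g x] hbd_closed[OF s(1) X Y x] cc_module[OF Y, of i] by algebra
 qed
qed

lemma htp_comp_left: assumes h: "htp X Y f f'" and f': "CM X Y f'" and g: "CM Y Z g"
 shows "htp X Z (%i x. g i (f i x)) (%i x. g i (f' i x))"
proof -
 note X = cm_complex(1)[OF f'] and Y = cm_complex(2)[OF f']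
 from h obtain s where s: "homotopy X Y s" "!!i x. x:El X i ==> f i x = f' i x +[obj Y i] hbd X Y s i x" by (rule htpE) blast
 show ?thesis
  by (rule htpI[OF homotopy_cm_left[OF s(1) g]])
   (simp add: s(2) hbd_cm_left[OF s(1) g X] cm_add[OF g] cm_closed[OF f'] hbd_closed[OF s(1) X Y])
qed

lemma htp_comp_right: assumes h: "htp Y Z g g'" and f: "CM X Y f"
 shows "htp X Z (%i x. g i (f i x)) (%i x. g' i (f i x))"
proof -
 from h obtain s where s: "homotopy Y Z s" "!!i x. x:El Y i ==> g i x = g' i x +[obj Z i] hbd Y Z s i x" by (rule htpE) blast
 show ?thesis
  by (rule htpI[OF homotopy_cm_right[OF s(1) f]]) (simp add: hbd_cm_right[OF f] s(2) cm_closed[OF f])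
qed

lemma null_comp_left: assumes h: "null X Y f" and X: "CC X" and g: "CM Y Z g"
 shows "null X Z (%i x. g i (f i x))"
proof -
 from h obtain s where s: "homotopy X Y s" "!!i x. x:El X i ==> f i x = hbd X Y s i x" by (rule nullE) blast
 show ?thesis by (rule nullI[OF homotopy_cm_left[OF s(1) g]]) (simp add: s(2) hbd_cm_left[OF s(1) g X])
qed

lemma null_comp_right: assumes h: "null Y Z g" and f: "CM X Y f"
 shows "null X Z (%i x. g i (f i x))"
proof -
 from h obtain s where s: "homotopy Y Z s" "!!i x. x:El Y i ==> g i x = hbd Y Z s i x" by (rule nullE) blast
 show ?thesis by (rule nullI[OF homotopy_cm_right[OF s(1) f]]) (simp add: hbd_cm_right[OF f] s(2) cm_closed[OF f])
qed

lemma htp_null_diff: assumes f: "CM X Y f" and g: "CM X Y g"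
 shows "htp X Y f g \<longleftrightarrow> null X Y (%i x. f i x -[obj Y i] g i x)"
proof -
 note X = cm_complex(1)[OF g] and Y = cm_complex(2)[OF g]
 have "f i x = g i x +[obj Y i] hbd X Y s i x \<longleftrightarrow> f i x -[obj Y i] g i x = hbd X Y s i x"
  if "homotopy X Y s" "x:El X i" for s i x
 proof -
  note c = cm_closed[OF f that(2)] cm_closed[OF g that(2)] hbd_closed[OF that(1) X Y that(2)] cc_module[OF Y, of i]
  have 1: "(g i x +[obj Y i] hbd X Y s i x) -[obj Y i] g i x = hbd X Y s i x" using c by algebra
  have 2: "g i x +[obj Y i] (f i x -[obj Y i] g i x) = f i x" using c by algebra
  from 1 2 show ?thesis by metis
 qed
 thus ?thesis unfolding htp_def null_def by blast
qed

lemma chain_map_plus: assumes f: "CM X Y f" and g: "CM X Y g"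
 shows "CM X Y (%i x. f i x +[obj Y i] g i x)"
 by (rule chain_mapI)
  (simp_all add: cm_complex[OF f] hom_plus[OF cm_hom[OF f] cm_hom[OF g]] d_add[OF cm_complex(2)[OF f]] cm_closed[OF f] cm_closed[OF g] cm_d[OF f] cm_d[OF g])

lemma chain_map_neg: assumes f: "CM X Y f"
 shows "CM X Y (%i x. ~[obj Y i] f i x)"
 by (rule chain_mapI)
  (simp_all add: cm_complex[OF f] hom_uminus[OF cm_hom[OF f]] d_neg[OF cm_complex(2)[OF f]] cm_closed[OF f] cm_d[OF f])

lemma chain_map_minus: assumes f: "CM X Y f" and g: "CM X Y g"
 shows "CM X Y (%i x. f i x -[obj Y i] g i x)"
 using chain_map_plus[OF f chain_map_neg[OF g]] by (simp add: a_minus_def)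

lemma chain_map_cong: assumes f: "CM X Y f" and e: "!!i x. x:El X i ==> g i x = f i x"
 shows "CM X Y g"
proof (rule chain_mapI)
 show "g i:Hom (obj X i) (obj Y i)" for i by (rule mod_hom_cong[OF cm_hom[OF f]]) (simp_all add: e cm_complex[OF f])
qed (simp_all add: e cm_complex[OF f] cm_d[OF f])

lemma null_cong: assumes f: "null X Y f" and e: "!!i x. x:El X i ==> g i x = f i x" shows "null X Y g"
 using f e unfolding null_def by force
lemma htp_cong: assumes f: "htp X Y f f'" and e: "!!i x. x:El X i ==> g i x = f i x"
 "!!i x. x:El X i ==> g' i x = f' i x" shows "htp X Y g g'"
 using f e unfolding htp_def by force

text \<open>The map \<open>d s + s d\<close> commutes with the differentials, since either composite
  equals \<open>d s d\<close>.\<close>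

lemma chain_map_htp: assumes h: "htp X Y f g" and g: "CM X Y g" shows "CM X Y f"
proof -
 note X = cm_complex(1)[OF g] and Y = cm_complex(2)[OF g]
 from h obtain s where s: "homotopy X Y s" "!!i x. x:El X i ==> f i x = g i x +[obj Y i] hbd X Y s i x" by (rule htpE) blast
 have "CM X Y (hbd X Y s)"
 proof (rule chain_mapI[OF X Y hbd_hom[OF s(1) X Y]])
  fix i x assume x: "x:El X i"
  note c = homotopy_closed[OF s(1) x] homotopy_closed'[OF s(1) d_closed[OF X x]]
  have "s (i - 1 - 1) (0[obj X (i - 1 - 1)]) = 0[obj Y (i - 1)]" using homotopy_zero[OF s(1) X Y, of "i - 1 - 1"] by simp
  thus "dif Y i (hbd X Y s i x) = hbd X Y s (i - 1) (dif X i x)" unfolding hbd_def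
   using c x X Y d_closed[OF Y c(2)] by (simp add: d_add)
 qed
 from chain_map_cong[OF chain_map_plus[OF g this]] show ?thesis using s(2) by simp
qed

text \<open>On a cycle the term \<open>s d\<close> vanishes, so the two maps differ by the boundary
  \<open>d (s x)\<close>.\<close>

lemma hmap_htp: assumes h: "htp X Y f g" and f: "CM X Y f" and g: "CM X Y g" and A: "A:carrier (homology X i)"
 shows "hmap f Y i A = hmap g Y i A"
proof -
 note X = cm_complex(1)[OF g] and Y = cm_complex(2)[OF g]
 from h obtain s where s: "homotopy X Y s" "!!i x. x:El X i ==> f i x = g i x +[obj Y i] hbd X Y s i x" by (rule htpE) blast
 from A obtain x where x: "x:carrier (cycles X i)" "A = boundaries X i +>\<^bsub>cycles X i\<^esub> x" unfolding homology_cos by blast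
 have x': "x:El X i" using x(1) by simp
 show ?thesis unfolding x(2) hmap_cos[OF f x(1)] hmap_cos[OF g x(1)]
   cos_eq[OF module_cycles[OF Y] submodule_boundaries[OF Y] cm_cycle[OF f x(1)] cm_cycle[OF g x(1)]]
  using hbd_cycle[OF s(1) X Y x(1)] s(2)[OF x'] m_comm'[OF cc_module[OF Y] cm_closed[OF g x'] hbd_closed[OF s(1) X Y x']]
  by (intro bexI[of _ "hbd X Y s i x"]) simp_all
qed

lemma qi_htp: assumes f: "QI X Y f" and h: "htp X Y f g" and g: "CM X Y g" shows "QI X Y g"
 by (rule qiI[OF g]) (simp only: bij_betw_cong[OF hmap_htp[OF h qi_cm[OF f] g], symmetric] qi_bij[OF f])

definition heq :: "('a, 'c) cpx => ('a, 'd) cpx => (int => 'c => 'd) => (int => 'd => 'c) => bool" where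
 "heq X Y f g \<longleftrightarrow> CM X Y f & CM Y X g &
  htp X X (%i x. g i (f i x)) (%i x. x) & htp Y Y (%i y. f i (g i y)) (%i y. y)"

lemma heq_sym: "heq X Y f g ==> heq Y X g f" by (simp add: heq_def)

lemma hmap_id: assumes X: "CC X" and A: "A:carrier (homology X i)" shows "hmap (%i x. x) X i A = A"
proof -
 from A obtain x where x: "x:carrier (cycles X i)" "A = boundaries X i +>\<^bsub>cycles X i\<^esub> x" unfolding homology_cos by blast
 show ?thesis unfolding x(2) using hmap_cos[OF chain_map_id[OF X] x(1)] .
qed

lemma heq_qi: assumes h: "heq X Y f g" shows "QI X Y f"
proof -
 have f: "CM X Y f" and g: "CM Y X g" and hX: "htp X X (%i x. g i (f i x)) (%i x. x)"
  and hY: "htp Y Y (%i y. f i (g i y)) (%i y. y)" using h by (simp_all add: heq_def)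
 note X = cm_complex(1)[OF f] and Y = cm_complex(2)[OF f]
 have 1: "hmap g X i (hmap f Y i A) = A" if "A:carrier (homology X i)" for i A
  unfolding hmap_comp[OF f g that, symmetric] hmap_htp[OF hX chain_map_comp[OF f g] chain_map_id[OF X] that] by (rule hmap_id[OF X that])
 have 2: "hmap f Y i (hmap g X i A) = A" if "A:carrier (homology Y i)" for i A
  unfolding hmap_comp[OF g f that, symmetric] hmap_htp[OF hY chain_map_comp[OF g f] chain_map_id[OF Y] that] by (rule hmap_id[OF Y that])
 show ?thesis
 proof (rule qiI[OF f], rule bij_betw_byWitness)
  fix i
  show "ALL A:carrier (homology X i). hmap g X i (hmap f Y i A) = A" using 1 by blast
  show "ALL A:carrier (homology Y i). hmap f Y i (hmap g X i A) = A" using 2 by blast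
  show "hmap f Y i ` carrier (homology X i) <= carrier (homology Y i)" using hmap_closed[OF f] by blast
  show "hmap g X i ` carrier (homology Y i) <= carrier (homology X i)" using hmap_closed[OF g] by blast
 qed
qed

text \<open>The differential keeps its sign under the shift; the usual sign (-1)^n is carried by the
  twist \<open>tw\<close> instead.\<close>

definition shift :: "('a, 'c) cpx => int => ('a, 'c) cpx" where
 "shift X n = \<lparr>obj = (%i. obj X (i + n)), dif = (%i. dif X (i + n))\<rparr>"

lemma shift_simps [simp]: "obj (shift X n) i = obj X (i + n)" "dif (shift X n) i = dif X (i + n)"
 by (simp_all add: shift_def)

lemma int_index: "(i::int) - 1 + n = i + n - 1" "(i::int) - 2 + n = i + n - 2" "(i::int) + (n - 1) = i + n - 1" "(i::int) + 1 + n = i + n + 1" "(i::int) + (n + 1) = i + n + 1"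
 by simp_all

lemma chain_complex_shift [simp]: assumes X: "CC X" shows "CC (shift X n)"
 by (rule chain_complexI) (use X cc_dif[OF X] in \<open>simp_all add: int_index\<close>)

lemma shift_0: "shift X 0 = X" by (simp add: shift_def)

lemma bd_shift: "boundaries (shift X n) i = boundaries X (i + n)"
 by (simp add: boundaries_def int_index)

lemma zero_homology_shift: "CC X ==> zero_homology (shift X n) i = zero_homology X (i + n)"
 by (simp add: zero_homology_iff bd_shift int_index)



section \<open>Hom complexes and their signs\<close>

definition sg :: "('a, 'c) module => bool => 'c => 'c" where
 "sg M b x = (if b then x else ~[M] x)"

lemma sg_closed [simp]: "Md M ==> x:carrier M ==> sg M b x:carrier M"
 by (simp add: sg_def)
lemma sg_sg [simp]: "Md M ==> x:carrier M ==> sg M b (sg M b x) = x"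
 by (simp add: sg_def)
lemma sg_zero [simp]: "Md M ==> sg M b 0[M] = 0[M]"
 by (simp add: sg_def)
lemma sg_hom: "Md N ==> f:Hom M N ==> (%x. sg N b (f x)):Hom M N"
 by (cases b) (simp_all add: sg_def hom_uminus)
lemma hom_sg: "f:Hom M N ==> Md M ==> Md N ==> x:carrier M ==> f (sg M b x) = sg N b (f x)"
 by (simp add: sg_def hom_neg)

lemma hom_cpx_obj:
 "ph:El (HC X Y) n \<longleftrightarrow>
  (ALL i. ph i:Hom (obj X i) (obj Y (i + n)) & ph i:extensional (El X i))"
 by (simp add: hom_cpx_def)

lemma hom_cpx_hom: "ph:El (HC X Y) n ==> ph i:Hom (obj X i) (obj Y (i + n))"
 by (simp add: hom_cpx_obj)
lemma hom_cpx_closed: "ph:El (HC X Y) n ==> x:El X i ==> ph i x:El Y (i + n)"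
 by (rule hom_closed[OF hom_cpx_hom])

lemma hom_cpx_ext:
 assumes "ph:El (HC X Y) n" "ps:El (HC X Y) m"
  "!!i x. x:El X i ==> ph i x = ps i x"
 shows "ph = ps"
proof
 fix i show "ph i = ps i"
  by (rule extensionalityI[of _ "El X i"]) (use assms in \<open>auto simp: hom_cpx_obj\<close>)
qed

lemma hom_cpx_ops:
 "0[obj (HC X Y) n] = (%i. \<lambda>x\<in>El X i. 0[obj Y (i + n)])"
 "ph +[obj (HC X Y) n] ps = (%i. \<lambda>x\<in>El X i. ph i x +[obj Y (i + n)] ps i x)"
 "r *[obj (HC X Y) n] ph = (%i. \<lambda>x\<in>El X i. r *[obj Y (i + n)] ph i x)"
 by (simp_all add: hom_cpx_def)

lemma module_hom_cpx [simp]: "CC X ==> CC Y ==> Md (obj (HC X Y) n)"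
 by (simp add: hom_cpx_def)

lemma hom_cpx_neg:
 assumes X: "CC X" and Y: "CC Y" and p: "ph:El (HC X Y) n"
  and x: "x:El X i"
 shows "(~[obj (HC X Y) n] ph) i x = ~[obj Y (i + n)] ph i x"
proof -
 have "(%ph. ph i x):Hom (obj (HC X Y) n) (obj Y (i + n))"
  by (rule mod_homI) (use x in \<open>simp_all add: hom_cpx_ops hom_cpx_closed\<close>)
 from hom_neg[OF this _ _ p] X Y show ?thesis by simp
qed

lemma hom_cpx_minus:
 assumes X: "CC X" and Y: "CC Y" and p: "ps:El (HC X Y) n"
  and x: "x:El X i"
 shows "(ph -[obj (HC X Y) n] ps) i x = ph i x -[obj Y (i + n)] ps i x"
 using hom_cpx_neg[OF X Y p x] x by (simp add: a_minus_def hom_cpx_ops)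

lemma hom_cpx_dif:
 "dif (HC X Y) n ph = (%i. \<lambda>x\<in>El X i. dif Y (i + n) (ph i x) +[obj Y (i + n - 1)] sg (obj Y (i + n - 1)) (odd n) (ph (i - 1) (dif X i x)))"
 by (auto simp: hom_cpx_def fun_eq_iff sg_def a_minus_def)

lemma hom_cpx_prev: "ph:El (HC X Y) n ==> ph (i - 1):Hom (obj X (i - 1)) (obj Y (i + n - 1))"
 using hom_cpx_hom[of ph X Y n "i - 1"] by (simp add: int_index)

lemma sg_dist: "Md M ==> x:carrier M ==> y:carrier M ==> sg M b (x +[M] y) = sg M b x +[M] sg M b y"
 by (simp add: sg_def m_neg_add)
lemma sg_smult: "Md M ==> x:carrier M ==> r:carrier R ==> sg M b (r *[M] x) = r *[M] sg M b x"
 by (simp add: sg_def m_smult_neg)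

lemma hom_cpx_dif_hom:
 assumes X: "CC X" and Y: "CC Y" and p: "ph:El (HC X Y) n"
 shows "dif (HC X Y) n ph:El (HC X Y) (n - 1)"
proof -
 have "dif (HC X Y) n ph i:Hom (obj X i) (obj Y (i + n - 1))" for i
  unfolding hom_cpx_dif
  by (rule restrict_mod_hom[OF cc_module[OF X] hom_plus[OF hom_comp[OF hom_cpx_hom[OF p] cc_dif[OF Y]]
   sg_hom[OF cc_module[OF Y] hom_comp[OF cc_dif[OF X] hom_cpx_prev[OF p]]] cc_module[OF Y]]])
 thus ?thesis unfolding hom_cpx_obj by (simp add: int_index) (simp add: hom_cpx_dif)
qed

lemma chain_complex_hom [simp]:
 assumes X: "CC X" and Y: "CC Y" shows "CC (HC X Y)"
proof (rule chain_complexI)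
 fix n
 show "dif (HC X Y) n:Hom (obj (HC X Y) n) (obj (HC X Y) (n - 1))"
 proof (rule mod_homI, erule hom_cpx_dif_hom[OF X Y])
  fix ph ps assume p: "ph:El (HC X Y) n" and q: "ps:El (HC X Y) n"
  show "dif (HC X Y) n (ph +[obj (HC X Y) n] ps) =
   dif (HC X Y) n ph +[obj (HC X Y) (n - 1)] dif (HC X Y) n ps"
   unfolding hom_cpx_dif hom_cpx_ops
  proof (intro ext restrict_ext, simp add: int_index X, intro impI)
   fix i x assume x: "x:El X i"
   note c = hom_cpx_closed[OF p x] hom_cpx_closed[OF q x]
    hom_closed[OF hom_cpx_prev[OF p] d_closed[OF X x]] hom_closed[OF hom_cpx_prev[OF q] d_closed[OF X x]]
   let ?M = "obj Y (i + n - 1)" let ?s = "sg ?M (odd n)"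
   have m: "Md ?M" using Y by simp
   note e = d_closed[OF Y c(1)] d_closed[OF Y c(2)] sg_closed[OF m c(3)] sg_closed[OF m c(4)]
   show "dif Y (i + n) (ph i x +[obj Y (i + n)] ps i x) +[?M]
     ?s (ph (i - 1) (dif X i x) +[?M] ps (i - 1) (dif X i x)) =
    dif Y (i + n) (ph i x) +[?M] ?s (ph (i - 1) (dif X i x)) +[?M]
    (dif Y (i + n) (ps i x) +[?M] ?s (ps (i - 1) (dif X i x)))"
    unfolding d_add[OF Y c(1,2)] sg_dist[OF m c(3,4)] using e m by algebra
  qed
 next
  fix r ph assume r: "r:carrier R" and p: "ph:El (HC X Y) n"
  show "dif (HC X Y) n (r *[obj (HC X Y) n] ph) = r *[obj (HC X Y) (n - 1)] dif (HC X Y) n ph"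
   unfolding hom_cpx_dif hom_cpx_ops
  proof (intro ext restrict_ext, simp add: int_index X, intro impI)
   fix i x assume x: "x:El X i"
   note c = hom_cpx_closed[OF p x] hom_closed[OF hom_cpx_prev[OF p] d_closed[OF X x]]
   let ?M = "obj Y (i + n - 1)" let ?s = "sg ?M (odd n)"
   have m: "Md ?M" using Y by simp
   note e = d_closed[OF Y c(1)] sg_closed[OF m c(2)]
   show "dif Y (i + n) (r *[obj Y (i + n)] ph i x) +[?M] ?s (r *[?M] ph (i - 1) (dif X i x)) =
    r *[?M] (dif Y (i + n) (ph i x) +[?M] ?s (ph (i - 1) (dif X i x)))"
    unfolding d_smult[OF Y r c(1)] sg_smult[OF m c(2) r] by (simp add: m_smult_add[OF m r e])
  qed
 qed
next
 fix n ph assume p: "ph:El (HC X Y) n"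
 show "dif (HC X Y) (n - 1) (dif (HC X Y) n ph) = 0[obj (HC X Y) (n - 1 - 1)]"
 proof (rule hom_cpx_ext)
  show "dif (HC X Y) (n - 1) (dif (HC X Y) n ph):El (HC X Y) (n - 1 - 1)"
   by (rule hom_cpx_dif_hom[OF X Y hom_cpx_dif_hom[OF X Y p]])
  show "0[obj (HC X Y) (n - 1 - 1)]:El (HC X Y) (n - 1 - 1)" using X Y by simp
  fix i x assume x: "x:El X i"
  let ?N = "obj Y (i + n - 1)" let ?M = "obj Y (i + n - 1 - 1)"
  have m: "Md ?N" "Md ?M" using Y by simp_all
  note c = hom_cpx_closed[OF p x] hom_closed[OF hom_cpx_prev[OF p] d_closed[OF X x]]
  have z: "ph (i - 1 - 1) 0[obj X (i - 1 - 1)] = 0[?M]"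
   using hom_zero[OF hom_cpx_prev[OF p, of "i - 1"]] X Y by (simp add: int_index)
  have "dif Y (i + n - 1) (dif Y (i + n) (ph i x) +[?N] sg ?N (odd n) (ph (i - 1) (dif X i x))) +[?M]
   sg ?M (~ odd n) (dif Y (i + n - 1) (ph (i - 1) (dif X i x)) +[?M] sg ?M (odd n) (0[?M])) = 0[?M]"
   using c x Y m d_closed[OF Y c(2)] by (cases "odd n") (simp_all add: sg_def d_simps)
  thus "dif (HC X Y) (n - 1) (dif (HC X Y) n ph) i x = 0[obj (HC X Y) (n - 1 - 1)] i x"
   using z by (simp add: hom_cpx_dif hom_cpx_ops x X int_index add_diff_eq)
 qed
qed (use X Y in simp)

definition tw :: "('a, 'c) cpx => int => (int => 'd => 'c) => int => 'd => 'c" where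
 "tw Y n ph i x = sg (obj Y (i + n)) (even n \<or> even i) (ph i x)"

text \<open>The twist by \<open>(-1)\<^sup>n\<^sup>i\<close> turns cycles of degree \<open>n\<close> of a Hom complex into chain maps to the
 shifted complex whose differential carries no sign, and boundaries into maps \<open>d s + s d\<close>.\<close>

definition hom_of :: "('a, 'd) cpx => ('a, 'c) cpx => int => (int => 'd => 'c) => int => 'd => 'c" where
 "hom_of X Y n f = (%i. \<lambda>x\<in>El X i. tw Y n f i x)"

lemma hom_of_carrier:
 assumes X: "CC X" and Y: "CC Y" and f: "!!i. f i:Hom (obj X i) (obj Y (i + n))"
 shows "hom_of X Y n f:El (HC X Y) n"
 unfolding hom_cpx_obj hom_of_def tw_def
 by (intro allI conjI restrict_mod_hom sg_hom f restrict_extensional cc_module X Y)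

lemma tw_hom_of:
 assumes Y: "CC Y" and f: "!!i. f i:Hom (obj X i) (obj Y (i + n))" and x: "x:El X i"
 shows "tw Y n (hom_of X Y n f) i x = f i x"
 using hom_closed[OF f x] Y x by (simp add: tw_def hom_of_def)

lemma tw_hom:
 assumes Y: "CC Y" and p: "ph:El (HC X Y) n"
 shows "tw Y n ph i:Hom (obj X i) (obj (shift Y n) i)"
 unfolding tw_def shift_simps using sg_hom[OF cc_module[OF Y] hom_cpx_hom[OF p]] .

text \<open>The twist (-1)^(n i) times the sign (-1)^n of the Hom differential is (-1)^(n (i - 1)),
  which is the twist belonging to the component in degree \<open>i - 1\<close>.\<close>

lemma tw_dif:
 assumes X: "CC X" and Y: "CC Y" and p: "ph:El (HC X Y) n" and x: "x:El X i"
 shows "sg (obj Y (i + n - 1)) (even n \<or> even i) (dif (HC X Y) n ph i x) =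
  dif Y (i + n) (tw Y n ph i x) -[obj Y (i + n - 1)] tw Y n ph (i - 1) (dif X i x)"
proof -
 let ?M = "obj Y (i + n - 1)"
 have m: "Md ?M" using Y by simp
 note c = hom_cpx_closed[OF p x] hom_closed[OF hom_cpx_prev[OF p] d_closed[OF X x]]
 show ?thesis using x c m d_closed[OF Y c(1)] Y
  by (cases "even n"; cases "even i") (simp_all add: hom_cpx_dif tw_def sg_def int_index m_minus_eq m_neg_add d_neg)
qed

lemma hom_cycle_iff:
 assumes X: "CC X" and Y: "CC Y" and p: "ph:El (HC X Y) n"
 shows "dif (HC X Y) n ph = 0[obj (HC X Y) (n - 1)] \<longleftrightarrow> CM X (shift Y n) (tw Y n ph)"
proof -
 let ?H = "HC X Y"
 have D: "dif ?H n ph:El ?H (n - 1)" by (rule hom_cpx_dif_hom[OF X Y p])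
 have "dif ?H n ph = 0[obj ?H (n - 1)] \<longleftrightarrow> (ALL i. ALL x:El X i. dif ?H n ph i x = 0[obj Y (i + n - 1)])"
  using hom_cpx_ext[OF D m_zero[OF module_hom_cpx[OF X Y], of "n - 1"]] by (auto simp: hom_cpx_ops int_index)
 also have "... \<longleftrightarrow> (ALL i. ALL x:El X i. dif Y (i + n) (tw Y n ph i x) = tw Y n ph (i - 1) (dif X i x))"
 proof (intro iff_allI ball_cong refl)
  fix i x assume x: "x:El X i"
  let ?M = "obj Y (i + n - 1)"
  have m: "Md ?M" using Y by simp
  have c: "tw Y n ph i x:El Y (i + n)" "tw Y n ph (i - 1) (dif X i x):carrier ?M"
   using hom_closed[OF tw_hom[OF Y p] x] hom_closed[OF tw_hom[OF Y p] d_closed[OF X x]] by (simp_all add: int_index)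
  have e: "dif ?H n ph i x:carrier ?M" using hom_cpx_closed[OF D x] by (simp add: int_index)
  have "dif ?H n ph i x = 0[?M] \<longleftrightarrow> sg ?M (even n \<or> even i) (dif ?H n ph i x) = 0[?M]"
   using sg_sg[OF m e] sg_zero[OF m] by metis
  thus "dif ?H n ph i x = 0[?M] \<longleftrightarrow> dif Y (i + n) (tw Y n ph i x) = tw Y n ph (i - 1) (dif X i x)"
   unfolding tw_dif[OF X Y p x] using m_minus_zero_iff[OF m d_closed[OF Y c(1)] c(2)] by simp
 qed
 also have "... \<longleftrightarrow> CM X (shift Y n) (tw Y n ph)"
  unfolding chain_map_def using X Y chain_complex_shift[OF Y] tw_hom[OF Y p] by simp
 finally show ?thesis .
qed

lemma hbd_cong: "(!!i x. x:El X i ==> s i x = t i x) ==> CC X ==> x:El X i ==> hbd X Y s i x = hbd X Y t i x"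
 by (simp add: hbd_def)

text \<open>The sign is (-1)^(n i) although the argument has degree \<open>n + 1\<close>: with this
  choice the twisted boundary of \<open>ps\<close> is exactly \<open>d s + s d\<close>.\<close>

definition twh :: "('a, 'c) cpx => int => (int => 'd => 'c) => int => 'd => 'c" where
 "twh Y n ps i x = sg (obj Y (i + n + 1)) (even n \<or> even i) (ps i x)"

lemma twh_homotopy:
 assumes Y: "CC Y" and p: "ps:El (HC X Y) (n + 1)"
 shows "homotopy X (shift Y n) (twh Y n ps)"
 unfolding homotopy_def twh_def shift_simps int_index
 using sg_hom[OF cc_module[OF Y] hom_cpx_hom[OF p, unfolded int_index]] by blast

lemma tw_bd:
 assumes X: "CC X" and Y: "CC Y" and p: "ps:El (HC X Y) (n + 1)" and x: "x:El X i"
 shows "tw Y n (dif (HC X Y) (n + 1) ps) i x = hbd X (shift Y n) (twh Y n ps) i x"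
proof -
 let ?M = "obj Y (i + n)"
 have m: "Md ?M" using Y by simp
 have c: "ps i x:El Y (i + n + 1)" "ps (i - 1) (dif X i x):carrier ?M"
  using hom_cpx_closed[OF p x] hom_cpx_closed[OF p d_closed[OF X x]] by (simp_all add: int_index)
 show ?thesis using x c m d_closed'[OF Y c(1)] Y d_neg[OF Y c(1)]
  by (cases "even n"; cases "even i") (simp_all add: hom_cpx_dif tw_def twh_def hbd_def sg_def int_index m_neg_add)
qed

lemma hom_bd_iff:
 assumes X: "CC X" and Y: "CC Y" and p: "ph:El (HC X Y) n"
 shows "ph:boundaries (HC X Y) n \<longleftrightarrow> null X (shift Y n) (tw Y n ph)"
proof
 assume "ph:boundaries (HC X Y) n"
 then obtain ps where q: "ps:El (HC X Y) (n + 1)" "ph = dif (HC X Y) (n + 1) ps" by (auto simp: bd_iff)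
 show "null X (shift Y n) (tw Y n ph)"
  unfolding q(2) by (rule nullI[OF twh_homotopy[OF Y q(1)] tw_bd[OF X Y q(1)]])
next
 assume "null X (shift Y n) (tw Y n ph)"
 then obtain s where s: "homotopy X (shift Y n) s" "!!i x. x:El X i ==> tw Y n ph i x = hbd X (shift Y n) s i x" by (rule nullE) blast
 define ps where "ps = (%i. \<lambda>x\<in>El X i. twh Y n s i x)"
 have sh: "s i:Hom (obj X i) (obj Y (i + n + 1))" for i using homotopy_hom[OF s(1), of i] by (simp add: int_index)
 have q: "ps:El (HC X Y) (n + 1)"
  unfolding hom_cpx_obj ps_def twh_def int_index
  by (intro allI conjI restrict_mod_hom sg_hom sh restrict_extensional cc_module X Y)
 have t: "twh Y n ps i x = s i x" if "x:El X i" for i x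
  using that hom_closed[OF sh that] Y by (simp add: ps_def twh_def)
 have "dif (HC X Y) (n + 1) ps = ph"
 proof (rule hom_cpx_ext[OF _ p])
  show 1: "dif (HC X Y) (n + 1) ps:El (HC X Y) n"
   using hom_cpx_dif_hom[OF X Y q] by simp
  fix i x assume x: "x:El X i"
  have "tw Y n (dif (HC X Y) (n + 1) ps) i x = tw Y n ph i x"
   unfolding tw_bd[OF X Y q x] s(2)[OF x] by (rule hbd_cong[OF t X x])
  thus "dif (HC X Y) (n + 1) ps i x = ph i x"
   using sg_sg[OF cc_module[OF Y] hom_cpx_closed[OF 1 x]] sg_sg[OF cc_module[OF Y] hom_cpx_closed[OF p x]] unfolding tw_def by metis
 qed
 thus "ph:boundaries (HC X Y) n" using q by (auto simp: bd_iff)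
qed

lemma hom_of_cycle: assumes f: "CM X (shift Y n) f" and Y: "CC Y"
 shows "hom_of X Y n f:carrier (cycles (HC X Y) n)"
proof -
 note X = cm_complex(1)[OF f]
 have h: "f i:Hom (obj X i) (obj Y (i + n))" for i using cm_hom[OF f, of i] by simp
 have c: "hom_of X Y n f:El (HC X Y) n" by (rule hom_of_carrier[OF X Y h])
 show ?thesis using c hom_cycle_iff[OF X Y c] chain_map_cong[OF f tw_hom_of[OF Y h]] by simp
qed

lemma cycle_chain_map: assumes p: "ph:carrier (cycles (HC X Y) n)" and X: "CC X" and Y: "CC Y"
 shows "CM X (shift Y n) (tw Y n ph)"
 using p hom_cycle_iff[OF X Y, of ph n] by simp

text \<open>Acyclicity of Hom(X, Y) in terms of maps rather than elements, so that the signs of the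
  Hom complex disappear.\<close>

definition orth :: "('a, 'c) cpx => ('a, 'd) cpx => bool" where
 "orth X Y \<longleftrightarrow> (ALL n f. CM X (shift Y n) f --> null X (shift Y n) f)"

lemma acyclic_hom_iff: assumes X: "CC X" and Y: "CC Y"
 shows "acyclic_cpx (HC X Y) \<longleftrightarrow> orth X Y"
proof
 assume A: "acyclic_cpx (HC X Y)"
 show "orth X Y" unfolding orth_def
 proof (intro allI impI)
  fix n f assume f: "CM X (shift Y n) f"
  have h: "f i:Hom (obj X i) (obj Y (i + n))" for i using cm_hom[OF f, of i] by simp
  have c: "hom_of X Y n f:carrier (cycles (HC X Y) n)" by (rule hom_of_cycle[OF f Y])
  have "hom_of X Y n f:boundaries (HC X Y) n"
   using A c unfolding acyclic_cpx_def zero_homology_iff[OF chain_complex_hom[OF X Y]] by simp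
  hence "null X (shift Y n) (tw Y n (hom_of X Y n f))" using hom_bd_iff[OF X Y] c by simp
  from null_cong[OF this] tw_hom_of[OF Y h] show "null X (shift Y n) f" by simp
 qed
next
 assume O: "orth X Y"
 show "acyclic_cpx (HC X Y)"
  unfolding acyclic_cpx_def zero_homology_iff[OF chain_complex_hom[OF X Y]]
  using O hom_bd_iff[OF X Y] hom_cycle_iff[OF X Y] unfolding orth_def by blast
qed

section \<open>Functoriality of Hom complexes\<close>

definition prec :: "('a, 'c) cpx => (int => 'c => 'd) => int => (int => 'd => 'e) => int => 'c => 'e" where
 "prec A a n ph = (%i. \<lambda>x\<in>El A i. ph i (a i x))"

definition postc :: "('a, 'c) cpx => (int => 'd => 'e) => int => (int => 'c => 'd) => int => 'c => 'e" where
 "postc X g n ph = (%i. \<lambda>x\<in>El X i. g (i + n) (ph i x))"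

lemma chain_map_prec:
 assumes a: "CM A B a" and Y: "CC Y"
 shows "CM (HC B Y) (HC A Y) (prec A a)"
proof (rule chain_mapI)
 note A = cm_complex(1)[OF a] and B = cm_complex(2)[OF a]
 show "CC (HC B Y)" "CC (HC A Y)" using A B Y by simp_all
 fix n
 have car: "prec A a n ph:El (HC A Y) n" if "ph:El (HC B Y) n" for ph n
  unfolding hom_cpx_obj prec_def using restrict_mod_hom[OF cc_module[OF A] hom_comp[OF cm_hom[OF a] hom_cpx_hom[OF that]]] by simp
 show "prec A a n:Hom (obj (HC B Y) n) (obj (HC A Y) n)"
  by (rule mod_homI, erule car) (auto simp: prec_def hom_cpx_ops fun_eq_iff cm_closed[OF a])
 fix ph assume p: "ph:El (HC B Y) n"
 show "dif (HC A Y) n (prec A a n ph) = prec A a (n - 1) (dif (HC B Y) n ph)"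
  by (auto simp: prec_def hom_cpx_dif fun_eq_iff cm_closed[OF a] cm_d[OF a] A)
qed

lemma chain_map_postc:
 assumes g: "CM Y Z g" and X: "CC X"
 shows "CM (HC X Y) (HC X Z) (postc X g)"
proof (rule chain_mapI)
 note Y = cm_complex(1)[OF g] and Z = cm_complex(2)[OF g]
 show "CC (HC X Y)" "CC (HC X Z)" using X Y Z by simp_all
 fix n
 have car: "postc X g n ph:El (HC X Z) n" if "ph:El (HC X Y) n" for ph n
  unfolding hom_cpx_obj postc_def using restrict_mod_hom[OF cc_module[OF X] hom_comp[OF hom_cpx_hom[OF that] cm_hom[OF g]]] by simp
 show "postc X g n:Hom (obj (HC X Y) n) (obj (HC X Z) n)"
  by (rule mod_homI, erule car)
   (auto simp: postc_def hom_cpx_ops fun_eq_iff cm_add[OF g hom_cpx_closed hom_cpx_closed] cm_smult[OF g _ hom_cpx_closed])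
 fix ph assume p: "ph:El (HC X Y) n"
 have "dif Z (i + n) (g (i + n) (ph i x)) +[obj Z (i + n - 1)] sg (obj Z (i + n - 1)) (odd n) (g (i - 1 + n) (ph (i - 1) (dif X i x))) =
  g (i + n - 1) (dif Y (i + n) (ph i x) +[obj Y (i + n - 1)] sg (obj Y (i + n - 1)) (odd n) (ph (i - 1) (dif X i x)))"
  if x: "x:El X i" for i x
 proof -
  note c = hom_cpx_closed[OF p x] hom_closed[OF hom_cpx_prev[OF p] d_closed[OF X x]]
  have "g (i + n - 1) (dif Y (i + n) (ph i x) +[obj Y (i + n - 1)] sg (obj Y (i + n - 1)) (odd n) (ph (i - 1) (dif X i x))) =
   g (i + n - 1) (dif Y (i + n) (ph i x)) +[obj Z (i + n - 1)] g (i + n - 1) (sg (obj Y (i + n - 1)) (odd n) (ph (i - 1) (dif X i x)))"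
   by (rule cm_add[OF g d_closed[OF Y c(1)] sg_closed[OF cc_module[OF Y] c(2)]])
  thus ?thesis unfolding hom_sg[OF cm_hom[OF g] cc_module[OF Y] cc_module[OF Z] c(2)] cm_d[OF g c(1)] by (simp add: int_index)
 qed
 thus "dif (HC X Z) n (postc X g n ph) = postc X g (n - 1) (dif (HC X Y) n ph)"
  by (auto simp: postc_def hom_cpx_dif fun_eq_iff X int_index)
qed

lemma tw_prec: "CM A B a ==> x:El A i ==> tw Y n (prec A a n ph) i x = tw Y n ph i (a i x)"
 by (simp add: tw_def prec_def)

lemma chain_map_shift: assumes g: "CM Y Z g" shows "CM (shift Y n) (shift Z n) (%i. g (i + n))"
 by (rule chain_mapI) (use cm_complex[OF g] cm_hom[OF g] in \<open>simp_all add: cm_d[OF g] int_index\<close>)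

text \<open>After the twist, homology classes of a Hom complex are homotopy classes of chain maps;
  \<open>inj\<close> and \<open>surj\<close> are injectivity and surjectivity of composition with
  \<open>a\<close> on these.\<close>

lemma prec_qi:
 assumes a: "CM A B a" and Y: "CC Y"
  and inj: "!!n f. CM B (shift Y n) f ==> null A (shift Y n) (%i x. f i (a i x)) ==> null B (shift Y n) f"
  and surj: "!!n f. CM A (shift Y n) f ==> EX g. CM B (shift Y n) g & htp A (shift Y n) f (%i x. g i (a i x))"
 shows "QI (HC B Y) (HC A Y) (prec A a)"
 unfolding quasi_iso_iff[OF chain_map_prec[OF a Y]]
proof (intro conjI allI impI)
 note A = cm_complex(1)[OF a] and B = cm_complex(2)[OF a]
 note P = chain_map_prec[OF a Y]
 fix n ph
 { assume p: "ph:carrier (cycles (HC B Y) n)" and b: "prec A a n ph:boundaries (HC A Y) n"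
  have c: "ph:El (HC B Y) n" using p by simp
  from b have "null A (shift Y n) (tw Y n (prec A a n ph))" using hom_bd_iff[OF A Y cm_closed[OF P c]] by simp
  hence "null A (shift Y n) (%i x. tw Y n ph i (a i x))" by (rule null_cong) (simp add: tw_prec[OF a])
  from inj[OF cycle_chain_map[OF p B Y] this] show "ph:boundaries (HC B Y) n" using hom_bd_iff[OF B Y c] by simp }
 { assume p: "ph:carrier (cycles (HC A Y) n)"
  have c: "ph:El (HC A Y) n" using p by simp
  obtain g where g: "CM B (shift Y n) g" "htp A (shift Y n) (tw Y n ph) (%i x. g i (a i x))"
   using surj[OF cycle_chain_map[OF p A Y]] by blast
  have gh: "g i:Hom (obj B i) (obj Y (i + n))" for i using cm_hom[OF g(1), of i] by simp
  let ?g = "hom_of B Y n g" let ?b = "ph -[obj (HC A Y) n] prec A a n ?g"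
  have gc: "?g:carrier (cycles (HC B Y) n)" by (rule hom_of_cycle[OF g(1) Y])
  hence pg: "prec A a n ?g:El (HC A Y) n" using cm_closed[OF P] by simp
  have m: "Md (obj (HC A Y) n)" using A Y by simp
  have bc: "?b:El (HC A Y) n" by (rule m_minus[OF m c pg])
  have "null A (shift Y n) (%i x. tw Y n ph i x -[obj (shift Y n) i] g i (a i x))"
   using htp_null_diff[OF cycle_chain_map[OF p A Y] chain_map_comp[OF a g(1)]] g(2) by simp
  hence "null A (shift Y n) (tw Y n ?b)"
  proof (rule null_cong)
   fix i x assume x: "x:El A i"
   have ga: "g i (a i x):El Y (i + n)" by (rule hom_closed[OF gh cm_closed[OF a x]])
   have "g i (a i x) = sg (obj Y (i + n)) (even n \<or> even i) (prec A a n ?g i x)"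
    using tw_hom_of[OF Y gh cm_closed[OF a x]] tw_prec[OF a x, of Y n ?g] by (simp add: tw_def)
   thus "tw Y n ?b i x = tw Y n ph i x -[obj (shift Y n) i] g i (a i x)"
    using hom_cpx_minus[OF A Y pg x, of ph] sg_dist[OF cc_module[OF Y] hom_cpx_closed[OF c x] m_neg[OF cc_module[OF Y] hom_cpx_closed[OF pg x]]]
    by (simp add: tw_def m_minus_eq[OF cc_module[OF Y]]) (simp add: sg_def)
  qed
  hence "?b:boundaries (HC A Y) n" using hom_bd_iff[OF A Y bc] by simp
  moreover have "ph = ?b +[obj (HC A Y) n] prec A a n ?g" using m_minus_add_cancel[OF m c pg] by simp
  ultimately show "EX ps:carrier (cycles (HC B Y) n). EX b:boundaries (HC A Y) n.
   ph = b +[obj (HC A Y) n] prec A a n ps" using gc by blast }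
qed

text \<open>A homotopy \<open>s\<close> on the target acts on Hom complexes by composition, f -> s
  f, with no sign.\<close>

lemma heq_postc_qi:
 assumes h: "heq Y Z f g" and X: "CC X"
 shows "QI (HC X Y) (HC X Z) (postc X f)"
proof -
 have f: "CM Y Z f" and g: "CM Z Y g" and hY: "htp Y Y (%i x. g i (f i x)) (%i x. x)"
  and hZ: "htp Z Z (%i y. f i (g i y)) (%i y. y)" using h by (simp_all add: heq_def)
 have id: "htp (HC X Y) (HC X Y) (%n ph. postc X g n (postc X f n ph)) (%n ph. ph)"
  if f: "CM Y Z f" and g: "CM Z Y g" and hY: "htp Y Y (%i x. g i (f i x)) (%i x. x)"
  for f g and Y :: "('a, 'x) cpx" and Z :: "('a, 'y) cpx"
 proof -
  note Y = cm_complex(1)[OF f]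
  from hY obtain s where s: "homotopy Y Y s" "!!i x. x:El Y i ==> g i (f i x) = x +[obj Y i] hbd Y Y s i x" by (rule htpE) blast
  define t where "t n ph = (%i. \<lambda>x\<in>El X i. s (i + n) (ph i x))" for n ph
  have tc: "t n ph:El (HC X Y) (n + 1)" if "ph:El (HC X Y) n" for n ph
   unfolding hom_cpx_obj t_def int_index
   using restrict_mod_hom[OF cc_module[OF X] hom_comp[OF hom_cpx_hom[OF that] homotopy_hom[OF s(1)]]] by simp
  have ht: "homotopy (HC X Y) (HC X Y) t" unfolding homotopy_def
   by (intro allI mod_homI, erule tc)
    (auto simp: t_def hom_cpx_ops fun_eq_iff int_index hom_add[OF homotopy_hom[OF s(1)] hom_cpx_closed hom_cpx_closed]
     hom_smult[OF homotopy_hom[OF s(1)] _ hom_cpx_closed])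
  show ?thesis
  proof (rule htpI[OF ht])
   fix n ph assume p: "ph:El (HC X Y) n"
   have P: "CM (HC X Y) (HC X Y) (%n ph. postc X g n (postc X f n ph))"
    by (rule chain_map_comp[OF chain_map_postc[OF f X] chain_map_postc[OF g X]])
   have m: "Md (obj (HC X Y) n)" using X Y by simp
   note H = chain_complex_hom[OF X Y]
   have hb: "hbd (HC X Y) (HC X Y) t n ph:El (HC X Y) n" by (rule hbd_closed[OF ht H H p])
   show "postc X g n (postc X f n ph) = ph +[obj (HC X Y) n] hbd (HC X Y) (HC X Y) t n ph"
   proof (rule hom_cpx_ext[OF cm_closed[OF P p] m_add[OF m p hb]])
    fix i x assume x: "x:El X i"
    let ?M = "obj Y (i + n)" let ?a = "ph i x" let ?b = "ph (i - 1) (dif X i x)"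
    note c = hom_cpx_closed[OF p x] hom_closed[OF hom_cpx_prev[OF p] d_closed[OF X x]]
    have m': "Md ?M" using Y by simp
    have sc: "s (i + n) ?a:El Y (i + n + 1)" "s (i + n - 1) ?b:carrier ?M"
     "s (i + n - 1) (dif Y (i + n) ?a):carrier ?M"
     using homotopy_closed[OF s(1) c(1)] homotopy_closed'[OF s(1) c(2)] homotopy_closed'[OF s(1) d_closed[OF Y c(1)]] by simp_all
    have dc: "dif Y (i + n + 1) (s (i + n) ?a):carrier ?M" by (rule d_closed'[OF Y sc(1)])
    have sd: "s (i + n - 1) (dif Y (i + n) ?a +[obj Y (i + n - 1)] sg (obj Y (i + n - 1)) (odd n) ?b) =
     s (i + n - 1) (dif Y (i + n) ?a) +[?M] sg ?M (odd n) (s (i + n - 1) ?b)"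
     using hom_add[OF homotopy_hom'[OF s(1)] d_closed[OF Y c(1)] sg_closed[OF cc_module[OF Y] c(2)]]
      hom_sg[OF homotopy_hom'[OF s(1)] cc_module[OF Y] m' c(2)] by simp
    \<comment> \<open>The two terms \<open>s ph d\<close> have opposite signs, one coming from
      degree \<open>n + 1\<close> and one from degree \<open>n\<close>, and cancel.\<close>
    have "hbd (HC X Y) (HC X Y) t n ph i x =
     (dif Y (i + n + 1) (s (i + n) ?a) +[?M] sg ?M (even n) (s (i + n - 1) ?b)) +[?M]
     (s (i + n - 1) (dif Y (i + n) ?a) +[?M] sg ?M (odd n) (s (i + n - 1) ?b))"
     unfolding hbd_def hom_cpx_ops using x X sd by (simp add: hom_cpx_dif t_def int_index)
    also have "... = hbd Y Y s (i + n) ?a" unfolding hbd_def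
     using sc dc m' unfolding sg_def by (cases "even n"; simp; algebra)
    finally show "postc X g n (postc X f n ph) i x = (ph +[obj (HC X Y) n] hbd (HC X Y) (HC X Y) t n ph) i x"
     using s(2)[OF c(1)] x by (simp add: postc_def hom_cpx_ops)
   qed
  qed
 qed
 have "heq (HC X Y) (HC X Z) (postc X f) (postc X g)"
  unfolding heq_def using chain_map_postc[OF f X] chain_map_postc[OF g X] id[OF f g hY] id[OF g f hZ] by blast
 thus ?thesis by (rule heq_qi)
qed



lemma shift_shift: "shift (shift X n) m = shift X (n + m)"
 by (simp add: shift_def add_ac)

section \<open>Mapping cones\<close>

text \<open>The cone below negates the differential of its second component, while shifts change no
  sign. Some maps into or out of a cone are then chain maps only after all differentials of the cone
  are negated.\<close>

definition ncpx :: "('a, 'c) cpx => ('a, 'c) cpx" where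
 "ncpx X = \<lparr>obj = obj X, dif = (%i x. ~[obj X (i - 1)] dif X i x)\<rparr>"

lemma ncpx_simps [simp]: "obj (ncpx X) = obj X" "dif (ncpx X) i x = ~[obj X (i - 1)] dif X i x"
 by (simp_all add: ncpx_def)

lemma chain_complex_ncpx: assumes X: "CC X" shows "CC (ncpx X)"
proof (rule chain_complexI)
 fix i show "dif (ncpx X) i:Hom (obj (ncpx X) i) (obj (ncpx X) (i - 1))"
  unfolding ncpx_def using hom_uminus[OF cc_dif[OF X] cc_module[OF X]] by simp
qed (use X in \<open>simp_all add: d_neg\<close>)

lemma acyclic_iff: "CC X ==> acyclic_cpx X \<longleftrightarrow>
  (ALL i x. x:El X i --> dif X i x = 0[obj X (i - 1)] --> (EX w:El X (i + 1). x = dif X (i + 1) w))"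
 by (simp add: acyclic_cpx_def zero_homology_iff bd_iff)

lemma acyclic_ncpx: assumes X: "CC X" and a: "acyclic_cpx X" shows "acyclic_cpx (ncpx X)"
 unfolding acyclic_iff[OF chain_complex_ncpx[OF X]]
proof (intro allI impI)
 fix i x assume x: "x:El (ncpx X) i" and d: "dif (ncpx X) i x = 0[obj (ncpx X) (i - 1)]"
 have xc: "x:El X i" using x by simp
 have "~[obj X (i - 1)] (~[obj X (i - 1)] dif X i x) = dif X i x" by (rule m_neg_neg[OF cc_module[OF X] d_closed[OF X xc]])
 hence "dif X i x = 0[obj X (i - 1)]" using d X by simp
 then obtain w where w: "w:El X (i + 1)" "x = dif X (i + 1) w" using a xc unfolding acyclic_iff[OF X] by blast
 hence "x = dif (ncpx X) (i + 1) (~[obj X (i + 1)] w)" using X d_neg[OF X w(1)] by simp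
 thus "EX w:El (ncpx X) (i + 1). x = dif (ncpx X) (i + 1) w" using w(1) X by auto
qed

definition cone :: "('a, 'c) cpx => ('a, 'd) cpx => (int => 'c => 'd) => ('a, 'c \<times> 'd) cpx" where
 "cone A B f = \<lparr>obj = (%i. dsum (obj A (i - 1)) (obj B i)),
  dif = (%i x. (dif A (i - 1) (fst x), f (i - 1) (fst x) -[obj B (i - 1)] dif B i (snd x)))\<rparr>"

lemma cone_simps [simp]: "obj (cone A B f) i = dsum (obj A (i - 1)) (obj B i)"
 "dif (cone A B f) i x = (dif A (i - 1) (fst x), f (i - 1) (fst x) -[obj B (i - 1)] dif B i (snd x))"
 by (simp_all add: cone_def)

lemma hom_pair: "f:Hom M N ==> g:Hom M P ==> (%x. (f x, g x)):Hom M (dsum N P)"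
 by (rule mod_homI) (simp_all add: hom_closed hom_add hom_smult)

lemma chain_complex_cone: assumes f: "CM A B f" shows "CC (cone A B f)"
proof -
 note A = cm_complex(1)[OF f] and B = cm_complex(2)[OF f]
 show ?thesis
 proof (rule chain_complexI)
  fix i
  show "Md (obj (cone A B f) i)" using A B by simp
  show "dif (cone A B f) i:Hom (obj (cone A B f) i) (obj (cone A B f) (i - 1))"
   using hom_pair[OF hom_comp[OF hom_fst cc_dif[OF A, of "i - 1"]]
    hom_diff[OF hom_comp[OF hom_fst cm_hom[OF f, of "i - 1"]] hom_comp[OF hom_snd cc_dif[OF B, of i]] cc_module[OF B]]]
   unfolding cone_def by simp
  fix x assume "x:El (cone A B f) i"
  hence x: "fst x:El A (i - 1)" "snd x:El B i" by auto
  have "f (i - 1 - 1) (dif A (i - 1) (fst x)) -[obj B (i - 1 - 1)] dif B (i - 1) (f (i - 1) (fst x) -[obj B (i - 1)] dif B i (snd x)) = 0[obj B (i - 1 - 1)]"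
   unfolding d_minus[OF B cm_closed[OF f x(1)] d_closed[OF B x(2)]] d_d[OF B x(2)] cm_d[OF f x(1)]
   using cm_closed[OF f d_closed[OF A x(1)]] B by (simp add: m_minus_eq)
  thus "dif (cone A B f) (i - 1) (dif (cone A B f) i x) = 0[obj (cone A B f) (i - 1 - 1)]"
   using d_d[OF A x(1)] by simp
 qed
qed

text \<open>A cycle (a, b) has f a = d b, so injectivity on homology gives a = d a'. Surjectivity,
  applied to the cycle f a' - b, corrects a' by a cycle so that b is reached as well.\<close>

lemma acyclic_cone: assumes q: "QI A B f" shows "acyclic_cpx (cone A B f)"
proof -
 note f = qi_cm[OF q]
 note A = cm_complex(1)[OF f] and B = cm_complex(2)[OF f]
 note I = q[unfolded quasi_iso_iff[OF f]]
 show ?thesis unfolding acyclic_iff[OF chain_complex_cone[OF f]]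
 proof (intro allI impI)
  fix i x assume xc: "x:El (cone A B f) i" and d: "dif (cone A B f) i x = 0[obj (cone A B f) (i - 1)]"
  define a b where "a = fst x" and "b = snd x"
  have x: "a:El A (i - 1)" "b:El B i" and xab: "x = (a, b)" using xc by (auto simp: a_def b_def)
  have da: "dif A (i - 1) a = 0[obj A (i - 1 - 1)]" and fa: "f (i - 1) a = dif B i b"
   using d x m_minus_zero_iff[OF cc_module[OF B] cm_closed[OF f x(1)] d_closed[OF B x(2)]] by (simp_all add: xab)
  have "f (i - 1) a:boundaries B (i - 1)" unfolding bd_iff fa using x by (auto intro!: bexI[of _ b])
  hence "a:boundaries A (i - 1)" using I x(1) da by simp
  then obtain a' where a': "a':El A i" "a = dif A i a'" by (auto simp: bd_iff)
  let ?c = "f i a' -[obj B i] b"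
  have fa': "f i a':El B i" by (rule cm_closed[OF f a'(1)])
  have "dif B i ?c = 0[obj B (i - 1)]"
   unfolding d_minus[OF B fa' x(2)] cm_d[OF f a'(1)] a'(2)[symmetric] fa using x B by (simp add: m_minus_cancel)
  hence "?c:carrier (cycles B i)" using fa' x(2) B by simp
  then obtain z n where z: "z:carrier (cycles A i)" "n:boundaries B i" "?c = n +[obj B i] f i z"
   using I by blast
  then obtain w where w: "w:El B (i + 1)" "n = dif B (i + 1) w" by (auto simp: bd_iff)
  have zc: "z:El A i" "dif A i z = 0[obj A (i - 1)]" using z(1) by simp_all
  have "f i (a' -[obj A i] z) -[obj B i] n = f i a' -[obj B i] ?c"
   unfolding z(3) cm_minus[OF f a'(1) zc(1)] using fa' cm_closed[OF f zc(1)] bd_closed[OF B z(2)] cc_module[OF B, of i] by algebra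
  also have "... = b" using fa' x(2) cc_module[OF B, of i] by algebra
  finally have 1: "b = f i (a' -[obj A i] z) -[obj B i] dif B (i + 1) w" using w by simp
  have 2: "a = dif A i (a' -[obj A i] z)" unfolding d_minus[OF A a'(1) zc(1)] a'(2) zc(2) using A a'(1) by (simp add: m_minus_eq)
  show "EX w:El (cone A B f) (i + 1). x = dif (cone A B f) (i + 1) w"
   by (rule bexI[of _ "(a' -[obj A i] z, w)"]) (use 1 2 xab w(1) a'(1) zc(1) A in simp_all)
 qed
qed

lemma hom_inl: "Md M ==> Md N ==> (%x. (x, 0[N])):Hom M (dsum M N)"
 and hom_inr: "Md M ==> Md N ==> (%x. (0[M], x)):Hom N (dsum M N)"
 by (rule mod_homI; simp)+

lemma hom_split: assumes "g:Hom (dsum M N) P" "Md M" "Md N" "x:carrier M" "y:carrier N"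
 shows "g (x, y) = g (x, 0[N]) +[P] g (0[M], y)"
 using hom_add[OF assms(1), of "(x, 0[N])" "(0[M], y)"] assms(2-) by simp

text \<open>The map (a, b) -> u a is a chain map of degree -1 on the cone. A null homotopy of it,
  restricted to \<open>B\<close>, is the extension \<open>v\<close>; restricted to \<open>A\<close>,
  it is the homotopy between u and v f.\<close>

lemma cone_source_surj:
 assumes f: "CM A B f" and u: "CM A N u"
  and O: "!!ph. CM (cone A B f) (shift N (- 1)) ph ==> null (cone A B f) (shift N (- 1)) ph"
 shows "EX v. CM B N v & htp A N u (%i x. v i (f i x))"
proof -
 note A = cm_complex(1)[OF f] and B = cm_complex(2)[OF f] and N = cm_complex(2)[OF u]
 let ?C = "cone A B f"
 have "CM ?C (shift N (- 1)) (%i x. u (i - 1) (fst x))"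
 proof (rule chain_mapI[OF chain_complex_cone[OF f] chain_complex_shift[OF N]])
  fix i show "(%x. u (i - 1) (fst x)):Hom (obj ?C i) (obj (shift N (- 1)) i)"
   using hom_comp[OF hom_fst cm_hom[OF u, of "i - 1"]] by simp
 qed (simp add: cm_d[OF u] mem_Times_iff)
 from O[OF this] obtain s where s: "homotopy ?C (shift N (- 1)) s"
  "!!i x. x:El ?C i ==> u (i - 1) (fst x) = hbd ?C (shift N (- 1)) s i x" by (rule nullE) blast
 have sh: "s i:Hom (dsum (obj A (i - 1)) (obj B i)) (obj N i)" for i using homotopy_hom[OF s(1), of i] by simp
 define v where "v i b = s i (0[obj A (i - 1)], b)" for i b
 define w where "w i a = s (i + 1) (a, 0[obj B (i + 1)])" for i a
 have vh: "v i:Hom (obj B i) (obj N i)" for i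
  unfolding v_def using hom_comp[OF hom_inr[of "obj A (i - 1)" "obj B i"] sh] A B by simp
 have sh': "s (i + 1):Hom (dsum (obj A i) (obj B (i + 1))) (obj N (i + 1))" for i using sh[of "i + 1"] by simp
 have wh: "homotopy A N w" unfolding homotopy_def w_def
  using hom_comp[OF hom_inl[OF cc_module[OF A] cc_module[OF B]] sh'] by blast
 note vc = hom_closed[OF vh]
 have e: "u (i - 1) (fst x) = dif N i (s i x) +[obj N (i - 1)] s (i - 1) (dif ?C i x)" if "x:El ?C i" for i x
  using s(2)[OF that] by (simp add: hbd_def)
 have v: "CM B N v"
 proof (rule chain_mapI[OF B N vh])
  fix i b assume b: "b:El B i"
  have "s (i - 1) (dif ?C i (0[obj A (i - 1)], b)) = ~[obj N (i - 1)] v (i - 1) (dif B i b)"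
   using hom_neg[OF vh cc_module[OF B] cc_module[OF N] d_closed[OF B b]] A B b
   by (simp add: v_def m_minus_eq cm_zero[OF f])
  hence "0[obj N (i - 1)] = dif N i (v i b) +[obj N (i - 1)] ~[obj N (i - 1)] v (i - 1) (dif B i b)"
   using e[of "(0[obj A (i - 1)], b)" i] A B b by (simp add: v_def cm_zero[OF u])
  thus "dif N i (v i b) = v (i - 1) (dif B i b)"
   using m_minus_zero_iff[OF cc_module[OF N] d_closed[OF N vc[OF b]] vc[OF d_closed[OF B b]]] by (simp add: a_minus_def)
 qed
 moreover have "htp A N u (%i x. v i (f i x))"
 proof (rule htpI[OF wh])
  fix i a assume a: "a:El A i"
  have fa: "f i a:El B i" and da: "dif A i a:El A (i - 1)"
   using cm_closed[OF f a] d_closed[OF A a] by auto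
  have 1: "s i (dif A i a, f i a) = s i (dif A i a, 0[obj B i]) +[obj N i] v i (f i a)"
   unfolding v_def by (rule hom_split[OF sh cc_module[OF A] cc_module[OF B] da fa])
  have 2: "s i (dif A i a, 0[obj B i]) = w (i - 1) (dif A i a)" by (simp add: w_def)
  have d: "dif ?C (i + 1) (a, 0[obj B (i + 1)]) = (dif A i a, f i a)"
   using d_zero[OF B, of "i + 1"] B fa by (simp add: m_minus_eq)
  have E: "u i a = dif N (i + 1) (w i a) +[obj N i] s i (dif A i a, f i a)"
   using e[of "(a, 0[obj B (i + 1)])" "i + 1", unfolded d] a B by (simp add: w_def)
  show "u i a = v i (f i a) +[obj N i] hbd A N w i a"
   unfolding hbd_def E 1 2
   using d_closed'[OF N homotopy_closed[OF wh a]] homotopy_closed'[OF wh da] vc[OF fa] cc_module[OF N, of i] by algebra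
 qed
 ultimately show ?thesis by blast
qed

text \<open>A null homotopy \<open>w\<close> of v f makes (a, b) -> v b - w a a chain map on the
  negated cone. Its null homotopy, restricted to \<open>B\<close>, kills \<open>v\<close>.\<close>

lemma cone_source_inj:
 assumes f: "CM A B f" and v: "CM B N v" and n: "null A N (%i x. v i (f i x))"
  and O: "!!ph. CM (ncpx (cone A B f)) N ph ==> null (ncpx (cone A B f)) N ph"
 shows "null B N v"
proof -
 note A = cm_complex(1)[OF f] and B = cm_complex(2)[OF f] and N = cm_complex(2)[OF v]
 let ?C = "ncpx (cone A B f)"
 from n obtain w where w: "homotopy A N w" "!!i a. a:El A i ==> v i (f i a) = hbd A N w i a" by (rule nullE) blast
 define ph where "ph i x = v i (snd x) -[obj N i] w (i - 1) (fst x)" for i x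
 have "CM ?C N ph"
 proof (rule chain_mapI[OF chain_complex_ncpx[OF chain_complex_cone[OF f]] N])
  fix i show "ph i:Hom (obj ?C i) (obj N i)"
   unfolding ph_def using hom_diff[OF hom_comp[OF hom_snd cm_hom[OF v]] hom_comp[OF hom_fst homotopy_hom'[OF w(1)]] cc_module[OF N]] by simp
  fix x assume "x:El ?C i"
  then obtain a b where x: "x = (a, b)" "a:El A (i - 1)" "b:El B i" by auto
  note c = cm_closed[OF v x(3)] homotopy_closed'[OF w(1) x(2)]
  have wd: "w (i - 1 - 1) (dif A (i - 1) a):El N (i - 1)" using homotopy_closed'[OF w(1) d_closed[OF A x(2)]] by simp
  have fb: "f (i - 1) a:El B (i - 1)" by (rule cm_closed[OF f x(2)])
  have d: "dif ?C i x = (~[obj A (i - 1 - 1)] dif A (i - 1) a, ~[obj B (i - 1)] (f (i - 1) a -[obj B (i - 1)] dif B i b))"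
   using A B x fb d_closed[OF A x(2)] by (simp add: dsum_neg)
  have vfa: "v (i - 1) (f (i - 1) a) = dif N i (w (i - 1) a) +[obj N (i - 1)] w (i - 1 - 1) (dif A (i - 1) a)"
   using w(2)[OF x(2)] by (simp add: hbd_def)
  have vb: "v (i - 1) (~[obj B (i - 1)] (f (i - 1) a -[obj B (i - 1)] dif B i b)) =
   ~[obj N (i - 1)] (v (i - 1) (f (i - 1) a) -[obj N (i - 1)] v (i - 1) (dif B i b))"
   unfolding cm_neg[OF v m_minus[OF cc_module[OF B] fb d_closed[OF B x(3)]]] cm_minus[OF v fb d_closed[OF B x(3)]] ..
  have wn: "w (i - 1 - 1) (~[obj A (i - 1 - 1)] dif A (i - 1) a) = ~[obj N (i - 1)] w (i - 1 - 1) (dif A (i - 1) a)"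
   using hom_neg[OF homotopy_hom'[OF w(1)] cc_module[OF A] cc_module[OF N] d_closed[OF A x(2)]] by simp
  show "dif N i (ph i x) = ph (i - 1) (dif ?C i x)"
   unfolding ph_def d snd_conv fst_conv vb wn vfa cm_d[OF v x(3), symmetric]
   unfolding x(1) fst_conv snd_conv d_minus[OF N c]
   using d_closed[OF N c(1)] d_closed[OF N c(2)] wd cc_module[OF N, of "i - 1"] by algebra
 qed
 from O[OF this] obtain s where s: "homotopy ?C N s" "!!i x. x:El ?C i ==> ph i x = hbd ?C N s i x" by (rule nullE) blast
 show ?thesis
 proof (rule nullI)
  show "homotopy B N (%i b. s i (0[obj A (i - 1)], b))" unfolding homotopy_def
   using hom_comp[OF hom_inr[OF cc_module[OF A] cc_module[OF B]] homotopy_hom[OF s(1), unfolded ncpx_simps cone_simps]] by blast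
  fix i b assume b: "b:El B i"
  have "ph i (0[obj A (i - 1)], b) = v i b"
   using homotopy_zero[OF w(1) A N, of "i - 1"] N cm_closed[OF v b] by (simp add: ph_def m_minus_eq)
  moreover have "dif ?C i (0[obj A (i - 1)], b) = (0[obj A (i - 1 - 1)], dif B i b)"
   using A B b by (simp add: dsum_neg cm_zero[OF f] m_minus_eq)
  ultimately show "v i b = hbd B N (%i b. s i (0[obj A (i - 1)], b)) i b"
   using s(2)[of "(0[obj A (i - 1)], b)" i] A b by (simp add: hbd_def)
 qed
qed

lemma orthD: "orth X Y ==> CM X (shift Y n) f ==> null X (shift Y n) f"
 by (simp add: orth_def)

lemma prec_qi_orth:
 assumes f: "CM A B f" and N: "CC N" and O: "orth (cone A B f) N" "orth (ncpx (cone A B f)) N"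
 shows "QI (HC B N) (HC A N) (prec A f)"
proof (rule prec_qi[OF f N])
 fix n v assume "CM B (shift N n) v" "null A (shift N n) (%i x. v i (f i x))"
 thus "null B (shift N n) v" by (rule cone_source_inj[OF f]) (rule orthD[OF O(2)])
next
 fix n u assume "CM A (shift N n) u"
 thus "EX v. CM B (shift N n) v & htp A (shift N n) u (%i x. v i (f i x))"
  by (rule cone_source_surj[OF f]) (unfold shift_shift, rule orthD[OF O(1)])
qed

text \<open>Dual to \<open>cone_source_surj\<close>: a null homotopy of x -> (0, u x) has two
  components, the negative of the first being the lift and the second the homotopy.\<close>

lemma cone_target_surj:
 assumes f: "CM Y Z f" and u: "CM V Z u"
  and O: "!!ph. CM V (ncpx (cone Y Z f)) ph ==> null V (ncpx (cone Y Z f)) ph"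
 shows "EX v. CM V Y v & htp V Z u (%i x. f i (v i x))"
proof -
 note Y = cm_complex(1)[OF f] and Z = cm_complex(2)[OF f] and V = cm_complex(1)[OF u]
 let ?C = "ncpx (cone Y Z f)"
 have "CM V ?C (%i x. (0[obj Y (i - 1)], u i x))"
 proof (rule chain_mapI[OF V chain_complex_ncpx[OF chain_complex_cone[OF f]]])
  show "(%x. (0[obj Y (i - 1)], u i x)):Hom (obj V i) (obj ?C i)" for i
   using hom_pair[OF hom_const_zero cm_hom[OF u, of i], of "obj Y (i - 1)"] Y by simp
 qed (use Y Z in \<open>simp add: dsum_neg cm_zero[OF f] m_minus_eq cm_closed[OF u] cm_d[OF u, symmetric]\<close>)
 from O[OF this] obtain s where s: "homotopy V ?C s"
  "!!i x. x:El V i ==> (0[obj Y (i - 1)], u i x) = hbd V ?C s i x" by (rule nullE) blast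
 have sh: "s i:Hom (obj V i) (dsum (obj Y i) (obj Z (i + 1)))" for i using homotopy_hom[OF s(1), of i] by simp
 define p q where "p i x = fst (s i x)" and "q i x = snd (s i x)" for i x
 have ph: "p i:Hom (obj V i) (obj Y i)" for i unfolding p_def by (rule hom_comp[OF sh hom_fst])
 have qh: "homotopy V Z q" unfolding homotopy_def q_def using hom_comp[OF sh hom_snd] by blast
 note pc = hom_closed[OF ph] and qc = homotopy_closed[OF qh]
 have pq: "s i x = (p i x, q i x)" for i x by (simp add: p_def q_def)
 have e: "0[obj Y (i - 1)] = ~[obj Y (i - 1)] dif Y i (p i x) +[obj Y (i - 1)] p (i - 1) (dif V i x)"
  "u i x = ~[obj Z i] (f i (p i x) -[obj Z i] dif Z (i + 1) (q i x)) +[obj Z i] q (i - 1) (dif V i x)"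
  if x: "x:El V i" for i x
  using s(2)[OF x] Y Z pc[OF x] cm_closed[OF f pc[OF x]] d_closed'[OF Z qc[OF x]] unfolding hbd_def pq by (simp_all add: dsum_neg)
 have p: "CM V Y p"
 proof (rule chain_mapI[OF V Y ph])
  fix i x assume x: "x:El V i"
  note c = d_closed[OF Y pc[OF x]] pc[OF d_closed[OF V x]]
  have "p (i - 1) (dif V i x) -[obj Y (i - 1)] dif Y i (p i x) = 0[obj Y (i - 1)]"
   using e(1)[OF x] m_comm'[OF cc_module[OF Y] m_neg[OF cc_module[OF Y] c(1)] c(2)] by (simp add: a_minus_def)
  thus "dif Y i (p i x) = p (i - 1) (dif V i x)" using m_minus_zero_iff[OF cc_module[OF Y] c(2,1)] by simp
 qed
 have "CM V Y (%i x. ~[obj Y i] p i x)" by (rule chain_map_neg[OF p])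
 moreover have "htp V Z u (%i x. f i (~[obj Y i] p i x))"
 proof (rule htpI[OF qh])
  fix i x assume x: "x:El V i"
  show "u i x = f i (~[obj Y i] p i x) +[obj Z i] hbd V Z q i x"
   unfolding e(2)[OF x] cm_neg[OF f pc[OF x]] hbd_def
   using cm_closed[OF f pc[OF x]] d_closed'[OF Z qc[OF x]] homotopy_closed'[OF qh d_closed[OF V x]] cc_module[OF Z, of i] by algebra
 qed
 ultimately show ?thesis by blast
qed

text \<open>With a null homotopy \<open>w\<close> of f v, the pair (v, w) is a chain map into the
  shifted cone; the first component of its null homotopy kills \<open>v\<close>.\<close>

lemma cone_target_inj:
 assumes f: "CM Y Z f" and v: "CM V Y v" and n: "null V Z (%i x. f i (v i x))"
  and O: "!!ph. CM V (shift (cone Y Z f) 1) ph ==> null V (shift (cone Y Z f) 1) ph"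
 shows "null V Y v"
proof -
 note Y = cm_complex(1)[OF f] and Z = cm_complex(2)[OF f] and V = cm_complex(1)[OF v]
 let ?C = "shift (cone Y Z f) 1"
 from n obtain w where w: "homotopy V Z w" "!!i x. x:El V i ==> f i (v i x) = hbd V Z w i x" by (rule nullE) blast
 have "CM V ?C (%i x. (v i x, w i x))"
 proof (rule chain_mapI[OF V chain_complex_shift[OF chain_complex_cone[OF f]]])
  show "(%x. (v i x, w i x)):Hom (obj V i) (obj ?C i)" for i
   using hom_pair[OF cm_hom[OF v, of i] homotopy_hom[OF w(1), of i]] by simp
  fix i x assume x: "x:El V i"
  have "f i (v i x) -[obj Z i] dif Z (i + 1) (w i x) = w (i - 1) (dif V i x)"
   unfolding w(2)[OF x] hbd_def using d_closed'[OF Z homotopy_closed[OF w(1) x]] homotopy_closed'[OF w(1) d_closed[OF V x]] cc_module[OF Z, of i] by algebra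
  thus "dif ?C i (v i x, w i x) = (v (i - 1) (dif V i x), w (i - 1) (dif V i x))" using cm_d[OF v x] by simp
 qed
 from O[OF this] obtain s where s: "homotopy V ?C s" "!!i x. x:El V i ==> (v i x, w i x) = hbd V ?C s i x" by (rule nullE) blast
 show ?thesis
 proof (rule nullI)
  have "s i:Hom (obj V i) (dsum (obj Y (i + 1)) (obj Z (i + 2)))" for i using homotopy_hom[OF s(1), of i] by (simp add: add.commute)
  from hom_comp[OF this hom_fst] show "homotopy V Y (%i x. fst (s i x))" unfolding homotopy_def by blast
  fix i x assume x: "x:El V i"
  show "v i x = hbd V Y (%i x. fst (s i x)) i x" using s(2)[OF x] by (simp add: hbd_def add.commute)
 qed
qed

end

text \<open>Dependent choice along the integers: \<open>P\<close> is the invariant that lets the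
  choice continue, \<open>Q\<close> the relation kept between neighbours. Homotopies are built
  degree by degree in this way.\<close>

lemma int_choice_down:
 fixes P :: "int => 'a => bool"
 assumes 0: "P c x0" and step: "!!i x. i <= c ==> P i x ==> EX y. P (i - 1) y & Q i x y"
 shows "EX g. g c = x0 & (ALL i<=c. P i (g i) & Q i (g i) (g (i - 1)))"
proof -
 have "EX h. ALL n. (P (c - int n) (h n) & (n = 0 --> h n = x0)) & Q (c - int n) (h n) (h (Suc n))"
 proof (rule dependent_nat_choice)
  show "EX x. P (c - int 0) x & (0 = (0::nat) --> x = x0)" using 0 by auto
  fix x n assume "P (c - int n) x & (n = 0 --> x = x0)"
  then obtain y where "P (c - int n - 1) y & Q (c - int n) x y" using step[of "c - int n" x] by auto
  moreover have "c - int n - 1 = c - int (Suc n)" by simp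
  ultimately show "EX y. (P (c - int (Suc n)) y & (Suc n = 0 --> y = x0)) & Q (c - int n) x y" by auto
 qed
 then obtain h where h: "!!n. (P (c - int n) (h n) & (n = 0 --> h n = x0)) & Q (c - int n) (h n) (h (Suc n))" by blast
 show ?thesis
 proof (intro exI[of _ "%i. h (nat (c - i))"] conjI allI impI)
  show "h (nat (c - c)) = x0" using h[of 0] by simp
  fix i assume i: "i <= c"
  hence e: "c - int (nat (c - i)) = i" "nat (c - (i - 1)) = Suc (nat (c - i))" by auto
  show "P i (h (nat (c - i)))" "Q i (h (nat (c - i))) (h (nat (c - (i - 1))))"
   using h[of "nat (c - i)"] unfolding e by auto
 qed
qed

lemma int_choice_up:
 fixes P :: "int => 'a => bool"
 assumes 0: "P c x0" and step: "!!i x. c <= i ==> P i x ==> EX y. P (i + 1) y & Q i x y"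
 shows "EX g. g c = x0 & (ALL i>=c. P i (g i) & Q i (g i) (g (i + 1)))"
proof -
 have "EX g. g (- c) = x0 & (ALL i<=- c. P (- i) (g i) & Q (- i) (g i) (g (i - 1)))"
 proof (rule int_choice_down[where P = "%i. P (- i)" and Q = "%i. Q (- i)"])
  fix i x assume "i <= - c" "P (- i) x"
  thus "EX y. P (- (i - 1)) y & Q (- i) x y" using step[of "- i" x] by auto
 qed (use 0 in simp)
 then obtain g where g: "g (- c) = x0" "!!i. i <= - c ==> P (- i) (g i) & Q (- i) (g i) (g (i - 1))" by blast
 show ?thesis
 proof (intro exI[of _ "%i. g (- i)"] conjI allI impI)
  show "g (- c) = x0" by (rule g)
  fix i assume "c <= i"
  thus "P i (g (- i))" "Q i (g (- i)) (g (- (i + 1)))" using g(2)[of "- i"] by auto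
 qed
qed

context cring begin

section \<open>Transport into the universe of test objects\<close>

text \<open>Transport of structure along a map meant to be injective on the carrier; it moves
  modules into a \<open>univ\<close> type.\<close>

definition tr_module :: "('a, 'c) module => ('c => 'd) => ('a, 'd) module" where
 "tr_module M e = \<lparr>carrier = e ` carrier M, monoid.mult = undefined, one = undefined,
  ring.zero = e 0[M],
  ring.add = (%x y. e (inv_into (carrier M) e x +[M] inv_into (carrier M) e y)),
  smult = (%r x. e (r *[M] inv_into (carrier M) e x))\<rparr>"

lemma tr_module_simps: "carrier (tr_module M e) = e ` carrier M" "0[tr_module M e] = e 0[M]"
 by (simp_all add: tr_module_def)

lemma tr_module_add: "inj_on e (carrier M) ==> x:carrier M ==> y:carrier M ==> e x +[tr_module M e] e y = e (x +[M] y)"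
 and tr_module_smult: "inj_on e (carrier M) ==> x:carrier M ==> r *[tr_module M e] e x = e (r *[M] x)"
 by (simp_all add: tr_module_def)

lemma module_tr: assumes M: "Md M" and e: "inj_on e (carrier M)" shows "Md (tr_module M e)"
 by (rule module_by_surj[OF M, where q = e]) (simp_all add: tr_module_simps tr_module_add[OF e] tr_module_smult[OF e])

lemma tr_hom: assumes e: "inj_on e (carrier M)" shows "e:Hom M (tr_module M e)"
 by (rule mod_homI) (simp_all add: tr_module_simps tr_module_add[OF e] tr_module_smult[OF e])

lemma tr_inv_hom: assumes M: "Md M" and e: "inj_on e (carrier M)" shows "inv_into (carrier M) e:Hom (tr_module M e) M"
proof (rule mod_homI)
 show "inv_into (carrier M) e x:carrier M" if "x:carrier (tr_module M e)" for x
  using that by (simp add: tr_module_simps inv_into_into)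
qed (use M e in \<open>auto simp: tr_module_simps tr_module_add[OF e] tr_module_smult[OF e]\<close>)

definition tr_cpx :: "('a, 'c) cpx => (int => 'c => 'd) => ('a, 'd) cpx" where
 "tr_cpx X e = \<lparr>obj = (%i. tr_module (obj X i) (e i)), dif = (%i x. e (i - 1) (dif X i (inv_into (El X i) (e i) x)))\<rparr>"

lemma tr_cpx_maps:
 assumes X: "CC X" and e: "!!i. inj_on (e i) (El X i)"
 shows "CM X (tr_cpx X e) e" "CM (tr_cpx X e) X (%i. inv_into (El X i) (e i))"
proof -
 let ?T = "tr_cpx X e"
 note ih = hom_closed[OF tr_inv_hom[OF cc_module[OF X] e]]
 have "CC ?T"
 proof (rule chain_complexI)
  fix i show "Md (obj ?T i)" using module_tr[OF cc_module[OF X] e] by (simp add: tr_cpx_def)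
  show "dif ?T i:Hom (obj ?T i) (obj ?T (i - 1))"
   using hom_comp[OF hom_comp[OF tr_inv_hom[OF cc_module[OF X] e] cc_dif[OF X]] tr_hom[OF e]] by (simp add: tr_cpx_def)
  fix x assume "x:El ?T i"
  then obtain y where "y:El X i" "x = e i y" by (auto simp: tr_cpx_def tr_module_simps)
  thus "dif ?T (i - 1) (dif ?T i x) = 0[obj ?T (i - 1 - 1)]"
   using d_closed[OF X] d_d[OF X] by (simp add: tr_cpx_def tr_module_simps inv_into_f_f[OF e])
 qed
 note T = this
 show "CM X ?T e"
  by (rule chain_mapI[OF X T]) (simp_all add: tr_cpx_def tr_hom[OF e] inv_into_f_f[OF e])
 show "CM ?T X (%i. inv_into (El X i) (e i))"
 proof (rule chain_mapI[OF T X])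
  fix i show "inv_into (El X i) (e i):Hom (obj ?T i) (obj X i)"
   using tr_inv_hom[OF cc_module[OF X] e] by (simp add: tr_cpx_def)
  fix x assume "x:El ?T i"
  then obtain y where y: "y:El X i" "x = e i y" by (auto simp: tr_cpx_def tr_module_simps)
  thus "dif X i (inv_into (El X i) (e i) x) = inv_into (El X (i - 1)) (e (i - 1)) (dif ?T i x)"
   using d_closed[OF X y(1)] by (simp add: tr_cpx_def inv_into_f_f[OF e])
 qed
qed

lemma acyclic_tr: assumes X: "CC X" and e: "!!i. inj_on (e i) (El X i)" and a: "acyclic_cpx X"
 shows "acyclic_cpx (tr_cpx X e)"
proof -
 note f = tr_cpx_maps(1)[OF X e] and g = tr_cpx_maps(2)[OF X e]
 note T = cm_complex(2)[OF f]
 show ?thesis unfolding acyclic_iff[OF T]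
 proof (intro allI impI)
  fix i x assume x: "x:El (tr_cpx X e) i" and d: "dif (tr_cpx X e) i x = 0[obj (tr_cpx X e) (i - 1)]"
  let ?y = "inv_into (El X i) (e i) x"
  have "dif X i ?y = 0[obj X (i - 1)]" unfolding cm_d[OF g x] d by (rule cm_zero[OF g])
  then obtain w where w: "w:El X (i + 1)" "?y = dif X (i + 1) w"
   using a cm_closed[OF g x] unfolding acyclic_iff[OF X] by blast
  have "x = e i ?y" using x by (simp add: tr_cpx_def tr_module_simps f_inv_into_f)
  hence "x = dif (tr_cpx X e) (i + 1) (e (i + 1) w)" unfolding w(2) cm_d'[OF f w(1)] .
  thus "EX w:El (tr_cpx X e) (i + 1). x = dif (tr_cpx X e) (i + 1) w" using cm_closed[OF f w(1)] by blast
 qed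
qed

text \<open>Embeddability of the terms as sets is enough, since the module structure can be
  transported along the embeddings.\<close>

definition small :: "'v itself => ('a, 'c) cpx => bool" where
 "small v X \<longleftrightarrow> (ALL i. EX e :: 'c => ('a, 'v) univ. inj_on e (El X i))"

lemma smallE:
 assumes "small TYPE('v) X"
 obtains e :: "int => 'c => ('a, 'v) univ" where "!!i. inj_on (e i) (El (X :: ('a, 'c) cpx) i)"
 using assms unfolding small_def by metis

lemma small_univ: "small TYPE('v) (X :: ('a, 'v) ucpx)"
 unfolding small_def by (intro allI exI[of _ "%x. x"]) simp

text \<open>The test complex is moved into the universe, and the resulting null homotopies are
  pulled back along the isomorphism.\<close>

lemma K_injective_orth:
 fixes I :: "('a, 'v) ucpx" and A :: "('a, 'c) cpx"
 assumes I: "K_injective R I" and A: "CC A" and ac: "acyclic_cpx A" and sm: "small TYPE('v) A"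
 shows "orth A I"
proof -
 obtain e :: "int => 'c => ('a, 'v) univ" where e: "!!i. inj_on (e i) (El A i)" by (rule smallE[OF sm]) blast
 note f = tr_cpx_maps(1)[OF A e] and g = tr_cpx_maps(2)[OF A e]
 note T = cm_complex(2)[OF f] and Ic = I[unfolded K_injective_def, THEN conjunct1]
 have "acyclic_cpx (HC (tr_cpx A e) I)" using I T acyclic_tr[OF A e ac] unfolding K_injective_def by blast
 hence O: "orth (tr_cpx A e) I" unfolding acyclic_hom_iff[OF T Ic] .
 show ?thesis unfolding orth_def
 proof (intro allI impI)
  fix n u assume u: "CM A (shift I n) u"
  have "null A (shift I n) (%i x. u i (inv_into (El A i) (e i) (e i x)))"
   by (rule null_comp_right[OF orthD[OF O chain_map_comp[OF g u]] f])
  thus "null A (shift I n) u" by (rule null_cong) (simp add: inv_into_f_f[OF e])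
 qed
qed

lemma K_projective_orth:
 fixes P :: "('a, 'v) ucpx" and A :: "('a, 'c) cpx"
 assumes P: "K_projective R P" and A: "CC A" and ac: "acyclic_cpx A" and sm: "small TYPE('v) A"
 shows "orth P A"
proof -
 obtain e :: "int => 'c => ('a, 'v) univ" where e: "!!i. inj_on (e i) (El A i)" by (rule smallE[OF sm]) blast
 note f = tr_cpx_maps(1)[OF A e] and g = tr_cpx_maps(2)[OF A e]
 note T = cm_complex(2)[OF f] and Pc = P[unfolded K_projective_def, THEN conjunct1]
 have "acyclic_cpx (HC P (tr_cpx A e))" using P T acyclic_tr[OF A e ac] unfolding K_projective_def by blast
 hence O: "orth P (tr_cpx A e)" unfolding acyclic_hom_iff[OF Pc T] .
 show ?thesis unfolding orth_def
 proof (intro allI impI)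
  fix n u assume u: "CM P (shift A n) u"
  have 1: "null P (shift A n) (%i x. inv_into (El A (i + n)) (e (i + n)) (e (i + n) (u i x)))"
   using null_comp_left[OF orthD[OF O chain_map_comp[OF u chain_map_shift[OF f]]] Pc chain_map_shift[OF g]] .
  have "u i x:El A (i + n)" if "x:El P i" for i x using cm_closed[OF u that] by simp
  thus "null P (shift A n) u" by (intro null_cong[OF 1]) (simp add: inv_into_f_f[OF e])
 qed
qed

section \<open>Injective modules by the criterion of Baer\<close>

text \<open>Only ideals of \<open>R\<close> are quantified over, so the notion applies to modules of
  any carrier type.\<close>

definition baer :: "('a, 'c) module => bool" where
 "baer E \<longleftrightarrow> Md E & (ALL J f. ideal J R --> f:Hom ((ring_module R)\<lparr>carrier := J\<rparr>) E -->
  (EX y:carrier E. ALL j:J. f j = j *[E] y))"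

lemma baer_module: "baer E ==> Md E" by (simp add: baer_def)

lemma idealD: assumes "ideal J R" shows "J <= carrier R" "\<zero>:J" "!!x y. x:J ==> y:J ==> x \<oplus> y:J"
 "!!r x. r:carrier R ==> x:J ==> r \<otimes> x:J"
proof -
 have a: "additive_subgroup J R" using assms by (rule ideal.axioms)
 show "J <= carrier R" by (rule additive_subgroup.a_subset[OF a])
 show "\<zero>:J" by (rule additive_subgroup.zero_closed[OF a])
 show "!!x y. x:J ==> y:J ==> x \<oplus> y:J" by (rule additive_subgroup.a_closed[OF a])
 show "!!r x. r:carrier R ==> x:J ==> r \<otimes> x:J" by (rule ideal.I_l_closed[OF assms])
qed

lemma idealI': assumes "J <= carrier R" "\<zero>:J" "!!x y. x:J ==> y:J ==> x \<oplus> y:J"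
 "!!r x. r:carrier R ==> x:J ==> r \<otimes> x:J" shows "ideal J R"
proof (rule idealI)
 show "ring R" by (rule ring_axioms)
 show "subgroup J (add_monoid R)"
 proof (rule add.subgroupI)
  fix a assume a: "a:J"
  hence "\<ominus> a = (\<ominus> \<one>) \<otimes> a" using assms(1) by (auto simp: l_minus)
  also have "...:J" using assms(4) a by simp
  finally show "\<ominus> a:J" .
 qed (use assms in auto)
 fix a x assume "a:J" "x:carrier R"
 thus "x \<otimes> a:J" "a \<otimes> x:J" using assms(4)[of x a] assms(1) m_comm[of a x] by auto
qed

text \<open>Zorn's lemma for partial extensions of \<open>f\<close>; the criterion for ideals adds
  one more element to the domain of a maximal one.\<close>

lemma baer_extend:
 fixes M :: "('a, 'c) module" and E :: "('a, 'd) module"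
 assumes E: "baer E" and M: "Md M" and N: "submodule N R M" and f: "f:Hom (M\<lparr>carrier := N\<rparr>) E"
 shows "EX g:Hom M E. ALL x:N. g x = f x"
proof -
 note mE = baer_module[OF E]
 let ?S = "dsum M E"
 have mS: "Md ?S" using M mE by simp
 note DN = submoduleD[OF M N]
 have mN: "Md (M\<lparr>carrier := N\<rparr>)" by (rule module_sub[OF M DN(1-4)])
 \<comment> \<open>Partial extensions as graphs: a submodule of the sum of \<open>M\<close> and
   \<open>E\<close> in which (0, e) forces e = 0 is the graph of a linear map on a submodule of
   \<open>M\<close>.\<close>
 define \<A> where "\<A> = {G. submodule G R ?S & (ALL e. (0[M], e):G --> e = 0[E]) & (%x. (x, f x)) ` N <= G}"
 have f0: "f 0[M] = 0[E]" using hom_zero[OF f mN mE] by simp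
 have fc: "f x:carrier E" if "x:N" for x using hom_closed[OF f] that by simp
 have "submodule ((%x. (x, f x)) ` N) R ?S"
 proof (rule submoduleI'[OF mS])
  show "(%x. (x, f x)) ` N <= carrier ?S" using DN(1) fc by auto
  show "0[?S]:(%x. (x, f x)) ` N" using DN(2) f0 by auto
 next
  fix a b assume "a:(%x. (x, f x)) ` N" "b:(%x. (x, f x)) ` N"
  then obtain x y where "x:N" "y:N" "a = (x, f x)" "b = (y, f y)" by auto
  thus "a +[?S] b:(%x. (x, f x)) ` N" using hom_add[OF f, of x y] DN(3) by (auto intro!: image_eqI[of _ _ "x +[M] y"])
 next
  fix r a assume "r:carrier R" "a:(%x. (x, f x)) ` N"
  then obtain x where "r:carrier R" "x:N" "a = (x, f x)" by auto
  thus "r *[?S] a:(%x. (x, f x)) ` N" using hom_smult[OF f, of r x] DN(4) by (auto intro!: image_eqI[of _ _ "r *[M] x"])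
 qed
 hence ne: "\<A> ~= {}" unfolding \<A>_def using f0 by auto
 have "EX G:\<A>. ALL X:\<A>. G <= X --> X = G"
 proof (rule subset_Zorn_nonempty[OF ne])
  fix \<C> assume C: "\<C> ~= {}" "subset.chain \<A> \<C>"
  then obtain G0 where G0: "G0:\<C>" by auto
  have CA: "G:\<A>" if "G:\<C>" for G using C(2) that by (auto simp: subset_chain_def)
  have sub: "submodule G R ?S" if "G:\<C>" for G using CA[OF that] by (simp add: \<A>_def)
  have "submodule (\<Union>\<C>) R ?S"
  proof (rule submoduleI'[OF mS])
   show "\<Union>\<C> <= carrier ?S" using submoduleD(1)[OF mS sub] by blast
   show "0[?S]:\<Union>\<C>" using submoduleD(2)[OF mS sub[OF G0]] G0 by blast
   show "r *[?S] x:\<Union>\<C>" if "r:carrier R" "x:\<Union>\<C>" for r x using submoduleD(4)[OF mS sub] that by blast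
   fix x y assume "x:\<Union>\<C>" "y:\<Union>\<C>"
   then obtain G G' where G: "G:\<C>" "x:G" "G':\<C>" "y:G'" by blast
   have "G <= G' \<or> G' <= G" using C(2) G(1,3) by (simp add: subset_chain_def)
   with G obtain H where "H:\<C>" "x:H" "y:H" by blast
   thus "x +[?S] y:\<Union>\<C>" using submoduleD(3)[OF mS sub] by blast
  qed
  thus "\<Union>\<C>:\<A>" using CA G0 unfolding \<A>_def by blast
 qed
 then obtain G where G: "G:\<A>" and max: "!!X. X:\<A> ==> G <= X ==> X = G" by blast
 have sG: "submodule G R ?S" and sv: "!!e. (0[M], e):G ==> e = 0[E]" and fG: "!!x. x:N ==> (x, f x):G"
  using G by (auto simp: \<A>_def)
 note DG = submoduleD[OF mS sG]
 have GM: "(x, e):G ==> x:carrier M & e:carrier E" for x e using DG(1) by auto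
 have Gadd: "(x, e):G ==> (x', e'):G ==> (x +[M] x', e +[E] e'):G" for x e x' e' using DG(3)[of "(x, e)" "(x', e')"] by simp
 have Gsm: "r:carrier R ==> (x, e):G ==> (r *[M] x, r *[E] e):G" for r x e using DG(4)[of r "(x, e)"] by simp
 have Gneg: "(x, e):G ==> (~[M] x, ~[E] e):G" for x e
  using DG(5)[of "(x, e)"] GM[of x e] dsum_neg[OF M mE, of "(x, e)"] by auto
 have uni: "e = e'" if "(x, e):G" "(x, e'):G" for x e e'
 proof -
  have "(x +[M] ~[M] x, e +[E] ~[E] e'):G" by (rule Gadd[OF that(1) Gneg[OF that(2)]])
  hence "e +[E] ~[E] e' = 0[E]" using sv GM[OF that(1)] M by simp
  thus ?thesis using GM[OF that(1)] GM[OF that(2)] m_minus_zero_iff[OF mE, of e e'] by (simp add: a_minus_def)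
 qed
 have tot: "EX e. (x, e):G" if x: "x:carrier M" for x
 proof -
  \<comment> \<open>The scalars that move \<open>x\<close> into the domain of the maximal graph;
    \<open>h\<close> sends such a scalar \<open>r\<close> to the value at \<open>r x\<close>, and
    the criterion makes it multiplication by some \<open>y\<close>.\<close>
  define J where "J = {r:carrier R. EX e. (r *[M] x, e):G}"
  define h where "h r = (THE e. (r *[M] x, e):G)" for r
  have h: "h r = e" if "(r *[M] x, e):G" for r e unfolding h_def using that uni by blast
  have hG: "(r *[M] x, h r):G" if "r:J" for r using that h unfolding J_def by blast
  have Jc: "r:carrier R" if "r:J" for r using that by (simp add: J_def)
  have hadd: "((r \<oplus> s) *[M] x, h r +[E] h s):G" if "r:J" "s:J" for r s
   using Gadd[OF hG[OF that(1)] hG[OF that(2)]] m_add_smult[OF M Jc[OF that(1)] Jc[OF that(2)] x] by simp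
  have hsm: "((r \<otimes> s) *[M] x, r *[E] h s):G" if "r:carrier R" "s:J" for r s
   using Gsm[OF that(1) hG[OF that(2)]] m_mult_smult[OF M that(1) Jc[OF that(2)] x] by simp
  have J: "ideal J R"
  proof (rule idealI')
   show "\<zero>:J" using DG(2) x M by (auto simp: J_def)
   show "r \<oplus> s:J" if "r:J" "s:J" for r s using hadd[OF that] Jc that unfolding J_def by blast
   show "r \<otimes> s:J" if "r:carrier R" "s:J" for r s using hsm[OF that] Jc that unfolding J_def by blast
  qed (use Jc in blast)
  have "h:Hom ((ring_module R)\<lparr>carrier := J\<rparr>) E"
   by (rule mod_homI) (use GM hG h[OF hadd] h[OF hsm] in \<open>auto simp: ring_module_def\<close>)
  then obtain y where y: "y:carrier E" "!!j. j:J ==> h j = j *[E] y" using E J unfolding baer_def by blast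
  \<comment> \<open>The pair (x, y) is added to the graph. The choice of \<open>y\<close> keeps it
    single-valued: if m + r x = 0, then r y is the value at r x, the negative of the value at
    m.\<close>
  define G' where "G' = {(m +[M] r *[M] x, e +[E] r *[E] y) | m e r. (m, e):G & r:carrier R}"
  have G'I: "(m, e):G ==> r:carrier R ==> (m +[M] r *[M] x, e +[E] r *[E] y):G'" for m e r unfolding G'_def by blast
  have GG': "G <= G'"
  proof
   fix p assume p: "p:G"
   obtain m e where me: "p = (m, e)" by fastforce
   show "p:G'" using G'I[of m e \<zero>] p GM[of m e] x y(1) M mE unfolding me by simp
  qed
  have "submodule G' R ?S"
  proof (rule submoduleI'[OF mS])
   show "G' <= carrier ?S" using GM x y(1) M mE by (auto simp: G'_def)
   show "0[?S]:G'" using DG(2) GG' by blast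
  next
   fix p q assume "p:G'" "q:G'"
   then obtain m e r m' e' r' where pq: "(m, e):G" "r:carrier R" "p = (m +[M] r *[M] x, e +[E] r *[E] y)"
    "(m', e'):G" "r':carrier R" "q = (m' +[M] r' *[M] x, e' +[E] r' *[E] y)" unfolding G'_def by blast
   have "m:carrier M" "m':carrier M" "e:carrier E" "e':carrier E" using GM pq by auto
   hence "p +[?S] q = ((m +[M] m') +[M] (r \<oplus> r') *[M] x, (e +[E] e') +[E] (r \<oplus> r') *[E] y)"
    using pq M mE x y(1) by (simp add: m_add_smult m_assoc' m_lcomm')
   thus "p +[?S] q:G'" using G'I[OF Gadd[OF pq(1,4)], of "r \<oplus> r'"] pq by simp
  next
   fix s p assume s: "s:carrier R" and "p:G'"
   then obtain m e r where p: "(m, e):G" "r:carrier R" "p = (m +[M] r *[M] x, e +[E] r *[E] y)" unfolding G'_def by blast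
   thus "s *[?S] p:G'" using G'I[OF Gsm[OF s p(1)], of "s \<otimes> r"] GM[OF p(1)] s M mE x y(1)
    by (simp add: m_smult_add m_mult_smult)
  qed
  moreover have "e = 0[E]" if "(0[M], e):G'" for e
  proof -
   from that obtain m e' r where m: "(m, e'):G" "r:carrier R" "0[M] = m +[M] r *[M] x" "e = e' +[E] r *[E] y"
    unfolding G'_def by blast
   note c = GM[OF m(1)]
   have "m = ~[M] (r *[M] x)" using m_add_eq_zero[OF M, of m "r *[M] x"] m c x M by simp
   hence rx: "(r *[M] x, ~[E] e'):G" using Gneg[OF m(1)] x M m(2) by simp
   hence "r:J" using m(2) unfolding J_def by blast
   hence "r *[E] y = ~[E] e'" using y(2) h[OF rx] by simp
   thus ?thesis unfolding m(4) using c mE by simp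
  qed
  moreover have "(%x. (x, f x)) ` N <= G'" using fG GG' by blast
  ultimately have "G':\<A>" unfolding \<A>_def by blast
  hence "G' = G" using max GG' by blast
  moreover have "(x, y):G'" using G'I[of "0[M]" "0[E]" \<one>] DG(2) x y(1) M mE by simp
  ultimately show ?thesis by blast
 qed
 define g where "g x = (THE e. (x, e):G)" for x
 have g: "g x = e" if "(x, e):G" for x e unfolding g_def using that uni by blast
 have gG: "(x, g x):G" if "x:carrier M" for x using tot[OF that] g by blast
 have "g:Hom M E"
 proof (rule mod_homI)
  show "g x:carrier E" if "x:carrier M" for x using GM[OF gG[OF that]] by simp
  show "g (x +[M] y) = g x +[E] g y" if "x:carrier M" "y:carrier M" for x y by (rule g[OF Gadd[OF gG[OF that(1)] gG[OF that(2)]]])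
  show "g (r *[M] x) = r *[E] g x" if "r:carrier R" "x:carrier M" for r x by (rule g[OF Gsm[OF that(1) gG[OF that(2)]]])
 qed
 thus ?thesis using g[OF fG] by blast
qed

text \<open>As \<open>h\<close> vanishes on the kernel of \<open>d\<close>, it descends to the
  submodule d(A) of \<open>B\<close> and extends from there. Most applications of injectivity take
  this form.\<close>

lemma baer_factor:
 fixes A :: "('a, 'c) module" and B :: "('a, 'd) module" and N :: "('a, 'e) module"
 assumes N: "baer N" and A: "Md A" and B: "Md B" and d: "d:Hom A B" and h: "h:Hom A N"
  and k: "!!x. x:carrier A ==> d x = 0[B] ==> h x = 0[N]"
 shows "EX s:Hom B N. ALL x:carrier A. s (d x) = h x"
proof -
 note mN = baer_module[OF N]
 define f where "f y = h (SOME x. x:carrier A & d x = y)" for y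
 have f: "f (d x) = h x" if x: "x:carrier A" for x
 proof -
  define x' where "x' = (SOME z. z:carrier A & d z = d x)"
  have x': "x':carrier A" "d x' = d x" using someI[of "%z. z:carrier A & d z = d x" x] x by (auto simp: x'_def)
  have "d (x' -[A] x) = 0[B]" unfolding hom_minus[OF d A B x'(1) x] x'(2) using m_minus_cancel[OF B hom_closed[OF d x]] .
  hence "h x' -[N] h x = 0[N]" using k[of "x' -[A] x"] x x' A hom_minus[OF h A mN x'(1) x] by simp
  thus ?thesis unfolding f_def x'_def[symmetric] using m_minus_zero_iff[OF mN hom_closed[OF h x'(1)] hom_closed[OF h x]] by simp
 qed
 have S: "submodule (d ` carrier A) R B" by (rule image_submodule[OF d A B carrier_submodule[OF A]])
 have "f:Hom (B\<lparr>carrier := d ` carrier A\<rparr>) N"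
 proof (rule mod_homI)
  show "f y:carrier N" if "y:carrier (B\<lparr>carrier := d ` carrier A\<rparr>)" for y using that f hom_closed[OF h] by auto
  fix y z assume "y:carrier (B\<lparr>carrier := d ` carrier A\<rparr>)" "z:carrier (B\<lparr>carrier := d ` carrier A\<rparr>)"
  then obtain a b where "a:carrier A" "b:carrier A" "y = d a" "z = d b" by auto
  thus "f (y +[B\<lparr>carrier := d ` carrier A\<rparr>] z) = f y +[N] f z"
   using f[of "a +[A] b"] f[of a] f[of b] hom_add[OF d] hom_add[OF h] A by simp
 next
  fix r y assume r: "r:carrier R" "y:carrier (B\<lparr>carrier := d ` carrier A\<rparr>)"
  then obtain a where "a:carrier A" "y = d a" by auto
  thus "f (r *[B\<lparr>carrier := d ` carrier A\<rparr>] y) = r *[N] f y"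
   using f[of "r *[A] a"] f[of a] hom_smult[OF d r(1)] hom_smult[OF h r(1)] A r by simp
 qed
 from baer_extend[OF N B S this] obtain g where "g:Hom B N" "ALL x:d ` carrier A. g x = f x" by blast
 thus ?thesis using f by (intro bexI[of _ g]) auto
qed

text \<open>The homotopy is built downwards from degree \<open>c + 1\<close>, where \<open>N\<close>
  vanishes. Exactness of \<open>A\<close> is asked for where \<open>N\<close> is nonzero, a form
  adapted to sources whose homology is merely bounded, as in
  \<open>zero_homology_hom\<close>.\<close>

lemma null_into_baer:
 fixes A :: "('a, 'c) cpx" and N :: "('a, 'd) cpx"
 assumes f: "CM A N f" and N: "!!i. baer (obj N i)" and b: "!!i. c < i ==> El N i = {0[obj N i]}"
  and ex: "!!i. El N i ~= {0[obj N i]} ==> zero_homology A i"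
 shows "null A N f"
proof -
 note A = cm_complex(1)[OF f] and Nc = cm_complex(2)[OF f]
 \<comment> \<open>The invariant says that f - d s vanishes on boundaries. Where \<open>A\<close> is
   exact it then vanishes on cycles, and the next component of the homotopy exists by
   injectivity.\<close>
 define P where "P i s \<longleftrightarrow> s:Hom (obj A i) (obj N (i + 1)) &
  (ALL x:El A (i + 1). f i (dif A (i + 1) x) = dif N (i + 1) (s (dif A (i + 1) x)))" for i s
 define Q where "Q i s s' \<longleftrightarrow> (ALL x:El A i. f i x = dif N (i + 1) (s x) +[obj N i] s' (dif A i x))" for i s s'
 define z where "z i = (%x::'c. 0[obj N (i + 1)])" for i
 have zero: "x = 0[obj N i]" if "c < i" "x:El N i" for i x using b that by auto
 have "EX g. g (c + 1) = z (c + 1) & (ALL i<=c + 1. P i (g i) & Q i (g i) (g (i - 1)))"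
 proof (rule int_choice_down)
  show "P (c + 1) (z (c + 1))" unfolding P_def z_def
   using A Nc zero[of "c + 1", OF _ cm_closed[OF f d_closed'[OF A]]] d_zero[OF Nc, of "c + 1 + 1"] by (simp add: add.commute)
  fix i s assume s: "P i s"
  have sh: "s:Hom (obj A i) (obj N (i + 1))" using s by (simp add: P_def)
  let ?h = "%x. f i x -[obj N i] dif N (i + 1) (s x)"
  have hh: "?h:Hom (obj A i) (obj N i)" by (rule hom_diff[OF cm_hom[OF f] hom_comp[OF sh cc_dif'[OF Nc]] cc_module[OF Nc]])
  have "EX s':Hom (obj A (i - 1)) (obj N i). ALL x:El A i. s' (dif A i x) = ?h x"
  proof (rule baer_factor[OF N cc_module[OF A] cc_module[OF A] cc_dif[OF A] hh])
   fix x assume x: "x:El A i" "dif A i x = 0[obj A (i - 1)]"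
   show "?h x = 0[obj N i]"
   \<comment> \<open>A zero target makes the condition trivial; otherwise \<open>x\<close> is a
     boundary and the invariant applies.\<close>
   proof (cases "El N i = {0[obj N i]}")
    case True thus ?thesis using hom_closed[OF hh x(1)] by simp
   next
    case False
    then obtain w where "w:El A (i + 1)" "x = dif A (i + 1) w"
     using ex x unfolding zero_homology_iff[OF A] bd_iff by blast
    thus ?thesis using s m_minus_cancel[OF cc_module[OF Nc] cm_closed[OF f x(1)]] unfolding P_def by metis
   qed
  qed
  then obtain s' where s': "s':Hom (obj A (i - 1)) (obj N i)" "!!x. x:El A i ==> s' (dif A i x) = ?h x" by blast
  have "f (i - 1) (dif A i x) = dif N i (s' (dif A i x))" if x: "x:El A i" for x
   unfolding s'(2)[OF x] d_minus[OF Nc cm_closed[OF f x] d_closed'[OF Nc hom_closed[OF sh x]]] d_d'[OF Nc hom_closed[OF sh x]] cm_d[OF f x]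
   using Nc cm_closed[OF f d_closed[OF A x]] by (simp add: m_minus_eq)
  hence "P (i - 1) s'" using s'(1) unfolding P_def by simp
  moreover have "Q i s s'" unfolding Q_def
  proof
   fix x assume x: "x:El A i"
   show "f i x = dif N (i + 1) (s x) +[obj N i] s' (dif A i x)"
    unfolding s'(2)[OF x] using cm_closed[OF f x] d_closed'[OF Nc hom_closed[OF sh x]] cc_module[OF Nc, of i] by algebra
  qed
  ultimately show "EX y. P (i - 1) y & Q i s y" by blast
 qed
 then obtain g where g: "g (c + 1) = z (c + 1)" "!!i. i <= c + 1 ==> P i (g i) & Q i (g i) (g (i - 1))" by blast
 define s where "s i = (if i <= c + 1 then g i else z i)" for i
 show ?thesis
 proof (rule nullI)
  have "s i:Hom (obj A i) (obj N (i + 1))" for i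
   using g(2)[of i] Nc unfolding s_def P_def z_def by simp
  thus sh: "homotopy A N s" unfolding homotopy_def by blast
  fix i x assume x: "x:El A i"
  show "f i x = hbd A N s i x"
  proof (cases "i <= c")
   case True thus ?thesis using g(2)[of i] x unfolding Q_def hbd_def s_def by simp
  next
   case False
   thus ?thesis using zero[OF _ cm_closed[OF f x]] zero[OF _ hbd_closed[OF sh A Nc x]] by simp
  qed
 qed
qed

text \<open>A complex with injective terms that vanishes in high degrees is thus K-injective with
  respect to acyclic complexes of every carrier type.\<close>

lemma orth_baer:
 fixes A :: "('a, 'c) cpx" and N :: "('a, 'd) cpx"
 assumes A: "CC A" and ac: "acyclic_cpx A" and N: "!!i. baer (obj N i)" and b: "!!i. c < i ==> El N i = {0[obj N i]}"
 shows "orth A N"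
 unfolding orth_def
proof (intro allI impI)
 fix n f assume f: "CM A (shift N n) f"
 show "null A (shift N n) f"
  by (rule null_into_baer[OF f, of "c - n"]) (use N b ac in \<open>auto simp: acyclic_cpx_def\<close>)
qed

lemma prec_qi_baer:
 assumes f: "QI A B f" and Nc: "CC N" and N: "!!i. baer (obj N i)" and b: "!!i. c < i ==> El N i = {0[obj N i]}"
 shows "QI (HC B N) (HC A N) (prec A f)"
proof -
 note fc = qi_cm[OF f]
 note C = chain_complex_cone[OF fc]
 show ?thesis
  by (rule prec_qi_orth[OF fc Nc orth_baer[OF C acyclic_cone[OF f] N b] orth_baer[OF chain_complex_ncpx[OF C] acyclic_ncpx[OF C acyclic_cone[OF f]] N b]])
qed

end

section \<open>Encodings into the universe\<close>

text \<open>The index set \<open>'a + nat\<close> is infinite, hence equipotent with its product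
  with \<open>nat\<close>; a sequence of functions is one function on that product.\<close>

lemma sequence_encoding: "EX enc :: (nat => ('a, 'v) univ) => ('a, 'v) univ. inj enc"
proof -
 include cardinal_syntax
 let ?U = "UNIV :: ('a + nat) set"
 have N: "|UNIV :: nat set| <=o |?U|" by (rule card_of_ordLeqI[of Inr]) auto
 hence inf: "infinite ?U" using card_of_ordLeq_infinite[OF N] by simp
 have "|?U \<times> (UNIV :: nat set)| =o |?U|" using card_of_Times_infinite[OF inf _ N] by simp
 hence "|?U \<times> (UNIV :: nat set)| <=o |?U|" by (rule ordIso_imp_ordLeq)
 then obtain p :: "('a + nat) \<times> nat => 'a + nat" where p: "inj p"
  unfolding card_of_ordLeq[symmetric] by auto
 define enc where "enc s z = s (snd (inv_into UNIV p z)) (fst (inv_into UNIV p z))" for s :: "nat => ('a, 'v) univ" and z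
 have E: "enc s (p (x, n)) = s n x" for s n x using inv_f_f[OF p] by (simp add: enc_def)
 have "inj enc"
 proof (rule injI)
  fix s t assume "enc s = enc t"
  thus "s = t" by (intro ext) (simp only: E[symmetric])
 qed
 thus ?thesis by blast
qed

definition seq_enc :: "(nat => ('a, 'v) univ) => ('a, 'v) univ" where "seq_enc = (SOME enc. inj enc)"

lemma seq_enc_eq [simp]: "seq_enc s = seq_enc t \<longleftrightarrow> s = t"
 unfolding seq_enc_def by (rule inj_eq[OF someI_ex[OF sequence_encoding]])

definition pair_enc :: "('a, 'v) univ => ('a, 'v) univ => ('a, 'v) univ" where
 "pair_enc x y = seq_enc (%n. if n = 0 then x else y)"

lemma pair_enc_eq [simp]: "pair_enc x y = pair_enc x' y' \<longleftrightarrow> x = x' & y = y'"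
 unfolding pair_enc_def seq_enc_eq by (auto dest: fun_cong[of _ _ 0] fun_cong[of _ _ 1])

text \<open>Indicator functions; the second value is taken different from the first one, if
  possible.\<close>

definition el_enc :: "'a => ('a, 'v) univ" where
 "el_enc r z = (if z = Inl r then SOME v. True else SOME v. v ~= (SOME v. True))"
definition nat_enc :: "nat => ('a, 'v) univ" where
 "nat_enc n z = (if z = Inr n then SOME v. True else SOME v. v ~= (SOME v. True))"

lemma some_neq: assumes "(a :: 'v) ~= b" shows "(SOME v. v ~= (SOME v :: 'v. True)) ~= (SOME v. True)"
 by (rule someI_ex) (use assms in metis)

lemma inj_el_enc: assumes "(a :: 'v) ~= b" shows "inj (el_enc :: 'a => ('a, 'v) univ)"
proof (rule injI, rule ccontr)
 fix r s :: 'a assume eq: "(el_enc r :: ('a, 'v) univ) = el_enc s" and ne: "r ~= s"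
 show False using ne fun_cong[OF eq, of "Inl r"] some_neq[OF assms] by (simp add: el_enc_def)
qed
lemma inj_nat_enc: assumes "(a :: 'v) ~= b" shows "inj (nat_enc :: nat => ('a, 'v) univ)"
proof (rule injI, rule ccontr)
 fix m n assume eq: "(nat_enc m :: ('a, 'v) univ) = nat_enc n" and ne: "m ~= n"
 show False using ne fun_cong[OF eq, of "Inr m"] some_neq[OF assms] by (simp add: nat_enc_def)
qed

text \<open>A list is its length together with a padded sequence; the length separates entries from
  padding.\<close>

lemma list_encoding:
 assumes v: "(a :: 'v) ~= b" shows "EX enc :: ('a, 'v) univ list => ('a, 'v) univ. inj enc"
proof -
 define enc :: "('a, 'v) univ list => ('a, 'v) univ" where
  "enc xs = pair_enc (nat_enc (length xs)) (seq_enc (%n. if n < length xs then xs ! n else nat_enc 0))" for xs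
 have "inj enc"
 proof (rule injI)
  fix xs ys assume "enc xs = enc ys"
  hence "length xs = length ys" "(%n. if n < length xs then xs ! n else nat_enc 0) = (%n. if n < length ys then ys ! n else nat_enc 0)"
   using injD[OF inj_nat_enc[OF v]] by (auto simp: enc_def)
  thus "xs = ys" by (intro nth_equalityI) (simp_all add: fun_eq_iff, metis)
 qed
 thus ?thesis by blast
qed

context cring begin

section \<open>Comparison with K-injective resolutions\<close>

lemma small_cone: assumes A: "small TYPE('v) A" and B: "small TYPE('v) B" shows "small TYPE('v) (cone A B f)"
 unfolding small_def
proof
 fix i
 obtain e :: "'c => ('a, 'v) univ" where e: "inj_on e (El A (i - 1))" using A unfolding small_def by blast
 obtain e' :: "'d => ('a, 'v) univ" where e': "inj_on e' (El B i)" using B unfolding small_def by blast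
 have "inj_on (%x. pair_enc (e (fst x)) (e' (snd x))) (El (cone A B f) i)"
 proof (rule inj_onI)
  fix x y assume x: "x:El (cone A B f) i" and y: "y:El (cone A B f) i"
   and "pair_enc (e (fst x)) (e' (snd x)) = pair_enc (e (fst y)) (e' (snd y))"
  thus "x = y" using inj_onD[OF e, of "fst x" "fst y"] inj_onD[OF e', of "snd x" "snd y"] by (auto simp: prod_eq_iff)
 qed
 thus "EX e :: 'c \<times> 'd => ('a, 'v) univ. inj_on e (El (cone A B f) i)" by blast
qed

lemma small_ncpx: "small TYPE('v) A ==> small TYPE('v) (ncpx A)" by (simp add: small_def)

text \<open>\<open>N\<close> receives only null homotopic maps from acyclic complexes of any type,
  while for \<open>I\<close> this is known for small ones. So \<open>N\<close> has to be small in
  order that \<open>I\<close> can be tested on the cone of the map from \<open>I\<close> to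
  \<open>N\<close>.\<close>

lemma K_injective_comparison:
 fixes W :: "('a, 'w) cpx" and I :: "('a, 'v) ucpx" and N :: "('a, 'n) cpx"
 assumes I: "K_injective R I" and wi: "QI W I \<eta>" and wn: "QI W N \<theta>"
  and N: "!!i. baer (obj N i)" and b: "!!i. c < i ==> El N i = {0[obj N i]}" and sm: "small TYPE('v) N"
 shows "EX g h. heq I N g h"
proof -
 note \<eta> = qi_cm[OF wi] and \<theta> = qi_cm[OF wn]
 note Ic = cm_complex(2)[OF \<eta>] and Nc = cm_complex(2)[OF \<theta>]
 have O: "orth (cone \<eta>X Y f) N" "orth (ncpx (cone \<eta>X Y f)) N" if "QI \<eta>X Y f" for \<eta>X :: "('a, 'x) cpx" and Y :: "('a, 'y) cpx" and f
 proof -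
  note C = chain_complex_cone[OF qi_cm[OF that]]
  show "orth (cone \<eta>X Y f) N" by (rule orth_baer[OF C acyclic_cone[OF that] N b])
  show "orth (ncpx (cone \<eta>X Y f)) N" by (rule orth_baer[OF chain_complex_ncpx[OF C] acyclic_ncpx[OF C acyclic_cone[OF that]] N b])
 qed
 have "EX g. CM I N g & htp W N \<theta> (%i x. g i (\<eta> i x))"
  by (rule cone_source_surj[OF \<eta> \<theta>]) (rule orthD[OF O(1)[OF wi]])
 then obtain g where g: "CM I N g" "htp W N \<theta> (%i x. g i (\<eta> i x))" by blast
 have gq: "QI I N g" by (rule qi_cancel_right[OF wi g(1), OF qi_htp[OF wn g(2) chain_map_comp[OF \<eta> g(1)]]])
 have C: "orth (cone I N g) I"
  by (rule K_injective_orth[OF I chain_complex_cone[OF g(1)] acyclic_cone[OF gq] small_cone[OF small_univ sm]])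
 have "EX h. CM N I h & htp I I (%i x. x) (%i x. h i (g i x))"
  by (rule cone_source_surj[OF g(1) chain_map_id[OF Ic]]) (rule orthD[OF C])
 then obtain h where h: "CM N I h" "htp I I (%i x. x) (%i x. h i (g i x))" by blast
 note hg = htp_sym[OF h(2) chain_map_comp[OF g(1) h(1)]]
 note gh = chain_map_comp[OF h(1) g(1)]
 \<comment> \<open>As h g is homotopic to the identity, g h g is homotopic to g. Composition with
   the quasi-isomorphism g is injective on homotopy classes of maps into \<open>N\<close>, so g h is
   homotopic to the identity.\<close>
 have "null I N (%i x. g i (h i (g i x)) -[obj N i] g i x)"
  using htp_comp_left[OF hg chain_map_id[OF Ic] g(1)] htp_null_diff[OF chain_map_comp[OF g(1) gh] g(1)] by simp
 hence "null N N (%i x. g i (h i x) -[obj N i] x)"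
  by (rule cone_source_inj[OF g(1) chain_map_minus[OF gh chain_map_id[OF Nc]]]) (rule orthD[OF O(2)[OF gq], of 0, unfolded shift_0])
 hence "htp N N (%i x. g i (h i x)) (%i x. x)" using htp_null_diff[OF gh chain_map_id[OF Nc]] by simp
 thus ?thesis unfolding heq_def using g(1) h(1) hg by blast
qed

section \<open>Free modules and bounded below complexes of free modules\<close>

lemma free_gen_carrier [simp]: "b:B ==> gen1 b:carrier (FM B)"
proof -
 assume b: "b:B"
 have "{s. gen1 b s ~= \<zero>} <= {b}" by (auto simp: free_gen_def)
 hence "finite {s. gen1 b s ~= \<zero>}" "{s. gen1 b s ~= \<zero>} <= B" using b finite_subset by blast+
 thus ?thesis unfolding free_module_simps by (simp add: free_gen_def)
qed

lemma free_induct [consumes 1, case_names zero step]: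
 assumes x: "x:carrier (FM B)" and z: "P (%s. \<zero>)"
  and s: "!!r b x. r:carrier R ==> b:B ==> x:carrier (FM B) ==> P x ==>
   P (r *[FM B] gen1 b +[FM B] x)"
 shows "P x"
proof -
 have "finite S ==> x:carrier (FM B) ==> {s. x s ~= \<zero>} <= S ==> P x" for S x
 proof (induction S arbitrary: x rule: finite_induct)
  case empty
  hence "x = (%s. \<zero>)" by auto
  thus ?case using z by simp
 next
  case (insert b S)
  show ?case
  proof (cases "x b = \<zero>")
   case True
   hence "{s. x s ~= \<zero>} <= S" using insert.prems(2) by auto
   thus ?thesis by (rule insert.IH[OF insert.prems(1)])
  next
   case False
   let ?y = "x(b := \<zero>)"
   have bB: "b:B" using False insert.prems(1) by auto
   have e: "x = (%s. (x b \<otimes> gen1 b s) \<oplus> ?y s)" using insert.prems(1) by (auto simp: fun_eq_iff free_gen_def)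
   have "{s. ?y s ~= \<zero>} <= {s. x s ~= \<zero>}" by auto
   hence "finite {s. ?y s ~= \<zero>} & {s. ?y s ~= \<zero>} <= B"
    using insert.prems(1) unfolding free_module_simps by (meson finite_subset subset_trans)
   hence y: "?y:carrier (FM B)" using insert.prems(1) by (simp only: free_module_simps) simp
   have "P ?y" by (rule insert.IH[OF y]) (use insert.prems(2) in auto)
   from s[OF _ bB y this, of "x b"] insert.prems(1) e show ?thesis by simp
  qed
 qed
 note this[OF _ x subset_refl]
 thus ?thesis using x by simp
qed

lemma free_hom_ext:
 assumes f: "f:Hom (FM B) N" and g: "g:Hom (FM B) N" and N: "Md N"
  and e: "!!b. b:B ==> f (gen1 b) = g (gen1 b)" and x: "x:carrier (FM B)"
 shows "f x = g x"
 using x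
proof (induction x rule: free_induct)
 case zero
 thus ?case using hom_zero[OF f module_free_module N] hom_zero[OF g module_free_module N] by simp
next
 case (step r b x)
 note c = m_smult[OF module_free_module step(1) free_gen_carrier[OF step(2)]]
 show ?case unfolding hom_add[OF f c step(3)] hom_add[OF g c step(3)] hom_smult[OF f step(1) free_gen_carrier[OF step(2)]]
   hom_smult[OF g step(1) free_gen_carrier[OF step(2)]] step(4) e[OF step(2)] ..
qed

definition free_lift :: "('a, 'c) module => ('s => 'c) => ('s => 'a) => 'c" where
 "free_lift N w x = finsum N (%b. x b *[N] w b) {b. x b ~= \<zero>}"

lemma free_lift:
 assumes N: "Md N" and w: "!!b. b:B ==> w b:carrier N"
 shows "free_lift N w:Hom (FM B) N" and "b:B ==> free_lift N w (gen1 b) = w b"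
proof -
 interpret N: abelian_group N by (rule module_abelian_group[OF N])
 \<comment> \<open>The sum may run over any finite set containing the support, so two elements can
   be summed over a common index set.\<close>
 have sup: "free_lift N w x = finsum N (%b. x b *[N] w b) S"
  if x: "x:carrier (FM B)" and S: "finite S" "{b. x b ~= \<zero>} <= S" "S <= B" for x S
  unfolding free_lift_def
 proof (rule N.add.finprod_mono_neutral_cong_left[OF S(1,2)])
  fix b assume "b:S - {b. x b ~= \<zero>}"
  thus "x b *[N] w b = 0[N]" using w[of b] S(3) N by auto
 next
  show "(%b. x b *[N] w b):S \<rightarrow> carrier N" using w S(3) N x by auto
 qed simp
 show "free_lift N w:Hom (FM B) N"
 proof (rule mod_homI)
  fix x y assume x: "x:carrier (FM B)" and y: "y:carrier (FM B)"
  let ?S = "{b. x b ~= \<zero>} \<union> {b. y b ~= \<zero>}"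
  have S: "finite ?S" "?S <= B" using x y by auto
  have wS: "(%b. x b *[N] w b):?S \<rightarrow> carrier N" "(%b. y b *[N] w b):?S \<rightarrow> carrier N"
   using w S(2) N x y by auto
  show "free_lift N w x:carrier N" unfolding sup[OF x S(1) _ S(2), simplified] using wS(1) by (rule N.finsum_closed)
  have "{b. (x +[FM B] y) b ~= \<zero>} <= ?S" by auto
  from sup[OF m_add[OF module_free_module x y] S(1) this S(2)]
  have "free_lift N w (x +[FM B] y) = finsum N (%b. (x b \<oplus> y b) *[N] w b) ?S" by simp
  also have "... = finsum N (%b. x b *[N] w b +[N] y b *[N] w b) ?S"
   by (rule N.finsum_cong') (use x y w S(2) N in \<open>auto simp: m_add_smult\<close>)
  also have "... = finsum N (%b. x b *[N] w b) ?S +[N] finsum N (%b. y b *[N] w b) ?S"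
   by (rule N.finsum_addf[OF wS])
  also have "... = free_lift N w x +[N] free_lift N w y"
   unfolding sup[OF x S(1) Un_upper1 S(2)] sup[OF y S(1) Un_upper2 S(2)] ..
  finally show "free_lift N w (x +[FM B] y) = free_lift N w x +[N] free_lift N w y" .
 next
  fix r x assume r: "r:carrier R" and x: "x:carrier (FM B)"
  let ?S = "{b. x b ~= \<zero>}"
  have S: "finite ?S" "?S <= B" using x by auto
  have wS: "(%b. x b *[N] w b):?S \<rightarrow> carrier N" using w S(2) N x by auto
  have "{b. (r *[FM B] x) b ~= \<zero>} <= ?S" using r by auto
  from sup[OF m_smult[OF module_free_module r x] S(1) this S(2)]
  have "free_lift N w (r *[FM B] x) = finsum N (%b. (r \<otimes> x b) *[N] w b) ?S" by simp
  also have "... = finsum N (%b. r *[N] (x b *[N] w b)) ?S"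
   by (rule N.finsum_cong') (use r x w S(2) N in \<open>auto simp: m_mult_smult\<close>)
  also have "... = r *[N] finsum N (%b. x b *[N] w b) ?S"
   by (rule module.finsum_smult_ldistr[OF N S(1) r wS, symmetric])
  finally show "free_lift N w (r *[FM B] x) = r *[N] free_lift N w x" by (simp add: free_lift_def)
 qed
 assume b: "b:B"
 have "free_lift N w (gen1 b) = finsum N (%c. gen1 b c *[N] w c) {b}"
  by (rule sup[OF free_gen_carrier[OF b]]) (use b in \<open>auto simp: free_gen_def\<close>)
 also have "... = gen1 b b *[N] w b"
  using N.finsum_insert[of "{}" b "%c. gen1 b c *[N] w c"] w[OF b] N by (simp add: free_gen_def)
 finally show "free_lift N w (gen1 b) = w b" using w[OF b] N by (simp add: free_gen_def)
qed

lemma free_projective: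
 assumes h: "h:Hom (FM B) N" and p: "p:Hom M N" and M: "Md M" and N: "Md N"
  and e: "!!b. b:B ==> EX m:carrier M. h (gen1 b) = p m"
 shows "EX s:Hom (FM B) M. ALL x:carrier (FM B). p (s x) = h x"
proof -
 obtain w where w: "!!b. b:B ==> w b:carrier M" "!!b. b:B ==> h (gen1 b) = p (w b)" using e by metis
 have s: "free_lift M w:Hom (FM B) M" "!!b. b:B ==> free_lift M w (gen1 b) = w b"
  by (rule free_lift[OF M w(1)]; assumption)+
 have "p (free_lift M w x) = h x" if x: "x:carrier (FM B)" for x
  by (rule free_hom_ext[OF hom_comp[OF s(1) p] h N _ x]) (simp add: s(2) w(2))
 thus ?thesis using s(1) by blast
qed

text \<open>The mirror image of \<open>null_into_baer\<close>, built upwards from degree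
  \<open>c - 1\<close>, where \<open>V\<close> vanishes: the invariant \<open>P\<close> puts the
  values of f - s d into cycles, hence boundaries, of \<open>A\<close>, and freeness lifts
  them.\<close>

lemma null_from_free:
 fixes V :: "('a, 's => 'a) cpx" and A :: "('a, 'd) cpx"
 assumes f: "CM V A f" and V: "!!i. obj V i = FM (B i)" and b: "!!i. i < c ==> B i = {}" and ac: "acyclic_cpx A"
 shows "null V A f"
proof -
 note Vc = cm_complex(1)[OF f] and Ac = cm_complex(2)[OF f]
 note a = ac[unfolded acyclic_iff[OF Ac], rule_format]
 define P where "P i s \<longleftrightarrow> s:Hom (obj V i) (obj A (i + 1)) &
  (ALL x:El V (i + 1). f i (dif V (i + 1) x) = dif A (i + 1) (s (dif V (i + 1) x)))" for i s
 define Q where "Q i s s' \<longleftrightarrow> (ALL x:El V (i + 1). f (i + 1) x = dif A (i + 2) (s' x) +[obj A (i + 1)] s (dif V (i + 1) x))" for i s s'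
 define z where "z i = (%x::'s => 'a. 0[obj A (i + 1)])" for i
 have zero: "x = 0[obj V i]" if "i < c" "x:El V i" for i x
  using that b[OF that(1)] unfolding V by auto
 have "EX g. g (c - 1) = z (c - 1) & (ALL i>=c - 1. P i (g i) & Q i (g i) (g (i + 1)))"
 proof (rule int_choice_up)
  have "f (c - 1) x = 0[obj A (c - 1)]" if "x:El V (c - 1)" for x
   unfolding zero[OF _ that, simplified] by (rule cm_zero[OF f])
  thus "P (c - 1) (z (c - 1))" unfolding P_def z_def using Ac d_closed'[OF Vc, of _ "c - 1"] d_zero[OF Ac, of c] by simp
  fix i s assume s: "P i s"
  have sh: "s:Hom (obj V i) (obj A (i + 1))" using s by (simp add: P_def)
  let ?h = "%x. f (i + 1) x -[obj A (i + 1)] s (dif V (i + 1) x)"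
  have hh: "?h:Hom (FM (B (i + 1))) (obj A (i + 1))"
   unfolding V[symmetric] by (rule hom_diff[OF cm_hom[OF f] hom_comp[OF cc_dif'[OF Vc] sh] cc_module[OF Ac]])
  have dp: "dif A (i + 2):Hom (obj A (i + 2)) (obj A (i + 1))" using cc_dif[OF Ac, of "i + 2"] by (simp add: add.commute)
  have dh: "dif A (i + 1) (?h x) = 0[obj A i]" if x: "x:El V (i + 1)" for x
  proof -
   have c: "s (dif V (i + 1) x):El A (i + 1)" by (rule hom_closed[OF sh d_closed'[OF Vc x]])
   have "dif A (i + 1) (?h x) = dif A (i + 1) (f (i + 1) x) -[obj A i] dif A (i + 1) (s (dif V (i + 1) x))"
    using d_minus[OF Ac cm_closed[OF f x] c] by simp
   also have "... = 0[obj A i]" using s x cm_d'[OF f x] m_minus_cancel[OF cc_module[OF Ac] cm_closed[OF f d_closed'[OF Vc x]]]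
    unfolding P_def by simp
   finally show ?thesis .
  qed
  have "EX s':Hom (FM (B (i + 1))) (obj A (i + 2)). ALL x:carrier (FM (B (i + 1))). dif A (i + 2) (s' x) = ?h x"
  proof (rule free_projective[OF hh dp cc_module[OF Ac] cc_module[OF Ac]])
   fix b assume "b:B (i + 1)"
   hence x: "gen1 b:El V (i + 1)" unfolding V by (rule free_gen_carrier)
   have "?h (gen1 b):El A (i + 1)" using hom_closed[OF hh] x unfolding V by blast
   from a[OF this] dh[OF x] show "EX m:El A (i + 2). ?h (gen1 b) = dif A (i + 2) m" by (simp add: add.commute)
  qed
  then obtain s' where s': "s':Hom (obj V (i + 1)) (obj A (i + 2))" "!!x. x:El V (i + 1) ==> dif A (i + 2) (s' x) = ?h x"
   unfolding V by blast
  have "f (i + 1) (dif V (i + 2) x) = dif A (i + 2) (s' (dif V (i + 2) x))" if x: "x:El V (i + 2)" for x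
  proof -
   have d: "dif V (i + 2) x:El V (i + 1)" "dif V (i + 1) (dif V (i + 2) x) = 0[obj V i]"
    using d_closed[OF Vc x] d_d[OF Vc x] by (simp_all add: add.commute)
   show ?thesis unfolding s'(2)[OF d(1)] d(2) using hom_zero[OF sh] Vc Ac cm_closed[OF f d(1)] by (simp add: m_minus_eq)
  qed
  hence "P (i + 1) s'" using s'(1) unfolding P_def by (simp add: add.commute add.left_commute)
  moreover have "Q i s s'" unfolding Q_def
  proof
   fix x assume x: "x:El V (i + 1)"
   show "f (i + 1) x = dif A (i + 2) (s' x) +[obj A (i + 1)] s (dif V (i + 1) x)"
    unfolding s'(2)[OF x] using m_minus_add_cancel[OF cc_module[OF Ac] cm_closed[OF f x] hom_closed[OF sh d_closed'[OF Vc x]]] by simp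
  qed
  ultimately show "EX y. P (i + 1) y & Q i s y" by blast
 qed
 then obtain g where g: "g (c - 1) = z (c - 1)" "!!i. c - 1 <= i ==> P i (g i) & Q i (g i) (g (i + 1))" by blast
 define s where "s i = (if c - 1 <= i then g i else z i)" for i
 show ?thesis
 proof (rule nullI)
  have "s i:Hom (obj V i) (obj A (i + 1))" for i
   using g(2)[of i] Ac unfolding s_def P_def z_def by simp
  thus sh: "homotopy V A s" unfolding homotopy_def by blast
  fix i x assume x: "x:El V i"
  show "f i x = hbd V A s i x"
  proof (cases "c <= i")
   case True thus ?thesis using g(2)[of "i - 1"] x unfolding Q_def hbd_def s_def by (simp add: add.commute)
  next
   case False
   hence x0: "x = 0[obj V i]" using zero x by simp
   show ?thesis unfolding x0 cm_zero[OF f] hom_zero[OF hbd_hom[OF sh Vc Ac] cc_module[OF Vc] cc_module[OF Ac]] ..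
  qed
 qed
qed

lemma orth_free:
 fixes V :: "('a, 's => 'a) cpx" and A :: "('a, 'd) cpx"
 assumes Vc: "CC V" and V: "!!i. obj V i = FM (B i)" and b: "!!i. i < c ==> B i = {}"
  and A: "CC A" and ac: "acyclic_cpx A"
 shows "orth V A"
 unfolding orth_def
proof (intro allI impI)
 fix n f assume f: "CM V (shift A n) f"
 have "acyclic_cpx (shift A n)" using ac by (simp add: acyclic_cpx_def zero_homology_shift[OF A])
 from null_from_free[OF f V b this] show "null V (shift A n) f" .
qed

text \<open>Quasi-isomorphisms need not be invertible up to homotopy, but a bounded below complex of
  free modules lifts through them.\<close>

lemma free_lift_quasi_iso:
 fixes V :: "('a, 's => 'a) cpx" and Q :: "('a, 'p) cpx" and S :: "('a, 'w) cpx"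
 assumes qs: "QI Q S \<pi>" and vs: "QI V S \<nu>"
  and V: "!!i. obj V i = FM (B i)" and b: "!!i. i < c ==> B i = {}"
 shows "EX u. QI V Q u"
proof -
 note \<pi> = qi_cm[OF qs] and \<nu> = qi_cm[OF vs]
 note C = chain_complex_cone[OF \<pi>]
 have O: "orth V (ncpx (cone Q S \<pi>))"
  by (rule orth_free[OF cm_complex(1)[OF \<nu>] V b chain_complex_ncpx[OF C] acyclic_ncpx[OF C acyclic_cone[OF qs]]])
 have "EX u. CM V Q u & htp V S \<nu> (%i x. \<pi> i (u i x))"
  by (rule cone_target_surj[OF \<pi> \<nu>]) (rule orthD[OF O, of 0, unfolded shift_0])
 then obtain u where u: "CM V Q u" "htp V S \<nu> (%i x. \<pi> i (u i x))" by blast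
 have "QI V Q u" by (rule qi_cancel_left[OF u(1) qs, OF qi_htp[OF vs u(2) chain_map_comp[OF u(1) \<pi>]]])
 thus ?thesis by blast
qed

text \<open>\<open>V\<close> can be tested on all acyclic complexes, \<open>P\<close> on small ones;
  hence \<open>V\<close> has to be small for \<open>P\<close> to be tested on the cone of the map
  from \<open>V\<close> to \<open>P\<close>.\<close>

lemma K_projective_comparison:
 fixes V :: "('a, 's => 'a) cpx" and P :: "('a, 'v) ucpx" and S :: "('a, 'w) cpx"
 assumes P: "K_projective R P" and ps: "QI P S \<pi>" and vs: "QI V S \<nu>"
  and V: "!!i. obj V i = FM (B i)" and b: "!!i. i < c ==> B i = {}" and sm: "small TYPE('v) V"
 shows "EX g h. heq P V g h"
proof -
 obtain u where uq: "QI V P u" using free_lift_quasi_iso[OF ps vs V b] by blast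
 note u = qi_cm[OF uq]
 note Vc = cm_complex(1)[OF u] and Pc = cm_complex(2)[OF u]
 note C = chain_complex_cone[OF u]
 have O: "orth P (ncpx (cone V P u))"
  by (rule K_projective_orth[OF P chain_complex_ncpx[OF C] acyclic_ncpx[OF C acyclic_cone[OF uq]] small_ncpx[OF small_cone[OF sm small_univ]]])
 have "EX s. CM P V s & htp P P (%i x. x) (%i x. u i (s i x))"
  by (rule cone_target_surj[OF u chain_map_id[OF Pc]]) (rule orthD[OF O, of 0, unfolded shift_0])
 then obtain s where s: "CM P V s" "htp P P (%i x. x) (%i x. u i (s i x))" by blast
 note us = htp_sym[OF s(2) chain_map_comp[OF s(1) u]]
 note su = chain_map_comp[OF u s(1)]
 have O': "orth V (cone V P u)" by (rule orth_free[OF Vc V b C acyclic_cone[OF uq]])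
 have "null V P (%i x. u i (s i (u i x)) -[obj P i] u i x)"
  using htp_comp_right[OF us u] htp_null_diff[OF chain_map_comp[OF su u] u] by simp
 \<comment> \<open>With the difference moved inside \<open>u\<close>, the quasi-isomorphism
   \<open>u\<close> can be cancelled on homotopy classes of maps out of \<open>V\<close>.\<close>
 hence "null V P (%i x. u i (s i (u i x) -[obj V i] x))"
  by (rule null_cong) (simp add: cm_minus[OF u cm_closed[OF su]])
 hence "null V V (%i x. s i (u i x) -[obj V i] x)"
  by (rule cone_target_inj[OF u chain_map_minus[OF su chain_map_id[OF Vc]]]) (rule orthD[OF O'])
 hence "htp V V (%i x. s i (u i x)) (%i x. x)" using htp_null_diff[OF su chain_map_id[OF Vc]] by simp
 thus ?thesis unfolding heq_def using u s(1) us by blast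
qed



section \<open>Spans and Noetherian finiteness\<close>

lemma span_submodule: assumes M: "Md M" and S: "S <= carrier M" shows "submodule (Span M S) R M"
proof (rule submoduleI'[OF M])
 show "Span M S <= carrier M" using carrier_submodule[OF M] S unfolding mod_span_def by blast
qed (use submoduleD[OF M] in \<open>auto simp: mod_span_def\<close>)

lemma span_minimal: "submodule N R M ==> S <= N ==> Span M S <= N"
 unfolding mod_span_def by blast
lemma span_incl: "S <= Span M S"
 unfolding mod_span_def by blast
lemma span_mono: "S <= T ==> Span M S <= Span M T"
 unfolding mod_span_def by blast

lemma vimage_submodule:
 assumes f: "f:Hom M N" and M: "Md M" and N: "Md N" and S: "submodule S R N"
 shows "submodule {x:carrier M. f x:S} R M"
 by (rule submoduleI'[OF M]) (use submoduleD[OF N S] M in \<open>auto simp: hom_zero[OF f M N] hom_add[OF f] hom_smult[OF f]\<close>)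

lemma span_hom:
 assumes f: "f:Hom M N" and M: "Md M" and N: "Md N" and T: "T <= carrier N"
  and S: "S <= carrier M" "!!s. s:S ==> f s:Span N T" and x: "x:Span M S"
 shows "f x:Span N T"
 using span_minimal[OF vimage_submodule[OF f M N span_submodule[OF N T]], of S] S x by blast

lemma submodule_plus:
 assumes M: "Md M" and A: "submodule A R M" and B: "submodule B R M"
 shows "submodule {a +[M] b | a b. a:A & b:B} R M"
proof (rule submoduleI'[OF M])
 note DA = submoduleD[OF M A] and DB = submoduleD[OF M B]
 have c: "a:A ==> a:carrier M" "b:B ==> b:carrier M" for a b using DA(1) DB(1) by auto
 let ?P = "{a +[M] b | a b. a:A & b:B}"
 show "?P <= carrier M" using c M by auto
 show "0[M]:?P" using DA(2) DB(2) M by (auto intro!: exI[of _ "0[M]"])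
 fix x y assume "x:?P" "y:?P"
 then obtain a b a' b' where x: "x = a +[M] b" "a:A" "b:B" and y: "y = a' +[M] b'" "a':A" "b':B" by blast
 have "x +[M] y = (a +[M] a') +[M] (b +[M] b')" unfolding x(1) y(1)
  using c(1)[OF x(2)] c(2)[OF x(3)] c(1)[OF y(2)] c(2)[OF y(3)] M by algebra
 thus "x +[M] y:?P" using DA(3)[OF x(2) y(2)] DB(3)[OF x(3) y(3)] by blast
next
 note DA = submoduleD[OF M A] and DB = submoduleD[OF M B]
 fix r x assume r: "r:carrier R" and "x:{a +[M] b | a b. a:A & b:B}"
 then obtain a b where x: "x = a +[M] b" "a:A" "b:B" by blast
 have "r *[M] x = r *[M] a +[M] r *[M] b" unfolding x(1) using m_smult_add[OF M r] x(2,3) DA(1) DB(1) by auto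
 thus "r *[M] x:{a +[M] b | a b. a:A & b:B}" using DA(4)[OF r x(2)] DB(4)[OF r x(3)] by blast
qed

lemma submodule_Int: "Md M ==> submodule A R M ==> submodule B R M ==> submodule (A \<inter> B) R M"
 by (rule submoduleI') (use submoduleD[of M A] submoduleD[of M B] in auto)

lemma submodule_mult: fixes M :: "('a, 'c) module" assumes M: "Md M" and s: "s:carrier M" shows "submodule ((%r. r *[M] s) ` carrier R) R M"
 using image_submodule[OF hom_mult[OF M s] module_ring_module M carrier_submodule[OF module_ring_module]] by simp

text \<open>Induction on the generators: the coefficients of the last generator \<open>s\<close> in
  elements of \<open>N\<close> form an ideal. Finitely many elements of \<open>N\<close> realise its
  generators, and the rest lies in N \<inter> ?W, which the induction hypothesis covers. Carrying
  the arbitrary set \<open>B\<close> along replaces the passage to a quotient module.\<close>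

lemma noetherian_relative:
 assumes noeth: "noetherian_ring R" and M: "Md M" and B: "B <= carrier M"
  and "finite S" "S <= carrier M" "submodule N R M" "N <= Span M (S \<union> B)"
 shows "EX S'. finite S' & S' <= N & N <= Span M (S' \<union> B)"
 using assms(4-)
proof (induction S arbitrary: N rule: finite_induct)
 case empty
 thus ?case by (intro exI[of _ "{}"]) auto
next
 case (insert s S)
 let ?W = "Span M (S \<union> B)"
 have s: "s:carrier M" and SB: "S \<union> B <= carrier M" using insert.prems(1) B by auto
 have W: "submodule ?W R M" by (rule span_submodule[OF M SB])
 note DW = submoduleD[OF M W] and DN = submoduleD[OF M insert.prems(2)]
 have rep: "EX r:carrier R. EX w:?W. x = r *[M] s +[M] w" if "x:Span M (insert s S \<union> B)" for x
 proof -
  have sub: "submodule {a +[M] b | a b. a:(%r. r *[M] s) ` carrier R & b:?W} R M"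
   by (rule submodule_plus[OF M submodule_mult[OF M s] W])
  note D1 = submoduleD[OF M submodule_mult[OF M s]]
  have z: "0[M]:(%r. r *[M] s) ` carrier R" by (rule D1(2))
  have z1: "s:(%r. r *[M] s) ` carrier R" using imageI[OF one_closed, of "%r. r *[M] s"] m_one_smult[OF M s] by simp
  have "insert s S \<union> B <= {a +[M] b | a b. a:(%r. r *[M] s) ` carrier R & b:?W}"
  proof
   fix t assume "t:insert s S \<union> B"
   then consider "t = s" | "t:S \<union> B" by blast
   thus "t:{a +[M] b | a b. a:(%r. r *[M] s) ` carrier R & b:?W}"
   proof cases
    case 1
    have "s = s +[M] 0[M]" using m_r_zero[OF M s] by simp
    thus ?thesis unfolding 1 using z1 DW(2) by (intro CollectI exI conjI)
   next
    case 2
    have "t = 0[M] +[M] t" using m_l_zero[OF M subsetD[OF SB 2]] by simp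
    thus ?thesis using z subsetD[OF span_incl 2] by (intro CollectI exI conjI)
   qed
  qed
  from subsetD[OF span_minimal[OF sub this] that]
  obtain a v where "a:(%r. r *[M] s) ` carrier R" "v:?W" "x = a +[M] v" by (elim CollectE exE conjE)
  thus ?thesis by auto
 qed
 \<comment> \<open>Stated for any submodule, as it is applied both to \<open>N\<close> and to the
   span of the elements chosen in \<open>N\<close>.\<close>
 have Ilem: "ideal {r:carrier R. EX w:?W. r *[M] s +[M] w:N'} R" if N': "submodule N' R M" for N'
 proof (rule idealI')
  note D' = submoduleD[OF M N']
  let ?I = "{r:carrier R. EX w:?W. r *[M] s +[M] w:N'}"
  show "\<zero>:?I" using D'(2) DW(2) s M by (auto intro!: bexI[of _ "0[M]"])
  fix x y assume "x:?I" "y:?I"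
  then obtain v w where xy: "x:carrier R" "y:carrier R" "v:?W" "w:?W" "x *[M] s +[M] v:N'" "y *[M] s +[M] w:N'" by blast
  have vw: "v:carrier M" "w:carrier M" using DW(1) xy by auto
  have "(x *[M] s +[M] v) +[M] (y *[M] s +[M] w) = (x \<oplus> y) *[M] s +[M] (v +[M] w)"
   using xy vw s M by (simp add: m_add_smult m_assoc' m_lcomm')
  thus "x \<oplus> y:?I" using D'(3)[OF xy(5,6)] DW(3)[OF xy(3,4)] xy(1,2) by auto
 next
  note D' = submoduleD[OF M N']
  fix r x assume r: "r:carrier R" and "x:{r:carrier R. EX w:?W. r *[M] s +[M] w:N'}"
  then obtain v where x: "x:carrier R" "v:?W" "x *[M] s +[M] v:N'" by blast
  have v: "v:carrier M" using DW(1) x by auto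
  have "r *[M] (x *[M] s +[M] v) = (r \<otimes> x) *[M] s +[M] r *[M] v" using r x v s M by (simp add: m_smult_add m_mult_smult)
  thus "r \<otimes> x:{r:carrier R. EX w:?W. r *[M] s +[M] w:N'}" using D'(4)[OF r x(3)] DW(4)[OF r x(2)] r x(1) by auto
 qed blast
 let ?I = "{r:carrier R. EX w:?W. r *[M] s +[M] w:N}"
 obtain A where A: "A <= carrier R" "finite A" "?I = Idl A"
  using noetherian_ring.finetely_gen[OF noeth Ilem[OF insert.prems(2)]] by blast
 have "ALL a:A. EX w. w:?W & a *[M] s +[M] w:N"
  using genideal_self[OF A(1)] unfolding A(3)[symmetric] by blast
 then obtain w where w: "!!a. a:A ==> w a:?W" "!!a. a:A ==> a *[M] s +[M] w a:N" by metis
 let ?n = "%a. a *[M] s +[M] w a"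
 have nN: "?n ` A <= N" using w(2) by blast
 have nM: "?n ` A <= carrier M" using nN DN(1) by blast
 have spN: "Span M (?n ` A) <= N" by (rule span_minimal[OF insert.prems(2) nN])
 have "A <= {r:carrier R. EX w:?W. r *[M] s +[M] w:Span M (?n ` A)}"
  using A(1) w(1) span_incl[of "?n ` A" M] by blast
 from genideal_minimal[OF Ilem[OF span_submodule[OF M nM]] this]
 have I': "EX w:?W. r *[M] s +[M] w:Span M (?n ` A)" if "r:?I" for r using that unfolding A(3) by blast
 obtain S1 where S1: "finite S1" "S1 <= N \<inter> ?W" "N \<inter> ?W <= Span M (S1 \<union> B)"
  using insert.IH[OF _ submodule_Int[OF M insert.prems(2) W]] insert.prems(1) by auto
 have S'M: "(S1 \<union> ?n ` A) \<union> B <= carrier M" using S1(2) DN(1) nM B by blast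
 note DS = submoduleD[OF M span_submodule[OF M S'M]]
 have "N <= Span M ((S1 \<union> ?n ` A) \<union> B)"
 proof
  fix x assume x: "x:N"
  then obtain r v where r: "r:carrier R" "v:?W" "x = r *[M] s +[M] v" using rep insert.prems(3) by blast
  hence "r:?I" using x by blast
  then obtain v' where v': "v':?W" "r *[M] s +[M] v':Span M (?n ` A)" using I' by blast
  let ?y = "r *[M] s +[M] v'"
  have c: "r *[M] s:carrier M" "v:carrier M" "v':carrier M" using r v'(1) DW(1) s M by auto
  \<comment> \<open>Equal coefficients at \<open>s\<close> cancel, which puts the difference into
    both \<open>N\<close> and \<open>?W\<close>.\<close>
  have "x -[M] ?y = v -[M] v'" unfolding r(3) using c M by algebra
  hence "x -[M] ?y:N \<inter> ?W" using DN(6)[OF x subsetD[OF spN v'(2)]] DW(6)[OF r(2) v'(1)] by simp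
  hence 1: "x -[M] ?y:Span M ((S1 \<union> ?n ` A) \<union> B)" using S1(3) span_mono[of "S1 \<union> B" "(S1 \<union> ?n ` A) \<union> B" M] by blast
  have 2: "?y:Span M ((S1 \<union> ?n ` A) \<union> B)" using v'(2) span_mono[of "?n ` A" "(S1 \<union> ?n ` A) \<union> B" M] by blast
  have "x = (x -[M] ?y) +[M] ?y" using m_minus_add_cancel[OF M, of x ?y] x DN(1) c M by auto
  thus "x:Span M ((S1 \<union> ?n ` A) \<union> B)" using DS(3)[OF 1 2] by simp
 qed
 thus ?case using S1(1,2) A(2) nN by (intro exI[of _ "S1 \<union> ?n ` A"]) blast
qed

text \<open>Finite generation of an extension, relative to \<open>B\<close> in the source and
  \<open>B'\<close> in the target: generators of the image are lifted, and \<open>S2\<close>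
  accounts for the part of \<open>W\<close> that \<open>h\<close> sends into
  \<open>B'\<close>.\<close>

lemma fg_extension:
 assumes noeth: "noetherian_ring R" and M: "Md M" and Y: "Md Y" and h: "h:Hom M Y"
  and W: "submodule W R M" and B': "submodule B' R Y" and S: "finite S" "S <= carrier Y"
  and img: "!!w. w:W ==> h w:Span Y (S \<union> B')"
  and S2: "finite S2" "S2 <= W" and B: "B <= carrier M"
  and ker: "!!w. w:W ==> h w:B' ==> w:Span M (S2 \<union> B)"
 shows "EX S3. finite S3 & S3 <= W & W <= Span M (S3 \<union> B)"
proof -
 note DW = submoduleD[OF M W] and DB' = submoduleD[OF Y B']
 note hW = image_submodule[OF h M Y W]
 obtain S' where S': "finite S'" "S' <= h ` W" "h ` W <= Span Y (S' \<union> B')"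
  using noetherian_relative[OF noeth Y DB'(1) S hW] img by blast
 obtain S0 where S0: "S0 <= W" "finite S0" "S' = h ` S0" using finite_subset_image[OF S'(1,2)] by blast
 have S0M: "S0 <= carrier M" using S0(1) DW(1) by blast
 have SB: "(S0 \<union> S2) \<union> B <= carrier M" using S0M S2(2) DW(1) B by blast
 note DS = submoduleD[OF M span_submodule[OF M SB]]
 note sp0 = span_submodule[OF M S0M]
 have sp0W: "Span M S0 <= W" by (rule span_minimal[OF W S0(1)])
 let ?P = "{a +[Y] b | a b. a:h ` Span M S0 & b:B'}"
 have P: "submodule ?P R Y" by (rule submodule_plus[OF Y image_submodule[OF h M Y sp0] B'])
 have "S' \<union> B' <= ?P"
 proof
  fix t assume "t:S' \<union> B'"
  then consider s where "s:S0" "t = h s" | "t:B'" using S0(3) by blast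
  thus "t:?P"
  proof cases
   case 1
   have "t = t +[Y] 0[Y]" using 1 hom_closed[OF h] S0M Y by auto
   thus ?thesis using 1 span_incl[of S0 M] DB'(2) by blast
  next
   case 2
   have "t = 0[Y] +[Y] t" using 2 DB'(1) Y by auto
   moreover have "0[Y]:h ` Span M S0" using submoduleD(2)[OF Y image_submodule[OF h M Y sp0]] .
   ultimately show ?thesis using 2 by blast
  qed
 qed
 note sub = span_minimal[OF P this]
 have "W <= Span M ((S0 \<union> S2) \<union> B)"
 proof
  fix x assume x: "x:W"
  hence "h x:?P" using S'(3) sub by blast
  then obtain u b where u: "u:Span M S0" "b:B'" "h x = h u +[Y] b" by blast
  have c: "x:carrier M" "u:carrier M" "u:W" "b:carrier Y" using x u sp0W DW(1) DB'(1) by auto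
  have "h (x -[M] u) = b" unfolding hom_minus[OF h M Y c(1,2)] u(3) using hom_closed[OF h c(2)] c(4) Y by algebra
  hence "x -[M] u:Span M (S2 \<union> B)" using ker DW(6)[OF x c(3)] u(2) by simp
  hence 1: "x -[M] u:Span M ((S0 \<union> S2) \<union> B)" using span_mono[of "S2 \<union> B" "(S0 \<union> S2) \<union> B" M] by blast
  have 2: "u:Span M ((S0 \<union> S2) \<union> B)" using u(1) span_mono[of S0 "(S0 \<union> S2) \<union> B" M] by blast
  show "x:Span M ((S0 \<union> S2) \<union> B)" using DS(3)[OF 1 2] m_minus_add_cancel[OF M c(1,2)] by simp
 qed
 thus ?thesis using S0 S2 by (intro exI[of _ "S0 \<union> S2"]) blast
qed

text \<open>Finite generation of H_i inside the module of chains: generation modulo boundaries is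
  the form that \<open>fg_extension\<close> handles.\<close>

definition fg_homology :: "('a, 'c) cpx => int => bool" where
 "fg_homology X i \<longleftrightarrow> (EX S. finite S & S <= carrier (cycles X i) & carrier (cycles X i) <= Span (obj X i) (S \<union> boundaries X i))"

lemma submodule_cycles: assumes X: "CC X" shows "submodule (carrier (cycles X i)) R (obj X i)"
 by (rule submoduleI') (use X in \<open>auto simp: d_simps\<close>)

lemma fg_homology_intro:
 assumes X: "CC X" and f: "finitely_generated R (homology X i)" shows "fg_homology X i"
proof -
 let ?Z = "cycles X i" let ?B = "boundaries X i" let ?q = "%x. ?B +>\<^bsub>?Z\<^esub> x" let ?H = "homology X i"
 note mZ = module_cycles[OF X, of i] and sB = submodule_boundaries[OF X, of i]
 have mH: "Md ?H" unfolding homology_def by (rule module_quot[OF mZ sB])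
 have q: "?q:Hom ?Z ?H" unfolding homology_def by (rule quot_hom[OF mZ sB])
 obtain S' where S': "finite S'" "S' <= carrier ?H" "Span ?H S' = carrier ?H" using f unfolding finitely_generated_def by blast
 have "S' <= ?q ` carrier ?Z" using S'(2) unfolding homology_def quot_carrier .
 then obtain S where S: "S <= carrier ?Z" "finite S" "S' = ?q ` S" using finite_subset_image[OF S'(1)] by blast
 have SB: "S \<union> ?B <= El X i" using S(1) bd_closed[OF X] by auto
 let ?N = "Span (obj X i) (S \<union> ?B) \<inter> carrier ?Z"
 have N0: "submodule ?N R (obj X i)" by (rule submodule_Int[OF cc_module[OF X] span_submodule[OF cc_module[OF X] SB] submodule_cycles[OF X]])
 have N: "submodule ?N R ?Z" by (rule submoduleI'[OF mZ]) (use submoduleD[OF cc_module[OF X] N0] in auto)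
 have "S' <= ?q ` ?N" unfolding S(3) using S(1) span_incl[of "S \<union> ?B" "obj X i"] by blast
 hence H: "carrier ?H <= ?q ` ?N" using span_minimal[OF image_submodule[OF q mZ mH N]] S'(3) by blast
 have "carrier ?Z <= Span (obj X i) (S \<union> ?B)"
 proof
  fix z assume z: "z:carrier ?Z"
  hence "?q z:?q ` ?N" using H hom_closed[OF q] by blast
  then obtain n where n: "n:?N" "?q z = ?q n" by blast
  have nZ: "n:carrier ?Z" using n(1) by blast
  obtain b where b: "b:?B" "z = b +[?Z] n" using n(2) cos_eq[OF mZ sB z nZ] by blast
  have "b:Span (obj X i) (S \<union> ?B)" using b(1) span_incl[of "S \<union> ?B" "obj X i"] by blast
  thus "z:Span (obj X i) (S \<union> ?B)"
   using b(2) n(1) submoduleD(3)[OF cc_module[OF X] span_submodule[OF cc_module[OF X] SB]] by simp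
 qed
 thus ?thesis unfolding fg_homology_def using S by blast
qed

lemma fg_homology_forward:
 assumes f: "QI X Y f" and g: "fg_homology X i" shows "fg_homology Y i"
proof -
 note fc = qi_cm[OF f]
 note X = cm_complex(1)[OF fc] and Y = cm_complex(2)[OF fc]
 obtain S where S: "finite S" "S <= carrier (cycles X i)" "carrier (cycles X i) <= Span (obj X i) (S \<union> boundaries X i)"
  using g unfolding fg_homology_def by blast
 let ?T = "f i ` S \<union> boundaries Y i"
 have T: "f i ` S <= carrier (cycles Y i)" using cm_cycle[OF fc] S(2) by blast
 hence Tc: "?T <= El Y i" using bd_closed[OF Y] by auto
 have SB: "S \<union> boundaries X i <= El X i" using S(2) bd_closed[OF X] by auto
 have "carrier (cycles Y i) <= Span (obj Y i) ?T"
 proof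
  fix y assume "y:carrier (cycles Y i)"
  then obtain x n where x: "x:carrier (cycles X i)" "n:boundaries Y i" "y = n +[obj Y i] f i x"
   using f unfolding quasi_iso_iff[OF fc] by blast
  have gen: "f i s:Span (obj Y i) ?T" if "s:S \<union> boundaries X i" for s
   using that span_incl[of ?T "obj Y i"] cm_bd[OF fc] by blast
  have "f i x:Span (obj Y i) ?T"
   by (rule span_hom[OF cm_hom[OF fc] cc_module[OF X] cc_module[OF Y] Tc SB gen subsetD[OF S(3) x(1)]])
  moreover have "n:Span (obj Y i) ?T" using x(2) span_incl[of ?T "obj Y i"] by blast
  ultimately show "y:Span (obj Y i) ?T" unfolding x(3)
   using submoduleD(3)[OF cc_module[OF Y] span_submodule[OF cc_module[OF Y] Tc]] by blast
 qed
 thus ?thesis unfolding fg_homology_def using S(1) T by blast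
qed

lemma fg_homology_backward:
 assumes f: "QI X Y f" and g: "fg_homology Y i" shows "fg_homology X i"
proof -
 note fc = qi_cm[OF f]
 note X = cm_complex(1)[OF fc] and Y = cm_complex(2)[OF fc]
 obtain S where S: "finite S" "S <= carrier (cycles Y i)" "carrier (cycles Y i) <= Span (obj Y i) (S \<union> boundaries Y i)"
  using g unfolding fg_homology_def by blast
 have "ALL s:S. EX x. x:carrier (cycles X i) & (EX n:boundaries Y i. s = n +[obj Y i] f i x)"
  using f S(2) unfolding quasi_iso_iff[OF fc] by blast
 then obtain w where w: "!!s. s:S ==> w s:carrier (cycles X i)" "!!s. s:S ==> EX n:boundaries Y i. s = n +[obj Y i] f i (w s)" by metis
 let ?T = "w ` S \<union> boundaries X i"
 have wZ: "w ` S <= carrier (cycles X i)" using w(1) by blast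
 have wc: "w ` S <= El X i" using w(1) by auto
 have Tc: "?T <= El X i" using wc bd_closed[OF X] by blast
 note DT = submoduleD[OF cc_module[OF X] span_submodule[OF cc_module[OF X] Tc]]
 note sw = span_submodule[OF cc_module[OF X] wc]
 note swZ = span_minimal[OF submodule_cycles[OF X] wZ]
 let ?P = "{a +[obj Y i] b | a b. a:boundaries Y i & b:f i ` Span (obj X i) (w ` S)}"
 note fw = image_submodule[OF cm_hom[OF fc] cc_module[OF X] cc_module[OF Y] sw]
 have P: "submodule ?P R (obj Y i)" by (rule submodule_plus[OF cc_module[OF Y] submodule_boundaries_obj[OF Y] fw])
 have "S \<union> boundaries Y i <= ?P"
 proof
  fix t assume "t:S \<union> boundaries Y i"
  then consider "t:S" | "t:boundaries Y i" by blast
  thus "t:?P"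
  proof cases
   case 1 thus ?thesis using w(2)[OF 1] span_incl[of "w ` S" "obj X i"] by blast
  next
   case 2
   have "t = t +[obj Y i] 0[obj Y i]" using bd_closed[OF Y 2] Y by simp
   thus ?thesis using 2 submoduleD(2)[OF cc_module[OF Y] fw] by blast
  qed
 qed
 note sub = span_minimal[OF P this]
 have "carrier (cycles X i) <= Span (obj X i) ?T"
 proof
  fix x assume x: "x:carrier (cycles X i)"
  hence "f i x:?P" using S(3) sub cm_cycle[OF fc x] by blast
  then obtain n u where u: "n:boundaries Y i" "u:Span (obj X i) (w ` S)" "f i x = n +[obj Y i] f i u" by blast
  have uZ: "u:carrier (cycles X i)" using u(2) swZ by blast
  have c: "x:El X i" "u:El X i" using x uZ by simp_all
  have "f i (x -[obj X i] u) = n" unfolding cm_minus[OF fc c] u(3)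
   using cm_closed[OF fc c(2)] bd_closed[OF Y u(1)] cc_module[OF Y, of i] by algebra
  moreover have "x -[obj X i] u:carrier (cycles X i)" by (rule submoduleD(6)[OF cc_module[OF X] submodule_cycles[OF X] x uZ])
  ultimately have "x -[obj X i] u:boundaries X i" using f u(1) unfolding quasi_iso_iff[OF fc] by blast
  hence 1: "x -[obj X i] u:Span (obj X i) ?T" using span_incl[of ?T "obj X i"] by blast
  have 2: "u:Span (obj X i) ?T" using u(2) span_mono[of "w ` S" ?T "obj X i"] by blast
  show "x:Span (obj X i) ?T" using DT(3)[OF 1 2] m_minus_add_cancel[OF cc_module[OF X] c] by simp
 qed
 thus ?thesis unfolding fg_homology_def using S(1) wZ by (intro exI[of _ "w ` S"]) simp
qed



section \<open>Free resolutions\<close>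

text \<open>Up to sign, with \<open>Z\<close> the cycles built so far, these are the cycles of the
  cone of the map built so far: a cycle of the partial resolution, and a chain of \<open>Y\<close>
  bounded by its image. A new generator is sent to such a pair: the first entry is its differential,
  the second its image in \<open>Y\<close>.\<close>

definition lift_rel :: "('a, 's => 'a) module => ('a, 'y) cpx => int => ('s => 'a) set => (('s => 'a) => 'y) => (('s => 'a) \<times> 'y) set" where
 "lift_rel M Y n Z f = {p:carrier (dsum M (obj Y (n + 1))). fst p:Z & f (fst p) = dif Y (n + 1) (snd p)}"

definition bd_part :: "('a, 'y) cpx => int => (('s => 'a) \<times> 'y) set" where
 "bd_part Y n = Pair (%s. \<zero>) ` boundaries Y (n + 1)"

text \<open>\<open>good\<close> abstracts the size of the bases. Two cases occur: finite sets of
  naturals and arbitrary subsets of the universe.\<close>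

definition resolving :: "('s set => bool) => ('a, 'y) cpx => bool" where
 "resolving good Y \<longleftrightarrow> good {} & (ALL n B Z f. good B --> submodule Z R (FM B) --> f:Hom (FM B) (obj Y n) -->
  (EX B' g. good B' & (ALL b:B'. g b:lift_rel (FM B) Y n Z f) &
   lift_rel (FM B) Y n Z f <= Span (dsum (FM B) (obj Y (n + 1))) (g ` B' \<union> bd_part Y n)))"

lemma zero_submodule: "Md M ==> submodule {0[M]} R M"
 by (rule submoduleI') simp_all

lemma lift_rel_submodule:
 fixes Y :: "('a, 'y) cpx"
 assumes Y: "CC Y" and Z: "submodule Z R (FM B)" and f: "f:Hom (FM B) (obj Y n)"
 shows "submodule (lift_rel (FM B) Y n Z f) R (dsum (FM B) (obj Y (n + 1)))"
proof -
 note DZ = submoduleD[OF module_free_module Z]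
 have Zc: "x:Z ==> x:carrier (FM B)" for x using DZ(1) by blast
 note dh = cc_dif'[OF Y, of n]
 show ?thesis
 proof (rule submoduleI')
  show "Md (dsum (FM B) (obj Y (n + 1)))" using Y module_free_module by simp
  show "0[dsum (FM B) (obj Y (n + 1))]:lift_rel (FM B) Y n Z f"
   unfolding lift_rel_def using DZ(2) Y hom_zero[OF f module_free_module cc_module[OF Y]] hom_zero[OF dh cc_module[OF Y] cc_module[OF Y]] by simp
  fix x y assume "x:lift_rel (FM B) Y n Z f" "y:lift_rel (FM B) Y n Z f"
  hence c: "fst x:Z" "fst y:Z" "snd x:El Y (n + 1)" "snd y:El Y (n + 1)"
   "f (fst x) = dif Y (n + 1) (snd x)" "f (fst y) = dif Y (n + 1) (snd y)" unfolding lift_rel_def by auto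
  show "x +[dsum (FM B) (obj Y (n + 1))] y:lift_rel (FM B) Y n Z f"
   unfolding lift_rel_def dsum_simps mem_Collect_eq fst_conv snd_conv mem_Times_iff
    hom_add[OF f Zc[OF c(1)] Zc[OF c(2)]] hom_add[OF dh c(3,4)] c(5,6)
   by (intro conjI DZ(3)[OF c(1,2)] Zc[OF DZ(3)[OF c(1,2)]] m_add[OF cc_module[OF Y] c(3,4)] refl)
 next
  fix r x assume r: "r:carrier R" and "x:lift_rel (FM B) Y n Z f"
  hence c: "fst x:Z" "snd x:El Y (n + 1)" "f (fst x) = dif Y (n + 1) (snd x)" unfolding lift_rel_def by auto
  show "r *[dsum (FM B) (obj Y (n + 1))] x:lift_rel (FM B) Y n Z f"
   unfolding lift_rel_def dsum_simps mem_Collect_eq fst_conv snd_conv mem_Times_iff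
    hom_smult[OF f r Zc[OF c(1)]] hom_smult[OF dh r c(2)] c(3)
   by (intro conjI DZ(4)[OF r c(1)] Zc[OF DZ(4)[OF r c(1)]] m_smult[OF cc_module[OF Y] r c(2)] refl)
 qed (auto simp: lift_rel_def)
qed

lemma bd_part_submodule: assumes Y: "CC Y"
 shows "submodule (bd_part Y n) R (dsum (FM B) (obj Y (n + 1)))"
proof -
 have h: "Pair (%s. \<zero>):Hom (obj Y (n + 1)) (dsum (FM B) (obj Y (n + 1)))"
  using hom_inr[OF module_free_module cc_module[OF Y]] by simp
 show ?thesis unfolding bd_part_def
  by (rule image_submodule[OF h cc_module[OF Y] _ submodule_boundaries_obj[OF Y]]) (use Y module_free_module in simp)
qed

text \<open>The last clause serves both halves of a quasi-isomorphism: for z = 0 it reaches all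
  classes of degree \<open>n + 1\<close>, and for general \<open>z\<close> it bounds those cycles of
  degree \<open>n\<close> whose images are boundaries.\<close>

lemma resolution_step:
 fixes Y :: "('a, 'y) cpx" and good :: "'s set => bool"
 assumes Y: "CC Y" and good: "resolving good Y" and B: "good B"
  and Z: "submodule Z R (FM B)" and f: "f:Hom (FM B) (obj Y n)"
 shows "EX B' d' f'. good B' & d':Hom (FM B') (FM B) & f':Hom (FM B') (obj Y (n + 1)) &
  (ALL t:carrier (FM B'). d' t:Z & f (d' t) = dif Y (n + 1) (f' t)) &
  (ALL z:Z. ALL y:El Y (n + 1). f z = dif Y (n + 1) y -->
   (EX t:carrier (FM B'). EX b:boundaries Y (n + 1). d' t = z & y = b +[obj Y (n + 1)] f' t))"
proof -
 let ?F = "FM B" let ?S = "dsum ?F (obj Y (n + 1))" let ?W = "lift_rel ?F Y n Z f"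
 note mF = module_free_module
 have mS: "Md ?S" using Y mF by simp
 obtain B' g where g: "good B'" "!!b. b:B' ==> g b:?W" "?W <= Span ?S (g ` B' \<union> bd_part Y n)"
  using good[unfolded resolving_def, THEN conjunct2, rule_format, OF B Z f] by blast
 let ?F' = "FM B'"
 note sW = lift_rel_submodule[OF Y Z f] and sB = bd_part_submodule[OF Y, of n B]
 have gS: "g b:carrier ?S" if "b:B'" for b using g(2)[OF that] submoduleD(1)[OF mS sW] by blast
 define k where "k = free_lift ?S g"
 have k: "k:Hom ?F' ?S" "!!b. b:B' ==> k (gen1 b) = g b"
  unfolding k_def by (rule free_lift[OF mS gS]; assumption)+
 have kW: "k t:?W" if "t:carrier ?F'" for t using that
 proof (induction t rule: free_induct)
  case zero
  thus ?case using hom_zero[OF k(1) mF mS] submoduleD(2)[OF mS sW] by simp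
 next
  case (step r b x)
  have c: "gen1 b:carrier ?F'" by (rule free_gen_carrier[OF step(2)])
  show ?case unfolding hom_add[OF k(1) m_smult[OF mF step(1) c] step(3)] hom_smult[OF k(1) step(1) c] k(2)[OF step(2)]
   by (rule submoduleD(3)[OF mS sW submoduleD(4)[OF mS sW step(1) g(2)[OF step(2)]] step(4)])
 qed
 define d' f' where "d' t = fst (k t)" and "f' t = snd (k t)" for t
 have d': "d':Hom ?F' ?F" unfolding d'_def by (rule hom_comp[OF k(1) hom_fst])
 have f': "f':Hom ?F' (obj Y (n + 1))" unfolding f'_def by (rule hom_comp[OF k(1) hom_snd])
 have 1: "d' t:Z & f (d' t) = dif Y (n + 1) (f' t)" if "t:carrier ?F'" for t
  using kW[OF that] unfolding lift_rel_def d'_def f'_def by blast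
 have 2: "EX t:carrier ?F'. EX b:boundaries Y (n + 1). d' t = z & y = b +[obj Y (n + 1)] f' t"
  if z: "z:Z" and y: "y:El Y (n + 1)" and e: "f z = dif Y (n + 1) y" for z y
 proof -
  let ?P = "{a +[?S] b | a b. a:bd_part Y n & b:k ` carrier ?F'}"
  note ki = image_submodule[OF k(1) mF mS carrier_submodule[OF mF]]
  have P: "submodule ?P R ?S" by (rule submodule_plus[OF mS sB ki])
  have "g ` B' \<union> bd_part Y n <= ?P"
  proof
   fix p assume "p:g ` B' \<union> bd_part Y n"
   then consider b where "b:B'" "p = g b" | "p:bd_part Y n" by blast
   thus "p:?P"
   proof cases
    case 1
    have "p = 0[?S] +[?S] p" using m_l_zero[OF mS gS[OF 1(1)]] 1(2) by simp
    moreover have "p:k ` carrier ?F'" using imageI[OF free_gen_carrier[OF 1(1)], of k] k(2)[OF 1(1)] 1(2) by simp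
    ultimately show ?thesis using submoduleD(2)[OF mS sB] by (intro CollectI exI conjI)
   next
    case 2
    have "p = p +[?S] 0[?S]" using m_r_zero[OF mS subsetD[OF submoduleD(1)[OF mS sB] 2]] by simp
    thus ?thesis using 2 submoduleD(2)[OF mS ki] by (intro CollectI exI conjI)
   qed
  qed
  note sub = span_minimal[OF P this]
  have "(z, y):?W" using z y e subsetD[OF submoduleD(1)[OF mF Z] z] unfolding lift_rel_def dsum_simps by simp
  hence "(z, y):?P" using g(3) sub by blast
  then obtain a t where t: "a:bd_part Y n" "t:carrier ?F'" "(z, y) = a +[?S] k t" by (elim CollectE exE conjE imageE) simp
  obtain b where b: "b:boundaries Y (n + 1)" "a = (%s. \<zero>, b)" using t(1) unfolding bd_part_def by blast
  have "z = 0[?F] +[?F] d' t" "y = b +[obj Y (n + 1)] f' t" using t(3) unfolding b(2) d'_def f'_def by simp_all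
  hence "d' t = z" "y = b +[obj Y (n + 1)] f' t" using m_l_zero[OF mF hom_closed[OF d' t(2)]] by simp_all
  thus ?thesis using t(2) b(1) by blast
 qed
 show ?thesis
  by (intro exI[of _ B'] exI[of _ d'] exI[of _ f'] conjI g(1) d' f' ballI impI 1[THEN conjunct1] 1[THEN conjunct2] 2)
qed

lemma free_resolution:
 fixes Y :: "('a, 'y) cpx" and good :: "'s set => bool"
 assumes Y: "CC Y" and good: "resolving good Y" and zh: "!!i. i < c ==> zero_homology Y i"
 shows "EX (T :: ('a, 's => 'a) cpx) f Bs. (ALL i. obj T i = FM (Bs i)) & (ALL i. good (Bs i)) & (ALL i<c. Bs i = {}) & QI T Y f"
proof -
 define ker where "ker B d = {z:carrier (FM B). d z = (%s. \<zero>)}" for B :: "'s set" and d :: "('s => 'a) => 's => 'a"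
 define P where "P n x \<longleftrightarrow> (case x of (B, d, f) => good B & submodule (ker B d) R (FM B) & f:Hom (FM B) (obj Y n))" for n x
 define Q where "Q n x x' \<longleftrightarrow> (case (x, x') of ((B, d, f), (B', d', f')) => d':Hom (FM B') (FM B) &
  (ALL t:carrier (FM B'). d (d' t) = (%s. \<zero>) & f (d' t) = dif Y (n + 1) (f' t)) &
  (ALL z:ker B d. ALL y:El Y (n + 1). f z = dif Y (n + 1) y -->
   (EX t:carrier (FM B'). EX b:boundaries Y (n + 1). d' t = z & y = b +[obj Y (n + 1)] f' t)))"
  for n and x x' :: "'s set \<times> (('s => 'a) => 's => 'a) \<times> (('s => 'a) => 'y)"
 define zst where "zst n = ({} :: 's set, %_ :: 's => 'a. %_ :: 's. \<zero>, %_ :: 's => 'a. 0[obj Y n])" for n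
 note mF = module_free_module
 have kd: "submodule (ker B d) R (FM B)" if "d:Hom (FM B) (FM B0)" for B d and B0 :: "'s set"
 proof -
  have "submodule {0[FM B0]} R (FM B0)" by (rule zero_submodule[OF mF])
  from vimage_submodule[OF that mF mF this] show ?thesis by (simp add: ker_def)
 qed
 have zd: "(%_. %_. \<zero>):Hom (FM B) (FM B')" for B B' :: "'s set"
  using hom_const_zero[OF mF] by simp
 \<comment> \<open>The empty basis is put in degree \<open>c - 1\<close>, one below the first
   possible homology, so that the first step with z = 0 generates the homology in degree
   \<open>c\<close>.\<close>
 have "EX g. g (c - 1) = zst (c - 1) & (ALL i>=c - 1. P i (g i) & Q i (g i) (g (i + 1)))"
 proof (rule int_choice_up)
  show "P (c - 1) (zst (c - 1))" unfolding P_def zst_def using good kd[OF zd] Y by (simp add: resolving_def)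
  fix n x assume x: "P n x"
  obtain B d f where e: "x = (B, d, f)" by (cases x)
  have p: "good B" "submodule (ker B d) R (FM B)" "f:Hom (FM B) (obj Y n)" using x unfolding P_def e by auto
  from resolution_step[OF Y good p] obtain B' d' f' where r: "good B'" "d':Hom (FM B') (FM B)"
   "f':Hom (FM B') (obj Y (n + 1))"
   "ALL t:carrier (FM B'). d' t:ker B d & f (d' t) = dif Y (n + 1) (f' t)"
   "ALL z:ker B d. ALL y:El Y (n + 1). f z = dif Y (n + 1) y -->
   (EX t:carrier (FM B'). EX b:boundaries Y (n + 1). d' t = z & y = b +[obj Y (n + 1)] f' t)" by blast
  have "P (n + 1) (B', d', f')" unfolding P_def using r(1,3) kd[OF r(2)] by simp
  moreover have "Q n x (B', d', f')" unfolding Q_def e prod.case using r(2,4,5) by (simp add: ker_def)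
  ultimately show "EX y. P (n + 1) y & Q n x y" by blast
 qed
 then obtain g where g: "g (c - 1) = zst (c - 1)" "!!i. c - 1 <= i ==> P i (g i) & Q i (g i) (g (i + 1))" by blast
 define Bs where "Bs i = (if c - 1 <= i then fst (g i) else {})" for i
 define d where "d i = (if c <= i then fst (snd (g i)) else (%_ _. \<zero>))" for i
 define f where "f i = (if c - 1 <= i then snd (snd (g i)) else (%_. 0[obj Y i]))" for i
 define T where "T = \<lparr>obj = (%i. FM (Bs i)), dif = d\<rparr>"
 have T_simps [simp]: "obj T i = FM (Bs i)" "dif T i = d i" for i by (simp_all add: T_def)
 have Bz: "Bs i = {}" if "i < c" for i using g(1) that by (cases "i = c - 1") (auto simp: Bs_def zst_def)
 have gi: "g i = (Bs i, d i, f i)" if "c - 1 <= i" for i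
 proof (cases "i = c - 1")
  case True thus ?thesis using g(1) by (simp add: Bs_def d_def f_def zst_def)
 next
  case False thus ?thesis using that by (simp add: Bs_def d_def f_def)
 qed
 have Pi: "good (Bs i) & f i:Hom (FM (Bs i)) (obj Y i)" for i
 proof (cases "c - 1 <= i")
  case True thus ?thesis using g(2)[OF True] unfolding gi[OF True] P_def by simp
 next
  case False thus ?thesis using good Y by (simp add: Bs_def f_def resolving_def)
 qed
 have Qi: "d (i + 1):Hom (FM (Bs (i + 1))) (FM (Bs i))"
   "!!t. t:carrier (FM (Bs (i + 1))) ==> d i (d (i + 1) t) = (%s. \<zero>) & f i (d (i + 1) t) = dif Y (i + 1) (f (i + 1) t)"
   "!!z y. z:ker (Bs i) (d i) ==> y:El Y (i + 1) ==> f i z = dif Y (i + 1) y ==>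
    (EX t:carrier (FM (Bs (i + 1))). EX b:boundaries Y (i + 1). d (i + 1) t = z & y = b +[obj Y (i + 1)] f (i + 1) t)"
  if i: "c - 1 <= i" for i
 proof -
  have "c - 1 <= i + 1" using i by simp
  from g(2)[OF i] show "d (i + 1):Hom (FM (Bs (i + 1))) (FM (Bs i))"
   "!!t. t:carrier (FM (Bs (i + 1))) ==> d i (d (i + 1) t) = (%s. \<zero>) & f i (d (i + 1) t) = dif Y (i + 1) (f (i + 1) t)"
   "!!z y. z:ker (Bs i) (d i) ==> y:El Y (i + 1) ==> f i z = dif Y (i + 1) y ==>
    (EX t:carrier (FM (Bs (i + 1))). EX b:boundaries Y (i + 1). d (i + 1) t = z & y = b +[obj Y (i + 1)] f (i + 1) t)"
   unfolding gi[OF i] gi[OF \<open>c - 1 <= i + 1\<close>] Q_def prod.case by blast+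
 qed
 have zero: "x = (%s. \<zero>)" if "i < c" "x:carrier (FM (Bs i))" for i x using that(2) unfolding Bz[OF that(1)] by auto
 have dh: "d i:Hom (FM (Bs i)) (FM (Bs (i - 1)))" for i
  using Qi(1)[of "i - 1"] zd by (cases "c <= i") (simp_all add: d_def)
 have T: "CC T"
 proof (rule chain_complexI)
  fix i x assume x: "x:El T i"
  show "dif T (i - 1) (dif T i x) = 0[obj T (i - 1 - 1)]"
  proof (cases "c <= i")
   case True thus ?thesis using Qi(2)[of "i - 1" x] x by simp
  qed (simp add: d_def)
 qed (use mF dh in simp_all)
 have cm: "CM T Y f"
 proof (rule chain_mapI[OF T Y])
  fix i x assume x: "x:El T i"
  show "dif Y i (f i x) = f (i - 1) (dif T i x)"
  proof (cases "c <= i")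
   case True thus ?thesis using Qi(2)[of "i - 1" x] x by simp
  next
   case False
   have x0: "x = 0[FM (Bs i)]" using False zero[of i x] x by simp
   have fz: "f j 0[FM (Bs j)] = 0[obj Y j]" for j using hom_zero[of "f j", OF _ mF cc_module[OF Y]] Pi by blast
   have "dif T i x = 0[FM (Bs (i - 1))]" unfolding x0 using hom_zero[OF dh mF mF] by simp
   thus ?thesis unfolding x0 fz using fz[of "i - 1"] Y by simp
  qed
 qed (use Pi in simp)
 have "QI T Y f" unfolding quasi_iso_iff[OF cm]
 proof (intro conjI allI impI)
  fix i x assume x: "x:carrier (cycles T i)" and b: "f i x:boundaries Y i"
  obtain y where y: "y:El Y (i + 1)" "f i x = dif Y (i + 1) y" using b unfolding bd_iff by blast
  have xc: "x:carrier (FM (Bs i))" "d i x = (%s. \<zero>)" using x by simp_all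
  show "x:boundaries T i"
  proof (cases "c - 1 <= i")
   case True
   have "x:ker (Bs i) (d i)" using xc unfolding ker_def by blast
   from Qi(3)[OF True this y] obtain t where "t:carrier (FM (Bs (i + 1)))" "d (i + 1) t = x" by blast
   thus ?thesis unfolding bd_iff T_simps by (intro bexI[of _ t]) simp_all
  next
   case False
   hence "x = 0[obj T i]" using zero[of i x] xc by simp
   thus ?thesis using submoduleD(2)[OF cc_module[OF T] submodule_boundaries_obj[OF T]] by simp
  qed
 next
  fix i y assume y: "y:carrier (cycles Y i)"
  show "EX x:carrier (cycles T i). EX n:boundaries Y i. y = n +[obj Y i] f i x"
  proof (cases "c <= i")
   case True
   have "0[FM (Bs (i - 1))]:ker (Bs (i - 1)) (d (i - 1))"
    using hom_zero[OF dh mF mF, of "i - 1"] m_zero[OF mF] unfolding ker_def by auto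
   moreover have "f (i - 1) 0[FM (Bs (i - 1))] = dif Y (i - 1 + 1) y" using cm_zero[OF cm, of "i - 1"] y by simp
   moreover have "c - 1 <= i - 1" "y:El Y (i - 1 + 1)" using True y by simp_all
   ultimately have "EX t:carrier (FM (Bs (i - 1 + 1))). EX b:boundaries Y (i - 1 + 1).
    d (i - 1 + 1) t = 0[FM (Bs (i - 1))] & y = b +[obj Y (i - 1 + 1)] f (i - 1 + 1) t" by (intro Qi(3))
   then obtain t b where t: "t:carrier (FM (Bs i))" "b:boundaries Y i" "d i t = 0[FM (Bs (i - 1))]" "y = b +[obj Y i] f i t"
    unfolding diff_add_cancel by blast
   have "t:carrier (cycles T i)" using t(1,3) by simp
   thus ?thesis using t(2,4) by blast
  next
   case False
   hence yb: "y:boundaries Y i" using zh[of i] y unfolding zero_homology_iff[OF Y] by simp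
   have "y = y +[obj Y i] f i 0[obj T i]" unfolding cm_zero[OF cm] using y Y by simp
   moreover have "0[obj T i]:carrier (cycles T i)" using submoduleD(2)[OF cc_module[OF T] submodule_cycles[OF T]] .
   ultimately show ?thesis using yb by blast
  qed
 qed
 thus ?thesis using Pi Bz by (intro exI[of _ T] exI[of _ f] exI[of _ Bs]) simp
qed

text \<open>Pairs are projected to their first entry. The image lies in a module with finite basis,
  and the kernel consists of pairs (0, y) with y a cycle of \<open>Y\<close>, so that
  \<open>fg_extension\<close> applies.\<close>

lemma resolving_finite:
 fixes Y :: "('a, 'y) cpx"
 assumes noeth: "noetherian_ring R" and Y: "CC Y" and fg: "!!i. fg_homology Y i"
 shows "resolving (finite :: nat set => bool) Y"
 unfolding resolving_def
proof (intro conjI allI impI)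
 fix n B Z f
 assume B: "finite (B :: nat set)" and Z: "submodule Z R (FM B)" and f: "f:Hom (FM B) (obj Y n)"
 let ?F = "FM B" let ?S = "dsum ?F (obj Y (n + 1))" let ?W = "lift_rel ?F Y n Z f"
 note mF = module_free_module
 have mS: "Md ?S" using Y mF by simp
 note sW = lift_rel_submodule[OF Y Z f] and sB = bd_part_submodule[OF Y, of n B]
 have Bc: "gen1 ` B <= carrier ?F" by (intro image_subsetI free_gen_carrier)
 have all: "x:Span ?F (gen1 ` B)" if "x:carrier ?F" for x using that
 proof (induction x rule: free_induct)
  case zero
  thus ?case using submoduleD(2)[OF mF span_submodule[OF mF Bc]] by simp
 next
  case (step r b x)
  have g: "gen1 b:Span ?F (gen1 ` B)" by (rule subsetD[OF span_incl imageI[OF step(2)]])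
  show ?case by (rule submoduleD(3)[OF mF span_submodule[OF mF Bc] submoduleD(4)[OF mF span_submodule[OF mF Bc] step(1) g] step(4)])
 qed
 obtain S2 where S2: "finite S2" "S2 <= carrier (cycles Y (n + 1))" "carrier (cycles Y (n + 1)) <= Span (obj Y (n + 1)) (S2 \<union> boundaries Y (n + 1))"
  using fg[of "n + 1"] unfolding fg_homology_def by blast
 have z: "submodule {0[?F]} R ?F" by (rule zero_submodule[OF mF])
 have inr: "Pair (%s::nat. \<zero>):Hom (obj Y (n + 1)) ?S" using hom_inr[OF mF cc_module[OF Y]] by simp
 have S2W: "Pair (%s::nat. \<zero>) ` S2 <= ?W"
 proof
  fix p assume "p:Pair (%s::nat. \<zero>) ` S2"
  then obtain s where s: "s:S2" "p = (%s::nat. \<zero>, s)" by blast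
  have "s:El Y (n + 1)" "dif Y (n + 1) s = 0[obj Y n]" using subsetD[OF S2(2) s(1)] by simp_all
  moreover have "f (%s::nat. \<zero>) = 0[obj Y n]" "(%s::nat. \<zero>):Z" "(%s::nat. \<zero>):carrier ?F"
   using hom_zero[OF f mF cc_module[OF Y]] submoduleD(2)[OF mF Z] m_zero[OF mF, of B] by simp_all
  ultimately show "p:?W" unfolding s lift_rel_def dsum_simps by simp
 qed
 have "EX S3. finite S3 & S3 <= ?W & ?W <= Span ?S (S3 \<union> bd_part Y n)"
 proof (rule fg_extension[OF noeth mS mF hom_fst sW z _ Bc _ _ S2W])
  show "finite (gen1 ` B)" "finite (Pair (%s::nat. \<zero>) ` S2)" using B S2(1) by simp_all
  show "bd_part Y n <= carrier ?S" by (rule submoduleD(1)[OF mS sB])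
  fix w assume w: "w:?W"
  have "fst w:carrier ?F" using subsetD[OF submoduleD(1)[OF mS sW] w] unfolding dsum_simps mem_Times_iff by (rule conjunct1)
  thus "fst w:Span ?F (gen1 ` B \<union> {0[?F]})" by (intro subsetD[OF span_mono[OF Un_upper1]] all)
  assume "fst w:{0[?F]}"
  hence w0: "fst w = 0[?F]" by simp
  have sw: "snd w:El Y (n + 1)" "dif Y (n + 1) (snd w) = f (fst w)" using w unfolding lift_rel_def dsum_simps mem_Collect_eq mem_Times_iff by simp_all
  hence "snd w:carrier (cycles Y (n + 1))" unfolding w0 hom_zero[OF f mF cc_module[OF Y]] by simp
  hence sp: "snd w:Span (obj Y (n + 1)) (S2 \<union> boundaries Y (n + 1))" using S2(3) by blast
  have T: "Pair (%s::nat. \<zero>) ` S2 \<union> bd_part Y n <= carrier ?S" using S2W submoduleD(1)[OF mS sW] submoduleD(1)[OF mS sB] by blast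
  have S2c: "S2 \<union> boundaries Y (n + 1) <= El Y (n + 1)" using S2(2) bd_closed[OF Y] by auto
  have "(%s::nat. \<zero>, s):Span ?S (Pair (%s::nat. \<zero>) ` S2 \<union> bd_part Y n)" if "s:S2 \<union> boundaries Y (n + 1)" for s
   by (rule subsetD[OF span_incl]) (use that in \<open>auto simp: bd_part_def\<close>)
  from span_hom[OF inr cc_module[OF Y] mS T S2c this sp]
  show "w:Span ?S (Pair (%s::nat. \<zero>) ` S2 \<union> bd_part Y n)" using w0 by (cases w) simp
 qed
 then obtain S3 where S3: "finite S3" "S3 <= ?W" "?W <= Span ?S (S3 \<union> bd_part Y n)" by blast
 obtain h where h: "bij_betw h {0..<card S3} S3" using ex_bij_betw_nat_finite[OF S3(1)] by blast
 have hi: "h ` {0..<card S3} = S3" using h by (simp add: bij_betw_def)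
 have hW: "h b:?W" if "b:{0..<card S3}" for b using subsetD[OF S3(2)] imageI[OF that, of h] unfolding hi by blast
 have hsp: "?W <= Span ?S (h ` {0..<card S3} \<union> bd_part Y n)" unfolding hi by (rule S3(3))
 show "EX (B' :: nat set) g. finite B' & (ALL b:B'. g b:?W) & ?W <= Span ?S (g ` B' \<union> bd_part Y n)"
 proof (rule exI[of _ "{0..<card S3}"], rule exI[of _ h], intro conjI ballI)
 qed (simp, rule hW, assumption, rule hsp)
qed simp

text \<open>An element is coded by a list of its support with coefficients; only the set of these
  pairs has to be recovered from the code.\<close>

lemma free_module_encoding:
 assumes v: "(a :: 'v) ~= b"
 shows "EX e :: (('a, 'v) univ => 'a) => ('a, 'v) univ. inj_on e (carrier (FM B))"
proof -
 obtain enc :: "('a, 'v) univ list => ('a, 'v) univ" where enc: "inj enc" using list_encoding[OF v] by (elim exE) (rule that)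
 define xs where "xs ph = (SOME l. set l = {s. ph s ~= \<zero>})" for ph :: "('a, 'v) univ => 'a"
 define e where "e ph = enc (map (%s. pair_enc s (el_enc (ph s))) (xs ph))" for ph
 have "inj_on e (carrier (FM B))"
 proof (rule inj_onI)
  fix ph ps assume p: "ph:carrier (FM B)" "ps:carrier (FM B)" and "e ph = e ps"
  have "set (xs ph) = {s. ph s ~= \<zero>}" if "ph:carrier (FM B)" for ph
   unfolding xs_def by (rule someI_ex, rule finite_list) (use that in simp)
  note sx = this[OF p(1)] this[OF p(2)]
  have eq: "map (%s. pair_enc s (el_enc (ph s) :: ('a, 'v) univ)) (xs ph) = map (%s. pair_enc s (el_enc (ps s))) (xs ps)"
   by (rule injD[OF enc]) (use \<open>e ph = e ps\<close> in \<open>simp add: e_def\<close>)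
  from arg_cong[OF this, of set]
  have S: "(%s. pair_enc s (el_enc (ph s) :: ('a, 'v) univ)) ` {s. ph s ~= \<zero>} = (%s. pair_enc s (el_enc (ps s))) ` {s. ps s ~= \<zero>}" by (simp add: sx)
  have one: "ph s = ps s" if S: "(%s. pair_enc s (el_enc (ph s) :: ('a, 'v) univ)) ` {s. ph s ~= \<zero>} = (%s. pair_enc s (el_enc (ps s))) ` {s. ps s ~= \<zero>}"
   and s: "ph s ~= \<zero>" for ph ps :: "('a, 'v) univ => 'a" and s
  proof -
   have "pair_enc s (el_enc (ph s) :: ('a, 'v) univ):(%s. pair_enc s (el_enc (ps s))) ` {s. ps s ~= \<zero>}" unfolding S[symmetric] using s by (intro imageI) simp
   thus ?thesis
   proof (rule imageE)
    fix t assume "pair_enc s (el_enc (ph s) :: ('a, 'v) univ) = pair_enc t (el_enc (ps t))"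
    thus ?thesis using injD[OF inj_el_enc[OF v], of "ph s" "ps t"] unfolding pair_enc_eq by blast
   qed
  qed
  show "ph = ps"
  proof (rule ext)
   fix s show "ph s = ps s"
   proof (rule ccontr)
    assume "ph s ~= ps s"
    hence "ph s ~= \<zero> \<or> ps s ~= \<zero>" by metis
    thus False
    proof
     assume "ph s ~= \<zero>" from one[OF S this] \<open>ph s ~= ps s\<close> show False by (rule notE[rotated])
    next
     assume "ps s ~= \<zero>" from one[OF S[symmetric] this] \<open>ph s ~= ps s\<close> show False by (elim notE) (rule sym)
    qed
   qed
  qed
 qed
 thus ?thesis by (intro exI[of _ e])
qed

text \<open>Every pair becomes a basis element: \<open>lift_rel\<close> as a whole embeds in the
  universe, because the free module and the terms of \<open>Y\<close> do.\<close>

lemma resolving_any: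
 fixes Y :: "('a, 'y) cpx"
 assumes v: "(a :: 'v) ~= b" and Y: "CC Y" and sm: "small TYPE('v) Y"
 shows "resolving (%B :: ('a, 'v) univ set. True) Y"
 unfolding resolving_def
proof (rule conjI, rule TrueI, intro allI impI)
 fix n B Z f
 let ?F = "FM (B :: ('a, 'v) univ set)" let ?S = "dsum ?F (obj Y (n + 1))" let ?W = "lift_rel ?F Y n Z f"
 obtain e1 :: "(('a, 'v) univ => 'a) => ('a, 'v) univ" where e1: "inj_on e1 (carrier ?F)" using free_module_encoding[OF v, of B] by (elim exE) (rule that)
 obtain e2 :: "'y => ('a, 'v) univ" where e2: "inj_on e2 (El Y (n + 1))"
  using sm[unfolded small_def, THEN spec, of "n + 1"] by (elim exE) (rule that)
 define e where "e p = pair_enc (e1 (fst p)) (e2 (snd p))" for p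
 have e: "inj_on e ?W"
 proof (rule inj_onI)
  fix p q assume p: "p:?W" and q: "q:?W" and "e p = e q"
  hence pq: "e1 (fst p) = e1 (fst q)" "e2 (snd p) = e2 (snd q)" unfolding e_def pair_enc_eq by blast+
  have W: "fst p:carrier ?F & snd p:El Y (n + 1)" if "p:?W" for p
   using that unfolding lift_rel_def dsum_simps mem_Collect_eq mem_Times_iff by (rule conjunct1)
  show "p = q"
   by (rule prod_eqI) (rule inj_onD[OF e1 pq(1) W[OF p, THEN conjunct1] W[OF q, THEN conjunct1]],
    rule inj_onD[OF e2 pq(2) W[OF p, THEN conjunct2] W[OF q, THEN conjunct2]])
 qed
 have i: "inv_into ?W e ` (e ` ?W) = ?W" by (rule inv_into_image_cancel[OF e subset_refl])
 have "ALL b:e ` ?W. inv_into ?W e b:?W" by (intro ballI inv_into_into)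
 moreover have "?W <= Span ?S (inv_into ?W e ` (e ` ?W) \<union> bd_part Y n)" unfolding i by (rule subset_trans[OF Un_upper1 span_incl])
 ultimately show "EX (B' :: ('a, 'v) univ set) g. True & (ALL b:B'. g b:?W) & ?W <= Span ?S (g ` B' \<union> bd_part Y n)"
  by (intro exI[of _ "e ` ?W"] exI[of _ "inv_into ?W e"] conjI TrueI)
qed

text \<open>An element of Hom(L, K) is determined by its values on countably many generators, hence
  by a sequence in the universe.\<close>

lemma small_hom_free:
 fixes L :: "('a, nat => 'a) cpx" and K :: "('a, 'v) ucpx"
 assumes L: "!!i. obj L i = FM (B i)" and K: "CC K"
 shows "small TYPE('v) (HC L K)"
 unfolding small_def
proof
 fix n
 define e where "e ph = seq_enc (%m. case from_nat m :: int \<times> nat of (i, b) => ph i (gen1 b))" for ph :: "int => (nat => 'a) => ('a, 'v) univ"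
 have "inj_on e (El (HC L K) n)"
 proof (rule inj_onI)
  fix ph ps assume p: "ph:El (HC L K) n" and q: "ps:El (HC L K) n" and "e ph = e ps"
  hence eq: "(%m. case from_nat m :: int \<times> nat of (i, b) => ph i (gen1 b)) = (%m. case from_nat m :: int \<times> nat of (i, b) => ps i (gen1 b))"
   by (simp add: e_def)
  have g: "ph i (gen1 b) = ps i (gen1 b)" for i b using fun_cong[OF eq, of "to_nat (i, b)"] by simp
  show "ph = ps"
  proof (rule hom_cpx_ext[OF p q])
   fix i x assume "x:El L i"
   thus "ph i x = ps i x" unfolding L
    by (rule free_hom_ext[OF hom_cpx_hom[OF p, of i, unfolded L] hom_cpx_hom[OF q, of i, unfolded L] cc_module[OF K] g])
  qed
 qed
 thus "EX e :: (int => (nat => 'a) => ('a, 'v) univ) => ('a, 'v) univ. inj_on e (El (HC L K) n)" by blast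
qed

end

section \<open>Hom complexes with degreewise finite free source\<close>

locale finite_free_source = cring R for R :: "('a, 'm) ring_scheme" (structure) +
 fixes L :: "('a, nat => 'a) cpx" and K :: "('a, 'k) cpx" and B :: "int => nat set"
 assumes L: "CC L" and K: "CC K"
  and Lf: "obj L i = FM (B i)" and fin: "finite (B i)"
begin

abbreviation "M \<equiv> HC L K"

lemma M: "CC M" by (rule chain_complex_hom[OF L K])

lemma gen [simp]: "b:B p ==> gen1 b:El L p"
 unfolding Lf by (rule free_gen_carrier)

lemma coef [simp]: "x:El L p ==> x b:carrier R"
 unfolding Lf by simp

text \<open>The element of Hom(L, K) of degree \<open>i\<close> with value \<open>k\<close> on the
  generator \<open>b\<close> of L_p and zero on the other generators. These copies of
  \<open>K\<close> are the coordinates on which linear maps out of Hom(L, K) are tested.\<close>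

definition iota :: "int => nat => int => 'k => int => (nat => 'a) => 'k" where
 "iota p b i k = (%j. \<lambda>x\<in>El L j. if j = p then x b *[obj K (j + i)] k else 0[obj K (j + i)])"

lemma iota_closed: assumes k: "k:El K (p + i)" shows "iota p b i k:El M i"
 unfolding hom_cpx_obj
proof (intro allI conjI)
 fix j
 show "iota p b i k j:Hom (obj L j) (obj K (j + i))"
 proof (rule mod_homI)
  fix x y assume x: "x:El L j" and y: "y:El L j"
  show "iota p b i k j x:El K (j + i)" using k coef[OF x] x K by (simp add: iota_def)
  have "x +[obj L j] y:El L j" using x y L by simp
  moreover have "(x +[obj L j] y) b = x b \<oplus> y b" unfolding Lf by simp
  ultimately show "iota p b i k j (x +[obj L j] y) = iota p b i k j x +[obj K (j + i)] iota p b i k j y"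
   using k x y K coef[OF x] coef[OF y] by (cases "j = p"; simp add: iota_def m_add_smult; hypsubst?; simp add: m_add_smult)
 next
  fix r x assume r: "r:carrier R" and x: "x:El L j"
  have "r *[obj L j] x:El L j" using x r L by simp
  moreover have "(r *[obj L j] x) b = r \<otimes> x b" unfolding Lf by simp
  ultimately show "iota p b i k j (r *[obj L j] x) = r *[obj K (j + i)] iota p b i k j x"
   using k x r K coef[OF x] by (cases "j = p"; simp add: iota_def m_mult_smult; hypsubst?; simp add: m_mult_smult)
 qed
 show "iota p b i k j:extensional (El L j)" by (simp add: iota_def)
qed

lemma iota_hom: "iota p b i:Hom (obj K (p + i)) (obj M i)"
 by (rule mod_homI, erule iota_closed)
  (auto simp: iota_def hom_cpx_ops fun_eq_iff m_smult_add[OF cc_module[OF K]] m_mult_smult[OF cc_module[OF K], symmetric] m_comm K)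

lemma iota_gen:
 assumes k: "k:El K (p + i)" and c: "c:B j"
 shows "iota p b i k j (gen1 c) = (if j = p & c = b then k else 0[obj K (j + i)])"
 using gen[OF c] k K by (simp add: iota_def free_gen_def)

lemma M_eq_on_gens:
 assumes f: "f:El M i" and g: "g:El M i"
  and e: "!!p b. b:B p ==> f p (gen1 b) = g p (gen1 b)"
 shows "f = g"
proof (rule hom_cpx_ext[OF f g])
 fix p x assume x: "x:El L p"
 show "f p x = g p x"
  by (rule free_hom_ext[OF hom_cpx_hom[OF f, of p, unfolded Lf] hom_cpx_hom[OF g, of p, unfolded Lf] cc_module[OF K] e x[unfolded Lf]])
qed

lemma eval_hom: assumes x: "x:El L p" shows "(%f. f p x):Hom (obj M i) (obj K (p + i))"
 by (rule mod_homI) (use x in \<open>simp_all add: hom_cpx_ops hom_cpx_closed\<close>)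

end

section \<open>Biduality\<close>

text \<open>The homothety assumptions spell out, for chain maps, that R -> Hom(K, K) is a
  quasi-isomorphism: vanishing in nonzero degrees, then surjectivity and injectivity in degree
  0.\<close>

locale biduality = finite_free_source R L K B
 for R :: "('a, 'm) ring_scheme" (structure) and L :: "('a, nat => 'a) cpx" and K :: "('a, 'k) cpx" and B :: "int => nat set" +
 fixes \<kappa> :: int
 assumes bnd: "\<kappa> < \<bar>i\<bar> ==> El K i = {0[obj K i]}"
  and homothety_zero: "n ~= 0 ==> CM K (shift K n) \<theta> ==> null K (shift K n) \<theta>"
  and homothety_surj: "CM K K \<theta> ==> EX r:carrier R. htp K K \<theta> (%i x. r *[obj K i] x)"
  and homothety_inj: "r:carrier R ==> null K K (%i x. r *[obj K i] x) ==> r = \<zero>"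
begin

text \<open>\<open>f\<close> is a finite sum of elements \<open>iota\<close>, one for each generator
  on which it is nonzero; such a generator can be split off until nothing is left.\<close>

lemma hom_vanish:
 assumes h: "h:Hom (obj M i) Y" and Y: "Md Y" and f: "f:El M i"
  and v: "!!p b. b:B p ==> f p (gen1 b) ~= 0[obj K (p + i)] ==> (!!k. k:El K (p + i) ==> h (iota p b i k) = 0[Y])"
 shows "h f = 0[Y]"
proof -
 have mM: "Md (obj M i)" by (rule cc_module[OF M])
 have "finite S ==> f:El M i ==>
   (!!p b. b:B p ==> f p (gen1 b) ~= 0[obj K (p + i)] ==> (p, b):S & (ALL k:El K (p + i). h (iota p b i k) = 0[Y])) ==> h f = 0[Y]" for S f
 proof (induction S arbitrary: f rule: finite_induct)
  case empty
  have "f = 0[obj M i]"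
   by (rule M_eq_on_gens[OF empty(1) m_zero[OF mM]]) (use empty(2) in \<open>auto simp: hom_cpx_ops\<close>)
  thus ?case using hom_zero[OF h mM Y] by simp
 next
  case (insert pb S)
  obtain p b where pb: "pb = (p, b)" by (cases pb)
  show ?case
  proof (cases "b:B p & f p (gen1 b) ~= 0[obj K (p + i)]")
   case False
   show ?thesis
   proof (rule insert.IH[OF insert.prems(1)])
    fix q c assume c: "c:B q" "f q (gen1 c) ~= 0[obj K (q + i)]"
    have "(q, c) ~= pb" using c False unfolding pb by auto
    thus "(q, c):S & (ALL k:El K (q + i). h (iota q c i k) = 0[Y])" using insert.prems(2)[OF c] by auto
   qed
  next
   case True
   let ?k = "f p (gen1 b)" let ?f = "f -[obj M i] iota p b i ?k"
   have k: "?k:El K (p + i)" using hom_cpx_closed[OF insert.prems(1)] True by simp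
   note ic = iota_closed[OF k, of b]
   have fc: "?f:El M i" by (rule m_minus[OF mM insert.prems(1) ic])
   have "h ?f = 0[Y]"
   proof (rule insert.IH[OF fc])
    fix q c assume c: "c:B q" "?f q (gen1 c) ~= 0[obj K (q + i)]"
    have e: "?f q (gen1 c) = f q (gen1 c) -[obj K (q + i)] iota p b i ?k q (gen1 c)"
     by (rule hom_cpx_minus[OF L K ic gen[OF c(1)]])
    have n: "~ (q = p & c = b)"
     using c(2) iota_gen[OF k c(1)] m_minus_cancel[OF cc_module[OF K] k] unfolding e by auto
    hence "?f q (gen1 c) = f q (gen1 c)"
     unfolding e iota_gen[OF k c(1)] using K hom_cpx_closed[OF insert.prems(1) gen[OF c(1)]] by (auto simp: m_minus_eq)
    thus "(q, c):S & (ALL k:El K (q + i). h (iota q c i k) = 0[Y])"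
     using insert.prems(2)[OF c(1)] c(2) n pb by auto
   qed
   moreover have "h (iota p b i ?k) = 0[Y]" using insert.prems(2)[of b p] True k by blast
   ultimately show ?thesis using hom_minus[OF h mM Y insert.prems(1) ic] m_minus_zero_iff[OF Y hom_closed[OF h insert.prems(1)] hom_closed[OF h ic]] by simp
  qed
 qed
 note ind = this
 show ?thesis
 proof (rule ind[OF _ f])
  \<comment> \<open>A nonzero value needs |p + i| \<le> \<kappa>, which leaves finitely many degrees
    \<open>p\<close>, each with a finite basis.\<close>
  show "finite (Sigma {- \<kappa> - i..\<kappa> - i} B)" using fin by (intro finite_SigmaI) simp_all
  fix p b assume b: "b:B p" and ne: "f p (gen1 b) ~= 0[obj K (p + i)]"
  have "~ \<kappa> < \<bar>p + i\<bar>" using bnd[of "p + i"] ne hom_cpx_closed[OF f gen[OF b]] by auto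
  hence "(p, b):Sigma {- \<kappa> - i..\<kappa> - i} B" using b by auto
  thus "(p, b):Sigma {- \<kappa> - i..\<kappa> - i} B & (ALL k:El K (p + i). h (iota p b i k) = 0[Y])" using v[OF b ne] by blast
 qed
qed

definition fam :: "int => (int => (int => (nat => 'a) => 'k) => 'k) => bool" where
 "fam m ph \<longleftrightarrow> (ALL i. ph i:Hom (obj M i) (obj K (i + m)))"

definition van :: "(int => (int => (nat => 'a) => 'k) => 'k) => int => int => nat => bool" where
 "van ph m p b \<longleftrightarrow> (ALL i k. k:El K (p + i) --> ph i (iota p b i k) = 0[obj K (i + m)])"

definition above :: "(int => (int => (nat => 'a) => 'k) => 'k) => int => int => bool" where
 "above ph m q \<longleftrightarrow> (ALL p b. q < p --> b:B p --> van ph m p b)"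

text \<open>Families need not be chain maps: the same descent serves cycles of the double dual, with
  zero defect, and null homotopies of an evaluation, whose defect after an alternating sign is again
  a signed evaluation.\<close>

definition defect :: "(int => (int => (nat => 'a) => 'k) => 'k) => int => int => (int => (nat => 'a) => 'k) => 'k" where
 "defect ph m i f = dif K (i + m) (ph i f) -[obj K (i + m - 1)] ph (i - 1) (dif M i f)"

lemma famD: "fam m ph ==> ph i:Hom (obj M i) (obj K (i + m))" by (simp add: fam_def)
lemma famD': "fam m ph ==> ph (i - 1):Hom (obj M (i - 1)) (obj K (i + m - 1))"
 using famD[of m ph "i - 1"] by (simp add: int_index)
lemma fam_closed: "fam m ph ==> f:El M i ==> ph i f:El K (i + m)" by (rule hom_closed[OF famD])
lemma fam_closed': "fam m ph ==> f:El M i ==> ph (i - 1) (dif M i f):El K (i + m - 1)"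
 by (rule hom_closed[OF famD' d_closed[OF M]])

text \<open>The two arguments differ by a composite with the differential of \<open>L\<close>, which
  is supported on generators of degree above \<open>p\<close>, where \<open>ph\<close>
  vanishes.\<close>

lemma dif_iota:
 assumes k: "k:El K (p + i)" and b: "b:B p" and ph: "fam m ph" and a: "above ph m p"
 shows "ph (i - 1) (dif M i (iota p b i k)) = ph (i - 1) (iota p b (i - 1) (dif K (p + i) k))"
proof -
 note ic = iota_closed[OF k, of b]
 have dk: "dif K (p + i) k:El K (p + (i - 1))" using d_closed[OF K k] by (simp add: int_index)
 note ic' = iota_closed[OF dk, of b] and dc = d_closed[OF M ic]
 let ?r = "dif M i (iota p b i k) -[obj M (i - 1)] iota p b (i - 1) (dif K (p + i) k)"
 have mM: "Md (obj M (i - 1))" by (rule cc_module[OF M])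
 have rc: "?r:El M (i - 1)" by (rule m_minus[OF mM dc ic'])
 have "ph (i - 1) ?r = 0[obj K (i - 1 + m)]"
 proof (rule hom_vanish[OF famD[OF ph] cc_module[OF K] rc])
  fix q c k' assume c: "c:B q" and ne: "?r q (gen1 c) ~= 0[obj K (q + (i - 1))]" and k': "k':El K (q + (i - 1))"
  have "p < q"
  proof (rule ccontr)
   assume "~ p < q"
   have dg: "dif L q (gen1 c):El L (q - 1)" by (rule d_closed[OF L gen[OF c]])
   have "iota p b i k (q - 1) (dif L q (gen1 c)) = 0[obj K (q + i - 1)]"
    using dg \<open>~ p < q\<close> by (simp add: iota_def int_index)
   hence "dif M i (iota p b i k) q (gen1 c) = dif K (q + i) (iota p b i k q (gen1 c)) +[obj K (q + i - 1)] 0[obj K (q + i - 1)]"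
    using gen[OF c] K by (simp add: hom_cpx_dif)
   also have "... = iota p b (i - 1) (dif K (p + i) k) q (gen1 c)"
    unfolding iota_gen[OF k c] iota_gen[OF dk c] using K k by (simp add: int_index)
   finally have "?r q (gen1 c) = 0[obj K (q + (i - 1))]"
    using hom_cpx_minus[OF L K ic' gen[OF c], of "dif M i (iota p b i k)"] m_minus_cancel[OF cc_module[OF K] hom_cpx_closed[OF ic' gen[OF c]]] by simp
   thus False using ne by simp
  qed
  thus "ph (i - 1) (iota q c (i - 1) k') = 0[obj K (i - 1 + m)]" using a c k' unfolding above_def van_def by blast
 qed
 thus ?thesis
  using hom_minus[OF famD[OF ph] mM cc_module[OF K] dc ic'] m_minus_zero_iff[OF cc_module[OF K] fam_closed[OF ph dc] fam_closed[OF ph ic']] by simp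
qed

text \<open>Equality up to a homotopy and evaluation at \<open>x\<close>; along the descent,
  \<open>x\<close> accumulates the preimage under biduality.\<close>

definition rel :: "int => (int => (int => (nat => 'a) => 'k) => 'k) => (int => (int => (nat => 'a) => 'k) => 'k) => (nat => 'a) => bool" where
 "rel m ph ph' x \<longleftrightarrow> (EX s. homotopy M (shift K m) s & (ALL i. ALL f:El M i. ph i f = ph' i f +[obj K (i + m)] (hbd M (shift K m) s i f +[obj K (i + m)] f m x)))"

lemma ev_closed: "f:El M i ==> x:El L m ==> f m x:El K (i + m)"
 using hom_cpx_closed[of f L K i x m] by (simp add: add.commute)

lemma hbd_M_closed: "homotopy M (shift K m) s ==> f:El M i ==> hbd M (shift K m) s i f:El K (i + m)"
 using hbd_closed[OF _ M chain_complex_shift[OF K], of m s f i] by simp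

lemma m_four: "Md N ==> p:carrier N ==> t:carrier N ==> y:carrier N ==> s:carrier N ==> x:carrier N ==>
 p +[N] (t +[N] y) +[N] (s +[N] x) = p +[N] (s +[N] t +[N] (x +[N] y))"
 by algebra

lemma m_neg_eq_add:
 assumes N: "Md N" and c: "D:carrier N" "y:carrier N" "x:carrier N" and e: "~[N] x = D +[N] y"
 shows "D = ~[N] (x +[N] y)"
proof -
 have "D = D +[N] y +[N] ~[N] y" using N c by algebra
 also have "... = ~[N] (x +[N] y)" unfolding e[symmetric] using N c by algebra
 finally show ?thesis .
qed

lemma rel_trans:
 assumes 1: "rel m ph ph' x" and 2: "rel m ph' ph'' y" and x: "x:El L m" and y: "y:El L m" and ph'': "fam m ph''"
 shows "rel m ph ph'' (x +[obj L m] y)"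
proof -
 obtain s where s: "homotopy M (shift K m) s" "!!i f. f:El M i ==> ph i f = ph' i f +[obj K (i + m)] (hbd M (shift K m) s i f +[obj K (i + m)] f m x)"
  using 1 unfolding rel_def by (elim exE conjE) (rule that, assumption, blast)
 obtain t where t: "homotopy M (shift K m) t" "!!i f. f:El M i ==> ph' i f = ph'' i f +[obj K (i + m)] (hbd M (shift K m) t i f +[obj K (i + m)] f m y)"
  using 2 unfolding rel_def by (elim exE conjE) (rule that, assumption, blast)
 note sK = chain_complex_shift[OF K, of m]
 show ?thesis unfolding rel_def
 proof (rule exI, intro conjI allI ballI)
  show "homotopy M (shift K m) (%i f. s i f +[obj (shift K m) (i + 1)] t i f)" by (rule homotopy_plus[OF s(1) t(1) sK])
  fix i f assume f: "f:El M i"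
  have "f m (x +[obj L m] y) = f m x +[obj K (i + m)] f m y" using hom_add[OF hom_cpx_hom[OF f] x y] by (simp add: add.commute)
  note e = this hbd_plus[OF s(1) t(1) M sK f, unfolded shift_simps]
  show "ph i f = ph'' i f +[obj K (i + m)] (hbd M (shift K m) (%i f. s i f +[obj (shift K m) (i + 1)] t i f) i f +[obj K (i + m)] f m (x +[obj L m] y))"
   unfolding s(2)[OF f] t(2)[OF f] shift_simps e
   by (rule m_four[OF cc_module[OF K, of "i + m"] fam_closed[OF ph'' f] hbd_M_closed[OF t(1) f] ev_closed[OF f y] hbd_M_closed[OF s(1) f] ev_closed[OF f x]])
 qed
qed

lemma rel_refl: assumes ph: "fam m ph" shows "rel m ph ph 0[obj L m]"
 unfolding rel_def
proof (intro exI conjI allI ballI)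
 show "homotopy M (shift K m) (%i f. 0[obj (shift K m) (i + 1)])" by (rule homotopy_zero_map[OF chain_complex_shift[OF K]])
 fix i f assume f: "f:El M i"
 have "f m 0[obj L m] = 0[obj K (i + m)]" using hom_zero[OF hom_cpx_hom[OF f, of m] cc_module[OF L] cc_module[OF K]] by (simp add: add.commute)
 thus "ph i f = ph i f +[obj K (i + m)] (hbd M (shift K m) (%i f. 0[obj (shift K m) (i + 1)]) i f +[obj K (i + m)] f m 0[obj L m])"
  unfolding hbd_zero_map[OF chain_complex_shift[OF K]] using fam_closed[OF ph f] K by simp
qed

lemma fam_ev: assumes x: "x:El L m" shows "fam m (%i f. f m x)"
 unfolding fam_def using eval_hom[OF x] by (simp add: add.commute)

text \<open>From (d f)(x) = d (f x) - (-1)^i f (d x) for \<open>f\<close> of degree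
  \<open>i\<close>.\<close>

lemma defect_ev:
 assumes x: "x:El L m" and f: "f:El M i"
 shows "defect (%i f. f m x) m i f = sg (obj K (i + m - 1)) (even i) (f (m - 1) (dif L m x))"
proof -
 let ?N = "obj K (i + m - 1)"
 have n: "Md ?N" using K by simp
 have c: "f m x:El K (i + m)" "f (m - 1) (dif L m x):carrier ?N"
  using ev_closed[OF f x] hom_closed[OF hom_cpx_prev[OF f] d_closed[OF L x]] by (simp_all add: add.commute)
 have e: "dif M i f m x = dif K (i + m) (f m x) +[?N] sg ?N (odd i) (f (m - 1) (dif L m x))"
  using x by (simp add: hom_cpx_dif add.commute)
 show ?thesis unfolding defect_def e sg_def using c n d_closed[OF K c(1)] by (cases "even i"; simp; (algebra)?)
qed

text \<open>The homotopy term \<open>d s + s d\<close> is a chain map and contributes no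
  defect.\<close>

lemma rel_defect:
 assumes r: "rel m ph ph' x" and ph': "fam m ph'" and x: "x:El L m" and f: "f:El M i"
 shows "defect ph m i f = defect ph' m i f +[obj K (i + m - 1)] defect (%i f. f m x) m i f"
proof -
 obtain s where s: "homotopy M (shift K m) s" "!!i f. f:El M i ==> ph i f = ph' i f +[obj K (i + m)] (hbd M (shift K m) s i f +[obj K (i + m)] f m x)"
  using r unfolding rel_def by (elim exE conjE) (rule that, assumption, blast)
 note sK = chain_complex_shift[OF K, of m]
 let ?N = "obj K (i + m - 1)"
 have zc: "CM M (shift K m) (%i f. 0[obj (shift K m) i])"
  by (rule chain_mapI[OF M sK]) (use K in \<open>simp_all add: int_index\<close>)
 have "htp M (shift K m) (hbd M (shift K m) s) (%i f. 0[obj (shift K m) i])"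
  by (rule htpI[OF s(1)]) (use hbd_M_closed[OF s(1)] K in simp)
 note hc = cm_d[OF chain_map_htp[OF this zc] f, unfolded shift_simps]
 note df = d_closed[OF M f]
 have c: "ph' i f:El K (i + m)" "hbd M (shift K m) s i f:El K (i + m)" "f m x:El K (i + m)"
  "ph' (i - 1) (dif M i f):carrier ?N" "hbd M (shift K m) s (i - 1) (dif M i f):carrier ?N" "dif M i f m x:carrier ?N"
  using fam_closed[OF ph' f] hbd_M_closed[OF s(1) f] ev_closed[OF f x] fam_closed'[OF ph' f] hbd_M_closed[OF s(1) df] ev_closed[OF df x]
  by (simp_all add: int_index)
 have n: "Md ?N" "Md (obj K (i + m))" using K by simp_all
 have s': "ph (i - 1) (dif M i f) = ph' (i - 1) (dif M i f) +[?N] (hbd M (shift K m) s (i - 1) (dif M i f) +[?N] dif M i f m x)"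
  using s(2)[OF df] by (simp add: int_index)
 have e: "dif K (i + m) (ph i f) = dif K (i + m) (ph' i f) +[?N] (hbd M (shift K m) s (i - 1) (dif M i f) +[?N] dif K (i + m) (f m x))"
  unfolding s(2)[OF f] d_add[OF K c(1) m_add[OF n(2) c(2,3)]] d_add[OF K c(2,3)] hc ..
 show ?thesis unfolding defect_def e s' using c n d_closed[OF K c(1)] d_closed[OF K c(3)] by algebra
qed

text \<open>On the copy of \<open>K\<close> at the generator \<open>b\<close>, \<open>ph\<close> is
  a chain map of degree \<open>m - p\<close>. It is null homotopic for p ~= m and homotopic to a
  scalar \<open>r\<close> for p = m. Subtracting the boundary of f -> s (f b), and for p = m also
  evaluation at r b, makes \<open>ph\<close> vanish there.\<close>

lemma kill_step:
 assumes ph: "fam m ph" and a: "above ph m p" and b: "b:B p"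
  and df: "!!i k. k:El K (p + i) ==> defect ph m i (iota p b i k) = 0[obj K (i + m - 1)]"
 shows "EX ph' x. fam m ph' & x:El L m & (p ~= m --> x = 0[obj L m]) & rel m ph ph' x & above ph' m p & van ph' m p b &
  (ALL c:B p. van ph m p c --> van ph' m p c)"
proof -
 define \<theta> where "\<theta> q k = ph (q - p) (iota p b (q - p) k)" for q k
 have \<theta>h: "\<theta> q:Hom (obj K q) (obj K (q + (m - p)))" for q
  using hom_comp[OF iota_hom[where p = p and i = "q - p" and b = b] famD[OF ph]] unfolding \<theta>_def by (simp add: add_diff_eq diff_add_eq)
 have \<theta>: "CM K (shift K (m - p)) \<theta>"
 proof (rule chain_mapI[OF K chain_complex_shift[OF K]])
  show "\<theta> q:Hom (obj K q) (obj (shift K (m - p)) q)" for q using \<theta>h by simp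
  fix q k assume k: "k:El K q"
  hence k': "k:El K (p + (q - p))" by simp
  note ic = iota_closed[OF k', of b]
  have "dif K (q - p + m) (ph (q - p) (iota p b (q - p) k)) = ph (q - p - 1) (dif M (q - p) (iota p b (q - p) k))"
   using df[OF k'] m_minus_zero_iff[OF cc_module[OF K] d_closed[OF K fam_closed[OF ph ic]] fam_closed'[OF ph ic]] unfolding defect_def by simp
  thus "dif (shift K (m - p)) q (\<theta> q k) = \<theta> (q - 1) (dif K q k)"
   unfolding dif_iota[OF k' b ph a] \<theta>_def by (simp add: algebra_simps)
 qed
 have "EX s r. homotopy K (shift K (m - p)) s & r:carrier R & (p ~= m --> r = \<zero>) &
  (ALL q. ALL k:El K q. \<theta> q k = hbd K (shift K (m - p)) s q k +[obj K (q + (m - p))] (if p = m then r *[obj K (q + (m - p))] k else 0[obj K (q + (m - p))]))"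
 proof (cases "p = m")
  case True
  have "CM K K \<theta>" using \<theta> True by (simp add: shift_0)
  from homothety_surj[OF this] obtain r where r: "r:carrier R" "htp K K \<theta> (%i x. r *[obj K i] x)" by blast
  from r(2) obtain s where s: "homotopy K K s" "!!q k. k:El K q ==> \<theta> q k = r *[obj K q] k +[obj K q] hbd K K s q k"
   by (rule htpE) blast
  show ?thesis
  proof (rule exI[of _ s], rule exI[of _ r], intro conjI allI ballI)
   fix q k assume k: "k:El K q"
   show "\<theta> q k = hbd K (shift K (m - p)) s q k +[obj K (q + (m - p))] (if p = m then r *[obj K (q + (m - p))] k else 0[obj K (q + (m - p))])"
    using s(2)[OF k] True m_comm'[OF cc_module[OF K] m_smult[OF cc_module[OF K] r(1) k] hbd_closed[OF s(1) K K k]] by (simp add: shift_0)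
  qed (use True r(1) s(1) in \<open>simp_all add: shift_0\<close>)
 next
  case False
  from homothety_zero[OF _ \<theta>] False have "null K (shift K (m - p)) \<theta>" by simp
  then obtain s where s: "homotopy K (shift K (m - p)) s" "!!q k. k:El K q ==> \<theta> q k = hbd K (shift K (m - p)) s q k" by (rule nullE) blast
  show ?thesis
  proof (rule exI[of _ s], rule exI[of _ \<zero>], intro conjI allI ballI)
   fix q k assume k: "k:El K q"
   show "\<theta> q k = hbd K (shift K (m - p)) s q k +[obj K (q + (m - p))] (if p = m then \<zero> *[obj K (q + (m - p))] k else 0[obj K (q + (m - p))])"
    using s(2)[OF k] False K hbd_closed[OF s(1) K chain_complex_shift[OF K] k] by simp
  qed (use s(1) in simp_all)
 qed
 then obtain s r where s: "homotopy K (shift K (m - p)) s" and r: "r:carrier R" "p ~= m --> r = \<zero>"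
  and sr: "!!q k. k:El K q ==> \<theta> q k = hbd K (shift K (m - p)) s q k +[obj K (q + (m - p))] (if p = m then r *[obj K (q + (m - p))] k else 0[obj K (q + (m - p))])"
  by (elim exE conjE) (rule that, assumption, assumption, assumption, blast)
 define x where "x = (if p = m then r *[obj L m] gen1 b else 0[obj L m])"
 have x: "x:El L m" unfolding x_def using gen[OF b] r(1) L by auto
 define E where "E i f = s (p + i) (f p (gen1 b))" for i f
 have Eh: "homotopy M (shift K m) E" unfolding homotopy_def
 proof
  fix i
  have "s (p + i):Hom (obj K (p + i)) (obj K (i + 1 + m))"
   using homotopy_hom[OF s, of "p + i"] by (simp add: algebra_simps)
  from hom_comp[OF eval_hom[OF gen[OF b]] this] show "E i:Hom (obj M i) (obj (shift K m) (i + 1))" unfolding E_def by simp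
 qed
 note hc = hbd_M_closed[OF Eh]
 have sz: "s q 0[obj K q] = 0[obj K (q + 1 + (m - p))]" for q using homotopy_zero[OF s K chain_complex_shift[OF K]] by simp
 \<comment> \<open>The correction does not touch other generators of degree at least
   \<open>p\<close>: for them the element is zero at \<open>b\<close> and at the boundary of
   \<open>b\<close>, which has degree \<open>p - 1\<close>.\<close>
 have hE: "hbd M (shift K m) E i (iota q c i k) = (if q = p & c = b then hbd K (shift K (m - p)) s (p + i) k else 0[obj K (i + m)])"
  if k: "k:El K (q + i)" and c: "c:B q" and pq: "p <= q" for q c i k
 proof -
  note ic = iota_closed[OF k, of c]
  have 1: "iota q c i k p (gen1 b) = (if q = p & c = b then k else 0[obj K (p + i)])"
   using iota_gen[OF k b, of c] by auto
  have dg: "dif L p (gen1 b):El L (p - 1)" by (rule d_closed[OF L gen[OF b]])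
  have "iota q c i k (p - 1) (dif L p (gen1 b)) = 0[obj K (p + i - 1)]" using dg pq by (simp add: iota_def int_index)
  hence 0: "dif M i (iota q c i k) p (gen1 b) = dif K (p + i) (if q = p & c = b then k else 0[obj K (p + i)]) +[obj K (p + i - 1)] 0[obj K (p + i - 1)]"
   using gen[OF b] K by (simp only: hom_cpx_dif 1 restrict_apply' if_True) (simp add: sg_def)
  have 2: "dif M i (iota q c i k) p (gen1 b) = (if q = p & c = b then dif K (p + i) k else 0[obj K (p + i - 1)])"
  proof (cases "q = p & c = b")
   case True
   thus ?thesis unfolding 0 using k d_closed[OF K k] K by simp
  next
   case False
   show ?thesis unfolding 0 if_not_P[OF False] using K d_zero[OF K, of "p + i"] by simp
  qed
  show ?thesis
  proof (cases "q = p & c = b")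
   case True
   thus ?thesis unfolding hbd_def E_def 1 2 by (simp add: algebra_simps)
  next
   case False
   have z1: "s (p + i) 0[obj K (p + i)] = 0[obj K (i + m + 1)]" using sz[of "p + i"] by (simp add: algebra_simps)
   have z2: "s (p + i - 1) 0[obj K (p + i - 1)] = 0[obj K (i + m)]" using sz[of "p + i - 1"] by (simp add: algebra_simps)
   have z3: "p + (i - 1) = p + i - 1" by simp
   show ?thesis unfolding hbd_def E_def 1 2 z3 if_not_P[OF False] using z1 z2 K d_zero[OF K, of "i + m + 1"] by (simp add: int_index)
  qed
 qed
 have xi: "iota q c i k m x = (if p = m & q = p & c = b then r *[obj K (i + m)] k else 0[obj K (i + m)])"
  if k: "k:El K (q + i)" for q c i k
 proof (cases "p = m")
  case True
  have g: "gen1 b:El L m" using gen[OF b] True by simp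
  have "iota q c i k m x = r *[obj K (m + i)] iota q c i k m (gen1 b)"
   unfolding x_def using True hom_smult[OF hom_cpx_hom[OF iota_closed[OF k]] r(1) g] by simp
  thus ?thesis using iota_gen[OF k, of b m c] b True r(1) K by (auto simp: add.commute)
 next
  case False
  thus ?thesis unfolding x_def using hom_zero[OF hom_cpx_hom[OF iota_closed[OF k]] cc_module[OF L] cc_module[OF K], of c m] by (simp add: add.commute)
 qed
 define ph' where "ph' i f = ph i f -[obj K (i + m)] (hbd M (shift K m) E i f +[obj K (i + m)] f m x)" for i f
 have ph': "fam m ph'" unfolding fam_def ph'_def
 proof
  fix i
  have h: "hbd M (shift K m) E i:Hom (obj M i) (obj K (i + m))" using hbd_hom[OF Eh M chain_complex_shift[OF K]] by simp
  show "(%f. ph i f -[obj K (i + m)] (hbd M (shift K m) E i f +[obj K (i + m)] f m x)):Hom (obj M i) (obj K (i + m))"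
   by (rule hom_diff[OF famD[OF ph] hom_plus[OF h famD[OF fam_ev[OF x]] cc_module[OF K]] cc_module[OF K]])
 qed
 have rel: "rel m ph ph' x" unfolding rel_def
 proof (rule exI[of _ E], intro conjI allI ballI Eh)
  fix i f assume f: "f:El M i"
  show "ph i f = ph' i f +[obj K (i + m)] (hbd M (shift K m) E i f +[obj K (i + m)] f m x)"
   unfolding ph'_def using m_minus_add_cancel[OF cc_module[OF K] fam_closed[OF ph f] m_add[OF cc_module[OF K] hc[OF f] ev_closed[OF f x]]] by simp
 qed
 have keep: "van ph' m q c" if v: "van ph m q c" and c: "c:B q" and pq: "p <= q" and ne: "~ (q = p & c = b)" for q c
  unfolding van_def
 proof (intro allI impI)
  fix i k assume k: "k:El K (q + i)"
  have "ph i (iota q c i k) = 0[obj K (i + m)]" using v k unfolding van_def by blast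
  thus "ph' i (iota q c i k) = 0[obj K (i + m)]" unfolding ph'_def hE[OF k c pq] xi[OF k] using ne K by (auto simp: m_minus_eq)
 qed
 have vb: "van ph' m p b" unfolding van_def
 proof (intro allI impI)
  fix i k assume k: "k:El K (p + i)"
  have e: "p + i + (m - p) = i + m" by simp
  have "ph i (iota p b i k) = hbd K (shift K (m - p)) s (p + i) k +[obj K (i + m)] (if p = m then r *[obj K (i + m)] k else 0[obj K (i + m)])"
   using sr[OF k] unfolding \<theta>_def e by simp
  thus "ph' i (iota p b i k) = 0[obj K (i + m)]" unfolding ph'_def
   using hE[OF k b order_refl] xi[OF k, of b] fam_closed[OF ph iota_closed[OF k, of b]] m_minus_cancel[OF cc_module[OF K], of "ph i (iota p b i k)" "i + m"] by simp
 qed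
 have "above ph' m p" unfolding above_def using a keep unfolding above_def by auto
 moreover have "ALL c:B p. van ph m p c --> van ph' m p c" using keep vb by blast
 moreover have "p ~= m --> x = 0[obj L m]" by (simp add: x_def)
 ultimately show ?thesis using ph' x rel vb by blast
qed

text \<open>The degrees p + i in the source and i + m in the target differ by p - m, so one of the
  two terms of \<open>K\<close> is zero.\<close>

lemma van_far:
 assumes ph: "fam m ph" and pm: "2 * \<kappa> < \<bar>p - m\<bar>" shows "van ph m p b"
 unfolding van_def
proof (intro allI impI)
 fix i k assume k: "k:El K (p + i)"
 have v: "ph i (iota p b i k):El K (i + m)" by (rule fam_closed[OF ph iota_closed[OF k]])
 show "ph i (iota p b i k) = 0[obj K (i + m)]"
 proof (cases "\<kappa> < \<bar>i + m\<bar>")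
  case True
  thus ?thesis using v bnd[of "i + m"] by simp
 next
  case False
  hence "\<kappa> < \<bar>p + i\<bar>" using pm by linarith
  hence "k = 0[obj K (p + i)]" using k bnd[of "p + i"] by simp
  thus ?thesis
   using hom_zero[OF hom_comp[OF iota_hom[where p = p and i = i and b = b] famD[OF ph]] cc_module[OF K] cc_module[OF K]] by simp
 qed
qed

lemma van_all:
 assumes ph: "fam m ph" and v: "!!p b. b:B p ==> van ph m p b" and f: "f:El M i"
 shows "ph i f = 0[obj K (i + m)]"
proof (rule hom_vanish[OF famD[OF ph] cc_module[OF K] f])
 fix p b k assume "b:B p" "k:El K (p + i)"
 thus "ph i (iota p b i k) = 0[obj K (i + m)]" using v[of b p] unfolding van_def by blast
qed

lemma defect_closed: "fam m ph ==> f:El M i ==> defect ph m i f:El K (i + m - 1)"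
 unfolding defect_def by (rule m_minus[OF cc_module[OF K] d_closed[OF K fam_closed] fam_closed'])

lemma iota_ev:
 assumes "k:El K (p + i)" "x:El L q" "q = p ==> x = 0[obj L q]"
 shows "iota p b i k q x = 0[obj K (q + i)]"
proof (cases "q = p")
 case True
 thus ?thesis using assms(3) hom_zero[OF hom_cpx_hom[OF iota_closed[OF assms(1)]] cc_module[OF L] cc_module[OF K], of b q] by simp
next
 case False
 thus ?thesis using assms(2) by (simp add: iota_def)
qed

lemma defect_ev_iota:
 assumes x: "x:El L m" and pm: "p ~= m --> x = 0[obj L m]" and k: "k:El K (p + i)"
 shows "defect (%i f. f m x) m i (iota p b i k) = 0[obj K (i + m - 1)]"
proof -
 have "iota p b i k (m - 1) (dif L m x) = 0[obj K (m - 1 + i)]"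
  by (rule iota_ev[OF k d_closed[OF L x]]) (use pm L in auto)
 thus ?thesis unfolding defect_ev[OF x iota_closed[OF k]] using K by (simp add: int_index add.commute)
qed

text \<open>The finitely many generators of degree \<open>p\<close> are treated one after another;
  earlier ones stay killed.\<close>

lemma level:
 assumes ph: "fam m ph" and a: "above ph m p"
  and df: "!!c i k. k:El K (p + i) ==> defect ph m i (iota p c i k) = 0[obj K (i + m - 1)]"
 shows "EX ph' x. fam m ph' & x:El L m & (p ~= m --> x = 0[obj L m]) & rel m ph ph' x & above ph' m (p - 1)"
proof -
 have mL: "Md (obj L m)" by (rule cc_module[OF L])
 have "finite S ==> S <= B p ==> EX ph' x. fam m ph' & x:El L m & (p ~= m --> x = 0[obj L m]) & rel m ph ph' x & above ph' m p & (ALL c:S. van ph' m p c)" for S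
 proof (induction S rule: finite_induct)
  case empty
  show ?case using rel_refl[OF ph] ph a m_zero[OF mL] by blast
 next
  case (insert b S)
  then obtain ph1 x where 1: "fam m ph1" "x:El L m" "p ~= m --> x = 0[obj L m]" "rel m ph ph1 x" "above ph1 m p" "ALL c:S. van ph1 m p c"
   by auto
  have d1: "defect ph1 m i (iota p b i k) = 0[obj K (i + m - 1)]" if k: "k:El K (p + i)" for i k
  proof -
   note ic = iota_closed[OF k, of b]
   show ?thesis using rel_defect[OF 1(4,1,2) ic] df[OF k, of b] defect_ev_iota[OF 1(2,3) k, of b] defect_closed[OF 1(1) ic] K by simp
  qed
  obtain ph2 y where 2: "fam m ph2" "y:El L m" "p ~= m --> y = 0[obj L m]" "rel m ph1 ph2 y" "above ph2 m p" "van ph2 m p b"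
   "ALL c:B p. van ph1 m p c --> van ph2 m p c"
   using kill_step[OF 1(1,5) _ d1] insert.prems by blast
  have "rel m ph ph2 (x +[obj L m] y)" by (rule rel_trans[OF 1(4) 2(4) 1(2) 2(2) 2(1)])
  moreover have "x +[obj L m] y:El L m" "p ~= m --> x +[obj L m] y = 0[obj L m]" using 1(2,3) 2(2,3) mL by auto
  moreover have "ALL c:insert b S. van ph2 m p c" using 1(6) 2(6,7) insert.prems by blast
  ultimately show ?case using 2(1,5) by blast
 qed
 from this[OF fin subset_refl] obtain ph' x where 1: "fam m ph'" "x:El L m" "p ~= m --> x = 0[obj L m]" "rel m ph ph' x" "above ph' m p" "ALL c:B p. van ph' m p c"
  by blast
 have "above ph' m (p - 1)" unfolding above_def
 proof (intro allI impI)
  fix q b assume q: "p - 1 < q" "b:B q"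
  show "van ph' m q b"
  proof (cases "q = p")
   case True thus ?thesis using 1(6) q by simp
  next
   case False
   hence "p < q" using q by simp
   thus ?thesis using 1(5) q(2) unfolding above_def by blast
  qed
 qed
 thus ?thesis using 1 by blast
qed

text \<open>Over a run of degrees that avoids \<open>m\<close>, only homotopies are needed, and the
  evaluation term stays zero.\<close>

lemma levels:
 assumes "fam m ph" and "above ph m (q + int n)" and "m \<notin> {q<..q + int n}"
  and "!!p c i k. q < p ==> p <= q + int n ==> k:El K (p + i) ==> defect ph m i (iota p c i k) = 0[obj K (i + m - 1)]"
 shows "EX ph'. fam m ph' & rel m ph ph' 0[obj L m] & above ph' m q"
 using assms
proof (induction n arbitrary: ph)
 case 0
 show ?case using rel_refl[OF 0(1)] 0 by auto
next
 case (Suc n)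
 have a: "above ph m (q + int (Suc n))" by (rule Suc.prems(2))
 obtain ph1 x where 1: "fam m ph1" "x:El L m" "q + int (Suc n) ~= m --> x = 0[obj L m]" "rel m ph ph1 x" "above ph1 m (q + int (Suc n) - 1)"
  using level[OF Suc.prems(1) a Suc.prems(4)] by auto
 have x0: "x = 0[obj L m]" using 1(3) Suc.prems(3) by auto
 have d: "defect ph1 m i (iota p c i k) = 0[obj K (i + m - 1)]" if p: "q < p" "p <= q + int n" and k: "k:El K (p + i)" for p c i k
 proof -
  note ic = iota_closed[OF k, of c]
  have p': "p <= q + int (Suc n)" using p by simp
  have e: "defect (%i f. f m x) m i (iota p c i k) = 0[obj K (i + m - 1)]" by (rule defect_ev_iota[OF 1(2) _ k]) (use x0 in simp)
  show ?thesis using rel_defect[OF 1(4,1,2) ic, unfolded e Suc.prems(4)[OF p(1) p' k], symmetric]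
   unfolding m_r_zero[OF cc_module[OF K] defect_closed[OF 1(1) ic]] .
 qed
 have m': "m \<notin> {q<..q + int n}" using Suc.prems(3) by auto
 have a': "above ph1 m (q + int n)" using 1(5) by simp
 from Suc.IH[OF 1(1) a' m' d] obtain ph' where 2: "fam m ph'" "rel m ph1 ph' 0[obj L m]" "above ph' m q" by blast
 have z: "0[obj L m]:El L m" using L by simp
 have "rel m ph ph' (0[obj L m] +[obj L m] 0[obj L m])" by (rule rel_trans[OF 1(4)[unfolded x0] 2(2) z z 2(1)])
 thus ?case using 2 L by auto
qed

text \<open>For a generator \<open>b\<close> of degree \<open>m - 1\<close>, the restriction of
  \<open>ph\<close> to its copy of \<open>K\<close> is, up to an alternating sign, a null homotopy
  of multiplication by the coefficient \<open>u b\<close>; injectivity of the homothety makes this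
  coefficient zero.\<close>

lemma coefficients:
 assumes ph: "fam m ph" and a: "above ph m (m - 1)" and u: "u:El L (m - 1)"
  and df: "!!i f. f:El M i ==> defect ph m i f = ~[obj K (i + m - 1)] sg (obj K (i + m - 1)) (even i) (f (m - 1) u)"
 shows "u = 0[obj L (m - 1)]"
proof -
 have "u b = \<zero>" if b: "b:B (m - 1)" for b
 proof -
  let ?p = "m - 1"
  define \<theta> where "\<theta> q k = ph (q - ?p) (iota ?p b (q - ?p) k)" for q k
  have \<theta>h: "\<theta> q:Hom (obj K q) (obj K (q + 1))" for q
   using hom_comp[OF iota_hom[where p = ?p and i = "q - ?p" and b = b] famD[OF ph]] unfolding \<theta>_def by (simp add: add_diff_eq diff_add_eq)
  define s where "s q k = sg (obj K (q + 1)) (odd (q - ?p)) (\<theta> q k)" for q k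
  have "null K K (%q k. u b *[obj K q] k)"
  proof (rule nullI[of _ _ s])
   show "homotopy K K s" unfolding homotopy_def s_def using sg_hom[OF cc_module[OF K] \<theta>h] by blast
   fix q k assume k: "k:El K q"
   let ?N = "obj K q"
   have n: "Md ?N" using K by simp
   have k': "k:El K (?p + (q - ?p))" using k by simp
   have uk: "u b *[?N] k:carrier ?N" using coef[OF u] k n by simp
   have c: "\<theta> q k:El K (q + 1)" "\<theta> (q - 1) (dif K q k):carrier ?N"
    using hom_closed[OF \<theta>h k] hom_closed[OF \<theta>h d_closed[OF K k]] by simp_all
   have "ph (q - ?p - 1) (dif M (q - ?p) (iota ?p b (q - ?p) k)) = \<theta> (q - 1) (dif K q k)"
    unfolding dif_iota[OF k' b ph a] \<theta>_def by (simp add: algebra_simps)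
   moreover have "iota ?p b (q - ?p) k ?p u = u b *[?N] k" using u by (simp add: iota_def)
   ultimately have e: "dif K (q + 1) (\<theta> q k) -[?N] \<theta> (q - 1) (dif K q k) = ~[?N] sg ?N (even (q - ?p)) (u b *[?N] k)"
    using df[OF iota_closed[OF k', of b]] unfolding defect_def \<theta>_def[of q k] by (simp add: add_diff_eq diff_add_eq)
   have o: "odd (q - 1 - ?p) \<longleftrightarrow> even (q - ?p)" by simp
   note dc = d_closed'[OF K c(1)]
   show "u b *[?N] k = hbd K K s q k"
   proof (cases "even (q - ?p)")
    case True
    have "hbd K K s q k = ~[?N] dif K (q + 1) (\<theta> q k) +[?N] \<theta> (q - 1) (dif K q k)"
     unfolding hbd_def s_def o using True d_neg[OF K c(1)] by (simp add: sg_def)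
    also have "... = ~[?N] (dif K (q + 1) (\<theta> q k) -[?N] \<theta> (q - 1) (dif K q k))" using n c(2) dc by algebra
    finally show ?thesis unfolding e using True uk n by (simp add: sg_def)
   next
    case False
    have "hbd K K s q k = dif K (q + 1) (\<theta> q k) -[?N] \<theta> (q - 1) (dif K q k)"
     unfolding hbd_def s_def o using False by (simp add: sg_def a_minus_def)
    thus ?thesis unfolding e using False uk n by (simp add: sg_def)
   qed
  qed
  thus ?thesis by (rule homothety_inj[OF coef[OF u]])
 qed
 thus ?thesis using u unfolding Lf by auto
qed

text \<open>Common core of both halves of biduality. For u = 0 the family is a chain map and
  \<open>x\<close> its preimage; for a null homotopy of evaluation at \<open>u\<close>, the element
  \<open>x\<close> exhibits \<open>u\<close> as a boundary.\<close>

lemma descend: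
 assumes ph: "fam m ph" and u: "u:El L (m - 1)"
  and df: "!!i f. f:El M i ==> defect ph m i f = ~[obj K (i + m - 1)] sg (obj K (i + m - 1)) (even i) (f (m - 1) u)"
 shows "EX ph' x. fam m ph' & x:El L m & rel m ph ph' x & above ph' m (m - 1) & u +[obj L (m - 1)] dif L m x = 0[obj L (m - 1)]"
proof -
 have mL: "Md (obj L (m - 1))" "Md (obj L m)" using L by simp_all
 have z: "0[obj L m]:El L m" using L by simp
 \<comment> \<open>Generators of degree beyond m + 2 \<kappa> are out of reach of \<open>K\<close>,
   so the descent can start there.\<close>
 have a: "above ph m (m + int (nat (2 * \<kappa>)))" unfolding above_def using van_far[OF ph] by auto
 have di: "defect ph m i (iota p c i k) = 0[obj K (i + m - 1)]" if p: "m - 1 < p" and k: "k:El K (p + i)" for p c i k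
  unfolding df[OF iota_closed[OF k]] using iota_ev[OF k u, of c] p K by (simp add: int_index add.commute)
 from levels[OF ph a _ di] obtain ph1 where 1: "fam m ph1" "rel m ph ph1 0[obj L m]" "above ph1 m m" by auto
 have ev0: "defect (%i f. f m 0[obj L m]) m i f = 0[obj K (i + m - 1)]" if f: "f:El M i" for i f
  unfolding defect_ev[OF z f] using hom_zero[OF hom_cpx_prev[OF f, of m] mL(1) cc_module[OF K]] d_zero[OF L, of m] K by (simp add: add.commute)
 have d1: "defect ph1 m i f = ~[obj K (i + m - 1)] sg (obj K (i + m - 1)) (even i) (f (m - 1) u)" if f: "f:El M i" for i f
  using rel_defect[OF 1(2,1) z f] df[OF f] ev0[OF f] defect_closed[OF 1(1) f] K by simp
 have di1: "defect ph1 m i (iota m c i k) = 0[obj K (i + m - 1)]" if k: "k:El K (m + i)" for c i k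
  unfolding d1[OF iota_closed[OF k]] using iota_ev[OF k u, of c] K by (simp add: int_index add.commute)
 from level[OF 1(1,3) di1] obtain ph2 x where 2: "fam m ph2" "x:El L m" "rel m ph1 ph2 x" "above ph2 m (m - 1)" by blast
 note dx = d_closed[OF L 2(2)]
 have ux: "u +[obj L (m - 1)] dif L m x:El L (m - 1)" using u dx mL by simp
 have "u +[obj L (m - 1)] dif L m x = 0[obj L (m - 1)]"
 proof (rule coefficients[OF 2(1,4) ux])
  fix i f assume f: "f:El M i"
  let ?N = "obj K (i + m - 1)"
  have n: "Md ?N" using K by simp
  have h: "f (m - 1):Hom (obj L (m - 1)) ?N" using hom_cpx_prev[OF f, of m] by (simp add: add.commute)
  note c = hom_closed[OF h u] hom_closed[OF h dx] defect_closed[OF 2(1) f]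
  have e: "~[?N] sg ?N (even i) (f (m - 1) u) = defect ph2 m i f +[?N] sg ?N (even i) (f (m - 1) (dif L m x))"
   using rel_defect[OF 2(3,1,2) f] d1[OF f] defect_ev[OF 2(2) f] by simp
  have "defect ph2 m i f = ~[?N] (sg ?N (even i) (f (m - 1) u) +[?N] sg ?N (even i) (f (m - 1) (dif L m x)))"
   by (rule m_neg_eq_add[OF n c(3) sg_closed[OF n c(2)] sg_closed[OF n c(1)] e])
  thus "defect ph2 m i f = ~[?N] sg ?N (even i) (f (m - 1) (u +[obj L (m - 1)] dif L m x))"
   unfolding hom_add[OF h u dx] sg_dist[OF n c(1,2)] .
 qed
 moreover have "rel m ph ph2 x" using rel_trans[OF 1(2) 2(3) z 2(2,1)] 2(2) mL by simp
 ultimately show ?thesis using 2 by blast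
qed

text \<open>Evaluation at \<open>x\<close> with the signs of the twist, which make it compatible
  with the Hom differential.\<close>

abbreviation "ev n x \<equiv> hom_of M K n (%i f. f n x)"

lemma ev_hom: "x:El L n ==> (%f. f n x):Hom (obj M i) (obj K (i + n))"
 by (rule famD[OF fam_ev])

lemma biduality_chain_map: "CM L (HC M K) ev"
proof (rule chain_mapI[OF L chain_complex_hom[OF M K]])
 fix n
 show "ev n:Hom (obj L n) (obj (HC M K) n)"
 proof (rule mod_homI)
  show "ev n x:El (HC M K) n" if "x:El L n" for x
   by (rule hom_of_carrier[OF M K ev_hom[OF that]])
  show "ev n (x +[obj L n] y) = ev n x +[obj (HC M K) n] ev n y" if x: "x:El L n" and y: "y:El L n" for x y
   unfolding hom_cpx_ops(2)
  proof (rule ext)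
   fix i show "ev n (x +[obj L n] y) i = (\<lambda>f\<in>El M i. ev n x i f +[obj K (i + n)] ev n y i f)"
    unfolding hom_of_def
   proof (rule restrict_ext)
    fix f assume f: "f:El M i"
    have "f n (x +[obj L n] y) = f n x +[obj K (i + n)] f n y" using hom_add[OF hom_cpx_hom[OF f] x y] by (simp add: add.commute)
    thus "tw K n (%i f. f n (x +[obj L n] y)) i f = restrict (tw K n (%i f. f n x) i) (El M i) f +[obj K (i + n)] restrict (tw K n (%i f. f n y) i) (El M i) f"
     using f sg_dist[OF cc_module[OF K] ev_closed[OF f x] ev_closed[OF f y]] by (simp add: tw_def)
   qed
  qed
  show "ev n (r *[obj L n] x) = r *[obj (HC M K) n] ev n x" if r: "r:carrier R" and x: "x:El L n" for r x
   unfolding hom_cpx_ops(3)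
  proof (rule ext)
   fix i show "ev n (r *[obj L n] x) i = (\<lambda>f\<in>El M i. r *[obj K (i + n)] ev n x i f)"
    unfolding hom_of_def
   proof (rule restrict_ext)
    fix f assume f: "f:El M i"
    have "f n (r *[obj L n] x) = r *[obj K (i + n)] f n x" using hom_smult[OF hom_cpx_hom[OF f] r x] by (simp add: add.commute)
    thus "tw K n (%i f. f n (r *[obj L n] x)) i f = r *[obj K (i + n)] restrict (tw K n (%i f. f n x) i) (El M i) f"
     using f sg_smult[OF cc_module[OF K] ev_closed[OF f x] r] by (simp add: tw_def)
   qed
  qed
 qed
 fix x assume x: "x:El L n"
 note dx = d_closed[OF L x]
 have e: "ev n x:El (HC M K) n" by (rule hom_of_carrier[OF M K ev_hom[OF x]])
 show "dif (HC M K) n (ev n x) = ev (n - 1) (dif L n x)"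
 proof (rule hom_cpx_ext[OF hom_cpx_dif_hom[OF M K e] hom_of_carrier[OF M K ev_hom[OF dx]]])
  fix i f assume f: "f:El M i"
  let ?N = "obj K (i + n - 1)"
  have n: "Md ?N" using K by simp
  note df = d_closed[OF M f]
  have c: "f n x:El K (i + n)" "f (n - 1) (dif L n x):carrier ?N"
   using ev_closed[OF f x] hom_closed[OF hom_cpx_prev[OF f] dx] by (simp_all add: add.commute)
  note dc = d_closed[OF K c(1)]
  have d: "dif M i f n x = dif K (i + n) (f n x) +[?N] sg ?N (odd i) (f (n - 1) (dif L n x))"
   using x by (simp add: hom_cpx_dif add.commute)
  have 1: "ev n x i f = sg (obj K (i + n)) (even n \<or> even i) (f n x)" using f by (simp add: hom_of_def tw_def)
  have 2: "ev n x (i - 1) (dif M i f) = sg ?N (even n \<or> odd i) (dif M i f n x)" using df by (simp add: hom_of_def tw_def int_index)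
  have 3: "ev (n - 1) (dif L n x) i f = sg ?N (odd n \<or> even i) (f (n - 1) (dif L n x))" using f by (simp add: hom_of_def tw_def add_diff_eq)
  show "dif (HC M K) n (ev n x) i f = ev (n - 1) (dif L n x) i f"
   unfolding hom_cpx_dif[of M K] restrict_apply'[OF f] 1 2 3 d
   using n c(2) dc by (cases "even n"; cases "even i"; simp add: sg_def d_neg[OF K c(1)] m_neg_add m_r_neg1 m_r_neg2)
 qed
qed

theorem biduality: "QI L (HC M K) ev"
 unfolding quasi_iso_iff[OF biduality_chain_map]
proof (intro conjI allI impI)
 fix n x assume x: "x:carrier (cycles L n)" and b: "ev n x:boundaries (HC M K) n"
 have xc: "x:El L n" using x by simp
 have e: "ev n x:El (HC M K) n" by (rule hom_of_carrier[OF M K ev_hom[OF xc]])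
 have "null M (shift K n) (tw K n (ev n x))" using b hom_bd_iff[OF M K e] by simp
 hence "null M (shift K n) (%i f. f n x)" by (rule null_cong) (use tw_hom_of[OF K ev_hom[OF xc]] in simp)
 then obtain w where w: "homotopy M (shift K n) w" "!!i f. f:El M i ==> f n x = hbd M (shift K n) w i f" by (rule nullE) blast
 let ?m = "n + 1"
 have wh: "w i:Hom (obj M i) (obj K (i + ?m))" for i using homotopy_hom[OF w(1), of i] by (simp add: add_ac)
 \<comment> \<open>An alternating sign converts the equation d w + w d = evaluation at
   \<open>x\<close> into a statement on the defect d ph - ph d.\<close>
 define ph where "ph i f = sg (obj K (i + ?m)) (odd i) (w i f)" for i f
 have ph: "fam ?m ph" unfolding fam_def ph_def using sg_hom[OF cc_module[OF K] wh] by blast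
 have xc': "x:El L (?m - 1)" using xc by simp
 have "defect ph ?m i f = ~[obj K (i + ?m - 1)] sg (obj K (i + ?m - 1)) (even i) (f (?m - 1) x)" if f: "f:El M i" for i f
 proof -
  let ?N = "obj K (i + n)"
  have n: "Md ?N" using K by simp
  have c: "w i f:El K (i + n + 1)" "w (i - 1) (dif M i f):carrier ?N"
   using hom_closed[OF wh f] hom_closed[OF wh d_closed[OF M f]] by (simp_all add: add_ac)
  note dc = d_closed'[OF K c(1)]
  have e: "f n x = dif K (i + n + 1) (w i f) +[?N] w (i - 1) (dif M i f)" using w(2)[OF f] by (simp add: hbd_def add_ac)
  have i1: "i + ?m - 1 = i + n" "i - 1 + ?m = i + n" "?m - 1 = n" "i + ?m = i + n + 1" by simp_all
  show ?thesis unfolding defect_def ph_def i1 e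
   by (cases "even i"; simp add: sg_def d_neg[OF K c(1)]; insert n c(2) dc; algebra)
 qed
 from descend[OF ph xc' this] obtain y where y: "y:El L ?m" "x +[obj L (?m - 1)] dif L ?m y = 0[obj L (?m - 1)]" by blast
 have "x = ~[obj L n] dif L (n + 1) y"
  by (rule m_add_eq_zero[OF cc_module[OF L] xc]) (use y d_closed'[OF L y(1)] in simp_all)
 thus "x:boundaries L n"
  unfolding bd_iff using y(1) d_neg[OF L y(1)] L by (intro bexI[of _ "~[obj L (n + 1)] y"]) simp_all
next
 fix m ps assume p: "ps:carrier (cycles (HC M K) m)"
 let ?ph = "tw K m ps"
 note phc = cycle_chain_map[OF p M K]
 have pc: "ps:El (HC M K) m" using p by simp
 have mL: "Md (obj L (m - 1))" "Md (obj L m)" using L by simp_all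
 have ph: "fam m ?ph" unfolding fam_def using cm_hom[OF phc] by simp
 have df: "defect ?ph m i f = 0[obj K (i + m - 1)]" if f: "f:El M i" for i f
  unfolding defect_def using cm_d[OF phc f] m_minus_cancel[OF cc_module[OF K] fam_closed'[OF ph f]] by simp
 have z: "0[obj L (m - 1)]:El L (m - 1)" using L by simp
 have dz: "defect ?ph m i f = ~[obj K (i + m - 1)] sg (obj K (i + m - 1)) (even i) (f (m - 1) 0[obj L (m - 1)])" if f: "f:El M i" for i f
  unfolding df[OF f] using hom_zero[OF hom_cpx_prev[OF f, of m] mL(1) cc_module[OF K]] K by (simp add: add.commute)
 from descend[OF ph z dz] obtain ph1 x where 1: "fam m ph1" "x:El L m" "rel m ?ph ph1 x" "above ph1 m (m - 1)"
  "0[obj L (m - 1)] +[obj L (m - 1)] dif L m x = 0[obj L (m - 1)]" by blast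
 have dx: "dif L m x = 0[obj L (m - 1)]" using 1(5) d_closed[OF L 1(2)] mL by simp
 hence xz: "x:carrier (cycles L m)" using 1(2) by simp
 have ev0: "defect (%i f. f m x) m i f = 0[obj K (i + m - 1)]" if f: "f:El M i" for i f
  unfolding defect_ev[OF 1(2) f] dx using hom_zero[OF hom_cpx_prev[OF f, of m] mL(1) cc_module[OF K]] K by (simp add: add.commute)
 have d1: "defect ph1 m i f = 0[obj K (i + m - 1)]" if f: "f:El M i" for i f
  using rel_defect[OF 1(3,1,2) f] df[OF f] ev0[OF f] defect_closed[OF 1(1) f] K by simp
 \<comment> \<open>Below \<open>?q\<close> the boundedness of \<open>K\<close> takes over again, so
   that finitely many levels suffice.\<close>
 let ?n = "nat (2 * \<kappa>)" let ?q = "m - 1 - int ?n"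
 have a: "above ph1 m (?q + int ?n)" using 1(4) by simp
 from levels[OF 1(1) a _ d1[OF iota_closed]] obtain ph2 where 2: "fam m ph2" "rel m ph1 ph2 0[obj L m]" "above ph2 m ?q" by auto
 have v: "van ph2 m p b" if "b:B p" for p b
 proof (cases "?q < p")
  case True thus ?thesis using 2(3) that unfolding above_def by blast
 next
  case False thus ?thesis by (intro van_far[OF 2(1)]) (cases "0 <= \<kappa>"; simp; linarith)
 qed
 have "rel m ?ph ph2 x" using rel_trans[OF 1(3) 2(2) 1(2) m_zero[OF mL(2)] 2(1)] 1(2) mL by simp
 then obtain s where s: "homotopy M (shift K m) s" "!!i f. f:El M i ==> ?ph i f = ph2 i f +[obj K (i + m)] (hbd M (shift K m) s i f +[obj K (i + m)] f m x)"
  unfolding rel_def by (elim exE conjE) (rule that, assumption, blast)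
 have e: "ev m x:El (HC M K) m" by (rule hom_of_carrier[OF M K ev_hom[OF 1(2)]])
 have mH: "Md (obj (HC M K) m)" using M K by simp
 have d: "ps -[obj (HC M K) m] ev m x:El (HC M K) m" by (rule m_minus[OF mH pc e])
 have "null M (shift K m) (tw K m (ps -[obj (HC M K) m] ev m x))"
 proof (rule nullI[OF s(1)])
  fix i f assume f: "f:El M i"
  let ?N = "obj K (i + m)"
  have n: "Md ?N" using K by simp
  have v2: "ph2 i f = 0[?N]" by (rule van_all[OF 2(1) _ f]) (rule v)
  note hc = hbd_M_closed[OF s(1) f] and fc = ev_closed[OF f 1(2)]
  have "tw K m (ps -[obj (HC M K) m] ev m x) i f = ?ph i f -[?N] tw K m (ev m x) i f"
   unfolding tw_def hom_cpx_minus[OF M K e f]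
   using n hom_cpx_closed[OF e f] hom_cpx_closed[OF pc f] by (simp add: sg_def m_minus_eq m_neg_add)
  also have "... = (ph2 i f +[?N] (hbd M (shift K m) s i f +[?N] f m x)) -[?N] f m x"
   unfolding tw_hom_of[OF K ev_hom[OF 1(2)] f] s(2)[OF f] ..
  also have "... = (hbd M (shift K m) s i f +[?N] f m x) -[?N] f m x"
   using v2 n hc fc by simp
  also have "... = hbd M (shift K m) s i f" using n hc fc by algebra
  finally show "tw K m (ps -[obj (HC M K) m] ev m x) i f = hbd M (shift K m) s i f" .
 qed
 hence "ps -[obj (HC M K) m] ev m x:boundaries (HC M K) m" using hom_bd_iff[OF M K d] by simp
 thus "EX x:carrier (cycles L m). EX n:boundaries (HC M K) m. ps = n +[obj (HC M K) m] ev m x"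
  using xz m_minus_add_cancel[OF mH pc e] by (intro bexI[of _ x] bexI[of _ "ps -[obj (HC M K) m] ev m x"]) simp_all
qed

end

section \<open>Vanishing, injectivity and finiteness for the dual of a free complex\<close>

context finite_free_source begin

lemma hom_vanish_above: "(!!i. i < c ==> B i = {}) ==> (!!i. d < i ==> El K i = {0[obj K i]}) ==> d - c < n ==>
  El M n = {0[obj M n]}"
proof -
 assume b: "!!i. i < c ==> B i = {}" and d: "!!i. d < i ==> El K i = {0[obj K i]}" and n: "d - c < n"
 have z: "0[obj M n]:El M n" by (rule m_zero[OF cc_module[OF M]])
 have "f = 0[obj M n]" if f: "f:El M n" for f
 proof (rule M_eq_on_gens[OF f z])
  fix p e assume e: "e:B p"
  have "d < p + n" using b[of p] e n by force
  from d[OF this] hom_cpx_closed[OF f gen[OF e]] hom_cpx_closed[OF z gen[OF e]] show "f p (gen1 e) = 0[obj M n] p (gen1 e)" by simp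
 qed
 thus ?thesis using z by blast
qed

text \<open>A term of Hom(L, K) is a product of terms of \<open>K\<close>, one factor per generator,
  and the criterion can be solved in each factor separately.\<close>

lemma baer_hom: assumes E: "!!i. baer (obj K i)" shows "baer (obj M n)"
 unfolding baer_def
proof (intro conjI allI impI)
 show "Md (obj M n)" by (rule cc_module[OF M])
 fix J f assume J: "ideal J R" and f: "f:Hom ((ring_module R)\<lparr>carrier := J\<rparr>) (obj M n)"
 have fc: "f j:El M n" if "j:J" for j using hom_closed[OF f] that by simp
 have "EX y:El K (p + n). ALL j:J. f j p (gen1 b) = j *[obj K (p + n)] y" if b: "b:B p" for p b
  using E[of "p + n"] J hom_comp[OF f eval_hom[OF gen[OF b]]] unfolding baer_def by blast
 note ex = this
 define y where "y p b = (SOME y. y:El K (p + n) & (ALL j:J. f j p (gen1 b) = j *[obj K (p + n)] y))" for p b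
 have y': "y p b:El K (p + n) & (ALL j:J. f j p (gen1 b) = j *[obj K (p + n)] y p b)" if "b:B p" for p b
  unfolding y_def by (rule someI_ex) (use ex[OF that] in blast)
 have y: "y p b:El K (p + n)" "!!j. j:J ==> f j p (gen1 b) = j *[obj K (p + n)] y p b" if "b:B p" for p b
  using y'[OF that] by simp_all
 define ph where "ph p = restrict (free_lift (obj K (p + n)) (y p)) (El L p)" for p
 have fl: "free_lift (obj K (p + n)) (y p):Hom (FM (B p)) (obj K (p + n))" for p by (rule free_lift(1)[OF cc_module[OF K] y(1)])
 have fg: "free_lift (obj K (p + n)) (y p) (gen1 b) = y p b" if "b:B p" for p b by (rule free_lift(2)[OF cc_module[OF K] y(1) that])
 have ph: "ph:El M n" unfolding hom_cpx_obj ph_def by (intro allI conjI restrict_extensional restrict_mod_hom cc_module[OF L]) (simp add: Lf fl)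
 show "EX y:El M n. ALL j:J. f j = j *[obj M n] y"
 proof (intro bexI[of _ ph] ballI ph)
  fix j assume j: "j:J"
  have jr: "j:carrier R" using idealD(1)[OF J] j by blast
  show "f j = j *[obj M n] ph"
  proof (rule M_eq_on_gens[OF fc[OF j] m_smult[OF cc_module[OF M] jr ph]])
   fix p b assume b: "b:B p"
   show "f j p (gen1 b) = (j *[obj M n] ph) p (gen1 b)"
    using gen[OF b] y(2)[OF b j] fg[OF b] by (simp add: hom_cpx_ops ph_def)
  qed
 qed
qed

text \<open>If K_(i+n) is nonzero, then i \<ge> -\<kappa> - n > N. So \<open>L\<close> is exact
  wherever the target is nonzero, even if \<open>L\<close> is unbounded above.\<close>

lemma zero_homology_hom:
 assumes E: "!!i. baer (obj K i)" and b: "!!i. \<kappa> < \<bar>i\<bar> ==> El K i = {0[obj K i]}" and z: "!!i. N < i ==> zero_homology L i" and n: "n < - \<kappa> - N"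
 shows "zero_homology M n"
 unfolding zero_homology_iff[OF M]
proof (intro allI impI)
 fix f assume f: "f:El M n" "dif M n f = 0[obj M (n - 1)]"
 have cm: "CM L (shift K n) (tw K n f)" using hom_cycle_iff[OF L K f(1)] f(2) by simp
 have "null L (shift K n) (tw K n f)"
 proof (rule null_into_baer[OF cm, of "\<kappa> - n"])
  show "baer (obj (shift K n) i)" for i using E by simp
  show "El (shift K n) i = {0[obj (shift K n) i]}" if "\<kappa> - n < i" for i using b[of "i + n"] that by simp
  fix i assume "El (shift K n) i ~= {0[obj (shift K n) i]}"
  hence "~ \<kappa> < \<bar>i + n\<bar>" using b[of "i + n"] by auto
  thus "zero_homology L i" using n by (intro z) simp
 qed
 thus "f:boundaries M n" using hom_bd_iff[OF L K f(1)] by simp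
qed

text \<open>Cycles are filtered by vanishing on an initial set of generators. If a cycle vanishes on
  L_(p-1), its value at a generator \<open>b\<close> of degree \<open>p\<close> is a cycle of
  \<open>K\<close>, and these are finitely generated modulo boundaries. If the value is a boundary d
  k, subtracting the boundary of \<open>iota p b (n + 1) k\<close> moves the element one step down
  the filtration.\<close>

lemma fg_homology_hom:
 assumes noeth: "noetherian_ring R" and fgK: "!!i. fg_homology K i" and c: "!!i. i < c ==> B i = {}"
  and d: "!!i. d < i ==> El K i = {0[obj K i]}"
 shows "fg_homology M n"
proof -
 define W where "W p A = {f:carrier (cycles M n). (ALL q<p. ALL x:El L q. f q x = 0[obj K (q + n)]) & (ALL a:A. f p (gen1 a) = 0[obj K (p + n)])}" for p A
 define fgW where "fgW V \<longleftrightarrow> (EX S. finite S & S <= V & V <= Span (obj M n) (S \<union> boundaries M n))" for V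
 note mM = cc_module[OF M]
 have Wc: "f:W p A ==> f:El M n" for f p A by (simp add: W_def)
 have sub: "submodule (W p A) R (obj M n)" if A: "A <= B p" for p A
 proof (rule submoduleI'[OF mM])
  have g: "a:A ==> gen1 a:El L p" for a using A gen by blast
  note Z = submoduleD[OF mM submodule_cycles[OF M, of n]]
  show "W p A <= El M n" using Wc by blast
  show "0[obj M n]:W p A" using Z(2) g by (auto simp: W_def hom_cpx_ops)
  show "x +[obj M n] y:W p A" if "x:W p A" "y:W p A" for x y
   using that Z(3)[of x y] g K unfolding W_def by (auto simp: hom_cpx_ops)
  show "r *[obj M n] x:W p A" if "r:carrier R" "x:W p A" for r x
   using that Z(4)[of r x] g K unfolding W_def by (auto simp: hom_cpx_ops)
 qed
 have step: "fgW (W p A)" if h: "fgW (W p (insert b A))" and A: "insert b A <= B p" for p b A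
 proof -
  have b: "b:B p" and A': "A <= B p" using A by auto
  obtain S2 where S2: "finite S2" "S2 <= W p (insert b A)" "W p (insert b A) <= Span (obj M n) (S2 \<union> boundaries M n)" using h unfolding fgW_def by blast
  obtain S where S: "finite S" "S <= carrier (cycles K (p + n))" "carrier (cycles K (p + n)) <= Span (obj K (p + n)) (S \<union> boundaries K (p + n))"
   using fgK[of "p + n"] unfolding fg_homology_def by blast
  have bM: "boundaries M n <= El M n" using bd_closed[OF M] by blast
  have S2B: "S2 \<union> boundaries M n <= El M n" using S2(2) Wc bM by blast
  have S2W: "S2 <= W p A" using S2(2) by (auto simp: W_def)
  have SK: "S <= El K (p + n)" using S(2) by auto
  show ?thesis unfolding fgW_def
  proof (rule fg_extension[OF noeth mM cc_module[OF K] eval_hom[OF gen[OF b]] sub[OF A'] submodule_boundaries_obj[OF K] S(1) SK _ S2(1) S2W bM])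
   fix w assume w: "w:W p A"
   have wz: "dif M n w = 0[obj M (n - 1)]" and w0: "!!q x. q < p ==> x:El L q ==> w q x = 0[obj K (q + n)]"
    and wA: "!!a. a:A ==> w p (gen1 a) = 0[obj K (p + n)]" using w by (auto simp: W_def)
   have "w (p - 1) (dif L p (gen1 b)) = 0[obj K (p + n - 1)]"
    using w0[OF _ d_closed[OF L gen[OF b]]] by (simp add: int_index)
   moreover have "dif M n w p (gen1 b) = 0[obj K (p + n - 1)]" unfolding wz using gen[OF b] by (simp add: hom_cpx_ops int_index)
   moreover note wc = hom_cpx_closed[OF Wc[OF w] gen[OF b]]
   ultimately have "dif K (p + n) (w p (gen1 b)) = 0[obj K (p + n - 1)]"
    using gen[OF b] K d_closed[OF K wc] by (simp add: hom_cpx_dif)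
   thus "w p (gen1 b):Span (obj K (p + n)) (S \<union> boundaries K (p + n))" using S(3) wc by auto
   assume "w p (gen1 b):boundaries K (p + n)"
   then obtain k where k0: "k:El K (p + n + 1)" and wk: "w p (gen1 b) = dif K (p + n + 1) k" by (auto simp: bd_iff)
   have k: "k:El K (p + (n + 1))" using k0 by (simp add: int_index)
   let ?g = "iota p b (n + 1) k"
   note gc = iota_closed[OF k, of b]
   have dgc: "dif M (n + 1) ?g:El M n" by (rule d_closed'[OF M gc])
   have dgZ: "dif M (n + 1) ?g:carrier (cycles M n)" using dgc d_d'[OF M gc] by simp
   have dg: "dif M (n + 1) ?g q x = dif K (q + n + 1) (?g q x)" if x: "x:El L q" and q: "q <= p" for q x
   proof -
    have "?g (q - 1) (dif L q x) = 0[obj K (q + n)]" using d_closed[OF L x] q by (simp add: iota_def int_index)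
    moreover have "?g q x:El K (q + n + 1)" using hom_cpx_closed[OF gc x] by (simp add: int_index)
    ultimately show ?thesis using x K by (simp add: hom_cpx_dif int_index)
   qed
   have m: "w -[obj M n] dif M (n + 1) ?g:W p (insert b A)"
    unfolding W_def mem_Collect_eq
   proof (intro conjI allI impI ballI)
    show "w -[obj M n] dif M (n + 1) ?g:carrier (cycles M n)"
     using submoduleD(6)[OF mM submodule_cycles[OF M] _ dgZ] w by (simp add: W_def)
    show "(w -[obj M n] dif M (n + 1) ?g) q x = 0[obj K (q + n)]" if q: "q < p" and x: "x:El L q" for q x
    proof -
     have "dif M (n + 1) ?g q x = 0[obj K (q + n)]" using dg[OF x] q x d_zero[OF K, of "q + n + 1"] by (simp add: iota_def int_index)
     thus ?thesis unfolding hom_cpx_minus[OF L K dgc x] w0[OF q x] using K by (simp add: m_minus_eq)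
    qed
    show "(w -[obj M n] dif M (n + 1) ?g) p (gen1 a) = 0[obj K (p + n)]" if a: "a:insert b A" for a
    proof -
     have aB: "a:B p" using a A by blast
     have "dif M (n + 1) ?g p (gen1 a) = (if a = b then dif K (p + n + 1) k else 0[obj K (p + n)])"
      unfolding dg[OF gen[OF aB] order_refl] iota_gen[OF k aB] using d_zero[OF K, of "p + n + 1"] by (simp add: int_index)
     thus ?thesis unfolding hom_cpx_minus[OF L K dgc gen[OF aB]]
      using a wk wA[of a] K m_minus_cancel[OF cc_module[OF K] d_closed'[OF K k0]] by (auto simp: m_minus_eq)
    qed
   qed
   note T = submoduleD[OF mM span_submodule[OF mM S2B]]
   have "dif M (n + 1) ?g:Span (obj M n) (S2 \<union> boundaries M n)"
    by (rule subsetD[OF span_incl]) (use gc in \<open>auto simp: bd_iff\<close>)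
   from T(3)[OF _ this] S2(3) m have "(w -[obj M n] dif M (n + 1) ?g) +[obj M n] dif M (n + 1) ?g:Span (obj M n) (S2 \<union> boundaries M n)" by blast
   thus "w:Span (obj M n) (S2 \<union> boundaries M n)" using m_minus_add_cancel[OF mM Wc[OF w] dgc] by simp
  qed
 qed
 have down: "fgW (W p {})" if h: "fgW (W (p + 1) {})" for p
 proof -
  have e: "W p (B p) = W (p + 1) {}"
  proof (intro equalityI subsetI)
   fix f assume f: "f:W p (B p)"
   have "f q x = 0[obj K (q + n)]" if q: "q < p + 1" and x: "x:El L q" for q x
   proof (cases "q = p")
    case True
    have "f p x = (%x. 0[obj K (p + n)]) x"
     by (rule free_hom_ext[OF hom_cpx_hom[OF Wc[OF f], of p, unfolded Lf] hom_const_zero[OF cc_module[OF K]] cc_module[OF K]])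
      (use f x True Lf in \<open>auto simp: W_def\<close>)
    thus ?thesis using True by simp
   next
    case False
    thus ?thesis using f q x by (auto simp: W_def)
   qed
   thus "f:W (p + 1) {}" using f by (auto simp: W_def)
  next
   fix f assume "f:W (p + 1) {}" thus "f:W p (B p)" using gen by (auto simp: W_def)
  qed
  have "finite A ==> A <= B p ==> fgW (W p A) ==> fgW (W p {})" for A
  proof (induction A rule: finite_induct)
   case (insert b A)
   show ?case using insert.IH step[OF insert.prems(2,1)] insert.prems(1) by blast
  qed
  from this[OF fin order_refl] show ?thesis using h e by simp
 qed
 \<comment> \<open>For q \<ge> p > d - n the target K_(q+n) is zero, so nothing is left.\<close>
 have top: "fgW (W p {})" if p: "d - n < p" for p
 proof -
  have z: "0[obj M n]:Span (obj M n) ({} \<union> boundaries M n)"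
   by (rule submoduleD(2)[OF mM span_submodule[OF mM]]) (use bd_closed[OF M] in auto)
  have "f = 0[obj M n]" if f: "f:W p {}" for f
  proof (rule hom_cpx_ext[OF Wc[OF f] m_zero[OF mM]])
   fix q x assume x: "x:El L q"
   show "f q x = 0[obj M n] q x"
   proof (cases "q < p")
    case True thus ?thesis using f x by (simp add: W_def hom_cpx_ops)
   next
    case False
    hence "d < q + n" using p by simp
    thus ?thesis using d[of "q + n"] hom_cpx_closed[OF Wc[OF f] x] x by (simp add: hom_cpx_ops)
   qed
  qed
  thus ?thesis unfolding fgW_def using z by (intro exI[of _ "{}"]) auto
 qed
 have "fgW (W (d - n + 1 - int k) {})" for k
 proof (induction k)
  case (Suc k)
  have e: "d - n + 1 - int (Suc k) + 1 = d - n + 1 - int k" by simp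
  show ?case by (rule down) (unfold e, rule Suc)
 qed (use top in simp)
 \<comment> \<open>The descent ends at the minimum of \<open>c\<close> and \<open>d - n\<close>,
   where no condition is left, as \<open>L\<close> has no generators below \<open>c\<close>.\<close>
 moreover have e: "d - n + 1 - int (nat (d - n + 1 - min c (d - n))) = min c (d - n)" by (cases "c <= d - n") (simp_all add: min_def)
 ultimately have "fgW (W (min c (d - n)) {})" by metis
 moreover have "W (min c (d - n)) {} = carrier (cycles M n)"
 proof (intro equalityI subsetI)
  fix f assume f: "f:carrier (cycles M n)"
  hence fc: "f:El M n" by simp
  have "f q x = 0[obj K (q + n)]" if q: "q < c" and x: "x:El L q" for q x
   using free_hom_ext[OF hom_cpx_hom[OF fc, of q, unfolded Lf] hom_const_zero[OF cc_module[OF K]] cc_module[OF K], of x] x c[OF q] Lf by auto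
  thus "f:W (min c (d - n)) {}" using f by (auto simp: W_def)
 qed (simp add: W_def)
 ultimately show ?thesis unfolding fg_homology_def fgW_def by simp
qed

end

context cring begin

text \<open>\<open>injective_module\<close> is tested on modules in the universe, so the ideal and
  the ring are transported there by \<open>el_enc\<close>, which needs two distinct values to be
  injective.\<close>

lemma baer_injective:
 fixes E :: "('a, ('a, 'v) univ) module"
 assumes v: "(v1 :: 'v) ~= v2" and E: "injective_module R E"
 shows "baer E"
 unfolding baer_def
proof (intro conjI allI impI)
 show mE: "Md E" using E by (simp add: injective_module_def)
 fix J f assume J: "ideal J R" and f: "f:Hom ((ring_module R)\<lparr>carrier := J\<rparr>) E"
 let ?J = "(ring_module R)\<lparr>carrier := J\<rparr>" and ?e = "el_enc :: 'a => ('a, 'v) univ"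
 have inj: "inj ?e" by (rule inj_el_enc[OF v])
 have i1: "inj_on ?e (carrier ?J)" and i2: "inj_on ?e (carrier (ring_module R))" by (rule inj_on_subset[OF inj]; simp)+
 have mJ: "Md ?J" by (rule module_sub[OF module_ring_module]) (use idealD[OF J] in auto)
 have h: "(%x. x):Hom (tr_module ?J ?e) (tr_module (ring_module R) ?e)"
 proof (rule mod_homI)
  have *: "EX j:J. x = ?e j" if "x:carrier (tr_module ?J ?e)" for x using that by (auto simp: tr_module_simps)
  fix x assume "x:carrier (tr_module ?J ?e)"
  from *[OF this] obtain j where j: "j:J" "x = ?e j" by blast
  have jr: "j:carrier R" using idealD(1)[OF J] j(1) by blast
  show "x:carrier (tr_module (ring_module R) ?e)" using j jr by (simp add: tr_module_simps)
  show "r *[tr_module ?J ?e] x = r *[tr_module (ring_module R) ?e] x" for r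
   using tr_module_smult[OF i1, of j r] tr_module_smult[OF i2, of j r] j jr by simp
  fix y assume "y:carrier (tr_module ?J ?e)"
  from *[OF this] obtain k where k: "k:J" "y = ?e k" by blast
  have kr: "k:carrier R" using idealD(1)[OF J] k(1) by blast
  show "x +[tr_module ?J ?e] y = x +[tr_module (ring_module R) ?e] y"
   using tr_module_add[OF i1, of j k] tr_module_add[OF i2, of j k] j jr k kr by simp
 qed
 have f': "(%x. f (inv_into (carrier ?J) ?e x)):Hom (tr_module ?J ?e) E" by (rule hom_comp[OF tr_inv_hom[OF mJ i1] f])
 obtain g where g: "g:Hom (tr_module (ring_module R) ?e) E" "ALL x:carrier (tr_module ?J ?e). g x = f (inv_into (carrier ?J) ?e x)"
  using E[unfolded injective_module_def, THEN conjunct2, rule_format, OF conjI[OF module_tr[OF mJ i1] conjI[OF module_tr[OF module_ring_module i2] conjI[OF h conjI[OF _ f']]]]]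
  by (elim bexE[rotated]) auto
 have c: "?e \<one>:carrier (tr_module (ring_module R) ?e)" by (simp add: tr_module_simps)
 show "EX y:carrier E. ALL j:J. f j = j *[E] y"
 proof (intro bexI[of _ "g (?e \<one>)"] ballI hom_closed[OF g(1) c])
  fix j assume j: "j:J"
  have jr: "j:carrier R" using idealD(1)[OF J] j by blast
  have "f j = g (?e j)" using g(2) j i1 by (simp add: tr_module_simps)
  also have "?e j = j *[tr_module (ring_module R) ?e] ?e \<one>" using tr_module_smult[OF i2, of \<one> j] jr by simp
  finally show "f j = j *[E] g (?e \<one>)" using hom_smult[OF g(1) jr c] by simp
 qed
qed



section \<open>Torsion submodules\<close>

text \<open>The elements killed by all n-fold products from \<open>S\<close>. The recursion makes it
  easy to pass from generators to an ideal, and for an ideal it agrees with annihilation by the n-th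
  power.\<close>

primrec killed :: "('a, 'c) module => 'a set => nat => 'c set" where
 "killed M S 0 = {0[M]}"
| "killed M S (Suc n) = {x:carrier M. ALL c:S. c *[M] x:killed M S n}"

lemma killed_submodule: assumes M: "Md M" and S: "S <= carrier R" shows "submodule (killed M S n) R M"
proof (induction n)
 case 0
 thus ?case by (simp add: zero_submodule[OF M])
next
 case (Suc n)
 note D = submoduleD[OF M Suc]
 show ?case
 proof (rule submoduleI'[OF M])
  show "r *[M] x:killed M S (Suc n)" if r: "r:carrier R" and x: "x:killed M S (Suc n)" for r x
  proof -
   have "c *[M] (r *[M] x) = r *[M] (c *[M] x)" if "c:S" for c
    using that S M r x m_comm[of c r] by (auto simp: m_mult_smult[symmetric])
   thus ?thesis using D(4)[OF r] M r x by simp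
  qed
 qed (use D M S in \<open>auto simp: m_smult_add subset_iff\<close>)
qed

lemma killed_mono: assumes M: "Md M" and S: "S <= carrier R" and mn: "m <= n" shows "killed M S m <= killed M S n"
proof -
 have "killed M S n <= killed M S (Suc n)" for n
 proof (induction n)
  case 0
  thus ?case using M S by auto
 next
  case (Suc n)
  thus ?case by auto
 qed
 thus ?thesis by (rule lift_Suc_mono_le[OF _ mn])
qed

lemma killed_hom: assumes f: "f:Hom M N" and M: "Md M" and N: "Md N" and S: "S <= carrier R" and x: "x:killed M S n"
 shows "f x:killed N S n"
 using x
proof (induction n arbitrary: x)
 case 0
 thus ?case using hom_zero[OF f M N] by simp
next
 case (Suc n)
 thus ?case using hom_closed[OF f] hom_smult[OF f] S by (auto simp: subset_iff) metis
qed

text \<open>For fixed \<open>x\<close>, the scalars moving \<open>x\<close> into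
  \<open>killed M S n\<close> form an ideal.\<close>

lemma killed_genideal: assumes M: "Md M" and S: "S <= carrier R" shows "killed M (Idl S) n = killed M S n"
proof (induction n)
 case (Suc n)
 note D = submoduleD[OF M killed_submodule[OF M S, of n]]
 have "c *[M] x:killed M S n" if x: "x:carrier M" "ALL c:S. c *[M] x:killed M S n" and c: "c:Idl S" for x c
 proof -
  have "ideal {c:carrier R. c *[M] x:killed M S n} R"
   by (rule idealI') (use D x M in \<open>auto simp: m_add_smult m_mult_smult\<close>)
  from genideal_minimal[OF this, of S] show ?thesis using x S c by blast
 qed
 thus ?case using Suc genideal_self[OF S] by auto
qed simp

lemma ideal_ideal_power: "ideal I R ==> ideal (ideal_power R I n) R"
 by (induction n) (simp_all add: oneideal ideal_prod_is_ideal)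

lemma killed_ideal_power: assumes M: "Md M" and I: "ideal I R"
 shows "killed M I n = {x:carrier M. ALL r:ideal_power R I n. r *[M] x = 0[M]}"
proof (induction n)
 case 0
 thus ?case using M by (auto dest!: bspec[OF _ one_closed])
next
 case (Suc n)
 note P = idealD[OF ideal_ideal_power[OF I]]
 have 1: "r *[M] x = 0[M]" if x: "x:carrier M" "ALL c:I. ALL r:ideal_power R I n. r *[M] (c *[M] x) = 0[M]"
  and r: "r:ideal_prod R I (ideal_power R I n)" for r x
  using r
 proof (induction rule: ideal_prod.induct)
  case (prod i j)
  hence c: "i:carrier R" "j:carrier R" using idealD(1)[OF I] P(1) by auto
  thus ?case using x prod M m_comm[OF c] m_mult_smult[OF M c(2,1) x(1)] by simp
 next
  case (sum s t)
  hence "s:carrier R" "t:carrier R" using ideal_prod_in_carrier[OF I ideal_ideal_power[OF I]] by auto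
  thus ?case using sum x M by (simp add: m_add_smult)
 qed
 have 2: "r *[M] (c *[M] x) = 0[M]" if x: "x:carrier M" "ALL r:ideal_prod R I (ideal_power R I n). r *[M] x = 0[M]"
  and c: "c:I" and r: "r:ideal_power R I n" for r c x
 proof -
  have cr: "c:carrier R" "r:carrier R" using idealD(1)[OF I] P(1) c r by auto
  have "c \<otimes> r:ideal_prod R I (ideal_power R I n)" by (rule ideal_prod.prod[OF c r])
  thus ?thesis using x m_comm[OF cr] m_mult_smult[OF M cr(2,1) x(1)] by simp
 qed
 show ?case
 proof (intro equalityI subsetI)
  fix x assume "x:killed M I (Suc n)"
  hence "x:carrier M" "ALL c:I. ALL r:ideal_power R I n. r *[M] (c *[M] x) = 0[M]" by (simp_all add: Suc)
  thus "x:{x:carrier M. ALL r:ideal_power R I (Suc n). r *[M] x = 0[M]}" using 1 by simp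
 next
  fix x assume "x:{x:carrier M. ALL r:ideal_power R I (Suc n). r *[M] x = 0[M]}"
  hence x: "x:carrier M" "ALL r:ideal_prod R I (ideal_power R I n). r *[M] x = 0[M]" by simp_all
  show "x:killed M I (Suc n)"
   using x(1) 2[OF x] M idealD(1)[OF I] by (simp add: Suc subset_iff)
 qed
qed

lemma killed_finite:
 assumes M: "Md M" and S: "finite S" "S <= carrier R" and x: "x:carrier M" and n: "ALL c:S. EX n. c [^] (n :: nat) *[M] x = 0[M]"
 shows "EX n. x:killed M S n"
 using S n
proof (induction S rule: finite_induct)
 case empty
 show ?case by (intro exI[of _ "Suc 0"]) (simp add: x)
next
 case (insert c S)
 have S: "S <= carrier R" and c: "c:carrier R" using insert.prems(1) by auto
 obtain k where k: "x:killed M S k" using insert.IH[OF S] insert.prems(2) by blast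
 obtain m :: nat where m: "c [^] m *[M] x = 0[M]" using insert.prems(2) by blast
 note z = submoduleD(2)[OF M killed_submodule[OF M insert.prems(1)]]
 \<comment> \<open>Multiplication by \<open>c\<close> lowers \<open>m\<close>, multiplication by an
   element of \<open>S\<close> lowers \<open>k\<close>; so k + m factors suffice.\<close>
 have "x:carrier M ==> x:killed M S k ==> c [^] m *[M] x = 0[M] ==> k + m = N ==> x:killed M (insert c S) N" for x k m N
 proof (induction N arbitrary: x k m)
  case 0
  have "k = 0" using 0(4) by (rule add_is_0[THEN iffD1, THEN conjunct1])
  thus ?case using 0(2) by simp
 next
  case (Suc N)
  have 1: "c *[M] x:killed M (insert c S) N"
  proof (cases m)
   case 0
   hence "x = 0[M]" using Suc.prems(1,3) M by simp
   thus ?thesis using z c M by simp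
  next
   case (Suc m')
   hence "c [^] m' *[M] (c *[M] x) = 0[M]" using Suc.prems(1,3) m_mult_smult[OF M nat_pow_closed[OF c] c Suc.prems(1)] by simp
   thus ?thesis
    using Suc.IH[of "c *[M] x" k m'] Suc.prems(1,4) \<open>m = Suc m'\<close> m_smult[OF M c] submoduleD(4)[OF M killed_submodule[OF M S] c Suc.prems(2)] by simp
  qed
  have 2: "s *[M] x:killed M (insert c S) N" if s: "s:S" for s
  proof (cases k)
   case 0
   thus ?thesis using Suc.prems(2) z s S M by auto
  next
   case (Suc k')
   have sr: "s:carrier R" using s S by blast
   have "c [^] m *[M] (s *[M] x) = s *[M] (c [^] m *[M] x)"
    unfolding m_mult_smult[OF M sr nat_pow_closed[OF c] Suc.prems(1), symmetric] m_mult_smult[OF M nat_pow_closed[OF c] sr Suc.prems(1), symmetric] m_comm[OF sr nat_pow_closed[OF c]] ..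
   moreover have "s *[M] x:killed M S k'" using Suc.prems(2) \<open>k = Suc k'\<close> s by simp
   ultimately show ?thesis using Suc.IH[of "s *[M] x" k' m] Suc.prems(1,3,4) \<open>k = Suc k'\<close> sr M by simp
  qed
  show ?case using 1 2 Suc.prems(1) by simp
 qed
 from this[OF x k m refl] show ?case by blast
qed

definition tors :: "'a set => ('a, 'c) module => 'c set" where
 "tors I M = (\<Union>n. killed M I n)"

lemma torsE: assumes "x:tors I M" "y:tors I M" "Md M" "I <= carrier R" obtains n where "x:killed M I n" "y:killed M I n"
proof -
 from assms obtain m k where "x:killed M I m" "y:killed M I k" by (auto simp: tors_def)
 thus thesis using killed_mono[OF assms(3,4), of m "max m k"] killed_mono[OF assms(3,4), of k "max m k"] by (intro that[of "max m k"]) auto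
qed

lemma tors_submodule: assumes M: "Md M" and I: "I <= carrier R" shows "submodule (tors I M) R M"
proof (rule submoduleI'[OF M])
 note D = submoduleD[OF M killed_submodule[OF M I]]
 show "x +[M] y:tors I M" if xy: "x:tors I M" "y:tors I M" for x y
  using torsE[OF xy M I] D(3)[of x _ y] unfolding tors_def by (metis UN_iff UNIV_I)
 show "0[M]:tors I M" unfolding tors_def using D(2)[of 0] by blast
 show "tors I M <= carrier M" unfolding tors_def using D(1) by blast
 show "r *[M] x:tors I M" if "r:carrier R" "x:tors I M" for r x using D(4)[OF that(1)] that(2) unfolding tors_def by blast
qed

lemma module_tors: "Md M ==> I <= carrier R ==> Md (M\<lparr>carrier := tors I M\<rparr>)"
 by (rule module_sub[OF _ submoduleD(1-4)[OF _ tors_submodule]])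

lemma tors_hom: assumes "f:Hom M N" "Md M" "Md N" "I <= carrier R" "x:tors I M" shows "f x:tors I N"
 using assms(5) killed_hom[OF assms(1-4)] unfolding tors_def by blast

lemma tors_mod_hom: assumes f: "f:Hom M N" and M: "Md M" and N: "Md N" and I: "I <= carrier R"
 shows "f:Hom (M\<lparr>carrier := tors I M\<rparr>) (N\<lparr>carrier := tors I N\<rparr>)"
 by (rule mod_homI) (use submoduleD(1)[OF M tors_submodule[OF M I]] hom_add[OF f] hom_smult[OF f] tors_hom[OF f M N I] in \<open>auto simp: subset_iff\<close>)

lemma tors_pow: assumes M: "Md M" and I: "I <= carrier R" and x: "x:tors I M" and c: "c:I" shows "EX n::nat. c [^] n *[M] x = 0[M]"
proof -
 have cr: "c:carrier R" using I c by blast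
 have "x:killed M I n ==> c [^] n *[M] x = 0[M]" for n x
 proof (induction n arbitrary: x)
  case (Suc n)
  hence "c [^] n *[M] (c *[M] x) = 0[M]" using c by auto
  thus ?case using Suc.prems cr M by (simp add: m_mult_smult)
 qed (use M in simp)
 thus ?thesis using x unfolding tors_def by blast
qed

lemma pow_kill_mono: assumes "Md M" "x:carrier M" "c:carrier R" "c [^] (m :: nat) *[M] x = 0[M]" "m <= n"
 shows "c [^] n *[M] x = 0[M]"
proof -
 have "c [^] n = c [^] (n - m) \<otimes> c [^] m" using nat_pow_mult[OF assms(3), of "n - m" m] assms(5) by simp
 thus ?thesis using m_mult_smult[OF assms(1) nat_pow_closed[OF assms(3)] nat_pow_closed[OF assms(3)] assms(2)] assms(1,3,4) by simp
qed

text \<open>The ideal of all \<open>r\<close> such that \<open>r y\<close> is killed by a power of \<open>c\<close> is \<open>J = (0 : c\<^sup>N y)\<close> for some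
 \<open>N\<close>; then \<open>j + c\<^sup>N r \<mapsto> j y\<close> is well defined on \<open>J + c\<^sup>N R\<close>.\<close>

lemma baer_pow:
 fixes E :: "('a, 'c) module"
 assumes noeth: "noetherian_ring R" and E: "baer E" and y: "y:carrier E" and c: "c:carrier R"
 shows "EX y':carrier E. (EX n::nat. c [^] n *[E] y' = 0[E]) &
  (ALL r:carrier R. (EX n::nat. c [^] n *[E] (r *[E] y) = 0[E]) --> r *[E] y' = r *[E] y)"
proof -
 note mE = baer_module[OF E]
 define A where "A n = {r:carrier R. c [^] (n :: nat) *[E] (r *[E] y) = 0[E]}" for n
 have cn: "c [^] (n :: nat):carrier R" for n using c by simp
 have A: "ideal (A n) R" for n
 proof (rule idealI')
  show "r \<otimes> x:A n" if "r:carrier R" "x:A n" for r x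
  proof -
   have xr: "x:carrier R" using that by (simp add: A_def)
   have "c [^] n *[E] ((r \<otimes> x) *[E] y) = r *[E] (c [^] n *[E] (x *[E] y))"
    using m_mult_smult[OF mE cn m_closed[OF that(1) xr] y] m_mult_smult[OF mE that(1) m_closed[OF cn xr] y] m_mult_smult[OF mE cn xr y] m_lcomm[OF cn that(1) xr] by simp
   thus ?thesis using that xr mE by (simp add: A_def)
  qed
 qed (use mE y c in \<open>auto simp: A_def m_add_smult m_smult_add\<close>)
 have mono: "A m <= A n" if "m <= n" for m n using pow_kill_mono[OF mE _ c _ that] y mE by (auto simp: A_def)
 have W: "ideal (\<Union>n. A n) R"
 proof (rule idealI')
  fix x z assume "x:(\<Union>n. A n)" "z:(\<Union>n. A n)"
  then obtain m n where "x:A m" "z:A n" by blast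
  hence "x:A (max m n)" "z:A (max m n)" using mono[of m "max m n"] mono[of n "max m n"] by auto
  thus "x \<oplus> z:(\<Union>n. A n)" using idealD(3)[OF A[of "max m n"]] by blast
 next
  fix r x assume r: "r:carrier R" and "x:(\<Union>n. A n)"
  then obtain n where "x:A n" by blast
  thus "r \<otimes> x:(\<Union>n. A n)" using idealD(4)[OF A[of n] r] by blast
 next
  show "\<zero>:(\<Union>n. A n)" using idealD(2)[OF A[of 0]] by blast
 qed (auto simp: A_def)
 obtain S where S: "S <= carrier R" "finite S" "(\<Union>n. A n) = Idl S" using noetherian_ring.finetely_gen[OF noeth W] by blast
 have "ALL s:S. EX n. s:A n" using genideal_self[OF S(1)] S(3) by blast
 then obtain k where k: "!!s. s:S ==> s:A (k s)" using bchoice[of S "%s n. s:A n"] by blast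
 \<comment> \<open>A common exponent for the finitely many generators; the chain \<open>A\<close> is
   stationary from \<open>N\<close> on.\<close>
 define N where "N = Max (insert 0 (k ` S))"
 have "S <= A N"
 proof
  fix s assume s: "s:S"
  have "k s <= N" unfolding N_def using S(2) s by (intro Max_ge) auto
  thus "s:A N" using mono k[OF s] by blast
 qed
 hence AN: "A n <= A N" for n using genideal_minimal[OF A, of S N] S(3) by blast
 let ?D = "dsum ((ring_module R)\<lparr>carrier := A N\<rparr>) (ring_module R)"
 let ?d = "%x. fst x \<oplus> c [^] N \<otimes> snd x" and ?h = "%x :: 'a \<times> 'a. fst x *[E] y"
 note I = idealD[OF A[of N]]
 have mA: "Md ((ring_module R)\<lparr>carrier := A N\<rparr>)" by (rule module_sub[OF module_ring_module]) (use I in auto)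
 have sub: "j:carrier R" if "j:A N" for j using that I(1) by blast
 have fh: "fst:Hom ?D (ring_module R)" by (rule mod_homI) (use sub in auto)
 have "EX s:Hom (ring_module R) E. ALL x:carrier ?D. s (?d x) = ?h x"
 proof (rule baer_factor[OF E])
  show "Md ?D" using mA by simp
  show "?d:Hom ?D (ring_module R)"
   using hom_plus[OF fh hom_scale[OF hom_snd module_ring_module cn]] by simp
  show "?h:Hom ?D E" by (rule hom_comp[OF fh hom_mult[OF mE y]])
  fix x assume x: "x:carrier ?D" and d: "?d x = 0[ring_module R]"
  obtain j r where jr: "x = (j, r)" "j:A N" "j:carrier R" "r:carrier R" using x sub by (cases x) auto
  have e: "j *[E] y = ~[E] (c [^] N *[E] (r *[E] y))"
  proof (rule m_add_eq_zero[OF mE])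
   show "j *[E] y +[E] c [^] N *[E] (r *[E] y) = 0[E]"
    using d jr c y mE m_add_smult[OF mE jr(3), of "c [^] N \<otimes> r" y] by (simp add: m_mult_smult)
  qed (use jr y c mE in simp_all)
  \<comment> \<open>One more factor c^N kills the left side of j y = -c^N r y, so c^(2 N) kills r y.
    Stationarity puts \<open>r\<close> into \<open>A N\<close>, and then j y = 0.\<close>
  have "~[E] (c [^] (N + N) *[E] (r *[E] y)) = c [^] N *[E] (j *[E] y)"
   unfolding e using c jr y mE nat_pow_mult[OF c, of N N] m_assoc[OF cn[of N] cn[of N] jr(4)] by (simp add: m_smult_neg m_mult_smult[symmetric])
  hence "c [^] (N + N) *[E] (r *[E] y) = 0[E]"
   using jr(2) mE c jr y m_neg_neg[OF mE, of "c [^] (N + N) *[E] (r *[E] y)"] by (simp add: A_def)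
  hence "r:A N" using AN[of "N + N"] jr(4) by (auto simp: A_def)
  thus "?h x = 0[E]" using jr(1) e mE by (simp add: A_def)
 qed simp
 then obtain s where s: "s:Hom (ring_module R) E" "!!j r. j:A N ==> r:carrier R ==> s (j \<oplus> c [^] N \<otimes> r) = j *[E] y" by fastforce
 have s1: "r *[E] s \<one> = s r" if "r:carrier R" for r using hom_smult[OF s(1) that, of \<one>] that by simp
 show ?thesis
 proof (intro bexI[of _ "s \<one>"] conjI ballI impI)
  show "s \<one>:carrier E" using hom_closed[OF s(1), of \<one>] by simp
  show "EX n::nat. c [^] n *[E] s \<one> = 0[E]" using s1[OF cn[of N]] s(2)[OF I(2) one_closed] mE y cn[of N] by (intro exI[of _ N]) simp
  fix r assume r: "r:carrier R" "EX n::nat. c [^] n *[E] (r *[E] y) = 0[E]"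
  hence "r:A N" using AN by (auto simp: A_def)
  from s(2)[OF this zero_closed] show "r *[E] s \<one> = r *[E] y" using s1[OF r(1)] r(1) cn[of N] by simp
 qed
qed

text \<open>The element \<open>y\<close> is modified for the generators of \<open>I\<close> in turn.
  The multiples j y with j in \<open>J\<close> are torsion already, so each modification leaves them
  unchanged.\<close>

lemma baer_tors:
 fixes E :: "('a, 'c) module"
 assumes noeth: "noetherian_ring R" and E: "baer E" and I: "ideal I R"
 shows "baer (E\<lparr>carrier := tors I E\<rparr>)"
 unfolding baer_def
proof (intro conjI allI impI)
 note mE = baer_module[OF E]
 have Ic: "I <= carrier R" by (rule idealD(1)[OF I])
 show "Md (E\<lparr>carrier := tors I E\<rparr>)" by (rule module_tors[OF mE Ic])
 fix J f assume J: "ideal J R" and f: "f:Hom ((ring_module R)\<lparr>carrier := J\<rparr>) (E\<lparr>carrier := tors I E\<rparr>)"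
 have ft: "f j:tors I E" if "j:J" for j using hom_closed[OF f] that by simp
 have "f:Hom ((ring_module R)\<lparr>carrier := J\<rparr>) E"
  by (rule mod_homI) (use ft hom_add[OF f] hom_smult[OF f] submoduleD(1)[OF mE tors_submodule[OF mE Ic]] in auto)
 then obtain y where y: "y:carrier E" "ALL j:J. f j = j *[E] y" using E J unfolding baer_def by blast
 obtain S where S: "S <= carrier R" "finite S" "I = Idl S" using noetherian_ring.finetely_gen[OF noeth I] by blast
 have SI: "S <= I" using genideal_self[OF S(1)] S(3) by simp
 have "S' <= S ==> EX y':carrier E. (ALL c:S'. EX n::nat. c [^] n *[E] y' = 0[E]) & (ALL j:J. j *[E] y' = j *[E] y)" if "finite S'" for S'
  using that
 proof (induction S' rule: finite_induct)
  case empty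
  thus ?case using y by auto
 next
  case (insert c S')
  then obtain z where z: "z:carrier E" "ALL c:S'. EX n::nat. c [^] n *[E] z = 0[E]" "ALL j:J. j *[E] z = j *[E] y" by auto
  have c: "c:carrier R" "c:I" using insert.prems S SI by auto
  obtain z' where z': "z':carrier E" "EX n::nat. c [^] n *[E] z' = 0[E]"
   "!!r n. r:carrier R ==> c [^] (n::nat) *[E] (r *[E] z) = 0[E] ==> r *[E] z' = r *[E] z" using baer_pow[OF noeth E z(1) c(1)] by blast
  \<comment> \<open>Earlier generators are preserved: as d^n z = 0, \<open>z'\<close> agrees with
    \<open>z\<close> after multiplication by d^n.\<close>
  have "EX n::nat. d [^] n *[E] z' = 0[E]" if d: "d:S'" for d
  proof -
   obtain n :: nat where n: "d [^] n *[E] z = 0[E]" using z(2) d by blast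
   have "d [^] n:carrier R" using d insert.prems S by auto
   from z'(3)[OF this, of 0] n show ?thesis using mE by (intro exI[of _ n]) simp
  qed
  moreover have "j *[E] z' = j *[E] y" if j: "j:J" for j
  proof -
   obtain n :: nat where "c [^] n *[E] (f j) = 0[E]" using tors_pow[OF mE Ic ft[OF j] c(2)] by blast
   thus ?thesis using z'(3)[of j n] idealD(1)[OF J] j z(3) y(2) by auto
  qed
  ultimately show ?case using z' by auto
 qed
 from this[OF S(2) order_refl] obtain y' where y': "y':carrier E" "ALL c:S. EX n::nat. c [^] n *[E] y' = 0[E]" "ALL j:J. j *[E] y' = j *[E] y" by blast
 have "y':tors I E" using killed_finite[OF mE S(2,1) y'(1,2)] unfolding tors_def S(3) killed_genideal[OF mE S(1)] by blast
 thus "EX y:carrier (E\<lparr>carrier := tors I E\<rparr>). ALL j:J. f j = j *[E\<lparr>carrier := tors I E\<rparr>] y" using y(2) y'(3) by (intro bexI[of _ y']) simp_all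
qed

definition tors_cpx :: "'a set => ('a, 'c) cpx => ('a, 'c) cpx" where
 "tors_cpx I X = \<lparr>obj = (%i. (obj X i)\<lparr>carrier := tors I (obj X i)\<rparr>), dif = dif X\<rparr>"

lemma tors_cpx_simps [simp]: "obj (tors_cpx I X) i = (obj X i)\<lparr>carrier := tors I (obj X i)\<rparr>" "dif (tors_cpx I X) = dif X"
 by (simp_all add: tors_cpx_def)

lemma tors_in: "Md M ==> I <= carrier R ==> x:tors I M ==> x:carrier M"
 using submoduleD(1)[OF _ tors_submodule] by blast

lemma chain_complex_tors: assumes X: "CC X" and I: "I <= carrier R" shows "CC (tors_cpx I X)"
 by (rule chain_complexI) (use module_tors[OF cc_module[OF X] I] tors_mod_hom[OF cc_dif[OF X] cc_module[OF X] cc_module[OF X] I] d_d[OF X tors_in[OF cc_module[OF X] I]] in simp_all)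

lemma chain_map_tors: assumes f: "CM X Y f" and I: "I <= carrier R" shows "CM (tors_cpx I X) (tors_cpx I Y) f"
proof (rule chain_mapI[OF chain_complex_tors[OF cm_complex(1)[OF f] I] chain_complex_tors[OF cm_complex(2)[OF f] I]])
 note X = cm_complex(1)[OF f] and Y = cm_complex(2)[OF f]
 show "f i:Hom (obj (tors_cpx I X) i) (obj (tors_cpx I Y) i)" for i using tors_mod_hom[OF cm_hom[OF f] cc_module[OF X] cc_module[OF Y] I] by simp
 show "dif (tors_cpx I Y) i (f i x) = f (i - 1) (dif (tors_cpx I X) i x)" if "x:El (tors_cpx I X) i" for i x
  using cm_d[OF f tors_in[OF cc_module[OF X] I]] that by simp
qed

lemma htp_tors: assumes h: "htp X Y f g" and X: "CC X" and Y: "CC Y" and I: "I <= carrier R"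
 shows "htp (tors_cpx I X) (tors_cpx I Y) f g"
proof -
 obtain s where s: "homotopy X Y s" "!!i x. x:El X i ==> f i x = g i x +[obj Y i] hbd X Y s i x" using h by (rule htpE) blast
 show ?thesis
 proof (rule htpI[of _ _ s])
  show "homotopy (tors_cpx I X) (tors_cpx I Y) s"
   unfolding homotopy_def using tors_mod_hom[OF homotopy_hom[OF s(1)] cc_module[OF X] cc_module[OF Y] I] by simp
  show "f i x = g i x +[obj (tors_cpx I Y) i] hbd (tors_cpx I X) (tors_cpx I Y) s i x" if "x:El (tors_cpx I X) i" for i x
   using s(2)[OF tors_in[OF cc_module[OF X] I]] that by (simp add: hbd_def)
 qed
qed

lemma heq_tors: "heq X Y f g ==> I <= carrier R ==> heq (tors_cpx I X) (tors_cpx I Y) f g"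
 unfolding heq_def using chain_map_tors[of X Y f I] chain_map_tors[of Y X g I] htp_tors[of X X _ _ I] htp_tors[of Y Y _ _ I] cm_complex[of X Y f] by blast



section \<open>Noetherian induction on ideals, ideal multiples of modules, flatness\<close>

text \<open>The ideal J + r R.\<close>

definition iadd :: "'a set => 'a => 'a set" where
 "iadd J r = {j \<oplus> r \<otimes> s | j s. j:J & s:carrier R}"

lemma ideal_iadd: assumes J: "ideal J R" and r: "r:carrier R" shows "ideal (iadd J r) R"
proof (rule idealI')
 note I = idealD[OF J]
 have c: "j:J ==> j:carrier R" for j using I(1) by blast
 show "iadd J r <= carrier R" unfolding iadd_def using c r by auto
 show "\<zero>:iadd J r" unfolding iadd_def using I(2) r by (intro CollectI exI[of _ \<zero>]) simp
 show "x \<oplus> y:iadd J r" if xy: "x:iadd J r" "y:iadd J r" for x y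
 proof -
  obtain j s k t where e: "x = j \<oplus> r \<otimes> s" "y = k \<oplus> r \<otimes> t" "j:J" "k:J" "s:carrier R" "t:carrier R" using xy unfolding iadd_def by blast
  have "x \<oplus> y = (j \<oplus> k) \<oplus> r \<otimes> (s \<oplus> t)" unfolding e(1,2) using e(3-6) r c by algebra
  thus ?thesis unfolding iadd_def using e I(3) by blast
 qed
 show "t \<otimes> x:iadd J r" if t: "t:carrier R" and x: "x:iadd J r" for t x
 proof -
  obtain j s where e: "x = j \<oplus> r \<otimes> s" "j:J" "s:carrier R" using x unfolding iadd_def by blast
  have "t \<otimes> x = t \<otimes> j \<oplus> r \<otimes> (t \<otimes> s)" unfolding e(1) using e(2,3) r t c by algebra
  thus ?thesis unfolding iadd_def using e I(4) t by blast
 qed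
qed

lemma iadd_incl: assumes J: "ideal J R" and r: "r:carrier R" shows "J <= iadd J r" "r:iadd J r"
proof -
 note I = idealD[OF J]
 show "J <= iadd J r" unfolding iadd_def using I(1) r by (intro subsetI CollectI exI[of _ _] exI[of _ \<zero>]) auto
 show "r:iadd J r" unfolding iadd_def using I(2) r by (intro CollectI exI[of _ \<zero>] exI[of _ \<one>]) simp
qed

text \<open>A finitely generated ideal is reached from 0 by adding one generator at a time.\<close>

lemma noetherian_ideal_induct [consumes 2, case_names zero add]:
 assumes noeth: "noetherian_ring R" and I: "ideal I R" and z: "P {\<zero>}"
  and a: "!!J r. ideal J R ==> P J ==> r:carrier R ==> P (iadd J r)"
 shows "P I"
proof -
 obtain S where S: "S <= carrier R" "finite S" "I = Idl S" using noetherian_ring.finetely_gen[OF noeth I] by blast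
 have "S <= carrier R ==> P (Idl S)" if "finite S" for S
  using that
 proof (induction S rule: finite_induct)
  case empty
  have "Idl {} = {\<zero>}" using genideal_minimal[OF zeroideal, of "{}"] idealD(2)[OF genideal_ideal[of "{}"]] by auto
  thus ?case using z by simp
 next
  case (insert r S)
  have S: "S <= carrier R" and r: "r:carrier R" using insert.prems by auto
  note J = genideal_ideal[OF S] and K = genideal_ideal[OF insert.prems]
  have "Idl (insert r S) = iadd (Idl S) r"
  proof (rule equalityI)
   show "Idl (insert r S) <= iadd (Idl S) r"
    using genideal_self[OF S] iadd_incl[OF J r] by (intro genideal_minimal[OF ideal_iadd[OF J r]]) blast
   have 1: "Idl S <= Idl (insert r S)" "r:Idl (insert r S)"
    using genideal_minimal[OF K, of S] genideal_self[OF insert.prems] by auto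
   show "iadd (Idl S) r <= Idl (insert r S)"
   proof
    fix x assume "x:iadd (Idl S) r"
    then obtain j s where e: "x = j \<oplus> r \<otimes> s" "j:Idl S" "s:carrier R" unfolding iadd_def by blast
    have "s \<otimes> r:Idl (insert r S)" by (rule idealD(4)[OF K e(3) 1(2)])
    thus "x:Idl (insert r S)" unfolding e(1) m_comm[OF r e(3)] using idealD(3)[OF K] 1(1) e(2) by blast
   qed
  qed
  thus ?case using a[OF J insert.IH[OF S] r] by simp
 qed
 thus ?thesis using S by simp
qed

text \<open>The submodule J A.\<close>

definition imul :: "'a set => ('a, 'c) module => 'c set" where
 "imul J A = Span A {r *[A] x | r x. r:J & x:carrier A}"

lemma imul_submodule: "Md A ==> ideal J R ==> submodule (imul J A) R A"
 unfolding imul_def by (rule span_submodule) (auto dest!: idealD(1))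

lemma imul_gen: "r:J ==> x:carrier A ==> r *[A] x:imul J A"
 unfolding imul_def by (rule subsetD[OF span_incl]) blast

lemma imul_least: "submodule N R A ==> (!!r x. r:J ==> x:carrier A ==> r *[A] x:N) ==> imul J A <= N"
 unfolding imul_def by (rule span_minimal) auto

lemma imul_mono: "J <= J' ==> imul J A <= imul J' A"
 unfolding imul_def by (rule span_mono) auto

lemma imul_hom: assumes f: "f:Hom A B" and A: "Md A" and B: "Md B" and J: "ideal J R" and x: "x:imul J A"
 shows "f x:imul J B"
proof -
 have "imul J A <= {x:carrier A. f x:imul J B}"
  by (rule imul_least[OF vimage_submodule[OF f A B imul_submodule[OF B J]]])
   (use idealD(1)[OF J] A hom_smult[OF f] hom_closed[OF f] in \<open>auto simp: imul_gen subset_iff\<close>)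
 thus ?thesis using x by blast
qed

lemma imul_lift: assumes f: "f:Hom A B" and A: "Md A" and B: "Md B" and J: "ideal J R"
  and s: "!!y. y:carrier B ==> EX x:carrier A. f x = y" and y: "y:imul J B"
 shows "EX x:imul J A. f x = y"
proof -
 have "imul J B <= f ` imul J A"
 proof (rule imul_least[OF image_submodule[OF f A B imul_submodule[OF A J]]])
  fix r y assume r: "r:J" and "y:carrier B"
  then obtain x where x: "x:carrier A" "f x = y" using s by blast
  have "r *[B] y = f (r *[A] x)" using hom_smult[OF f _ x(1), of r] x r idealD(1)[OF J] by auto
  thus "r *[B] y:f ` imul J A" using imul_gen[OF r x(1)] by blast
 qed
 thus ?thesis using y by blast
qed

lemma imul_zero: "Md A ==> imul {\<zero>} A <= {0[A]}"
 by (rule imul_least[OF zero_submodule]) simp_all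

lemma imul_iadd: assumes A: "Md A" and J: "ideal J R" and r: "r:carrier R" and x: "x:imul (iadd J r) A"
 shows "EX u:imul J A. EX y:carrier A. x = u +[A] r *[A] y"
proof -
 have rs: "submodule ((%x. r *[A] x) ` carrier A) R A" by (rule image_submodule[OF hom_scale[OF hom_id A r] A A carrier_submodule[OF A]])
 have "imul (iadd J r) A <= {a +[A] b | a b. a:imul J A & b:(%x. r *[A] x) ` carrier A}"
 proof (rule imul_least[OF submodule_plus[OF A imul_submodule[OF A J] rs]])
  fix t x assume t: "t:iadd J r" and x: "x:carrier A"
  then obtain j s where e: "t = j \<oplus> r \<otimes> s" "j:J" "j:carrier R" "s:carrier R" unfolding iadd_def using idealD(1)[OF J] by blast
  have "t *[A] x = j *[A] x +[A] r *[A] (s *[A] x)" unfolding e(1) using e(3,4) r x A by (simp add: m_add_smult m_mult_smult)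
  thus "t *[A] x:{a +[A] b | a b. a:imul J A & b:(%x. r *[A] x) ` carrier A}"
   using imul_gen[OF e(2) x] m_smult[OF A e(4) x] by blast
 qed
 thus ?thesis using x by blast
qed

text \<open>The ideal quotient (J : r).\<close>

definition colon :: "'a set => 'a => 'a set" where
 "colon J r = {s:carrier R. r \<otimes> s:J}"

lemma ideal_colon: assumes J: "ideal J R" and r: "r:carrier R" shows "ideal (colon J r) R"
 by (rule idealI') (use idealD[OF J] r m_lcomm[OF r] in \<open>auto simp: colon_def r_distr\<close>)

lemma imul_colon: assumes A: "Md A" and J: "ideal J R" and r: "r:carrier R" and x: "x:imul (colon J r) A"
 shows "r *[A] x:imul J A"
proof -
 have "imul (colon J r) A <= {x:carrier A. r *[A] x:imul J A}"
 proof (rule imul_least[OF vimage_submodule[OF hom_scale[OF hom_id A r] A A imul_submodule[OF A J]]])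
  fix s x assume s: "s:colon J r" and x: "x:carrier A"
  thus "s *[A] x:{x:carrier A. r *[A] x:imul J A}"
   using imul_gen[of "r \<otimes> s" J x A] A r by (simp add: colon_def m_mult_smult)
 qed
 thus ?thesis using x by blast
qed

text \<open>The equational criterion: \<open>A\<close> is flat iff \<open>(JA : r) = (J : r)A\<close> for all ideals \<open>J\<close> and all \<open>r\<close>.\<close>

definition flat :: "('a, 'c) module => bool" where
 "flat A \<longleftrightarrow> Md A & (ALL J r x. ideal J R --> r:carrier R --> x:carrier A --> r *[A] x:imul J A --> x:imul (colon J r) A)"

lemma flatD: "flat A ==> ideal J R ==> r:carrier R ==> x:carrier A ==> r *[A] x:imul J A ==> x:imul (colon J r) A"
 by (simp add: flat_def)

text \<open>Elements of J F have all coordinates in \<open>J\<close>; conversely, an element with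
  its finitely many nonzero coordinates in (J : r) lies in (J : r) F.\<close>

lemma flat_free: fixes B :: "'s set" shows "flat (FM B)"
 unfolding flat_def
proof (intro conjI allI impI)
 let ?F = "FM B"
 show "Md ?F" by simp
 have mF: "Md ?F" by simp
 fix J r x assume J: "ideal J R" and r: "r:carrier R" and x: "x:carrier ?F" and rx: "r *[?F] x:imul J ?F"
 have "imul J ?F <= {ph:carrier ?F. ALL b. ph b:J}"
 proof (rule imul_least)
  show "submodule {ph:carrier ?F. ALL b. ph b:J} R ?F"
   by (rule submoduleI'[OF mF]) (use m_add[OF mF] m_smult[OF mF] m_zero[OF mF] idealD[OF J] in auto)
  show "s *[?F] ph:{ph:carrier ?F. ALL b. ph b:J}" if s: "s:J" and p: "ph:carrier ?F" for s ph
  proof -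
   have sr: "s:carrier R" using idealD(1)[OF J] s by blast
   have "s \<otimes> ph b:J" for b using idealD(4)[OF J _ s, of "ph b"] m_comm[OF sr, of "ph b"] p by simp
   thus ?thesis using m_smult[OF mF sr p] by simp
  qed
 qed
 hence c: "x b:colon J r" for b using rx x by (auto simp: colon_def)
 note K = imul_submodule[OF mF ideal_colon[OF J r]]
 have "ph:carrier ?F ==> (ALL b. ph b:colon J r) ==> {b. ph b ~= \<zero>} <= S ==> ph:imul (colon J r) ?F" if "finite S" for S ph
  using that
 proof (induction S arbitrary: ph rule: finite_induct)
  case empty
  hence "ph = 0[?F]" by auto
  thus ?case using submoduleD(2)[OF mF K] by simp
 next
  case (insert b S)
  show ?case
  proof (cases "ph b = \<zero>")
   case True
   thus ?thesis using insert.prems by (intro insert.IH) auto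
  next
   case False
   hence b: "b:B" using insert.prems(1) by auto
   let ?ps = "ph(b := \<zero>)"
   have "finite {s. ?ps s ~= \<zero>}" by (rule finite_subset[of _ "{s. ph s ~= \<zero>}"]) (use insert.prems(1) in auto)
   hence "?ps:carrier ?F" using insert.prems(1) by auto
   moreover have "ALL c. ?ps c:colon J r" using insert.prems(2) idealD(2)[OF ideal_colon[OF J r]] by simp
   ultimately have 1: "?ps:imul (colon J r) ?F" using insert.prems(3) by (intro insert.IH) auto
   have 2: "ph b *[?F] gen1 b:imul (colon J r) ?F" using insert.prems(2) by (intro imul_gen free_gen_carrier b) simp
   have "ph = ?ps +[?F] ph b *[?F] gen1 b" using insert.prems(1) by (auto simp: fun_eq_iff free_gen_def)
   thus ?thesis using submoduleD(3)[OF mF K 1 2] by simp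
  qed
 qed
 note ind = this
 show "x:imul (colon J r) ?F" by (rule ind[of "{b. x b ~= \<zero>}"]) (use x c in auto)
qed

lemma flat_dsum: assumes A: "flat A" and B: "flat B" shows "flat (dsum A B)"
 unfolding flat_def
proof (intro conjI allI impI)
 have m: "Md A" "Md B" using A B by (simp_all add: flat_def)
 show mS: "Md (dsum A B)" using m by simp
 fix J r x assume J: "ideal J R" and r: "r:carrier R" and x: "x:carrier (dsum A B)" and rx: "r *[dsum A B] x:imul J (dsum A B)"
 note C = ideal_colon[OF J r]
 have "r *[A] fst x:imul J A" "r *[B] snd x:imul J B"
  using imul_hom[OF hom_fst mS m(1) J rx] imul_hom[OF hom_snd mS m(2) J rx] by simp_all
 hence "fst x:imul (colon J r) A" "snd x:imul (colon J r) B" using x flatD[OF A J r, of "fst x"] flatD[OF B J r, of "snd x"] by auto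
 hence "(fst x, 0[B]) +[dsum A B] (0[A], snd x):imul (colon J r) (dsum A B)"
  by (intro submoduleD(3)[OF mS imul_submodule[OF mS C]] imul_hom[OF hom_inl[OF m] m(1) mS C] imul_hom[OF hom_inr[OF m] m(2) mS C])
 thus "x:imul (colon J r) (dsum A B)" using x m by auto
qed

section \<open>Maps between injectives: ideal multiples and flatness of Hom\<close>

definition vanishes :: "('a, 'c) cpx => 'a set => ('a, 'd) cpx => int => (int => 'c => 'd) => bool" where
 "vanishes M J U n f \<longleftrightarrow> (ALL i. ALL x:El M i. (ALL j:J. j *[obj M i] x = 0[obj M i]) --> f i x = 0[obj U (i + n)])"

text \<open>Induction on \<open>J\<close>. Suppose that \<open>f\<close> vanishes on the elements
  killed by J + r R. On the submodule (0 : J) of \<open>M\<close> it then kills the kernel of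
  \<open>r\<close>, so injectivity of \<open>U\<close> gives \<open>s\<close> with f = s r there.
  Now f - r s vanishes on (0 : J) and belongs to the J-multiples.\<close>

lemma imul_hom_cpx:
 fixes M :: "('a, 'c) cpx" and U :: "('a, 'd) cpx"
 assumes noeth: "noetherian_ring R" and M: "CC M" and U: "CC U" and b: "!!i. baer (obj U i)"
  and J: "ideal J R" and f: "f:El (HC M U) n"
 shows "f:imul J (obj (HC M U) n) \<longleftrightarrow> vanishes M J U n f"
proof
 let ?H = "obj (HC M U) n"
 have mH: "Md ?H" using M U by simp
 have "submodule {f:carrier ?H. vanishes M J U n f} R ?H"
  by (rule submoduleI'[OF mH]) (use m_zero[OF mH] m_add[OF mH] m_smult[OF mH] M U in \<open>auto simp: vanishes_def hom_cpx_ops\<close>)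
 hence "imul J ?H <= {f:carrier ?H. vanishes M J U n f}"
 proof (rule imul_least)
  fix r g assume r: "r:J" and g: "g:carrier ?H"
  have rr: "r:carrier R" using idealD(1)[OF J] r by blast
  have "vanishes M J U n (r *[?H] g)" unfolding vanishes_def
  proof (intro allI ballI impI)
   fix i x assume x: "x:El M i" "ALL j:J. j *[obj M i] x = 0[obj M i]"
   have "r *[obj U (i + n)] g i x = g i (r *[obj M i] x)" using hom_smult[OF hom_cpx_hom[OF g] rr x(1)] by simp
   also have "... = 0[obj U (i + n)]" using x(2) r hom_zero[OF hom_cpx_hom[OF g] cc_module[OF M] cc_module[OF U]] by simp
   finally show "(r *[?H] g) i x = 0[obj U (i + n)]" using x(1) by (simp add: hom_cpx_ops)
  qed
  thus "r *[?H] g:{f:carrier ?H. vanishes M J U n f}" using m_smult[OF mH rr g] by blast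
 qed
 thus "f:imul J ?H ==> vanishes M J U n f" by blast
 have "f:carrier ?H ==> vanishes M J U n f ==> f:imul J ?H"
  using noeth J
 proof (induction arbitrary: f rule: noetherian_ideal_induct)
  case zero
  have "f = 0[?H]"
   by (rule hom_cpx_ext[OF zero(1) m_zero[OF mH]]) (use zero(2) M in \<open>auto simp: vanishes_def hom_cpx_ops\<close>)
  thus ?case using submoduleD(2)[OF mH imul_submodule[OF mH zeroideal]] by simp
 next
  case (add J r)
  note f = add.prems(1)
  let ?A = "%i. {x:El M i. ALL j:J. j *[obj M i] x = 0[obj M i]}"
  have "EX s:Hom (obj M i) (obj U (i + n)). ALL x:carrier ((obj M i)\<lparr>carrier := ?A i\<rparr>). s (r *[obj M i] x) = f i x" for i
  proof (rule baer_factor[OF b])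
   have mM: "Md (obj M i)" using M by simp
   have jr: "j:J ==> j:carrier R" for j using idealD(1)[OF add.hyps(1)] by blast
   have "s *[obj M i] x:?A i" if s: "s:carrier R" and x: "x:?A i" for s x
    using x s mM jr m_mult_smult[OF mM s jr, of _ x] m_mult_smult[OF mM jr s, of _ x] m_comm[OF s jr] by auto
   thus "Md ((obj M i)\<lparr>carrier := ?A i\<rparr>)" by (intro module_sub[OF mM]) (use mM jr in \<open>auto simp: m_smult_add\<close>)
   show "Md (obj M i)" by (rule mM)
   have inc: "(%x. x):Hom ((obj M i)\<lparr>carrier := ?A i\<rparr>) (obj M i)" by (rule mod_homI) auto
   show "(%x. r *[obj M i] x):Hom ((obj M i)\<lparr>carrier := ?A i\<rparr>) (obj M i)" by (rule hom_scale[OF inc mM add.hyps(2)])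
   show "f i:Hom ((obj M i)\<lparr>carrier := ?A i\<rparr>) (obj U (i + n))" by (rule hom_comp[OF inc hom_cpx_hom[OF f]])
   fix x assume x: "x:carrier ((obj M i)\<lparr>carrier := ?A i\<rparr>)" and rx: "r *[obj M i] x = 0[obj M i]"
   have "j *[obj M i] x = 0[obj M i]" if "j:iadd J r" for j
   proof -
    obtain k s where e: "j = k \<oplus> r \<otimes> s" "k:J" "s:carrier R" using \<open>j:iadd J r\<close> unfolding iadd_def by blast
    show ?thesis unfolding e(1) m_comm[OF add.hyps(2) e(3)] using x rx e(2,3) jr[OF e(2)] add.hyps(2) mM by (simp add: m_add_smult m_mult_smult)
   qed
   thus "f i x = 0[obj U (i + n)]" using add.prems(2) x unfolding vanishes_def by simp
  qed
  then obtain s where s: "!!i. s i:Hom (obj M i) (obj U (i + n))" "!!i x. x:?A i ==> s i (r *[obj M i] x) = f i x" by simp metis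
  define g where "g i = restrict (s i) (El M i)" for i
  have g: "g:carrier ?H" unfolding hom_cpx_obj g_def using s(1) M by simp
  have rg: "r *[?H] g:carrier ?H" by (rule m_smult[OF mH add.hyps(2) g])
  note K = imul_submodule[OF mH ideal_iadd[OF add.hyps(1,2)]]
  have "f -[?H] r *[?H] g:imul J ?H"
  proof (rule add.IH[OF m_minus[OF mH f rg]])
   show "vanishes M J U n (f -[?H] r *[?H] g)" unfolding vanishes_def
   proof (intro allI ballI impI)
    fix i x assume x: "x:El M i" "ALL j:J. j *[obj M i] x = 0[obj M i]"
    have "(r *[?H] g) i x = f i x" using s(2)[of x i] x hom_smult[OF s(1) add.hyps(2) x(1)] by (simp add: hom_cpx_ops g_def)
    thus "(f -[?H] r *[?H] g) i x = 0[obj U (i + n)]"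
     unfolding hom_cpx_minus[OF M U rg x(1)] using m_minus_cancel[OF cc_module[OF U] hom_cpx_closed[OF f x(1)]] by simp
   qed
  qed
  hence 1: "f -[?H] r *[?H] g:imul (iadd J r) ?H" by (rule subsetD[OF imul_mono[OF iadd_incl(1)[OF add.hyps(1,2)]]])
  from submoduleD(3)[OF mH K 1 imul_gen[OF iadd_incl(2)[OF add.hyps(1,2)] g]]
  show ?case using m_minus_add_cancel[OF mH f rg] by simp
 qed
 thus "vanishes M J U n f ==> f:imul J ?H" using f by blast
qed

text \<open>For \<open>x\<close> killed by (J : r), the rule j + r t -> t x is well defined on J + r
  R. Injectivity of \<open>M\<close> extends it to \<open>R\<close>; the image m of 1 satisfies J m
  = 0 and r m = x. Since r f vanishes on elements killed by \<open>J\<close>, it follows that f x =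
  (r f) m = 0.\<close>

lemma flat_hom_cpx:
 fixes M :: "('a, 'c) cpx" and U :: "('a, 'd) cpx"
 assumes noeth: "noetherian_ring R" and M: "CC M" and U: "CC U" and b: "!!i. baer (obj U i)" and bM: "!!i. baer (obj M i)"
 shows "flat (obj (HC M U) n)"
 unfolding flat_def
proof (intro conjI allI impI)
 let ?H = "obj (HC M U) n"
 show mH: "Md ?H" using M U by simp
 fix J r f assume J: "ideal J R" and r: "r:carrier R" and f: "f:carrier ?H" and rf: "r *[?H] f:imul J ?H"
 have v: "vanishes M J U n (r *[?H] f)" using rf imul_hom_cpx[OF noeth M U b J m_smult[OF mH r f]] by blast
 have jr: "j:J ==> j:carrier R" for j using idealD(1)[OF J] by blast
 have "vanishes M (colon J r) U n f" unfolding vanishes_def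
 proof (intro allI ballI impI)
  fix i x assume x: "x:El M i" "ALL j:colon J r. j *[obj M i] x = 0[obj M i]"
  have mM: "Md (obj M i)" using M by simp
  let ?J = "(ring_module R)\<lparr>carrier := J\<rparr>"
  have mJ: "Md ?J" by (rule module_sub[OF module_ring_module]) (use idealD[OF J] in auto)
  have "EX s:Hom (ring_module R) (obj M i). ALL p:carrier (dsum ?J (ring_module R)). s (fst p \<oplus> r \<otimes> snd p) = snd p *[obj M i] x"
  proof (rule baer_factor[OF bM])
   show "Md (dsum ?J (ring_module R))" "Md (ring_module R)" using mJ by simp_all
   have fh: "fst:Hom (dsum ?J (ring_module R)) (ring_module R)" by (rule mod_homI) (use jr in auto)
   show "(%p. fst p \<oplus> r \<otimes> snd p):Hom (dsum ?J (ring_module R)) (ring_module R)"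
    using hom_plus[OF fh hom_scale[OF hom_snd module_ring_module r]] by simp
   show "(%p. snd p *[obj M i] x):Hom (dsum ?J (ring_module R)) (obj M i)" by (rule hom_comp[OF hom_snd hom_mult[OF mM x(1)]])
   fix p assume p: "p:carrier (dsum ?J (ring_module R))" and z: "fst p \<oplus> r \<otimes> snd p = 0[ring_module R]"
   have c: "fst p:J" "snd p:carrier R" using p by auto
   have "r \<otimes> snd p = \<ominus> fst p" using z c jr[OF c(1)] r minus_equality[of "r \<otimes> snd p" "fst p"] by (simp add: a_comm)
   also have "... = (\<ominus> \<one>) \<otimes> fst p" using jr[OF c(1)] by (simp add: l_minus)
   also have "...:J" by (rule idealD(4)[OF J _ c(1)]) simp
   finally show "snd p *[obj M i] x = 0[obj M i]" using x(2) c(2) by (simp add: colon_def)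
  qed
  then obtain s where s: "s:Hom (ring_module R) (obj M i)" and sp: "!!j t. j:J ==> t:carrier R ==> s (j \<oplus> r \<otimes> t) = t *[obj M i] x" by fastforce
  let ?m = "s \<one>"
  have m: "?m:El M i" using hom_closed[OF s, of \<one>] by simp
  have sm: "t *[obj M i] ?m = s t" if "t:carrier R" for t using hom_smult[OF s that, of \<one>] that by simp
  have "ALL j:J. j *[obj M i] ?m = 0[obj M i]" using sm sp[OF _ zero_closed] jr r x(1) mM by simp
  hence "(r *[?H] f) i ?m = 0[obj U (i + n)]" using v m unfolding vanishes_def by blast
  hence "f i (r *[obj M i] ?m) = 0[obj U (i + n)]" using m hom_smult[OF hom_cpx_hom[OF f] r m] by (simp add: hom_cpx_ops)
  moreover have "r *[obj M i] ?m = x" using sm[OF r] sp[OF idealD(2)[OF J] one_closed] r x(1) mM by simp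
  ultimately show "f i x = 0[obj U (i + n)]" by simp
 qed
 thus "f:imul (colon J r) ?H" using imul_hom_cpx[OF noeth M U b ideal_colon[OF J r] f] by blast
qed

section \<open>Purity, and exactness modulo powers of an ideal\<close>

lemma cycles_incl: "(%x. x):Hom (cycles X i) (obj X i)" by (rule mod_homI) simp_all

text \<open>The inclusion of the cycles into the chains stays injective modulo every ideal.\<close>

definition pure :: "('a, 'c) cpx => int => bool" where
 "pure X n \<longleftrightarrow> (ALL J x. ideal J R --> x:carrier (cycles X n) --> x:imul J (obj X n) --> x:imul J (cycles X n))"

lemma dif_cycles: assumes X: "CC X" shows "dif X n:Hom (obj X n) (cycles X (n - 1))"
 by (rule mod_homI) (use X in \<open>simp_all add: d_simps\<close>)

text \<open>Upwards from the degrees where \<open>X\<close> vanishes: purity in degree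
  \<open>n\<close> makes the cycles Z_n flat, and flatness of Z_n makes the kernel Z_(n+1) of
  X_(n+1) -> Z_n pure.\<close>

lemma flat_acyclic_pure:
 assumes noeth: "noetherian_ring R" and X: "CC X" and ac: "acyclic_cpx X" and fl: "!!i. flat (obj X i)"
  and b: "!!i. i < c ==> El X i = {0[obj X i]}"
 shows "pure X n"
proof -
 have mX: "Md (obj X i)" and mZ: "Md (cycles X i)" for i using X by simp_all
 have low: "pure X i" if "i < c" for i
  unfolding pure_def using submoduleD(2)[OF mZ imul_submodule[OF mZ]] b[OF that] by auto
 have step: "pure X (n + 1)" if p: "pure X n" for n
 proof -
  \<comment> \<open>The flatness criterion for Z_n: flatness of X_n puts \<open>x\<close> into (J :
    r) X_n, and purity brings it back into (J : r) Z_n.\<close>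
  have flZ: "x:imul (colon J r) (cycles X n)" if J: "ideal J R" and r: "r:carrier R" and x: "x:carrier (cycles X n)" and rx: "r *[obj X n] x:imul J (cycles X n)" for J r x
   using p[unfolded pure_def, rule_format, OF ideal_colon[OF J r] x] flatD[OF fl J r _ imul_hom[OF cycles_incl mZ mX J rx]] x by simp
  have d: "dif X (n + 1):Hom (obj X (n + 1)) (cycles X n)" using dif_cycles[OF X, of "n + 1"] by simp
  have surj: "EX x:El X (n + 1). dif X (n + 1) x = y" if "y:carrier (cycles X n)" for y
   using ac that unfolding acyclic_iff[OF X] by force
  show ?thesis unfolding pure_def
  proof (intro allI impI)
   fix J x assume "ideal J R" "x:carrier (cycles X (n + 1))" "x:imul J (obj X (n + 1))"
   with noeth show "x:imul J (cycles X (n + 1))"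
   proof (induction J arbitrary: x rule: noetherian_ideal_induct)
    case zero
    thus ?case using imul_zero[OF mX] submoduleD(2)[OF mZ imul_submodule[OF mZ zeroideal], of "n + 1"] by auto
   next
    case (add J r)
    note J = add.hyps(1) and r = add.hyps(2)
    let ?A = "obj X (n + 1)" let ?Z = "cycles X (n + 1)"
    obtain u y where uy: "u:imul J ?A" "y:carrier ?A" "x = u +[?A] r *[?A] y" using imul_iadd[OF mX J r add.prems(2)] by blast
    have u: "u:carrier ?A" using submoduleD(1)[OF mX imul_submodule[OF mX J]] uy(1) by blast
    have ry: "r *[?A] y:carrier ?A" using mX r uy(2) by simp
    have dy: "dif X (n + 1) y:carrier (cycles X n)" by (rule hom_closed[OF d uy(2)])
    have du: "dif X (n + 1) u:imul J (cycles X n)" by (rule imul_hom[OF d mX mZ J uy(1)])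
    have rdy: "r *[cycles X n] dif X (n + 1) y:carrier (cycles X n)" by (rule m_smult[OF mZ r dy])
    have "dif X (n + 1) u +[cycles X n] r *[cycles X n] dif X (n + 1) y = 0[cycles X n]"
     using add.prems(1) hom_add[OF d u ry] hom_smult[OF d r uy(2)] uy(3) by simp
    from m_add_eq_zero[OF mZ rdy hom_closed[OF d u]] this
    have "r *[cycles X n] dif X (n + 1) y = ~[cycles X n] dif X (n + 1) u" using m_comm'[OF mZ rdy hom_closed[OF d u]] by simp
    hence "r *[obj X n] dif X (n + 1) y:imul J (cycles X n)" using submoduleD(5)[OF mZ imul_submodule[OF mZ J] du] by simp
    \<comment> \<open>Since d x = 0 for x = u + r y, the element r d y is in J Z_n, so d y is in (J
      : r) Z_n and lifts to \<open>v\<close> in (J : r) X_(n+1). Then x = (u + r v) + r (y - v),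
      with u + r v in J X_(n+1) and y - v a cycle.\<close>
    from imul_lift[OF d mX mZ ideal_colon[OF J r] surj flZ[OF J r dy this]] obtain v where v: "v:imul (colon J r) ?A" "dif X (n + 1) v = dif X (n + 1) y" by blast
    have vc: "v:carrier ?A" using submoduleD(1)[OF mX imul_submodule[OF mX ideal_colon[OF J r]]] v(1) by blast
    let ?z = "y -[?A] v" let ?w = "u +[?A] r *[?A] v"
    have z: "?z:carrier ?Z" using uy(2) vc mX v(2) X d_minus[OF X uy(2) vc] m_minus_cancel[OF mX d_closed[OF X vc]] by simp
    have rv: "r *[?A] v:imul J ?A" by (rule imul_colon[OF mX J r v(1)])
    have w: "?w:imul J ?A" by (rule submoduleD(3)[OF mX imul_submodule[OF mX J] uy(1) rv])
    have x: "x = ?w +[?A] r *[?A] ?z" unfolding uy(3) using u uy(2) vc r mX[of "n + 1"] by algebra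
    have wz: "?w = x -[?A] r *[?A] ?z" unfolding uy(3) using u uy(2) vc r mX[of "n + 1"] by algebra
    have "?w:carrier ?Z" unfolding wz
     by (rule submoduleD(6)[OF mX submodule_cycles[OF X] add.prems(1) submoduleD(4)[OF mX submodule_cycles[OF X] r z]])
    from add.IH[OF this w] have 1: "?w:imul (iadd J r) ?Z" by (rule subsetD[OF imul_mono[OF iadd_incl(1)[OF J r]]])
    from submoduleD(3)[OF mZ imul_submodule[OF mZ ideal_iadd[OF J r]] 1 imul_gen[OF iadd_incl(2)[OF J r] z]]
    show ?case using x by simp
   qed
  qed
 qed
 have "pure X (c - 1 + int k)" for k
 proof (induction k)
  case (Suc k)
  thus ?case using step[of "c - 1 + int k"] by (simp add: add_ac)
 qed (use low in simp)
 from this[of "nat (n - c + 1)"] show ?thesis using low[of n] by (cases "n < c") simp_all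
qed

text \<open>Sequences of representatives of a point of the inverse limit of the modules A / I^k A;
  neighbouring indices are enough to state compatibility.\<close>

definition coherent :: "'a set => ('a, 'c) module => (nat => 'c) => bool" where
 "coherent I A x \<longleftrightarrow> (ALL k. x k:carrier A & x (Suc k) -[A] x k:imul (ideal_power R I k) A)"

lemma power_Suc_subset: "ideal I R ==> ideal_power R I (Suc k) <= ideal_power R I k"
 using ideal_prod_inter[OF _ ideal_ideal_power, of I I k] by auto

text \<open>Exactness after completion, in terms of representatives. Purity allows every correction
  of index \<open>k\<close> to be chosen in I^k times the module, and so the solution is again
  coherent.\<close>

lemma pro_acyclic:
 assumes X: "CC X" and ac: "acyclic_cpx X" and pu: "!!i. pure X i" and I: "ideal I R"
  and x: "coherent I (obj X n) x" and dx: "!!k. dif X n (x k):imul (ideal_power R I k) (obj X (n - 1))"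
 shows "EX y. coherent I (obj X (n + 1)) y & (ALL k. x k -[obj X n] dif X (n + 1) (y k):imul (ideal_power R I k) (obj X n))"
proof -
 have mX: "Md (obj X i)" and mZ: "Md (cycles X i)" for i using X by simp_all
 have xc: "x k:El X n" for k using x by (simp add: coherent_def)
 let ?J = "ideal_power R I"
 note J = ideal_ideal_power[OF I]
 note N = submoduleD[OF mX imul_submodule[OF mX J]]
 have surj: "EX x:El X (i + 1). dif X (i + 1) x = y" if "y:carrier (cycles X i)" for i y
  using ac that unfolding acyclic_iff[OF X] by force
 have d: "dif X (i + 1):Hom (obj X (i + 1)) (cycles X i)" for i using dif_cycles[OF X, of "i + 1"] by simp
 have lift: "EX v:imul (?J k) (obj X (i + 1)). dif X (i + 1) v = y" if "y:carrier (cycles X i)" "y:imul (?J k) (obj X i)" for i k y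
  by (rule imul_lift[OF d mX mZ J surj]) (use pu[of i] that J in \<open>auto simp: pure_def\<close>)
 \<comment> \<open>Purity lets \<open>x k\<close> be changed into an honest cycle \<open>z k\<close>
   without altering it modulo I^k.\<close>
 have "EX v:imul (?J k) (obj X n). dif X n v = dif X n (x k)" for k
  using lift[of "dif X n (x k)" "n - 1" k] dx[of k] hom_closed[OF dif_cycles[OF X] xc[of k]] by simp
 then obtain v where v: "!!k. v k:imul (?J k) (obj X n)" "!!k. dif X n (v k) = dif X n (x k)" by metis
 have vc: "v k:El X n" for k using subsetD[OF N(1) v(1)] .
 define z where "z k = x k -[obj X n] v k" for k
 have z: "z k:carrier (cycles X n)" for k
  using m_minus[OF mX xc[of k] vc[of k]] d_minus[OF X xc[of k] vc[of k]] m_minus_cancel[OF mX d_closed[OF X xc[of k]]] v(2)[of k] by (simp add: z_def)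
 have "EX w:imul (?J k) (obj X (n + 1)). dif X (n + 1) w = z (Suc k) -[obj X n] z k" for k
 proof (rule lift)
  show "z (Suc k) -[obj X n] z k:carrier (cycles X n)" by (rule submoduleD(6)[OF mX submodule_cycles[OF X] z z])
  have e: "z (Suc k) -[obj X n] z k = (x (Suc k) -[obj X n] x k) -[obj X n] (v (Suc k) -[obj X n] v k)"
   unfolding z_def using mX[of n] xc[of k] xc[of "Suc k"] vc[of k] vc[of "Suc k"] by algebra
  have "v (Suc k):imul (?J k) (obj X n)" using imul_mono[OF power_Suc_subset[OF I, of k], of "obj X n"] v(1)[of "Suc k"] by blast
  from N(6)[OF _ N(6)[OF this v(1)]] show "z (Suc k) -[obj X n] z k:imul (?J k) (obj X n)" unfolding e
   by this (use x in \<open>simp_all add: coherent_def\<close>)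
 qed
 then obtain w where w: "!!k. w k:imul (?J k) (obj X (n + 1))" "!!k. dif X (n + 1) (w k) = z (Suc k) -[obj X n] z k" by metis
 obtain y0 where y0: "y0:El X (n + 1)" "dif X (n + 1) y0 = z 0" using surj[OF z] by blast
 \<comment> \<open>A preimage of \<open>z 0\<close> plus lifts of the differences of neighbours in
   \<open>z\<close>, the k-th lift lying in I^k X.\<close>
 define y where "y = rec_nat y0 (%k a. a +[obj X (n + 1)] w k)"
 have ys: "y 0 = y0" "!!k. y (Suc k) = y k +[obj X (n + 1)] w k" by (simp_all add: y_def)
 have wc: "w k:El X (n + 1)" for k using subsetD[OF N(1) w(1)] .
 have y: "y k:El X (n + 1) & dif X (n + 1) (y k) = z k" for k
 proof (induction k)
  case (Suc k)
  have "dif X (n + 1) (y (Suc k)) = z k +[obj X n] (z (Suc k) -[obj X n] z k)"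
   unfolding ys(2) using Suc d_add[OF X, of "y k" "n + 1" "w k"] wc[of k] w(2)[of k] by simp
  also have "... = z (Suc k)" using mX[of n] z[of k] z[of "Suc k"] unfolding cycles_simps by algebra
  finally show ?case using Suc wc[of k] mX ys(2) by simp
 qed (use y0 ys in simp)
 show ?thesis
 proof (intro exI[of _ y] conjI allI)
  show "coherent I (obj X (n + 1)) y" unfolding coherent_def
  proof (intro allI conjI)
   fix k show "y k:El X (n + 1)" using y by blast
   have "y (Suc k) -[obj X (n + 1)] y k = w k" unfolding ys(2) using mX[of "n + 1"] y[of k, THEN conjunct1] wc[of k] by algebra
   thus "y (Suc k) -[obj X (n + 1)] y k:imul (?J k) (obj X (n + 1))" using w(1) by simp
  qed
  fix k
  have "x k -[obj X n] z k = v k" unfolding z_def using mX[of n] xc[of k] vc[of k] by algebra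
  thus "x k -[obj X n] dif X (n + 1) (y k):imul (?J k) (obj X n)" using y[of k] v(1)[of k] by simp
 qed
qed



section \<open>Tensor products with R/I^n\<close>

lemma cos_cong: fixes M :: "('a, 'c) module"
 assumes M: "Md M" and N: "submodule N R M" and x: "x:carrier M" and y: "y:carrier M"
 shows "N +>\<^bsub>M\<^esub> x = N +>\<^bsub>M\<^esub> y \<longleftrightarrow> x -[M] y:N"
 unfolding cos_eq[OF M N x y]
proof
 assume "EX n:N. x = n +[M] y"
 then obtain n where n: "n:N" "x = n +[M] y" by blast
 have nc: "n:carrier M" using submoduleD(1)[OF M N] n(1) by blast
 have "x -[M] y = n" unfolding n(2) using M nc y by algebra
 thus "x -[M] y:N" using n(1) by simp
next
 assume "x -[M] y:N"
 thus "EX n:N. x = n +[M] y" using m_minus_add_cancel[OF M x y] by (intro bexI[of _ "x -[M] y"]) simp_all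
qed

text \<open>Summation over the fibres of \<open>q\<close> is the linear extension of
  \<open>q\<close> on generators; this identifies the map of free modules inside
  \<open>tensor_map\<close> as linear.\<close>

lemma free_push:
 fixes q :: "'s => 't"
 assumes p: "ph:carrier (FM S)" and q: "!!s. s:S ==> q s:S'"
 shows "(%t. finsum R ph {s. ph s ~= \<zero> & q s = t}) = free_lift (FM S') (%s. gen1 (q s)) ph"
proof
 fix t
 let ?F = "FM S'"
 have mF: "Md ?F" by simp
 interpret F: abelian_group ?F by (rule module_abelian_group[OF mF])
 have "P <= S ==> finsum ?F (%s. ph s *[?F] gen1 (q s)) P t = finsum R ph {s:P. q s = t}" if "finite P" for P
  using that
 proof (induction P rule: finite_induct)
  case empty
  thus ?case by simp
 next
  case (insert a P)
  have c: "ph s:carrier R" for s using p by simp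
  have g: "ph s *[?F] gen1 (q s):carrier ?F" if "s:S" for s by (rule m_smult[OF mF c free_gen_carrier[OF q[OF that]]])
  have 1: "finsum ?F (%s. ph s *[?F] gen1 (q s)) (insert a P) = ph a *[?F] gen1 (q a) +[?F] finsum ?F (%s. ph s *[?F] gen1 (q s)) P"
   using insert.hyps insert.prems g by (intro F.finsum_insert) auto
  have 2: "{s:insert a P. q s = t} = (if q a = t then insert a {s:P. q s = t} else {s:P. q s = t})" by auto
  have 3: "finsum R ph {s:P. q s = t}:carrier R" using c by (intro finsum_closed) auto
  show ?case unfolding 1 2
   using insert c 3 finsum_insert[of "{s:P. q s = t}" a ph] by (auto simp: free_gen_def)
 qed
 note ind = this
 have "finite {s. ph s ~= \<zero>}" "{s. ph s ~= \<zero>} <= S" using p by auto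
 from ind[OF this] show "finsum R ph {s. ph s ~= \<zero> & q s = t} = free_lift ?F (%s. gen1 (q s)) ph t"
  by (simp add: free_lift_def)
qed

lemma bilinear_relationsI:
 fixes M :: "('a, 'c) module" and N :: "('a, 'd) module" defines "F \<equiv> free_pairs R M N"
 shows "x:carrier M ==> x':carrier M ==> y:carrier N ==>
   gen1 (x +[M] x', y) -[F] (gen1 (x, y) +[F] gen1 (x', y)):bilinear_relations R M N"
  and "x:carrier M ==> y:carrier N ==> y':carrier N ==>
   gen1 (x, y +[N] y') -[F] (gen1 (x, y) +[F] gen1 (x, y')):bilinear_relations R M N"
  and "r:carrier R ==> x:carrier M ==> y:carrier N ==>
   gen1 (r *[M] x, y) -[F] r *[F] gen1 (x, y):bilinear_relations R M N"
  and "r:carrier R ==> x:carrier M ==> y:carrier N ==>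
   gen1 (x, r *[N] y) -[F] r *[F] gen1 (x, y):bilinear_relations R M N"
 unfolding bilinear_relations_def F_def by blast+

lemma relations_carrier:
 assumes M: "Md M" and N: "Md N" shows "bilinear_relations R M N <= carrier (free_pairs R M N)"
proof -
 have m: "Md (free_pairs R M N)" by simp
 show ?thesis unfolding bilinear_relations_def
  by (intro Un_least subsetI; elim CollectE exE conjE; hypsubst; intro m_minus[OF m] m_add[OF m] m_smult[OF m] free_gen_carrier SigmaI m_add[OF M] m_add[OF N] m_smult[OF M] m_smult[OF N]; assumption)
qed

lemma tensor_kernel_submodule: "Md M ==> Md N ==> submodule (tensor_kernel R M N) R (free_pairs R M N)"
 unfolding tensor_kernel_def by (rule span_submodule[OF module_free_module relations_carrier])

lemma module_tensor: "Md M ==> Md N ==> Md (tensor R M N)"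
 unfolding tensor_def by (rule module_quot[OF module_free_module tensor_kernel_submodule])

definition tcos :: "('a, 'c) module => ('a, 'd) module => ('c \<times> 'd => 'a) => ('c \<times> 'd => 'a) set" where
 "tcos M N ph = tensor_kernel R M N +>\<^bsub>free_pairs R M N\<^esub> ph"

lemma tcos_hom: "Md M ==> Md N ==> tcos M N:Hom (free_pairs R M N) (tensor R M N)"
 unfolding tensor_def tcos_def[abs_def] by (rule quot_hom[OF module_free_module tensor_kernel_submodule])

lemma tcos_relation:
 assumes M: "Md M" and N: "Md N" and p: "ph:carrier (free_pairs R M N)" "ps:carrier (free_pairs R M N)"
  and r: "ph -[free_pairs R M N] ps:bilinear_relations R M N"
 shows "tcos M N ph = tcos M N ps"
 unfolding tcos_def cos_cong[OF module_free_module tensor_kernel_submodule[OF M N] p]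
 unfolding tensor_kernel_def by (rule subsetD[OF span_incl r])

definition tgen :: "('a, 'c) module => ('a, 'd) module => 'c => 'd => ('c \<times> 'd => 'a) set" where
 "tgen M N x y = tcos M N (gen1 (x, y))"

lemma tgen_bilinear:
 assumes M: "Md M" and N: "Md N"
 shows "x:carrier M ==> y:carrier N ==> tgen M N x y:carrier (tensor R M N)"
  and "x:carrier M ==> y:carrier N ==> y':carrier N ==> tgen M N x (y +[N] y') = tgen M N x y +[tensor R M N] tgen M N x y'"
  and "r:carrier R ==> x:carrier M ==> y:carrier N ==> tgen M N (r *[M] x) y = r *[tensor R M N] tgen M N x y"
  and "r:carrier R ==> x:carrier M ==> y:carrier N ==> tgen M N x (r *[N] y) = r *[tensor R M N] tgen M N x y"
proof -
 let ?F = "free_pairs R M N"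
 have mF: "Md ?F" by simp
 note h = tcos_hom[OF M N]
 have g: "gen1 (x, y):carrier ?F" if "x:carrier M" "y:carrier N" for x y by (rule free_gen_carrier) (use that in simp)
 show "x:carrier M ==> y:carrier N ==> tgen M N x y:carrier (tensor R M N)" unfolding tgen_def by (rule hom_closed[OF h g])
 show "tgen M N x (y +[N] y') = tgen M N x y +[tensor R M N] tgen M N x y'" if "x:carrier M" "y:carrier N" "y':carrier N"
  unfolding tgen_def hom_add[OF h g[OF that(1,2)] g[OF that(1,3)], symmetric]
  by (rule tcos_relation[OF M N g m_add[OF mF g g] bilinear_relationsI(2)[OF that]]) (use that N in simp_all)
 show "tgen M N (r *[M] x) y = r *[tensor R M N] tgen M N x y" if "r:carrier R" "x:carrier M" "y:carrier N"
  unfolding tgen_def hom_smult[OF h that(1) g[OF that(2,3)], symmetric]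
  by (rule tcos_relation[OF M N g m_smult[OF mF _ g] bilinear_relationsI(3)[OF that]]) (use that M in simp_all)
 show "tgen M N x (r *[N] y) = r *[tensor R M N] tgen M N x y" if "r:carrier R" "x:carrier M" "y:carrier N"
  unfolding tgen_def hom_smult[OF h that(1) g[OF that(2,3)], symmetric]
  by (rule tcos_relation[OF M N g m_smult[OF mF _ g] bilinear_relationsI(4)[OF that]]) (use that N in simp_all)
qed

text \<open>The preimage of a submodule is a submodule, so checking the four kinds of relations
  suffices. It serves both functoriality and maps out of the tensor product.\<close>

lemma tensor_kernel_image:
 fixes W :: "('a, 'w) module" and M :: "('a, 'c) module" and N :: "('a, 'd) module"
 assumes M: "Md M" and N: "Md N" and W: "Md W" and h: "h:Hom (free_pairs R M N) W" and S: "submodule S R W"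
  and rel: "!!x x' y. x:carrier M ==> x':carrier M ==> y:carrier N ==>
    h (gen1 (x +[M] x', y)) -[W] (h (gen1 (x, y)) +[W] h (gen1 (x', y))):S"
   "!!x y y'. x:carrier M ==> y:carrier N ==> y':carrier N ==>
    h (gen1 (x, y +[N] y')) -[W] (h (gen1 (x, y)) +[W] h (gen1 (x, y'))):S"
   "!!r x y. r:carrier R ==> x:carrier M ==> y:carrier N ==> h (gen1 (r *[M] x, y)) -[W] r *[W] h (gen1 (x, y)):S"
   "!!r x y. r:carrier R ==> x:carrier M ==> y:carrier N ==> h (gen1 (x, r *[N] y)) -[W] r *[W] h (gen1 (x, y)):S"
 shows "h ` tensor_kernel R M N <= S"
proof -
 let ?F = "free_pairs R M N"
 have mF: "Md ?F" by simp
 have g: "gen1 (x, y):carrier ?F" if "x:carrier M" "y:carrier N" for x y by (rule free_gen_carrier) (use that in simp)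
 note hm = hom_minus[OF h mF W] and ha = hom_add[OF h] and hs = hom_smult[OF h]
 have "bilinear_relations R M N <= {ph:carrier ?F. h ph:S}"
 proof
  fix \<rho> assume r: "\<rho>:bilinear_relations R M N"
  have "h \<rho>:S" using r unfolding bilinear_relations_def Un_iff
  proof (elim disjE CollectE exE conjE)
   fix x x' y assume "\<rho> = gen1 (x +[M] x', y) -[?F] (gen1 (x, y) +[?F] gen1 (x', y))" and c: "x:carrier M" "x':carrier M" "y:carrier N"
   thus ?thesis using rel(1)[OF c] hm[OF g m_add[OF mF g g], of "x +[M] x'" y x y x' y] ha[OF g g, of x y x' y] M by simp
  next
   fix x y y' assume "\<rho> = gen1 (x, y +[N] y') -[?F] (gen1 (x, y) +[?F] gen1 (x, y'))" and c: "x:carrier M" "y:carrier N" "y':carrier N"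
   thus ?thesis using rel(2)[OF c] hm[OF g m_add[OF mF g g], of x "y +[N] y'" x y x y'] ha[OF g g, of x y x y'] N by simp
  next
   fix s x y assume "\<rho> = gen1 (s *[M] x, y) -[?F] s *[?F] gen1 (x, y)" and c: "s:carrier R" "x:carrier M" "y:carrier N"
   thus ?thesis using rel(3)[OF c] hm[OF g m_smult[OF mF c(1) g], of "s *[M] x" y x y] hs[OF c(1) g, of x y] M by simp
  next
   fix s x y assume "\<rho> = gen1 (x, s *[N] y) -[?F] s *[?F] gen1 (x, y)" and c: "s:carrier R" "x:carrier M" "y:carrier N"
   thus ?thesis using rel(4)[OF c] hm[OF g m_smult[OF mF c(1) g], of x "s *[N] y" x y] hs[OF c(1) g, of x y] N by simp
  qed
  thus "\<rho>:{ph:carrier ?F. h ph:S}" using r relations_carrier[OF M N] by blast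
 qed
 from span_minimal[OF vimage_submodule[OF h mF W S] this] show ?thesis unfolding tensor_kernel_def by blast
qed

lemma tensor_map_tgen:
 fixes M :: "('a, 'c) module" and N :: "('a, 'd) module" and M' :: "('a, 'e) module" and N' :: "('a, 'f) module"
 assumes M: "Md M" and N: "Md N" and M': "Md M'" and N': "Md N'"
  and f: "f:Hom M M'" and g: "g:Hom N N'" and x: "x:carrier M" and y: "y:carrier N"
 shows "tensor_map R M' N' f g (tgen M N x y) = tgen M' N' (f x) (g y)"
proof -
 let ?F = "free_pairs R M N" and ?G = "free_pairs R M' N'"
 let ?w = "%p. gen1 (map_prod f g p) :: 'e \<times> 'f => 'a"
 let ?push = "%ph t. finsum R ph {p. ph p ~= \<zero> & map_prod f g p = t}"
 have mF: "Md ?F" and mG: "Md ?G" by simp_all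
 have q: "p:carrier M \<times> carrier N ==> map_prod f g p:carrier M' \<times> carrier N'" for p by (auto intro: hom_closed[OF f] hom_closed[OF g])
 have gc: "gen1 (x, y):carrier ?F" if "x:carrier M" "y:carrier N" for x y by (rule free_gen_carrier) (use that in simp)
 have w: "?w p:carrier ?G" if "p:carrier M \<times> carrier N" for p by (rule free_gen_carrier[OF q[OF that]])
 have l: "free_lift ?G ?w:Hom ?F ?G" by (rule free_lift(1)[OF mG w])
 have lw: "free_lift ?G ?w (gen1 p) = ?w p" if "p:carrier M \<times> carrier N" for p by (rule free_lift(2)[OF mG w that])
 have e: "?push ph = free_lift ?G ?w ph" if "ph:carrier ?F" for ph by (rule free_push[OF that q])
 have h: "?push:Hom ?F ?G" by (rule mod_hom_cong[OF l mF e])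
 have v: "?push (gen1 (x, y)) = gen1 (f x, g y)" if "x:carrier M" "y:carrier N" for x y
  unfolding e[OF gc[OF that]] using lw[of "(x, y)"] that by simp
 have K: "?push ` tensor_kernel R M N <= tensor_kernel R M' N'"
 proof (rule tensor_kernel_image[OF M N mG h tensor_kernel_submodule[OF M' N']])
  have *: "bilinear_relations R M' N' <= tensor_kernel R M' N'" unfolding tensor_kernel_def by (rule span_incl)
  show "?push (gen1 (x +[M] x', y)) -[?G] (?push (gen1 (x, y)) +[?G] ?push (gen1 (x', y))):tensor_kernel R M' N'"
   if c: "x:carrier M" "x':carrier M" "y:carrier N" for x x' y
   unfolding v[OF m_add[OF M c(1,2)] c(3)] v[OF c(1,3)] v[OF c(2,3)] hom_add[OF f c(1,2)]
   by (rule subsetD[OF * bilinear_relationsI(1)[OF hom_closed[OF f c(1)] hom_closed[OF f c(2)] hom_closed[OF g c(3)]]])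
  show "?push (gen1 (x, y +[N] y')) -[?G] (?push (gen1 (x, y)) +[?G] ?push (gen1 (x, y'))):tensor_kernel R M' N'"
   if c: "x:carrier M" "y:carrier N" "y':carrier N" for x y y'
   unfolding v[OF c(1) m_add[OF N c(2,3)]] v[OF c(1,2)] v[OF c(1,3)] hom_add[OF g c(2,3)]
   by (rule subsetD[OF * bilinear_relationsI(2)[OF hom_closed[OF f c(1)] hom_closed[OF g c(2)] hom_closed[OF g c(3)]]])
  show "?push (gen1 (r *[M] x, y)) -[?G] r *[?G] ?push (gen1 (x, y)):tensor_kernel R M' N'"
   if c: "r:carrier R" "x:carrier M" "y:carrier N" for r x y
   unfolding v[OF m_smult[OF M c(1,2)] c(3)] v[OF c(2,3)] hom_smult[OF f c(1,2)]
   by (rule subsetD[OF * bilinear_relationsI(3)[OF c(1) hom_closed[OF f c(2)] hom_closed[OF g c(3)]]])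
  show "?push (gen1 (x, r *[N] y)) -[?G] r *[?G] ?push (gen1 (x, y)):tensor_kernel R M' N'"
   if c: "r:carrier R" "x:carrier M" "y:carrier N" for r x y
   unfolding v[OF c(2) m_smult[OF N c(1,3)]] v[OF c(2,3)] hom_smult[OF g c(1,3)]
   by (rule subsetD[OF * bilinear_relationsI(4)[OF c(1) hom_closed[OF f c(2)] hom_closed[OF g c(3)]]])
 qed
 show ?thesis unfolding tensor_map_def tgen_def tcos_def
  using quot_map_hom[OF mF tensor_kernel_submodule[OF M N] mG tensor_kernel_submodule[OF M' N'] h K gc[OF x y]] v[OF x y] by simp
qed

lemma ideal_submodule: assumes J: "ideal J R" shows "submodule J R (ring_module R)"
 by (rule submoduleI'[OF module_ring_module]) (use idealD[OF J] in auto)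

abbreviation "Q I n \<equiv> quot_power R I n"

lemma module_Q: "ideal I R ==> Md (Q I n)"
 by (rule module_quot[OF module_ring_module ideal_submodule[OF ideal_ideal_power]])

definition qcos :: "'a set => nat => 'a => 'a set" where
 "qcos I n r = ideal_power R I n +>\<^bsub>ring_module R\<^esub> r"

lemma qcos_hom: "ideal I R ==> qcos I n:Hom (ring_module R) (Q I n)"
 unfolding qcos_def[abs_def] by (rule quot_hom[OF module_ring_module ideal_submodule[OF ideal_ideal_power]])

lemma qcos_carrier: "carrier (Q I n) = qcos I n ` carrier R"
 unfolding quot_carrier qcos_def by simp

lemma qcos_smult: "ideal I R ==> r:carrier R ==> qcos I n r = r *[Q I n] qcos I n \<one>"
 using hom_smult[OF qcos_hom, of I r \<one> n] by simp

lemma power_antimono: assumes I: "ideal I R" and mn: "m <= n" shows "ideal_power R I n <= ideal_power R I m"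
 using lift_Suc_antimono_le[of "ideal_power R I", OF _ mn] power_Suc_subset[OF I] by blast

lemma quot_proj_hom:
 assumes I: "ideal I R" and mn: "m <= n"
 shows "r:carrier R ==> quot_power_proj R I m (qcos I n r) = qcos I m r" and "quot_power_proj R I m:Hom (Q I n) (Q I m)"
proof -
 note P = ideal_submodule[OF ideal_ideal_power[OF I]]
 show 1: "quot_power_proj R I m (qcos I n r) = qcos I m r" if "r:carrier R" for r
  unfolding qcos_def by (rule quot_map_hom[OF module_ring_module P module_ring_module P hom_id]) (use power_antimono[OF I mn] that in auto)
 note h = qcos_hom[OF I]
 show "quot_power_proj R I m:Hom (Q I n) (Q I m)"
 proof (rule mod_homI)
  fix A assume "A:carrier (Q I n)"
  then obtain r where r: "r:carrier R" "A = qcos I n r" unfolding qcos_carrier by blast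
  show "quot_power_proj R I m A:carrier (Q I m)" unfolding r(2) 1[OF r(1)] using hom_closed[OF h] r(1) by simp
  show "quot_power_proj R I m (s *[Q I n] A) = s *[Q I m] quot_power_proj R I m A" if s: "s:carrier R" for s
   using hom_smult[OF h s, of r n] hom_smult[OF h s, of r m] 1[of r] 1[of "s \<otimes> r"] r s by simp
  fix B assume "B:carrier (Q I n)"
  then obtain t where t: "t:carrier R" "B = qcos I n t" unfolding qcos_carrier by blast
  show "quot_power_proj R I m (A +[Q I n] B) = quot_power_proj R I m A +[Q I m] quot_power_proj R I m B"
   using hom_add[OF h, of r t n] hom_add[OF h, of r t m] 1[of r] 1[of t] 1[of "r \<oplus> t"] r t by simp
 qed
qed

text \<open>The element 1 \<otimes> x of R/I^n \<otimes> A; every element has this form, by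
  \<open>tone_surj\<close>.\<close>

definition tone :: "'a set => ('a, 'c) module => nat => 'c => ('a set \<times> 'c => 'a) set" where
 "tone I A n x = tgen (Q I n) A (qcos I n \<one>) x"

lemma one_closed_Q: "ideal I R ==> qcos I n \<one>:carrier (Q I n)" unfolding qcos_carrier by simp

lemma tone_hom: assumes I: "ideal I R" and A: "Md A" shows "tone I A n:Hom A (tensor R (Q I n) A)"
 by (rule mod_homI) (simp_all add: tone_def tgen_bilinear[OF module_Q[OF I] A] one_closed_Q[OF I])

lemma tone_surj: assumes I: "ideal I R" and A: "Md A" and s: "s:carrier (tensor R (Q I n) A)"
 shows "EX x:carrier A. s = tone I A n x"
proof -
 note mQ = module_Q[OF I, of n]
 have "EX x:carrier A. tcos (Q I n) A ph = tone I A n x" if "ph:carrier (free_pairs R (Q I n) A)" for ph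
  using that
 proof (induction rule: free_induct)
  case zero
  have "tcos (Q I n) A (%s. \<zero>) = 0[tensor R (Q I n) A]"
   using hom_zero[OF tcos_hom[OF mQ A] module_free_module module_tensor[OF mQ A]] by simp
  thus ?case using hom_zero[OF tone_hom[OF I A] A module_tensor[OF mQ A]] A by (intro bexI[of _ "0[A]"]) simp_all
 next
  case (step r b x)
  obtain y where y: "y:carrier A" "tcos (Q I n) A x = tone I A n y" using step by blast
  obtain s m where b: "b = (qcos I n s, m)" "s:carrier R" "m:carrier A" using step(2) unfolding qcos_carrier by auto
  have g: "gen1 b:carrier (free_pairs R (Q I n) A)" by (rule free_gen_carrier[OF step(2)])
  have "tcos (Q I n) A (gen1 b) = tone I A n (s *[A] m)"
   unfolding b(1) tgen_def[symmetric] tone_def using tgen_bilinear(3,4)[OF mQ A b(2) one_closed_Q[OF I] b(3)] qcos_smult[OF I b(2)] by simp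
  hence "tcos (Q I n) A (r *[free_pairs R (Q I n) A] gen1 b +[free_pairs R (Q I n) A] x) = tone I A n (r *[A] (s *[A] m) +[A] y)"
   using hom_add[OF tcos_hom[OF mQ A] m_smult[OF module_free_module step(1) g] step(3)] hom_smult[OF tcos_hom[OF mQ A] step(1) g]
    hom_add[OF tone_hom[OF I A, of n], of "r *[A] (s *[A] m)" y] hom_smult[OF tone_hom[OF I A, of n] step(1), of "s *[A] m"] y b A step(1) by simp
  thus ?case using A y(1) b step(1) by (intro bexI[of _ "r *[A] (s *[A] m) +[A] y"]) simp_all
 qed
 moreover obtain ph where "ph:carrier (free_pairs R (Q I n) A)" "s = tcos (Q I n) A ph"
  using s unfolding tensor_def quot_carrier tcos_def by blast
 ultimately show ?thesis by blast
qed

text \<open>Together with \<open>tone_surj\<close> this identifies R/I^n \<otimes> A with A / I^n A.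
  The kernel is bounded from above by a bilinear map to A / I^n A.\<close>

lemma tone_kernel: fixes A :: "('a, 'c) module" assumes I: "ideal I R" and A: "Md A" and x: "x:carrier A"
 shows "tone I A n x = 0[tensor R (Q I n) A] \<longleftrightarrow> x:imul (ideal_power R I n) A"
proof
 let ?J = "ideal_power R I n" let ?T = "tensor R (Q I n) A" let ?F = "free_pairs R (Q I n) A" let ?N = "imul ?J A"
 note J = ideal_ideal_power[OF I, of n] and mQ = module_Q[OF I, of n]
 note N = imul_submodule[OF A J] and t = tone_hom[OF I A, of n]
 have mT: "Md ?T" by (rule module_tensor[OF mQ A])
 have "imul ?J A <= {x:carrier A. tone I A n x:{0[?T]}}"
 proof (rule imul_least[OF vimage_submodule[OF t A mT zero_submodule[OF mT]]])
  fix r y assume r: "r:?J" and y: "y:carrier A"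
  have rr: "r:carrier R" using idealD(1)[OF J] r by blast
  have "ideal_power R I n +>\<^bsub>ring_module R\<^esub> r = ideal_power R I n +>\<^bsub>ring_module R\<^esub> 0[ring_module R]"
   unfolding cos_eq[OF module_ring_module ideal_submodule[OF J] rr[folded ring_module_simps(1)] m_zero[OF module_ring_module]]
   by (rule bexI[OF _ r]) (simp add: rr)
  hence "qcos I n r = 0[Q I n]" unfolding qcos_def quot_zero cos_zero[OF module_ring_module ideal_submodule[OF J]] .
  hence 1: "r *[Q I n] qcos I n \<one> = \<zero> *[Q I n] qcos I n \<one>"
   unfolding qcos_smult[OF I rr] m_zero_smult[OF mQ one_closed_Q[OF I]] .
  have "tone I A n (r *[A] y) = tgen (Q I n) A (r *[Q I n] qcos I n \<one>) y"
   unfolding tone_def tgen_bilinear(3)[OF mQ A rr one_closed_Q[OF I] y] by (rule tgen_bilinear(4)[OF mQ A rr one_closed_Q[OF I] y])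
  also have "... = \<zero> *[?T] tone I A n y" unfolding 1 tone_def by (rule tgen_bilinear(3)[OF mQ A zero_closed one_closed_Q[OF I] y])
  also have "... = 0[?T]" by (rule m_zero_smult[OF mT hom_closed[OF t y]])
  finally show "r *[A] y:{x:carrier A. tone I A n x:{0[?T]}}" using m_smult[OF A rr y] by simp
 qed
 thus "x:imul ?J A ==> tone I A n x = 0[?T]" by blast
 assume z: "tone I A n x = 0[?T]"
 let ?M = "quot_module A ?N" let ?c = "%x. ?N +>\<^bsub>A\<^esub> x"
 have mM: "Md ?M" by (rule module_quot[OF A N])
 note ch = quot_hom[OF A N]
 \<comment> \<open>The bilinear map (s, m) -> s m modulo I^n A, given on a coset of scalars by
   \<open>quot_map\<close>.\<close>
 define w where "w p = quot_map A ?N (%s. s *[A] snd p) (fst p)" for p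
 have wc: "w (qcos I n s, m) = ?c (s *[A] m)" if "s:carrier R" "m:carrier A" for s m
  unfolding w_def fst_conv snd_conv qcos_def
  by (rule quot_map_hom[OF module_ring_module ideal_submodule[OF J] A N hom_mult[OF A that(2)]]) (use that in \<open>auto intro: imul_gen\<close>)
 have wcl: "w p:carrier ?M" if "p:carrier (Q I n) \<times> carrier A" for p
 proof -
  obtain u m where u: "p = (qcos I n u, m)" "u:carrier R" "m:carrier A" using \<open>p:_\<close> unfolding qcos_carrier by blast
  show ?thesis unfolding u(1) wc[OF u(2,3)] by (rule hom_closed[OF ch m_smult[OF A u(2,3)]])
 qed
 have l: "free_lift ?M w:Hom ?F ?M" by (rule free_lift(1)[OF mM wcl])
 have lw: "free_lift ?M w (gen1 p) = w p" if "p:carrier (Q I n) \<times> carrier A" for p by (rule free_lift(2)[OF mM wcl that])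
 have lg: "free_lift ?M w (gen1 (qcos I n s, m)) = ?c (s *[A] m)" if "s:carrier R" "m:carrier A" for s m
  using lw[of "(qcos I n s, m)"] wc[OF that] that by (simp add: qcos_carrier)
 have cl: "?c y:carrier ?M" if "y:carrier A" for y using hom_closed[OF ch that] .
 note qh = qcos_hom[OF I, of n]
 have "free_lift ?M w ` tensor_kernel R (Q I n) A <= {0[?M]}"
 proof (rule tensor_kernel_image[OF mQ A mM l zero_submodule[OF mM]], goal_cases)
  case (1 S T y)
  then obtain s u where s: "s:carrier R" "S = qcos I n s" "u:carrier R" "T = qcos I n u" unfolding qcos_carrier by blast
  have "S +[Q I n] T = qcos I n (s \<oplus> u)" using hom_add[OF qh, of s u] s by simp
  moreover have "?c ((s \<oplus> u) *[A] y) = ?c (s *[A] y) +[?M] ?c (u *[A] y)" using hom_add[OF ch, of "s *[A] y" "u *[A] y"] m_add_smult[OF A s(1,3) 1(3)] A 1(3) s by simp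
  ultimately show ?case using s 1(3) A lg m_minus_cancel[OF mM m_add[OF mM cl cl], of "s *[A] y" "u *[A] y"] by simp
 next
  case (2 S y z)
  then obtain s where s: "s:carrier R" "S = qcos I n s" unfolding qcos_carrier by blast
  have "?c (s *[A] (y +[A] z)) = ?c (s *[A] y) +[?M] ?c (s *[A] z)" using hom_add[OF ch, of "s *[A] y" "s *[A] z"] m_smult_add[OF A s(1) 2(2,3)] A 2 s by simp
  thus ?case using s 2 A lg m_minus_cancel[OF mM m_add[OF mM cl cl], of "s *[A] y" "s *[A] z"] by simp
 next
  case (3 r S y)
  then obtain s where s: "s:carrier R" "S = qcos I n s" unfolding qcos_carrier by blast
  have "r *[Q I n] S = qcos I n (r \<otimes> s)" using hom_smult[OF qh 3(1), of s] s by simp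
  moreover have "?c ((r \<otimes> s) *[A] y) = r *[?M] ?c (s *[A] y)" using hom_smult[OF ch 3(1), of "s *[A] y"] m_mult_smult[OF A 3(1) s(1) 3(3)] A 3 s by simp
  ultimately show ?case using s 3 A lg m_minus_cancel[OF mM m_smult[OF mM 3(1) cl], of "s *[A] y"] by simp
 next
  case (4 r S y)
  then obtain s where s: "s:carrier R" "S = qcos I n s" unfolding qcos_carrier by blast
  have "?c (s *[A] (r *[A] y)) = r *[?M] ?c (s *[A] y)"
   using hom_smult[OF ch 4(1), of "s *[A] y"] m_mult_smult[OF A 4(1) s(1) 4(3)] m_mult_smult[OF A s(1) 4(1,3)] m_comm[OF s(1) 4(1)] A 4 s by simp
  thus ?case using s 4 A lg m_minus_cancel[OF mM m_smult[OF mM 4(1) cl], of "s *[A] y"] by simp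
 qed
 moreover have "gen1 (qcos I n \<one>, x):tensor_kernel R (Q I n) A"
 proof -
  have g: "gen1 (qcos I n \<one>, x):carrier ?F" by (rule free_gen_carrier) (use one_closed_Q[OF I] x in simp)
  have "tensor_kernel R (Q I n) A +>\<^bsub>?F\<^esub> gen1 (qcos I n \<one>, x) = tensor_kernel R (Q I n) A"
   using z unfolding tone_def tgen_def tcos_def tensor_def quot_zero .
  thus ?thesis using cos_self[OF module_free_module tensor_kernel_submodule[OF mQ A] g] by simp
 qed
 ultimately have "free_lift ?M w (gen1 (qcos I n \<one>, x)) = 0[?M]" by blast
 hence "?c x = ?N" using lg[OF one_closed x] x A by (simp add: quot_zero)
 thus "x:?N" using cos_self[OF A N x] by simp
qed



section \<open>The completion functor on complexes\<close>

lemma bij_quasi_iso: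
 assumes f: "CM X Y f" and inj: "!!i. inj_on (f i) (El X i)" and surj: "!!i y. y:El Y i ==> EX x:El X i. f i x = y"
 shows "QI X Y f"
 unfolding quasi_iso_iff[OF f]
proof (intro conjI allI impI)
 note X = cm_complex(1)[OF f] and Y = cm_complex(2)[OF f]
 fix i x assume x: "x:carrier (cycles X i)" and b: "f i x:boundaries Y i"
 obtain y where y: "y:El Y (i + 1)" "f i x = dif Y (i + 1) y" using b unfolding bd_iff by blast
 obtain w where w: "w:El X (i + 1)" "f (i + 1) w = y" using surj[OF y(1)] by blast
 have "f i x = f i (dif X (i + 1) w)" using y(2) w cm_d[OF f w(1)] by simp
 hence "x = dif X (i + 1) w" by (rule inj_onD[OF inj]) (use x d_closed'[OF X w(1)] in simp_all)
 thus "x:boundaries X i" using w(1) unfolding bd_iff by blast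
next
 note X = cm_complex(1)[OF f] and Y = cm_complex(2)[OF f]
 fix i y assume y: "y:carrier (cycles Y i)"
 then obtain x where x: "x:El X i" "f i x = y" using surj[of y i] by auto
 have "f (i - 1) (dif X i x) = f (i - 1) 0[obj X (i - 1)]" using cm_d[OF f x(1)] x(2) y hom_zero[OF cm_hom[OF f] cc_module[OF X] cc_module[OF Y]] by simp
 hence "dif X i x = 0[obj X (i - 1)]" by (rule inj_onD[OF inj]) (use d_closed[OF X x(1)] X in simp_all)
 thus "EX x:carrier (cycles X i). EX n:boundaries Y i. y = n +[obj Y i] f i x"
  using x y Y submoduleD(2)[OF cc_module[OF Y] submodule_boundaries_obj[OF Y]] by (intro bexI[of _ x] bexI[of _ "0[obj Y i]"]) simp_all
qed

lemma coherentD: assumes "coherent I A x" shows "x k:carrier A" "x (Suc k) -[A] x k:imul (ideal_power R I k) A"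
 using assms by (simp_all add: coherent_def)

lemma coherent_plus: assumes I: "ideal I R" and A: "Md A" and x: "coherent I A x" and y: "coherent I A y"
 shows "coherent I A (%k. x k +[A] y k)"
 unfolding coherent_def
proof (intro allI conjI)
 fix k note c = coherentD(1)[OF x, of k] coherentD(1)[OF x, of "Suc k"] coherentD(1)[OF y, of k] coherentD(1)[OF y, of "Suc k"]
 show "x k +[A] y k:carrier A" using c A by simp
 have "(x (Suc k) +[A] y (Suc k)) -[A] (x k +[A] y k) = (x (Suc k) -[A] x k) +[A] (y (Suc k) -[A] y k)" using A c by algebra
 thus "(x (Suc k) +[A] y (Suc k)) -[A] (x k +[A] y k):imul (ideal_power R I k) A"
  using submoduleD(3)[OF A imul_submodule[OF A ideal_ideal_power[OF I]] coherentD(2)[OF x] coherentD(2)[OF y]] by simp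
qed

lemma coherent_hom: assumes I: "ideal I R" and A: "Md A" and B: "Md B" and f: "f:Hom A B" and x: "coherent I A x"
 shows "coherent I B (%k. f (x k))"
 unfolding coherent_def
proof (intro allI conjI)
 fix k show "f (x k):carrier B" by (rule hom_closed[OF f coherentD(1)[OF x]])
 show "f (x (Suc k)) -[B] f (x k):imul (ideal_power R I k) B"
  using imul_hom[OF f A B ideal_ideal_power[OF I] coherentD(2)[OF x]] hom_minus[OF f A B coherentD(1)[OF x] coherentD(1)[OF x]] by simp
qed

lemma coherent_const: "ideal I R ==> Md A ==> a:carrier A ==> coherent I A (%k. a)"
 unfolding coherent_def using submoduleD(2)[of A, OF _ imul_submodule[of A, OF _ ideal_ideal_power[of I]]] by (simp add: m_minus_cancel)

lemma coherent_le: assumes I: "ideal I R" and A: "Md A" and x: "coherent I A x" and kl: "k <= l"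
 shows "x l -[A] x k:imul (ideal_power R I k) A"
 using kl
proof (induction l rule: dec_induct)
 case base
 show ?case using submoduleD(2)[OF A imul_submodule[OF A ideal_ideal_power[OF I]]] m_minus_cancel[OF A coherentD(1)[OF x]] by simp
next
 case (step l)
 have e: "x (Suc l) -[A] x k = (x (Suc l) -[A] x l) +[A] (x l -[A] x k)"
  using A coherentD(1)[OF x, of k] coherentD(1)[OF x, of l] coherentD(1)[OF x, of "Suc l"] by algebra
 show ?case unfolding e
  by (rule submoduleD(3)[OF A imul_submodule[OF A ideal_ideal_power[OF I]] subsetD[OF imul_mono[OF power_antimono[OF I step(1)]] coherentD(2)[OF x]] step(3)])
qed

definition lam :: "'a set => ('a, 'c) module => (nat => 'c) => nat => ('a set \<times> 'c => 'a) set" where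
 "lam I A x = (%n. tone I A n (x n))"

lemma tone_eq: assumes I: "ideal I R" and A: "Md A" and x: "x:carrier A" and y: "y:carrier A"
 shows "tone I A n x = tone I A n y \<longleftrightarrow> x -[A] y:imul (ideal_power R I n) A"
proof -
 note h = tone_hom[OF I A, of n] and mT = module_tensor[OF module_Q[OF I] A, of n]
 show ?thesis unfolding tone_kernel[OF I A m_minus[OF A x y], symmetric] hom_minus[OF h A mT x y]
  using m_minus_zero_iff[OF mT hom_closed[OF h x] hom_closed[OF h y]] by simp
qed

lemma lam_eq: "ideal I R ==> Md A ==> coherent I A x ==> coherent I A y ==>
  lam I A x = lam I A y \<longleftrightarrow> (ALL n. x n -[A] y n:imul (ideal_power R I n) A)"
 by (simp add: lam_def fun_eq_iff tone_eq coherentD)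

lemma tone_proj: assumes I: "ideal I R" and A: "Md A" and x: "x:carrier A" and mn: "m <= n"
 shows "tensor_map R (Q I m) A (quot_power_proj R I m) (%x. x) (tone I A n x) = tone I A m x"
 unfolding tone_def tensor_map_tgen[OF module_Q[OF I] A module_Q[OF I] A quot_proj_hom(2)[OF I mn] hom_id one_closed_Q[OF I] x] quot_proj_hom(1)[OF I mn one_closed] ..

text \<open>Each component of a compatible family is 1 \<otimes> x_n for some x_n, and compatibility
  of neighbours is coherence of these representatives.\<close>

lemma Lambda_carrier: assumes I: "ideal I R" and A: "Md A"
 shows "s:carrier (Lambda_module R I A) \<longleftrightarrow> (EX x. coherent I A x & s = lam I A x)"
proof
 assume "s:carrier (Lambda_module R I A)"
 hence s: "!!n. s n:carrier (tensor R (Q I n) A)"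
  "!!m n. m <= n ==> tensor_map R (Q I m) A (quot_power_proj R I m) (%x. x) (s n) = s m"
  by (simp_all add: Lambda_module_def invlim_def)
 have "ALL n. EX x. x:carrier A & s n = tone I A n x" using tone_surj[OF I A s(1)] by blast
 then obtain x where x: "!!n. x n:carrier A" "!!n. s n = tone I A n (x n)" by metis
 have "tone I A n (x (Suc n)) = tone I A n (x n)" for n
  using s(2)[of n "Suc n"] tone_proj[OF I A x(1), of n "Suc n" "Suc n"] unfolding x(2) by simp
 hence "coherent I A x" unfolding coherent_def using x(1) tone_eq[OF I A x(1) x(1)] by blast
 thus "EX x. coherent I A x & s = lam I A x" using x(2) by (auto simp: lam_def fun_eq_iff)
next
 assume "EX x. coherent I A x & s = lam I A x"
 then obtain x where x: "coherent I A x" "s = lam I A x" by blast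
 note c = coherentD(1)[OF x(1)]
 show "s:carrier (Lambda_module R I A)" unfolding x(2) lam_def
  using hom_closed[OF tone_hom[OF I A] c] tone_proj[OF I A c] coherent_le[OF I A x(1)] tone_eq[OF I A c c]
  by (auto simp: Lambda_module_def invlim_def)
qed

lemma lam_ops: assumes I: "ideal I R" and A: "Md A"
 shows "0[Lambda_module R I A] = lam I A (%k. 0[A])"
  and "coherent I A x ==> coherent I A y ==> lam I A x +[Lambda_module R I A] lam I A y = lam I A (%k. x k +[A] y k)"
  and "r:carrier R ==> coherent I A x ==> r *[Lambda_module R I A] lam I A x = lam I A (%k. r *[A] x k)"
 using hom_zero[OF tone_hom[OF I A] A module_tensor[OF module_Q[OF I] A]] hom_add[OF tone_hom[OF I A]] hom_smult[OF tone_hom[OF I A]]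
 by (auto simp: Lambda_module_def invlim_def lam_def fun_eq_iff coherentD)

lemma coherent_smult: "ideal I R ==> Md A ==> r:carrier R ==> coherent I A x ==> coherent I A (%k. r *[A] x k)"
 by (rule coherent_hom[OF _ _ _ hom_scale[OF hom_id]])

lemma module_Lambda: assumes I: "ideal I R" and A: "Md A" shows "Md (Lambda_module R I A)"
proof -
 let ?L = "Lambda_module R I A" let ?P = "prod_module (%n. tensor R (Q I n) A)"
 have mP: "Md ?P" using module_tensor[OF module_Q[OF I] A] by simp
 note C = Lambda_carrier[OF I A]
 show ?thesis
 proof (rule module_by_inj[OF mP, where e = "%x. x"])
  show "x:carrier ?P" if "x:carrier ?L" for x using that by (simp add: Lambda_module_def invlim_def)
  show "0[?L]:carrier ?L" unfolding C lam_ops(1)[OF I A] using coherent_const[OF I A m_zero[OF A]] by blast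
  show "x +[?L] y:carrier ?L" if "x:carrier ?L" "y:carrier ?L" for x y
   using that lam_ops(2)[OF I A] coherent_plus[OF I A] unfolding C by blast
  show "r *[?L] x:carrier ?L" if "r:carrier R" "x:carrier ?L" for r x
   using that lam_ops(3)[OF I A] coherent_smult[OF I A] unfolding C by blast
 qed (simp_all add: Lambda_module_def invlim_def)
qed

lemma Lambda_map_lam: assumes I: "ideal I R" and A: "Md A" and B: "Md B" and f: "f:Hom A B" and x: "coherent I A x"
 shows "Lambda_map R I B f (lam I A x) = lam I B (%k. f (x k))"
 unfolding Lambda_map_def lam_def tone_def
 using tensor_map_tgen[OF module_Q[OF I] A module_Q[OF I] B hom_id f one_closed_Q[OF I] coherentD(1)[OF x]] by simp

lemma Lambda_map_hom: assumes I: "ideal I R" and A: "Md A" and B: "Md B" and f: "f:Hom A B"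
 shows "Lambda_map R I B f:Hom (Lambda_module R I A) (Lambda_module R I B)"
proof (rule mod_homI)
 note CA = Lambda_carrier[OF I A] and CB = Lambda_carrier[OF I B] and e = Lambda_map_lam[OF I A B f] and h = coherent_hom[OF I A B f]
 fix s assume "s:carrier (Lambda_module R I A)"
 then obtain x where x: "coherent I A x" "s = lam I A x" unfolding CA by blast
 show "Lambda_map R I B f s:carrier (Lambda_module R I B)" unfolding CB x(2) e[OF x(1)] using h[OF x(1)] by blast
 show "Lambda_map R I B f (r *[Lambda_module R I A] s) = r *[Lambda_module R I B] Lambda_map R I B f s" if r: "r:carrier R" for r
  unfolding x(2) lam_ops(3)[OF I A r x(1)] e[OF x(1)] e[OF coherent_smult[OF I A r x(1)]] lam_ops(3)[OF I B r h[OF x(1)]] hom_smult[OF f r coherentD(1)[OF x(1)]] ..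
 fix t assume "t:carrier (Lambda_module R I A)"
 then obtain y where y: "coherent I A y" "t = lam I A y" unfolding CA by blast
 show "Lambda_map R I B f (s +[Lambda_module R I A] t) = Lambda_map R I B f s +[Lambda_module R I B] Lambda_map R I B f t"
  unfolding x(2) y(2) lam_ops(2)[OF I A x(1) y(1)] e[OF x(1)] e[OF y(1)] e[OF coherent_plus[OF I A x(1) y(1)]] lam_ops(2)[OF I B h[OF x(1)] h[OF y(1)]]
   hom_add[OF f coherentD(1)[OF x(1)] coherentD(1)[OF y(1)]] ..
qed

lemma Lambda_cpx_simps [simp]: "obj (Lambda_cpx R I X) i = Lambda_module R I (obj X i)" "dif (Lambda_cpx R I X) i = Lambda_map R I (obj X (i - 1)) (dif X i)"
 by (simp_all add: Lambda_cpx_def)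

definition Lmap :: "'a set => ('a, 'd) cpx => (int => 'c => 'd) => int => (nat => ('a set \<times> 'c => 'a) set) => nat => ('a set \<times> 'd => 'a) set" where
 "Lmap I Y f i = Lambda_map R I (obj Y i) (f i)"

lemma LambdaE: assumes "s:El (Lambda_cpx R I X) i" "ideal I R" "CC X"
 obtains x where "coherent I (obj X i) x" "s = lam I (obj X i) x"
 using assms Lambda_carrier[OF assms(2) cc_module[OF assms(3)], of s i] by auto

lemma Lambda_dif: "ideal I R ==> CC X ==> coherent I (obj X i) x ==> dif (Lambda_cpx R I X) i (lam I (obj X i) x) = lam I (obj X (i - 1)) (%k. dif X i (x k))"
 unfolding Lambda_cpx_simps by (rule Lambda_map_lam[OF _ cc_module cc_module cc_dif])

lemma chain_complex_Lambda: assumes I: "ideal I R" and X: "CC X" shows "CC (Lambda_cpx R I X)"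
proof (rule chain_complexI)
 fix i
 show "Md (obj (Lambda_cpx R I X) i)" using module_Lambda[OF I cc_module[OF X]] by simp
 show "dif (Lambda_cpx R I X) i:Hom (obj (Lambda_cpx R I X) i) (obj (Lambda_cpx R I X) (i - 1))"
  using Lambda_map_hom[OF I cc_module[OF X] cc_module[OF X] cc_dif[OF X]] by simp
 fix s assume "s:El (Lambda_cpx R I X) i"
 then obtain x where x: "coherent I (obj X i) x" "s = lam I (obj X i) x" using I X by (rule LambdaE)
 note dx = coherent_hom[OF I cc_module[OF X] cc_module[OF X] cc_dif[OF X] x(1)]
 show "dif (Lambda_cpx R I X) (i - 1) (dif (Lambda_cpx R I X) i s) = 0[obj (Lambda_cpx R I X) (i - 1 - 1)]"
  unfolding x(2) Lambda_dif[OF I X x(1)] Lambda_dif[OF I X dx] unfolding Lambda_cpx_simps(1) lam_ops(1)[OF I cc_module[OF X]] d_d[OF X coherentD(1)[OF x(1)]] ..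
qed

lemma chain_map_Lambda: assumes I: "ideal I R" and f: "CM X Y f" shows "CM (Lambda_cpx R I X) (Lambda_cpx R I Y) (Lmap I Y f)"
proof (rule chain_mapI)
 note X = cm_complex(1)[OF f] and Y = cm_complex(2)[OF f]
 show "CC (Lambda_cpx R I X)" "CC (Lambda_cpx R I Y)" using chain_complex_Lambda[OF I] X Y by auto
 show "Lmap I Y f i:Hom (obj (Lambda_cpx R I X) i) (obj (Lambda_cpx R I Y) i)" for i
  unfolding Lmap_def using Lambda_map_hom[OF I cc_module[OF X] cc_module[OF Y] cm_hom[OF f]] by simp
 fix i s assume "s:El (Lambda_cpx R I X) i"
 then obtain x where x: "coherent I (obj X i) x" "s = lam I (obj X i) x" using I X by (rule LambdaE)
 note dx = coherent_hom[OF I cc_module[OF X] cc_module[OF X] cc_dif[OF X] x(1)] and fx = coherent_hom[OF I cc_module[OF X] cc_module[OF Y] cm_hom[OF f] x(1)]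
 show "dif (Lambda_cpx R I Y) i (Lmap I Y f i s) = Lmap I Y f (i - 1) (dif (Lambda_cpx R I X) i s)"
  unfolding x(2) Lmap_def Lambda_dif[OF I X x(1)] Lambda_map_lam[OF I cc_module[OF X] cc_module[OF Y] cm_hom[OF f] x(1)] Lambda_map_lam[OF I cc_module[OF X] cc_module[OF Y] cm_hom[OF f] dx]
   Lambda_dif[OF I Y fx] cm_d[OF f coherentD(1)[OF x(1)]] ..
qed

lemma htp_Lambda: assumes I: "ideal I R" and f: "CM X X f" and h: "htp X X f (%i x. x)"
 shows "htp (Lambda_cpx R I X) (Lambda_cpx R I X) (Lmap I X f) (%i x. x)"
proof -
 obtain s where s: "homotopy X X s" "!!i x. x:El X i ==> f i x = x +[obj X i] hbd X X s i x" using h by (rule htpE) blast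
 note X = cm_complex(1)[OF f]
 have sh: "s i:Hom (obj X i) (obj X (i + 1))" "s (i - 1):Hom (obj X (i - 1)) (obj X i)" for i using homotopy_hom[OF s(1)] homotopy_hom'[OF s(1)] by auto
 note M = cc_module[OF X]
 show ?thesis
 proof (rule htpI[of _ _ "%i. Lambda_map R I (obj X (i + 1)) (s i)"])
  show "homotopy (Lambda_cpx R I X) (Lambda_cpx R I X) (%i. Lambda_map R I (obj X (i + 1)) (s i))"
   unfolding homotopy_def using Lambda_map_hom[OF I M M sh(1)] by simp
  fix i t assume "t:El (Lambda_cpx R I X) i"
  then obtain x where x: "coherent I (obj X i) x" "t = lam I (obj X i) x" using I X by (rule LambdaE)
  note dx = coherent_hom[OF I M M cc_dif[OF X] x(1)] and sx = coherent_hom[OF I M M sh(1) x(1)]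
  note sdx = coherent_hom[OF I M M sh(2) dx] and dsx = coherent_hom[OF I M M cc_dif'[OF X] sx]
  have 1: "Lambda_map R I (obj X i) (dif X (i + 1)) (lam I (obj X (i + 1)) (%k. s i (x k))) = lam I (obj X i) (%k. dif X (i + 1) (s i (x k)))"
   by (rule Lambda_map_lam[OF I M M cc_dif'[OF X] sx])
  have 2: "f i (x k) = x k +[obj X i] (dif X (i + 1) (s i (x k)) +[obj X i] s (i - 1) (dif X i (x k)))" for k
   using s(2)[OF coherentD(1)[OF x(1)]] by (simp add: hbd_def)
  have 3: "hbd (Lambda_cpx R I X) (Lambda_cpx R I X) (%i. Lambda_map R I (obj X (i + 1)) (s i)) i t =
    lam I (obj X i) (%k. dif X (i + 1) (s i (x k))) +[Lambda_module R I (obj X i)] lam I (obj X i) (%k. s (i - 1) (dif X i (x k)))"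
   unfolding hbd_def x(2) using 1 Lambda_map_lam[OF I M M sh(1) x(1)] Lambda_map_lam[OF I M M sh(2) dx] Lambda_map_lam[OF I M M cc_dif[OF X] x(1)] by simp
  show "Lmap I X f i t = t +[obj (Lambda_cpx R I X) i] hbd (Lambda_cpx R I X) (Lambda_cpx R I X) (%i. Lambda_map R I (obj X (i + 1)) (s i)) i t"
   unfolding 3 unfolding x(2) Lmap_def Lambda_map_lam[OF I M M cm_hom[OF f] x(1)] Lambda_cpx_simps(1) lam_ops(2)[OF I M dsx sdx] lam_ops(2)[OF I M x(1) coherent_plus[OF I M dsx sdx]] 2 ..
 qed
qed

lemma Lmap_comp: assumes I: "ideal I R" and f: "CM X Y f" and g: "CM Y Z g" and s: "s:El (Lambda_cpx R I X) i"
 shows "Lmap I Z g i (Lmap I Y f i s) = Lmap I Z (%i x. g i (f i x)) i s"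
proof -
 note X = cm_complex(1)[OF f] and Y = cm_complex(2)[OF f] and Z = cm_complex(2)[OF g]
 obtain x where x: "coherent I (obj X i) x" "s = lam I (obj X i) x" using s I X by (rule LambdaE)
 show ?thesis unfolding x(2) Lmap_def Lambda_map_lam[OF I cc_module[OF X] cc_module[OF Y] cm_hom[OF f] x(1)]
  Lambda_map_lam[OF I cc_module[OF Y] cc_module[OF Z] cm_hom[OF g] coherent_hom[OF I cc_module[OF X] cc_module[OF Y] cm_hom[OF f] x(1)]]
  Lambda_map_lam[OF I cc_module[OF X] cc_module[OF Z] hom_comp[OF cm_hom[OF f] cm_hom[OF g]] x(1)] ..
qed

lemma heq_Lambda: assumes I: "ideal I R" and h: "heq X Y f g" shows "heq (Lambda_cpx R I X) (Lambda_cpx R I Y) (Lmap I Y f) (Lmap I X g)"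
proof -
 have f: "CM X Y f" and g: "CM Y X g" and hX: "htp X X (%i x. g i (f i x)) (%i x. x)"
  and hY: "htp Y Y (%i y. f i (g i y)) (%i y. y)" using h by (simp_all add: heq_def)
 show ?thesis unfolding heq_def
  using chain_map_Lambda[OF I f] chain_map_Lambda[OF I g] htp_cong[OF htp_Lambda[OF I chain_map_comp[OF f g] hX]] htp_cong[OF htp_Lambda[OF I chain_map_comp[OF g f] hY]]
   Lmap_comp[OF I f g] Lmap_comp[OF I g f] by simp
qed

text \<open>Acyclicity of the cone survives completion by \<open>pro_acyclic\<close>; the two halves
  of a quasi-isomorphism are read off from representatives in the cone.\<close>

lemma quasi_iso_Lambda:
 assumes I: "ideal I R" and f: "QI X Y f" and pu: "!!i. pure (cone X Y f) i"
 shows "QI (Lambda_cpx R I X) (Lambda_cpx R I Y) (Lmap I Y f)"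
proof -
 note fc = qi_cm[OF f]
 note X = cm_complex(1)[OF fc] and Y = cm_complex(2)[OF fc]
 note MX = cc_module[OF X] and MY = cc_module[OF Y]
 let ?C = "cone X Y f" let ?J = "ideal_power R I"
 note C = chain_complex_cone[OF fc] and J = ideal_ideal_power[OF I]
 have mS: "Md (dsum (obj X i) (obj Y j))" for i j using MX MY by simp
 have pair: "(a, b):imul (?J k) (dsum (obj X i) (obj Y j))" if a: "a:imul (?J k) (obj X i)" and b: "b:imul (?J k) (obj Y j)" for a b i j k
 proof -
  have c: "a:El X i" "b:El Y j" using subsetD[OF submoduleD(1)[OF MX imul_submodule[OF MX J]] a] subsetD[OF submoduleD(1)[OF MY imul_submodule[OF MY J]] b] by auto
  show ?thesis
   using submoduleD(3)[OF mS imul_submodule[OF mS J] imul_hom[OF hom_inl[OF MX MY] MX mS J a] imul_hom[OF hom_inr[OF MX MY] MY mS J b]] c MX MY by simp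
 qed
 have proj: "fst c:imul (?J k) (obj X i)" "snd c:imul (?J k) (obj Y j)" if "c:imul (?J k) (dsum (obj X i) (obj Y j))" for c i j k
  using imul_hom[OF hom_fst mS MX J that] imul_hom[OF hom_snd mS MY J that] by auto
 have cp: "coherent I (dsum (obj X i) (obj Y j)) (%k. (x k, y k))" if x: "coherent I (obj X i) x" and y: "coherent I (obj Y j) y" for x y i j
  unfolding coherent_def
 proof (intro allI conjI)
  fix k
  note c = coherentD(1)[OF x] coherentD(1)[OF y]
  show "(x k, y k):carrier (dsum (obj X i) (obj Y j))" using c by simp
  show "(x (Suc k), y (Suc k)) -[dsum (obj X i) (obj Y j)] (x k, y k):imul (?J k) (dsum (obj X i) (obj Y j))"
   using pair[OF coherentD(2)[OF x] coherentD(2)[OF y]] dsum_neg[OF MX MY, of "(x k, y k)"] c by (simp add: a_minus_def)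
 qed
 \<comment> \<open>\<open>pro_acyclic\<close> for the cone, split into components. A general
   \<open>x\<close> gives injectivity on homology, x = 0 gives surjectivity.\<close>
 have key: "EX u v. coherent I (obj X i) u & coherent I (obj Y (i + 1)) v & (ALL k. x k -[obj X (i - 1)] dif X i (u k):imul (?J k) (obj X (i - 1)) &
   y k -[obj Y i] (f i (u k) -[obj Y i] dif Y (i + 1) (v k)):imul (?J k) (obj Y i))"
  if x: "coherent I (obj X (i - 1)) x" and y: "coherent I (obj Y i) y" and dx: "!!k. dif X (i - 1) (x k):imul (?J k) (obj X (i - 1 - 1))"
   and dy: "!!k. f (i - 1) (x k) -[obj Y (i - 1)] dif Y i (y k):imul (?J k) (obj Y (i - 1))" for i x y
 proof -
  have "coherent I (obj ?C i) (%k. (x k, y k))" using cp[OF x y] by simp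
  moreover have "dif ?C i (x k, y k):imul (?J k) (obj ?C (i - 1))" for k using pair[OF dx dy] by simp
  ultimately obtain w where w: "coherent I (obj ?C (i + 1)) w" "!!k. (x k, y k) -[obj ?C i] dif ?C (i + 1) (w k):imul (?J k) (obj ?C i)"
   using pro_acyclic[OF C acyclic_cone[OF f] pu I, of i "%k. (x k, y k)"] by blast
  have wc: "w k:carrier (dsum (obj X i) (obj Y (i + 1)))" for k using coherentD(1)[OF w(1), of k] by simp
  have dw: "dif ?C (i + 1) (w k):carrier (dsum (obj X (i - 1)) (obj Y i))" for k using d_closed'[OF C coherentD(1)[OF w(1), of k]] by simp
  have w1: "coherent I (dsum (obj X i) (obj Y (i + 1))) w" using w(1) by simp
  have "(x k, y k) -[obj ?C i] dif ?C (i + 1) (w k) = (x k -[obj X (i - 1)] dif X i (fst (w k)), y k -[obj Y i] (f i (fst (w k)) -[obj Y i] dif Y (i + 1) (snd (w k))))" for k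
   using dsum_neg[OF MX MY dw[of k]] by (simp add: a_minus_def)
  thus ?thesis using w(2) proj
   by (intro exI[of _ "%k. fst (w k)"] exI[of _ "%k. snd (w k)"] conjI coherent_hom[OF I mS MX hom_fst w1] coherent_hom[OF I mS MY hom_snd w1]) fastforce
 qed
 note LC = chain_map_Lambda[OF I fc]
 note LX = cm_complex(1)[OF LC] and LY = cm_complex(2)[OF LC]
 note lf = Lambda_map_lam[OF I MX MY cm_hom[OF fc]]
 have cyc: "dif Z i (x k):imul (?J k) (obj Z (i - 1))" if Z: "CC Z" and x: "coherent I (obj Z i) x" and d: "dif (Lambda_cpx R I Z) i (lam I (obj Z i) x) = 0[obj (Lambda_cpx R I Z) (i - 1)]"
  for i x k and Z :: "('a, 'z) cpx"
 proof -
  note MZ = cc_module[OF Z]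
  have "lam I (obj Z (i - 1)) (%k. dif Z i (x k)) = lam I (obj Z (i - 1)) (%k. 0[obj Z (i - 1)])"
   using d unfolding Lambda_dif[OF I Z x] unfolding Lambda_cpx_simps lam_ops(1)[OF I MZ] .
  hence "dif Z i (x k) -[obj Z (i - 1)] 0[obj Z (i - 1)]:imul (?J k) (obj Z (i - 1))"
   unfolding lam_eq[OF I MZ coherent_hom[OF I MZ MZ cc_dif[OF Z] x] coherent_const[OF I MZ m_zero[OF MZ]]] by blast
  thus ?thesis using d_closed[OF Z coherentD(1)[OF x]] MZ by (simp add: m_minus_eq)
 qed
 show ?thesis unfolding quasi_iso_iff[OF LC]
 proof (intro conjI allI impI)
  fix i s assume s: "s:carrier (cycles (Lambda_cpx R I X) i)" and b: "Lmap I Y f i s:boundaries (Lambda_cpx R I Y) i"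
  have so: "s:El (Lambda_cpx R I X) i" using s unfolding cycles_simps by blast
  obtain x where x: "coherent I (obj X i) x" "s = lam I (obj X i) x" using so I X by (rule LambdaE)
  obtain t where t: "t:El (Lambda_cpx R I Y) (i + 1)" "Lmap I Y f i s = dif (Lambda_cpx R I Y) (i + 1) t" using b unfolding bd_iff by blast
  obtain y where y: "coherent I (obj Y (i + 1)) y" "t = lam I (obj Y (i + 1)) y" using t(1) I Y by (rule LambdaE)
  have dx: "dif X i (x k):imul (?J k) (obj X (i - 1))" for k using s unfolding cycles_simps x(2) by (intro cyc[OF X x(1)]) blast
  have "lam I (obj Y i) (%k. f i (x k)) = lam I (obj Y i) (%k. dif Y (i + 1) (y k))"
   using t(2) Lambda_dif[OF I Y y(1)] unfolding x(2) y(2) Lmap_def lf[OF x(1)] by simp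
  hence "f i (x k) -[obj Y i] dif Y (i + 1) (y k):imul (?J k) (obj Y i)" for k
   unfolding lam_eq[OF I MY coherent_hom[OF I MX MY cm_hom[OF fc] x(1)] coherent_hom[OF I MY MY cc_dif'[OF Y] y(1)]] by blast
  then obtain u where u: "coherent I (obj X (i + 1)) u" "!!k. x k -[obj X i] dif X (i + 1) (u k):imul (?J k) (obj X i)"
   using key[of "i + 1" x y] x(1) y(1) dx by auto
  have "s = lam I (obj X i) (%k. dif X (i + 1) (u k))"
   unfolding x(2) lam_eq[OF I MX x(1) coherent_hom[OF I MX MX cc_dif'[OF X] u(1)]] using u(2) by blast
  also have "... = dif (Lambda_cpx R I X) (i + 1) (lam I (obj X (i + 1)) u)" using Lambda_dif[OF I X u(1)] by simp
  finally show "s:boundaries (Lambda_cpx R I X) i" unfolding bd_iff using Lambda_carrier[OF I MX] u(1) by auto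
 next
  fix i t assume t: "t:carrier (cycles (Lambda_cpx R I Y) i)"
  have to: "t:El (Lambda_cpx R I Y) i" using t unfolding cycles_simps by blast
  obtain y where y: "coherent I (obj Y i) y" "t = lam I (obj Y i) y" using to I Y by (rule LambdaE)
  have dy: "dif Y i (y k):imul (?J k) (obj Y (i - 1))" for k using t unfolding cycles_simps y(2) by (intro cyc[OF Y y(1)]) blast
  have "0[obj Y (i - 1)] -[obj Y (i - 1)] dif Y i (y k):imul (?J k) (obj Y (i - 1))" for k
   by (rule submoduleD(6)[OF MY imul_submodule[OF MY J] submoduleD(2)[OF MY imul_submodule[OF MY J]] dy])
  moreover have "0[obj X (i - 1 - 1)]:imul (?J k) (obj X (i - 1 - 1))" for k by (rule submoduleD(2)[OF MX imul_submodule[OF MX J]])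
  ultimately obtain u v where u: "coherent I (obj X i) u" and v: "coherent I (obj Y (i + 1)) v"
   and uk: "!!k. 0[obj X (i - 1)] -[obj X (i - 1)] dif X i (u k):imul (?J k) (obj X (i - 1))"
   and vk: "!!k. y k -[obj Y i] (f i (u k) -[obj Y i] dif Y (i + 1) (v k)):imul (?J k) (obj Y i)"
   using key[OF coherent_const[OF I MX m_zero[OF MX]] y(1)] d_zero[OF X, of "i - 1"] hom_zero[OF cm_hom[OF fc] MX MY, of "i - 1"] by auto
  \<comment> \<open>The differential of the cone contains \<open>f u - d v\<close>, hence the
    negative of \<open>v\<close> bounds the difference.\<close>
  let ?s = "lam I (obj X i) u" and ?w = "lam I (obj Y (i + 1)) (%k. (\<ominus> \<one>) *[obj Y (i + 1)] v k)"
  note du = coherent_hom[OF I MX MX cc_dif[OF X] u] and fu = coherent_hom[OF I MX MY cm_hom[OF fc] u]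
  have w: "coherent I (obj Y (i + 1)) (%k. (\<ominus> \<one>) *[obj Y (i + 1)] v k)" by (rule coherent_smult[OF I MY _ v]) simp
  note dw = coherent_hom[OF I MY MY cc_dif'[OF Y] w]
  have so: "?s:El (Lambda_cpx R I X) i" using Lambda_carrier[OF I MX] u by auto
  have "lam I (obj X (i - 1)) (%k. 0[obj X (i - 1)]) = lam I (obj X (i - 1)) (%k. dif X i (u k))"
   unfolding lam_eq[OF I MX coherent_const[OF I MX m_zero[OF MX]] du] using uk by blast
  hence sz: "dif (Lambda_cpx R I X) i ?s = 0[obj (Lambda_cpx R I X) (i - 1)]"
   unfolding Lambda_dif[OF I X u] unfolding Lambda_cpx_simps lam_ops(1)[OF I MX] by simp
  have wb: "dif (Lambda_cpx R I Y) (i + 1) ?w = lam I (obj Y i) (%k. dif Y (i + 1) ((\<ominus> \<one>) *[obj Y (i + 1)] v k))"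
   using Lambda_dif[OF I Y w] by simp
  have 1: "dif (Lambda_cpx R I Y) (i + 1) ?w +[obj (Lambda_cpx R I Y) i] Lmap I Y f i ?s =
   lam I (obj Y i) (%k. dif Y (i + 1) ((\<ominus> \<one>) *[obj Y (i + 1)] v k) +[obj Y i] f i (u k))"
   unfolding wb Lmap_def lf[OF u] unfolding Lambda_cpx_simps by (rule lam_ops(2)[OF I MY dw fu])
  have "t = dif (Lambda_cpx R I Y) (i + 1) ?w +[obj (Lambda_cpx R I Y) i] Lmap I Y f i ?s"
   unfolding 1 unfolding y(2) lam_eq[OF I MY y(1) coherent_plus[OF I MY dw fu]]
  proof
   fix k
   note c = coherentD(1)[OF y(1), of k] coherentD(1)[OF fu, of k] coherentD(1)[OF v, of k]
   have "dif Y (i + 1) ((\<ominus> \<one>) *[obj Y (i + 1)] v k) = ~[obj Y i] dif Y (i + 1) (v k)"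
    using hom_smult[OF cc_dif'[OF Y] _ c(3), of "\<ominus> \<one>"] m_neg_smult[OF MY one_closed d_closed'[OF Y c(3)]] d_closed'[OF Y c(3)] MY by simp
   hence "dif Y (i + 1) ((\<ominus> \<one>) *[obj Y (i + 1)] v k) +[obj Y i] f i (u k) = f i (u k) -[obj Y i] dif Y (i + 1) (v k)"
    using m_comm'[OF MY m_neg[OF MY d_closed'[OF Y c(3)]] c(2)] by (simp add: a_minus_def)
   thus "y k -[obj Y i] (dif Y (i + 1) ((\<ominus> \<one>) *[obj Y (i + 1)] v k) +[obj Y i] f i (u k)):imul (?J k) (obj Y i)" using vk[of k] by simp
  qed
  moreover have "dif (Lambda_cpx R I Y) (i + 1) ?w:boundaries (Lambda_cpx R I Y) i" unfolding bd_iff using Lambda_carrier[OF I MY] w by auto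
  ultimately show "EX x:carrier (cycles (Lambda_cpx R I X) i). EX n:boundaries (Lambda_cpx R I Y) i. t = n +[obj (Lambda_cpx R I Y) i] Lmap I Y f i x"
   using so sz by (intro bexI[of _ ?s] bexI[of _ "dif (Lambda_cpx R I Y) (i + 1) ?w"]) (simp_all only: cycles_simps simp_thms)
 qed
qed



section \<open>Completion of Hom into injectives\<close>

lemma bij_inverse_quasi_iso:
 assumes f: "CM X Y f" and inj: "!!i. inj_on (f i) (El X i)" and surj: "!!i y. y:El Y i ==> EX x:El X i. f i x = y"
 shows "QI Y X (%i. inv_into (El X i) (f i))"
proof -
 let ?g = "%i. inv_into (El X i) (f i)"
 note X = cm_complex(1)[OF f] and Y = cm_complex(2)[OF f]
 have g: "?g i (f i x) = x" if "x:El X i" for i x by (rule inv_into_f_f[OF inj that])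
 show ?thesis
 proof (rule bij_quasi_iso[OF chain_mapI[OF Y X]])
  show "?g i:Hom (obj Y i) (obj X i)" for i
  proof (rule mod_homI)
   fix y assume "y:El Y i"
   then obtain x where x: "x:El X i" "y = f i x" using surj[of y i] by blast
   show "?g i y:El X i" unfolding x(2) g[OF x(1)] by (rule x(1))
   show "?g i (r *[obj Y i] y) = r *[obj X i] ?g i y" if r: "r:carrier R" for r
    unfolding x(2) g[OF x(1)] hom_smult[OF cm_hom[OF f] r x(1), symmetric] by (rule g[OF m_smult[OF cc_module[OF X] r x(1)]])
   fix z assume "z:El Y i"
   then obtain w where w: "w:El X i" "z = f i w" using surj[of z i] by blast
   show "?g i (y +[obj Y i] z) = ?g i y +[obj X i] ?g i z"
    unfolding x(2) w(2) g[OF x(1)] g[OF w(1)] hom_add[OF cm_hom[OF f] x(1) w(1), symmetric] by (rule g[OF m_add[OF cc_module[OF X] x(1) w(1)]])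
  qed
  fix i y assume y: "y:El Y i"
  then obtain x where x: "x:El X i" "y = f i x" using surj[of y i] by blast
  show "dif X i (?g i y) = ?g (i - 1) (dif Y i y)" unfolding x(2) g[OF x(1)] cm_d[OF f x(1)] g[OF d_closed[OF X x(1)]] ..
 next
  fix i show "inj_on (?g i) (El Y i)" by (rule inj_onI) (metis surj g)
  fix x assume "x:El X i" thus "EX y:El Y i. ?g i y = x" using g[of x i] cm_closed[OF f] by blast
 qed
qed

text \<open>On an element killed by I^k the k-th map is used; for a coherent sequence the choice of
  \<open>k\<close> does not matter.\<close>

definition glue :: "'a set => ('a, 'c) cpx => (nat => int => 'c => 'd) => int => 'c => 'd" where
 "glue I M f i x = f (SOME k. x:killed (obj M i) I k) i x"

definition Lambda_hom :: "'a set => ('a, 'c) cpx => ('a, 'd) cpx => int => (nat => ('a set \<times> (int => 'c => 'd) => 'a) set) => int => 'c => 'd" where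
 "Lambda_hom I M U n s = (%i. \<lambda>x\<in>tors I (obj M i). glue I M (SOME f. coherent I (obj (HC M U) n) f & s = lam I (obj (HC M U) n) f) i x)"

text \<open>By \<open>imul_hom_cpx\<close>, congruence modulo I^k Hom(M, U) is agreement on the
  elements of \<open>M\<close> killed by I^k. Coherent sequences up to congruence are therefore
  compatible families on these submodules, and the map is bijective in each degree.\<close>

lemma quasi_iso_Lambda_hom:
 fixes M :: "('a, 'c) cpx" and U :: "('a, 'd) cpx"
 assumes noeth: "noetherian_ring R" and M: "CC M" and U: "CC U" and b: "!!i. baer (obj U i)" and I: "ideal I R"
 shows "QI (Lambda_cpx R I (HC M U)) (HC (tors_cpx I M) U) (Lambda_hom I M U)"
proof -
 let ?H = "%n. obj (HC M U) n" let ?G = "HC (tors_cpx I M) U" let ?J = "ideal_power R I"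
 note H = chain_complex_hom[OF M U] and Ic = idealD(1)[OF I]
 note mH = cc_module[OF H] and mM = cc_module[OF M] and mU = cc_module[OF U]
 note TM = chain_complex_tors[OF M Ic]
 note G = chain_complex_hom[OF TM U]
 have kc: "x:killed (obj M i) I k ==> x:El M i" for x i k using submoduleD(1)[OF mM killed_submodule[OF mM Ic]] by blast
 have tc: "x:tors I (obj M i) ==> x:El M i" for x i by (rule tors_in[OF mM Ic])
 have imul_iff: "f -[?H n] g:imul (?J k) (?H n) \<longleftrightarrow> (ALL i. ALL x:killed (obj M i) I k. f i x = g i x)"
  if f: "f:carrier (?H n)" and g: "g:carrier (?H n)" for f g n k
 proof -
  have "(f -[?H n] g) i x = 0[obj U (i + n)] \<longleftrightarrow> f i x = g i x" if "x:El M i" for i x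
   unfolding hom_cpx_minus[OF M U g that] by (rule m_minus_zero_iff[OF mU hom_cpx_closed[OF f that] hom_cpx_closed[OF g that]])
  thus ?thesis
   unfolding imul_hom_cpx[OF noeth M U b ideal_ideal_power[OF I] m_minus[OF mH f g]] vanishes_def killed_ideal_power[OF mM I] by auto
 qed
 have glue: "glue I M f i x = f k i x" if f: "coherent I (?H n) f" and x: "x:killed (obj M i) I k" for f n i x k
 proof -
  let ?l = "SOME k. x:killed (obj M i) I k"
  have l: "x:killed (obj M i) I ?l" by (rule someI[of "%k. x:killed (obj M i) I k", OF x])
  note c = coherentD(1)[OF f]
  have "f (max k ?l) i x = f j i x" if "x:killed (obj M i) I j" "j <= max k ?l" for j
   using coherent_le[OF I mH f that(2)] that(1) unfolding imul_iff[OF c c] by blast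
  from this[OF x] this[OF l] show ?thesis unfolding glue_def by simp
 qed
 have torsD: "EX k. x:killed (obj M i) I k" if "x:tors I (obj M i)" for x i using that unfolding tors_def by blast
 have Psi: "Lambda_hom I M U n (lam I (?H n) f) = (%i. \<lambda>x\<in>tors I (obj M i). glue I M f i x)" if f: "coherent I (?H n) f" for n f
 proof -
  define g where "g = (SOME g. coherent I (?H n) g & lam I (?H n) f = lam I (?H n) g)"
  have g: "coherent I (?H n) g" "lam I (?H n) f = lam I (?H n) g"
   using someI_ex[of "%g. coherent I (?H n) g & lam I (?H n) f = lam I (?H n) g"] f unfolding g_def by blast+
  have "glue I M g i x = glue I M f i x" if x: "x:tors I (obj M i)" for i x
  proof -
   obtain k where k: "x:killed (obj M i) I k" using torsD[OF x] by blast
   have "ALL i. ALL x:killed (obj M i) I k. f k i x = g k i x"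
    using g(2) unfolding lam_eq[OF I mH f g(1)] imul_iff[OF coherentD(1)[OF f] coherentD(1)[OF g(1)]] by blast
   thus ?thesis unfolding glue[OF f k] glue[OF g(1) k] using k by simp
  qed
  thus ?thesis unfolding Lambda_hom_def g_def[symmetric] by (intro ext restrict_ext)
 qed
 have gh: "glue I M f i:Hom (obj (tors_cpx I M) i) (obj U (i + n))" if f: "coherent I (?H n) f" for f i n
 proof (rule mod_homI)
  note c = hom_cpx_hom[OF coherentD(1)[OF f]]
  fix x assume "x:El (tors_cpx I M) i"
  then obtain k where k: "x:killed (obj M i) I k" using torsD by auto
  show "glue I M f i x:El U (i + n)" unfolding glue[OF f k] by (rule hom_closed[OF c kc[OF k]])
  show "glue I M f i (r *[obj (tors_cpx I M) i] x) = r *[obj U (i + n)] glue I M f i x" if r: "r:carrier R" for r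
   using glue[OF f submoduleD(4)[OF mM killed_submodule[OF mM Ic] r k]] glue[OF f k] hom_smult[OF c r kc[OF k]] by simp
  fix y assume y: "y:El (tors_cpx I M) i"
  have "x:tors I (obj M i)" "y:tors I (obj M i)" using k y by (auto simp: tors_def)
  then obtain l where l: "x:killed (obj M i) I l" "y:killed (obj M i) I l" using mM Ic by (rule torsE)
  show "glue I M f i (x +[obj (tors_cpx I M) i] y) = glue I M f i x +[obj U (i + n)] glue I M f i y"
   using glue[OF f submoduleD(3)[OF mM killed_submodule[OF mM Ic] l]] glue[OF f l(1)] glue[OF f l(2)] hom_add[OF c kc[OF l(1)] kc[OF l(2)]] by simp
 qed
 have Pc: "Lambda_hom I M U n (lam I (?H n) f):El ?G n" if f: "coherent I (?H n) f" for n f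
  unfolding Psi[OF f] hom_cpx_obj using restrict_mod_hom[OF cc_module[OF TM] gh[OF f]] by simp
 have C: "s:El (Lambda_cpx R I (HC M U)) n \<longleftrightarrow> (EX f. coherent I (?H n) f & s = lam I (?H n) f)" for s n
  using Lambda_carrier[OF I mH] by simp
 have cm: "CM (Lambda_cpx R I (HC M U)) ?G (Lambda_hom I M U)"
 proof (rule chain_mapI[OF chain_complex_Lambda[OF I H] G])
  fix n
  show "Lambda_hom I M U n:Hom (obj (Lambda_cpx R I (HC M U)) n) (obj ?G n)"
  proof (rule mod_homI)
   fix s assume "s:El (Lambda_cpx R I (HC M U)) n"
   then obtain f where f: "coherent I (?H n) f" "s = lam I (?H n) f" unfolding C by blast
   show "Lambda_hom I M U n s:El ?G n" unfolding f(2) by (rule Pc[OF f(1)])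
   show "Lambda_hom I M U n (r *[obj (Lambda_cpx R I (HC M U)) n] s) = r *[obj ?G n] Lambda_hom I M U n s" if r: "r:carrier R" for r
   proof -
    note rf = coherent_smult[OF I mH r f(1)]
    have "glue I M (%k. r *[?H n] f k) i x = r *[obj U (i + n)] glue I M f i x" if x: "x:tors I (obj M i)" for i x
    proof -
     obtain k where k: "x:killed (obj M i) I k" using torsD[OF x] by blast
     show ?thesis unfolding glue[OF rf k] glue[OF f(1) k] using kc[OF k] by (simp add: hom_cpx_ops)
    qed
    thus ?thesis unfolding f(2) Lambda_cpx_simps lam_ops(3)[OF I mH r f(1)] Psi[OF rf] Psi[OF f(1)] by (auto simp: hom_cpx_ops fun_eq_iff)
   qed
   fix t assume "t:El (Lambda_cpx R I (HC M U)) n"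
   then obtain g where g: "coherent I (?H n) g" "t = lam I (?H n) g" unfolding C by blast
   note fg = coherent_plus[OF I mH f(1) g(1)]
   have "glue I M (%k. f k +[?H n] g k) i x = glue I M f i x +[obj U (i + n)] glue I M g i x" if x: "x:tors I (obj M i)" for i x
   proof -
    obtain k where k: "x:killed (obj M i) I k" using torsD[OF x] by blast
    show ?thesis unfolding glue[OF fg k] glue[OF f(1) k] glue[OF g(1) k] using kc[OF k] by (simp add: hom_cpx_ops)
   qed
   thus "Lambda_hom I M U n (s +[obj (Lambda_cpx R I (HC M U)) n] t) = Lambda_hom I M U n s +[obj ?G n] Lambda_hom I M U n t"
    unfolding f(2) g(2) Lambda_cpx_simps lam_ops(2)[OF I mH f(1) g(1)] Psi[OF fg] Psi[OF f(1)] Psi[OF g(1)] by (auto simp: hom_cpx_ops fun_eq_iff)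
  qed
  fix s assume "s:El (Lambda_cpx R I (HC M U)) n"
  then obtain f where f: "coherent I (?H n) f" "s = lam I (?H n) f" unfolding C by blast
  note df = coherent_hom[OF I mH mH cc_dif[OF H] f(1)]
  show "dif ?G n (Lambda_hom I M U n s) = Lambda_hom I M U (n - 1) (dif (Lambda_cpx R I (HC M U)) n s)"
  proof (rule hom_cpx_ext[OF hom_cpx_dif_hom[OF TM U]])
   show "Lambda_hom I M U n s:El ?G n" unfolding f(2) by (rule Pc[OF f(1)])
   show "Lambda_hom I M U (n - 1) (dif (Lambda_cpx R I (HC M U)) n s):El ?G (n - 1)"
    unfolding f(2) Lambda_dif[OF I H f(1)] by (rule Pc[OF df])
   fix i x assume "x:El (tors_cpx I M) i"
   hence x: "x:tors I (obj M i)" by simp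
   then obtain k where k: "x:killed (obj M i) I k" using torsD by blast
   have dk: "dif M i x:killed (obj M (i - 1)) I k" by (rule killed_hom[OF cc_dif[OF M] mM mM Ic k])
   hence dt: "dif M i x:tors I (obj M (i - 1))" unfolding tors_def by blast
   show "dif ?G n (Lambda_hom I M U n s) i x = Lambda_hom I M U (n - 1) (dif (Lambda_cpx R I (HC M U)) n s) i x"
    unfolding f(2) Lambda_dif[OF I H f(1)] Psi[OF df] restrict_apply'[OF x] glue[OF df k]
    unfolding Psi[OF f(1)] using x dt kc[OF k] glue[OF f(1) k] glue[OF f(1) dk] by (simp add: hom_cpx_dif)
  qed
 qed
 show ?thesis
 proof (rule bij_quasi_iso[OF cm])
  fix n
  show "inj_on (Lambda_hom I M U n) (El (Lambda_cpx R I (HC M U)) n)"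
  proof (rule inj_onI)
   fix s t assume "s:El (Lambda_cpx R I (HC M U)) n" "t:El (Lambda_cpx R I (HC M U)) n" and e: "Lambda_hom I M U n s = Lambda_hom I M U n t"
   then obtain f g where f: "coherent I (?H n) f" "s = lam I (?H n) f" and g: "coherent I (?H n) g" "t = lam I (?H n) g" unfolding C by blast
   show "s = t" unfolding f(2) g(2) lam_eq[OF I mH f(1) g(1)] imul_iff[OF coherentD(1)[OF f(1)] coherentD(1)[OF g(1)]]
   proof (intro allI ballI)
    fix k i x assume k: "x:killed (obj M i) I k"
    have x: "x:tors I (obj M i)" using k unfolding tors_def by blast
    have "glue I M f i x = glue I M g i x" using fun_cong[OF fun_cong[OF e[unfolded f(2) g(2) Psi[OF f(1)] Psi[OF g(1)]], of i], of x] x by simp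
    thus "f k i x = g k i x" unfolding glue[OF f(1) k] glue[OF g(1) k] .
   qed
  qed
  fix h assume h: "h:El ?G n"
  \<comment> \<open>A map on the torsion part extends to \<open>M\<close> by injectivity of
    \<open>U\<close>; the constant sequence at the extension is a preimage.\<close>
  have "EX e:Hom (obj M i) (obj U (i + n)). ALL x:tors I (obj M i). e x = h i x" for i
   by (rule baer_extend[OF b mM tors_submodule[OF mM Ic]]) (use hom_cpx_hom[OF h, of i] in simp)
  then obtain e where e: "!!i. e i:Hom (obj M i) (obj U (i + n))" "!!i x. x:tors I (obj M i) ==> e i x = h i x" by metis
  define f where "f i = restrict (e i) (El M i)" for i
  have "f:carrier (?H n)" unfolding hom_cpx_obj f_def using restrict_mod_hom[OF mM e(1)] by simp
  hence f: "coherent I (?H n) (%k. f)" by (rule coherent_const[OF I mH])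
  have "Lambda_hom I M U n (lam I (?H n) (%k. f)) = h"
  proof (rule hom_cpx_ext[OF Pc[OF f] h])
   fix i x assume "x:El (tors_cpx I M) i"
   hence x: "x:tors I (obj M i)" by simp
   then obtain k where k: "x:killed (obj M i) I k" using torsD by blast
   show "Lambda_hom I M U n (lam I (?H n) (%k. f)) i x = h i x"
    unfolding Psi[OF f] restrict_apply'[OF x] glue[OF f k] using e(2)[OF x] tc[OF x] by (simp add: f_def)
  qed
  thus "EX s:El (Lambda_cpx R I (HC M U)) n. Lambda_hom I M U n s = h" using C f by blast
 qed
qed

section \<open>The torsion functor as a direct limit\<close>

text \<open>For torsion \<open>x\<close>, the class in the direct limit formed by all maps R/I^m ->
  A with 1 -> x, for every possible \<open>m\<close>. A map is determined by the image of 1, which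
  identifies the limit with the torsion submodule.\<close>

definition gclass :: "'a set => ('a, 'c) module => 'c => (nat \<times> ('a set => 'c)) set" where
 "gclass I A x = {(m, g). g:carrier (Gamma_sys R I A m) & g (qcos I m \<one>) = x}"

context
 fixes I :: "'a set" and A :: "('a, 'c) module"
 assumes I: "ideal I R" and A: "Md A"
begin

lemma Gsys: "f:carrier (Gamma_sys R I A n) \<longleftrightarrow> f:Hom (Q I n) A & f:extensional (carrier (Q I n))"
 by (simp add: Gamma_sys_def)

lemma Gsys_value: "f:carrier (Gamma_sys R I A n) ==> r:carrier R ==> f (qcos I n r) = r *[A] f (qcos I n \<one>)"
 unfolding Gsys qcos_smult[OF I, of r] using hom_smult[OF _ _ one_closed_Q[OF I]] by blast

lemma Gtrans:
 assumes f: "f:carrier (Gamma_sys R I A m)" and mn: "m <= n"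
 shows "Gamma_trans R I m n f:carrier (Gamma_sys R I A n)" and "Gamma_trans R I m n f (qcos I n \<one>) = f (qcos I m \<one>)"
proof -
 have h: "f:Hom (Q I m) A" using f unfolding Gsys by blast
 show "Gamma_trans R I m n f:carrier (Gamma_sys R I A n)" unfolding Gsys Gamma_trans_def
  using restrict_mod_hom[OF module_Q[OF I] hom_comp[OF quot_proj_hom(2)[OF I mn] h]] by simp
 show "Gamma_trans R I m n f (qcos I n \<one>) = f (qcos I m \<one>)"
  unfolding Gamma_trans_def restrict_apply'[OF one_closed_Q[OF I]] quot_proj_hom(1)[OF I mn one_closed] ..
qed

lemma Gsys_eq: assumes f: "f:carrier (Gamma_sys R I A n)" and g: "g:carrier (Gamma_sys R I A n)" and e: "f (qcos I n \<one>) = g (qcos I n \<one>)"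
 shows "f = g"
proof (rule extensionalityI)
 show "f:extensional (carrier (Q I n))" "g:extensional (carrier (Q I n))" using f g unfolding Gsys by auto
 fix S assume "S:carrier (Q I n)"
 then obtain r where r: "r:carrier R" "S = qcos I n r" unfolding qcos_carrier by blast
 show "f S = g S" unfolding r(2) Gsys_value[OF f r(1)] Gsys_value[OF g r(1)] e ..
qed

lemma dirlim_gclass: assumes f: "f:carrier (Gamma_sys R I A n)"
 shows "dirlim_class (Gamma_sys R I A) (Gamma_trans R I) n f = gclass I A (f (qcos I n \<one>))"
proof -
 have "(EX k. n <= k & m <= k & Gamma_trans R I n k f = Gamma_trans R I m k g) \<longleftrightarrow> g (qcos I m \<one>) = f (qcos I n \<one>)"
  if g: "g:carrier (Gamma_sys R I A m)" for m g
 proof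
  assume "EX k. n <= k & m <= k & Gamma_trans R I n k f = Gamma_trans R I m k g"
  then obtain k where k: "n <= k" "m <= k" "Gamma_trans R I n k f = Gamma_trans R I m k g" by blast
  thus "g (qcos I m \<one>) = f (qcos I n \<one>)" using Gtrans(2)[OF f k(1)] Gtrans(2)[OF g k(2)] by simp
 next
  assume e: "g (qcos I m \<one>) = f (qcos I n \<one>)"
  have k: "n <= max m n" "m <= max m n" by simp_all
  have "Gamma_trans R I n (max m n) f = Gamma_trans R I m (max m n) g"
   by (rule Gsys_eq[OF Gtrans(1)[OF f k(1)] Gtrans(1)[OF g k(2)]]) (simp add: Gtrans(2)[OF f k(1)] Gtrans(2)[OF g k(2)] e)
  thus "EX k. n <= k & m <= k & Gamma_trans R I n k f = Gamma_trans R I m k g" using k by blast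
 qed
 thus ?thesis unfolding dirlim_class_def gclass_def by (intro Collect_cong) auto
qed

lemma Gsys_tors: assumes f: "f:carrier (Gamma_sys R I A n)" shows "f (qcos I n \<one>):tors I A"
proof -
 note J = ideal_ideal_power[OF I, of n]
 have h: "f:Hom (Q I n) A" using f unfolding Gsys by blast
 have "r *[A] f (qcos I n \<one>) = 0[A]" if r: "r:ideal_power R I n" for r
 proof -
  have rr: "r:carrier R" using idealD(1)[OF J] r by blast
  have "ideal_power R I n +>\<^bsub>ring_module R\<^esub> r = ideal_power R I n +>\<^bsub>ring_module R\<^esub> 0[ring_module R]"
   unfolding cos_eq[OF module_ring_module ideal_submodule[OF J] rr[folded ring_module_simps(1)] m_zero[OF module_ring_module]]
   by (rule bexI[OF _ r]) (simp add: rr)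
  hence "qcos I n r = 0[Q I n]" unfolding qcos_def quot_zero cos_zero[OF module_ring_module ideal_submodule[OF J]] .
  thus ?thesis using Gsys_value[OF f rr] hom_zero[OF h module_Q[OF I] A] by simp
 qed
 hence "f (qcos I n \<one>):killed A I n" unfolding killed_ideal_power[OF A I] using hom_closed[OF h one_closed_Q[OF I]] by blast
 thus ?thesis unfolding tors_def by blast
qed

text \<open>Multiplication r -> r x is well defined on R/I^n as soon as I^n kills
  \<open>x\<close>.\<close>

lemma Gsys_ex: assumes x: "x:tors I A" shows "EX n f. f:carrier (Gamma_sys R I A n) & f (qcos I n \<one>) = x"
proof -
 obtain n where n: "x:killed A I n" using x unfolding tors_def by blast
 note J = ideal_ideal_power[OF I, of n]
 have xc: "x:carrier A" and k: "!!r. r:ideal_power R I n ==> r *[A] x = 0[A]" using n unfolding killed_ideal_power[OF A I] by auto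
 define f where "f = (\<lambda>S\<in>carrier (Q I n). (SOME r. r:carrier R & S = qcos I n r) *[A] x)"
 have fv: "f (qcos I n r) = r *[A] x" if r: "r:carrier R" for r
 proof -
  have c: "qcos I n r:carrier (Q I n)" unfolding qcos_carrier using r by blast
  define s where "s = (SOME s. s:carrier R & qcos I n r = qcos I n s)"
  have s: "s:carrier R" "qcos I n r = qcos I n s"
   using someI_ex[of "%s. s:carrier R & qcos I n r = qcos I n s"] r unfolding s_def by blast+
  obtain j where j: "j:ideal_power R I n" "r = j \<oplus> s"
   using s(2) cos_eq[OF module_ring_module ideal_submodule[OF J], of r s] r s(1) unfolding qcos_def by auto
  have jr: "j:carrier R" using idealD(1)[OF J] j(1) by blast
  show ?thesis unfolding f_def restrict_apply'[OF c] s_def[symmetric] unfolding j(2) m_add_smult[OF A jr s(1) xc] k[OF j(1)] using A s(1) xc by simp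
 qed
 have "f:Hom (Q I n) A"
 proof (rule mod_homI)
  note h = qcos_hom[OF I, of n]
  fix S assume "S:carrier (Q I n)"
  then obtain r where r: "r:carrier R" "S = qcos I n r" unfolding qcos_carrier by blast
  show "f S:carrier A" unfolding r(2) fv[OF r(1)] by (rule m_smult[OF A r(1) xc])
  show "f (t *[Q I n] S) = t *[A] f S" if t: "t:carrier R" for t
   using hom_smult[OF h t, of r] fv[OF m_closed[OF t r(1)]] fv[OF r(1)] m_mult_smult[OF A t r(1) xc] r by simp
  fix T assume "T:carrier (Q I n)"
  then obtain s where s: "s:carrier R" "T = qcos I n s" unfolding qcos_carrier by blast
  show "f (S +[Q I n] T) = f S +[A] f T"
   using hom_add[OF h, of r s] fv[OF a_closed[OF r(1) s(1)]] fv[OF r(1)] fv[OF s(1)] m_add_smult[OF A r(1) s(1) xc] r s by simp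
 qed
 hence "f:carrier (Gamma_sys R I A n)" unfolding Gsys by (simp add: f_def)
 moreover have "f (qcos I n \<one>) = x" using fv[OF one_closed] A xc by simp
 ultimately show ?thesis by blast
qed

lemma Gamma_carrier: "carrier (Gamma_module R I A) = gclass I A ` tors I A"
proof (intro equalityI subsetI)
 fix \<xi> assume "\<xi>:carrier (Gamma_module R I A)"
 then obtain n f where "f:carrier (Gamma_sys R I A n)" "\<xi> = dirlim_class (Gamma_sys R I A) (Gamma_trans R I) n f" unfolding Gamma_module_def dirlim_def by auto
 thus "\<xi>:gclass I A ` tors I A" using dirlim_gclass Gsys_tors by blast
next
 fix \<xi> assume "\<xi>:gclass I A ` tors I A"
 then obtain x where x: "x:tors I A" "\<xi> = gclass I A x" by blast
 obtain n f where f: "f:carrier (Gamma_sys R I A n)" "f (qcos I n \<one>) = x" using Gsys_ex[OF x(1)] by blast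
 have "\<xi> = dirlim_class (Gamma_sys R I A) (Gamma_trans R I) n f" unfolding dirlim_gclass[OF f(1)] f(2) x(2) ..
 thus "\<xi>:carrier (Gamma_module R I A)" using f(1) by (auto simp: Gamma_module_def dirlim_def)
qed

text \<open>The operations of the direct limit are unions over representatives; when all members
  agree and one exists, the union is that member.\<close>

lemma UN_gclass: assumes x: "x:tors I A" and c: "!!n f. f:carrier (Gamma_sys R I A n) ==> f (qcos I n \<one>) = x ==> F n f = C"
 shows "(\<Union>(n, f)\<in>gclass I A x. F n f) = C"
proof -
 obtain n f where "f:carrier (Gamma_sys R I A n)" "f (qcos I n \<one>) = x" using Gsys_ex[OF x] by blast
 hence "(n, f):gclass I A x" by (simp add: gclass_def)
 thus ?thesis using c unfolding gclass_def by auto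
qed

lemma gclass_inj: "inj_on (gclass I A) (tors I A)"
proof (rule inj_onI)
 fix x y assume x: "x:tors I A" and e: "gclass I A x = gclass I A y"
 obtain n f where "f:carrier (Gamma_sys R I A n)" "f (qcos I n \<one>) = x" using Gsys_ex[OF x] by blast
 hence "(n, f):gclass I A y" unfolding e[symmetric] by (simp add: gclass_def)
 thus "x = y" using \<open>f (qcos I n \<one>) = x\<close> by (simp add: gclass_def)
qed

lemma module_Gsys: "Md (Gamma_sys R I A n)"
 unfolding Gamma_sys_def by (rule module_hom_module[OF module_Q[OF I] A])

lemma Gsys_ops: "f:carrier (Gamma_sys R I A n) ==> g:carrier (Gamma_sys R I A n) ==> (f +[Gamma_sys R I A n] g) (qcos I n \<one>) = f (qcos I n \<one>) +[A] g (qcos I n \<one>)"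
 "(r *[Gamma_sys R I A n] f) (qcos I n \<one>) = r *[A] f (qcos I n \<one>)" "0[Gamma_sys R I A n] (qcos I n \<one>) = 0[A]"
 using one_closed_Q[OF I, of n] by (simp_all add: Gamma_sys_def)

lemma Gamma_ops:
 shows "0[Gamma_module R I A] = gclass I A 0[A]"
  and "x:tors I A ==> y:tors I A ==> gclass I A x +[Gamma_module R I A] gclass I A y = gclass I A (x +[A] y)"
  and "r:carrier R ==> x:tors I A ==> r *[Gamma_module R I A] gclass I A x = gclass I A (r *[A] x)"
proof -
 show "0[Gamma_module R I A] = gclass I A 0[A]"
  using dirlim_gclass[OF m_zero[OF module_Gsys], of 0] by (simp add: Gamma_module_def dirlim_def Gsys_ops)
 show "gclass I A x +[Gamma_module R I A] gclass I A y = gclass I A (x +[A] y)" if x: "x:tors I A" and y: "y:tors I A"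
  unfolding Gamma_module_def dirlim_def monoid.simps ring.simps
 proof (rule UN_gclass[OF x], rule UN_gclass[OF y])
  fix m f n g assume f: "f:carrier (Gamma_sys R I A m)" "f (qcos I m \<one>) = x" and g: "g:carrier (Gamma_sys R I A n)" "g (qcos I n \<one>) = y"
  note t = Gtrans[OF f(1) max.cobounded1[of m n]] Gtrans[OF g(1) max.cobounded2[of n m]]
  show "dirlim_class (Gamma_sys R I A) (Gamma_trans R I) (max m n) (Gamma_trans R I m (max m n) f +[Gamma_sys R I A (max m n)] Gamma_trans R I n (max m n) g) = gclass I A (x +[A] y)"
   using dirlim_gclass[OF m_add[OF module_Gsys t(1,3)]] Gsys_ops(1)[OF t(1,3)] t(2,4) f(2) g(2) by simp
 qed
 show "r *[Gamma_module R I A] gclass I A x = gclass I A (r *[A] x)" if r: "r:carrier R" and x: "x:tors I A"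
  unfolding Gamma_module_def dirlim_def module.simps
 proof (rule UN_gclass[OF x])
  fix n f assume f: "f:carrier (Gamma_sys R I A n)" "f (qcos I n \<one>) = x"
  show "dirlim_class (Gamma_sys R I A) (Gamma_trans R I) n (r *[Gamma_sys R I A n] f) = gclass I A (r *[A] x)"
   unfolding dirlim_gclass[OF m_smult[OF module_Gsys r f(1)]] Gsys_ops(2) f(2) ..
 qed
qed

lemma module_Gamma: "Md (Gamma_module R I A)"
 by (rule module_by_surj[OF module_tors[OF A idealD(1)[OF I]], where q = "gclass I A"]) (simp_all add: Gamma_carrier Gamma_ops)

lemma gclass_hom: "gclass I A:Hom (A\<lparr>carrier := tors I A\<rparr>) (Gamma_module R I A)"
 by (rule mod_homI) (simp_all add: Gamma_carrier Gamma_ops)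

end

lemma Gamma_map_gclass:
 fixes A :: "('a, 'c) module" and B :: "('a, 'd) module"
 assumes I: "ideal I R" and A: "Md A" and B: "Md B" and h: "h:Hom A B" and x: "x:tors I A"
 shows "Gamma_map R I B h (gclass I A x) = gclass I B (h x)"
 unfolding Gamma_map_def
proof (rule UN_gclass[OF I A x])
 fix n f assume f: "f:carrier (Gamma_sys R I A n)" "f (qcos I n \<one>) = x"
 have "(\<lambda>S\<in>carrier (Q I n). h (f S)):carrier (Gamma_sys R I B n)"
  using f(1) restrict_mod_hom[OF module_Q[OF I] hom_comp[OF _ h, of f]] unfolding Gsys[OF I A] Gsys[OF I B] by simp
 from dirlim_gclass[OF I B this] show "dirlim_class (Gamma_sys R I B) (Gamma_trans R I) n (\<lambda>S\<in>carrier (Q I n). h (f S)) = gclass I B (h x)"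
  using one_closed_Q[OF I, of n] f(2) by simp
qed

lemma Gamma_cpx_simps [simp]: "obj (Gamma_cpx R I X) i = Gamma_module R I (obj X i)" "dif (Gamma_cpx R I X) i = Gamma_map R I (obj X (i - 1)) (dif X i)"
 by (simp_all add: Gamma_cpx_def)

lemma chain_map_gclass: assumes I: "ideal I R" and X: "CC X"
 shows "CM (tors_cpx I X) (Gamma_cpx R I X) (%i. gclass I (obj X i))"
proof -
 note Ic = idealD(1)[OF I] and M = cc_module[OF X]
 note T = chain_complex_tors[OF X Ic]
 note c = Gamma_carrier[OF I M] and e = Gamma_map_gclass[OF I M M cc_dif[OF X]]
 have dt: "dif X i x:tors I (obj X (i - 1))" if "x:tors I (obj X i)" for i x by (rule tors_hom[OF cc_dif[OF X] M M Ic that])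
 show ?thesis
 proof (rule chain_mapI[OF T])
  show "CC (Gamma_cpx R I X)"
  proof (rule chain_complexI)
   fix i show "Md (obj (Gamma_cpx R I X) i)" using module_Gamma[OF I M] by simp
   show "dif (Gamma_cpx R I X) i:Hom (obj (Gamma_cpx R I X) i) (obj (Gamma_cpx R I X) (i - 1))"
    unfolding Gamma_cpx_simps
   proof (rule mod_homI)
    note D = submoduleD[OF M tors_submodule[OF M Ic]]
    fix s assume "s:carrier (Gamma_module R I (obj X i))"
    then obtain x where x: "x:tors I (obj X i)" "s = gclass I (obj X i) x" unfolding c by blast
    show "Gamma_map R I (obj X (i - 1)) (dif X i) s:carrier (Gamma_module R I (obj X (i - 1)))" unfolding x(2) e[OF x(1)] c using dt[OF x(1)] by blast
    show "Gamma_map R I (obj X (i - 1)) (dif X i) (r *[Gamma_module R I (obj X i)] s) = r *[Gamma_module R I (obj X (i - 1))] Gamma_map R I (obj X (i - 1)) (dif X i) s" if r: "r:carrier R" for r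
     unfolding x(2) Gamma_ops(3)[OF I M r x(1)] e[OF x(1)] e[OF D(4)[OF r x(1)]] Gamma_ops(3)[OF I M r dt[OF x(1)]] d_smult[OF X r subsetD[OF D(1) x(1)]] ..
    fix t assume "t:carrier (Gamma_module R I (obj X i))"
    then obtain y where y: "y:tors I (obj X i)" "t = gclass I (obj X i) y" unfolding c by blast
    show "Gamma_map R I (obj X (i - 1)) (dif X i) (s +[Gamma_module R I (obj X i)] t) = Gamma_map R I (obj X (i - 1)) (dif X i) s +[Gamma_module R I (obj X (i - 1))] Gamma_map R I (obj X (i - 1)) (dif X i) t"
     unfolding x(2) y(2) Gamma_ops(2)[OF I M x(1) y(1)] e[OF x(1)] e[OF y(1)] e[OF D(3)[OF x(1) y(1)]] Gamma_ops(2)[OF I M dt[OF x(1)] dt[OF y(1)]]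
      d_add[OF X subsetD[OF D(1) x(1)] subsetD[OF D(1) y(1)]] ..
   qed
   fix s assume "s:El (Gamma_cpx R I X) i"
   then obtain x where x: "x:tors I (obj X i)" "s = gclass I (obj X i) x" unfolding Gamma_cpx_simps c by blast
   show "dif (Gamma_cpx R I X) (i - 1) (dif (Gamma_cpx R I X) i s) = 0[obj (Gamma_cpx R I X) (i - 1 - 1)]"
    unfolding x(2) Gamma_cpx_simps e[OF x(1)] e[OF dt[OF x(1)]] Gamma_ops(1)[OF I M] d_d[OF X tors_in[OF M Ic x(1)]] ..
  qed
  show "gclass I (obj X i):Hom (obj (tors_cpx I X) i) (obj (Gamma_cpx R I X) i)" for i using gclass_hom[OF I M] by simp
  show "dif (Gamma_cpx R I X) i (gclass I (obj X i) x) = gclass I (obj X (i - 1)) (dif (tors_cpx I X) i x)" if "x:El (tors_cpx I X) i" for i x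
   using e[of x i] that by simp
 qed
qed

lemma quasi_iso_tors_Gamma: assumes I: "ideal I R" and X: "CC X"
 shows "QI (tors_cpx I X) (Gamma_cpx R I X) (%i. gclass I (obj X i))"
  and "EX g. QI (Gamma_cpx R I X) (tors_cpx I X) g"
proof -
 note M = cc_module[OF X]
 have inj: "inj_on (gclass I (obj X i)) (El (tors_cpx I X) i)" for i using gclass_inj[OF I M] by simp
 have surj: "EX x:El (tors_cpx I X) i. gclass I (obj X i) x = y" if "y:El (Gamma_cpx R I X) i" for i y
  using that Gamma_carrier[OF I M] by auto
 show "QI (tors_cpx I X) (Gamma_cpx R I X) (%i. gclass I (obj X i))" by (rule bij_quasi_iso[OF chain_map_gclass[OF I X] inj surj])
 show "EX g. QI (Gamma_cpx R I X) (tors_cpx I X) g" using bij_inverse_quasi_iso[OF chain_map_gclass[OF I X] inj surj] by blast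
qed

end

section \<open>Torsion of Hom with finite free source\<close>

context finite_free_source begin

text \<open>Only generators of degree between \<open>c\<close> and \<open>d - n\<close> can have
  nonzero values, and these are finitely many; a common power of \<open>I\<close> kills all the
  values, hence the map.\<close>

lemma tors_hom_cpx:
 assumes I: "ideal I R" and c: "!!i. i < c ==> B i = {}" and d: "!!i. d < i ==> El K i = {0[obj K i]}"
 shows "f:tors I (obj M n) \<longleftrightarrow> f:El (HC L (tors_cpx I K)) n"
proof
 note Ic = idealD(1)[OF I] and mM = cc_module[OF M] and mK = cc_module[OF K]
 have H: "f:El (HC L (tors_cpx I K)) n \<longleftrightarrow> f:El M n & (ALL i. ALL x:El L i. f i x:tors I (obj K (i + n)))"
  unfolding hom_cpx_obj mod_hom_def using tors_in[OF mK Ic] by (auto simp: Pi_iff)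
 show "f:El (HC L (tors_cpx I K)) n" if f: "f:tors I (obj M n)"
  unfolding H using tors_in[OF mM Ic f] tors_hom[OF eval_hom mM mK Ic f] by blast
 assume f: "f:El (HC L (tors_cpx I K)) n"
 have fM: "f:El M n" and ft: "!!i x. x:El L i ==> f i x:tors I (obj K (i + n))" using f unfolding H by auto
 let ?P = "Sigma {c..d - n} B"
 have "ALL p:?P. EX k. f (fst p) (gen1 (snd p)):killed (obj K (fst p + n)) I k" using ft[OF gen] by (auto simp: tors_def)
 then obtain k where k: "!!p. p:?P ==> f (fst p) (gen1 (snd p)):killed (obj K (fst p + n)) I (k p)" by metis
 define N where "N = Max (insert 0 (k ` ?P))"
 have fP: "finite ?P" using fin by (intro finite_SigmaI) simp_all
 have "f:killed (obj M n) I N" unfolding killed_ideal_power[OF mM I] mem_Collect_eq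
 proof (intro conjI ballI fM)
  fix r assume r: "r:ideal_power R I N"
  have rr: "r:carrier R" using idealD(1)[OF ideal_ideal_power[OF I]] r by blast
  show "r *[obj M n] f = 0[obj M n]"
  proof (rule M_eq_on_gens[OF m_smult[OF mM rr fM] m_zero[OF mM]])
   fix p e assume e: "e:B p"
   note g = gen[OF e]
   have "r *[obj K (p + n)] f p (gen1 e) = 0[obj K (p + n)]"
   proof (cases "d < p + n")
    case True
    thus ?thesis using d[OF True] hom_cpx_closed[OF fM g] rr K by auto
   next
    case False
    hence P: "(p, e):?P" using e c[of p] by (cases "p < c") auto
    have "k (p, e) <= N" unfolding N_def using fP P by (intro Max_ge) auto
    hence "f p (gen1 e):killed (obj K (p + n)) I N" using k[OF P] killed_mono[OF mK Ic] by auto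
    thus ?thesis using r unfolding killed_ideal_power[OF mK I] by blast
   qed
   thus "(r *[obj M n] f) p (gen1 e) = 0[obj M n] p (gen1 e)" using g by (simp add: hom_cpx_ops)
  qed
 qed
 thus "f:tors I (obj M n)" unfolding tors_def by blast
qed

lemma quasi_iso_tors_hom:
 assumes I: "ideal I R" and c: "!!i. i < c ==> B i = {}" and d: "!!i. d < i ==> El K i = {0[obj K i]}"
 shows "QI (tors_cpx I M) (HC L (tors_cpx I K)) (%i x. x)"
proof (rule bij_quasi_iso)
 note Ic = idealD(1)[OF I] and t = tors_hom_cpx[OF I c d]
 show "CM (tors_cpx I M) (HC L (tors_cpx I K)) (%i x. x)"
 proof (rule chain_mapI[OF chain_complex_tors[OF M Ic] chain_complex_hom[OF L chain_complex_tors[OF K Ic]]])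
  show "(%x. x):Hom (obj (tors_cpx I M) i) (obj (HC L (tors_cpx I K)) i)" for i
   by (rule mod_homI) (simp_all add: t hom_cpx_ops)
  fix i x assume "x:El (tors_cpx I M) i"
  hence x: "x:tors I (obj M i)" by simp
  have ct: "x p y:tors I (obj K (p + i))" if "y:El L p" for p y
   by (rule tors_hom[OF eval_hom[OF that] cc_module[OF M] cc_module[OF K] Ic x])
  have "~[(obj K (p + i - 1))\<lparr>carrier := tors I (obj K (p + i - 1))\<rparr>] x (p - 1) (dif L p y) = ~[obj K (p + i - 1)] x (p - 1) (dif L p y)" if "y:El L p" for p y
   using ct[OF d_closed[OF L that]]
   by (intro neg_sub[OF cc_module[OF K] module_tors[OF cc_module[OF K] Ic] submoduleD(1)[OF cc_module[OF K] tors_submodule[OF cc_module[OF K] Ic]]]) (simp add: int_index)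
  thus "dif (HC L (tors_cpx I K)) i x = dif (tors_cpx I M) i x" by (auto simp: hom_cpx_dif sg_def fun_eq_iff)
 qed
qed (use tors_hom_cpx[OF I c d] in auto)

end

context cring begin

section \<open>Homotheties\<close>

lemma zero_homology_quasi_iso:
 assumes f: "QI X Y f"
 shows "zero_homology Y i ==> zero_homology X i" and "zero_homology X i ==> zero_homology Y i"
proof -
 note c = qi_cm[OF f]
 note X = cm_complex(1)[OF c] and Y = cm_complex(2)[OF c] and q = f[unfolded quasi_iso_iff[OF c]]
 show "zero_homology X i" if z: "zero_homology Y i" unfolding zero_homology_iff[OF X]
 proof (intro allI impI)
  fix x assume x: "x:El X i" "dif X i x = 0[obj X (i - 1)]"
  have "f i x:carrier (cycles Y i)" by (rule cm_cycle[OF c]) (use x in simp)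
  hence "f i x:boundaries Y i" using z unfolding zero_homology_iff[OF Y] by simp
  thus "x:boundaries X i" using q x by simp
 qed
 show "zero_homology Y i" if z: "zero_homology X i" unfolding zero_homology_iff[OF Y]
 proof (intro allI impI)
  fix y assume "y:El Y i" "dif Y i y = 0[obj Y (i - 1)]"
  then obtain x n where x: "x:carrier (cycles X i)" "n:boundaries Y i" "y = n +[obj Y i] f i x" using q by (metis cycles_simps(1))
  have "x:boundaries X i" using z x(1) unfolding zero_homology_iff[OF X] by simp
  hence "f i x:boundaries Y i" by (rule cm_bd[OF c])
  thus "y:boundaries Y i" unfolding x(3) using submoduleD(3)[OF cc_module[OF Y] submodule_boundaries_obj[OF Y]] x(2) by blast
 qed
qed

lemma trivial_zero_homology: "CC X ==> El X i = {0[obj X i]} ==> zero_homology X i"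
 using submoduleD(2)[of "obj X i", OF _ submodule_boundaries_obj[of X i]] by (simp add: zero_homology_iff)

lemma ring_cpx_complex: "CC (ring_cpx R)"
proof (rule chain_complexI)
 fix i
 have "Md ((ring_module R)\<lparr>carrier := {\<zero>}\<rparr>)" by (rule module_sub[OF module_ring_module]) simp_all
 thus m: "Md (obj (ring_cpx R) i)" by (simp add: ring_cpx_def)
 show "dif (ring_cpx R) i:Hom (obj (ring_cpx R) i) (obj (ring_cpx R) (i - 1))"
  by (rule mod_homI) (auto simp: ring_cpx_def)
qed (simp add: ring_cpx_def)

lemma homothety_chain_map:
 assumes X: "CC X" shows "CM (ring_cpx R) (HC X X) (homothety R X X (%i x. x))"
proof (rule chain_mapI[OF ring_cpx_complex chain_complex_hom[OF X X]])
 let ?H = "HC X X" let ?\<mu> = "homothety R X X (%i x. x)"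
 note H = chain_complex_hom[OF X X] and mX = cc_module[OF X]
 have c: "?\<mu> 0 r:El ?H 0" if r: "r:carrier R" for r
  unfolding hom_cpx_obj homothety_def using restrict_mod_hom[OF mX hom_scale[OF hom_id mX r]] by simp
 fix n
 show "?\<mu> n:Hom (obj (ring_cpx R) n) (obj ?H n)"
 proof (cases "n = 0")
  case True
  have "?\<mu> 0:Hom (ring_module R) (obj ?H 0)"
   by (rule mod_homI) (use c in \<open>auto simp: homothety_def hom_cpx_ops fun_eq_iff m_add_smult[OF mX] m_mult_smult[OF mX] m_smult[OF mX]\<close>)
  thus ?thesis using True by (simp add: ring_cpx_def)
 next
  case False
  have m: "Md (obj (ring_cpx R) n)" using ring_cpx_complex by simp
  show ?thesis by (rule mod_hom_cong[OF hom_const_zero[OF cc_module[OF H]] m]) (use False in \<open>simp add: homothety_def\<close>)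
 qed
 fix r assume r: "r:El (ring_cpx R) n"
 have z: "0[obj ?H (n - 1)] = ?\<mu> (n - 1) \<zero>" using X by (auto simp: homothety_def hom_cpx_ops fun_eq_iff m_zero_smult[OF mX])
 show "dif ?H n (?\<mu> n r) = ?\<mu> (n - 1) (dif (ring_cpx R) n r)"
 proof (cases "n = 0")
  case True
  hence r: "r:carrier R" using r by (simp add: ring_cpx_def)
  have "dif ?H 0 (?\<mu> 0 r) = 0[obj ?H (0 - 1)]"
  proof (rule hom_cpx_ext[OF hom_cpx_dif_hom[OF X X c[OF r]] m_zero[OF cc_module[OF H]]])
   fix i x assume x: "x:El X i"
   thus "dif ?H 0 (?\<mu> 0 r) i x = 0[obj ?H (0 - 1)] i x"
    using d_closed[OF X x] d_smult[OF X r x] r mX m_r_neg[OF mX m_smult[OF mX r d_closed[OF X x]]] by (simp add: hom_cpx_dif homothety_def hom_cpx_ops sg_def)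
  qed
  thus ?thesis using z True by (simp add: ring_cpx_def)
 next
  case False
  hence "?\<mu> n r = 0[obj ?H n]" by (simp add: homothety_def)
  thus ?thesis using d_zero[OF H, of n] z by (simp add: ring_cpx_def)
 qed
qed

lemma quasi_iso_cong: assumes f: "QI X Y f" and e: "!!i x. x:El X i ==> g i x = f i x" shows "QI X Y g"
proof -
 note c = qi_cm[OF f]
 have c': "CM X Y g" by (rule chain_map_cong[OF c e])
 show ?thesis using f unfolding quasi_iso_iff[OF c] quasi_iso_iff[OF c'] using e by simp
qed

text \<open>In Hom(Z, K) the homotheties of \<open>K\<close> and of the pair D, I become the same
  map, r -> r g \<eta> p. The comparison maps into Hom(Z, K) are quasi-isomorphisms, so
  two-out-of-three applies.\<close>

lemma homothety_transport:
 fixes K :: "('a, 'c) cpx"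
 assumes D: "CC D" and e: "QI D I \<eta>" and hm: "QI (ring_cpx R) (HC D I) (homothety R D I \<eta>)"
  and h: "heq I K g h" and p: "QI Z D p" and b: "!!i. baer (obj K i)" and bd: "!!i. d < i ==> El K i = {0[obj K i]}"
 shows "QI (ring_cpx R) (HC K K) (homothety R K K (%i x. x))"
proof -
 note gq = heq_qi[OF h]
 note K = cm_complex(2)[OF qi_cm[OF gq]] and Z = cm_complex(1)[OF qi_cm[OF p]] and I = cm_complex(2)[OF qi_cm[OF e]]
 note mK = cc_module[OF K] and mI = cc_module[OF I]
 let ?q = "%i x. g i (\<eta> i (p i x))"
 have q: "QI Z K ?q" by (rule qi_comp[OF qi_comp[OF p e] gq])
 have a: "QI (ring_cpx R) (HC Z K) (%n r. prec Z p n (postc D g n (homothety R D I \<eta> n r)))"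
  by (rule qi_comp[OF qi_comp[OF hm heq_postc_qi[OF h D]] prec_qi_baer[OF p K b bd]])
 have "prec Z ?q n (homothety R K K (%i x. x) n r) = prec Z p n (postc D g n (homothety R D I \<eta> n r))" if r: "r:El (ring_cpx R) n" for n r
 proof (intro ext)
  fix i x
  show "prec Z ?q n (homothety R K K (%i x. x) n r) i x = prec Z p n (postc D g n (homothety R D I \<eta> n r)) i x"
  proof (cases "x:El Z i")
   case True
   note c = cm_closed[OF qi_cm[OF p] True]
   note c' = cm_closed[OF qi_cm[OF e] c]
   have rr: "r:carrier R" using r by (auto simp: ring_cpx_def split: if_splits)
   show ?thesis
    using True c cm_closed[OF qi_cm[OF q] True] hom_smult[OF cm_hom[OF qi_cm[OF gq]] rr c'] hom_zero[OF cm_hom[OF qi_cm[OF gq]] mI mK, of "i + n"]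
    by (simp add: prec_def postc_def homothety_def hom_cpx_ops)
  qed (simp add: prec_def)
 qed
 hence "QI (ring_cpx R) (HC Z K) (%n r. prec Z ?q n (homothety R K K (%i x. x) n r))"
  by (rule quasi_iso_cong[OF a])
 note 1 = this
 have "QI (HC K K) (HC Z K) (prec Z ?q)" by (rule prec_qi_baer[OF q K b bd])
 from qi_cancel_left[OF homothety_chain_map[OF K] this] 1 show ?thesis by blast
qed

text \<open>Translation into the assumptions of the locale \<open>biduality\<close>.\<close>

lemma homothety_elements:
 assumes K: "CC K" and q: "QI (ring_cpx R) (HC K K) (homothety R K K (%i x. x))"
 shows "n ~= 0 ==> CM K (shift K n) \<theta> ==> null K (shift K n) \<theta>"
  and "CM K K \<theta> ==> EX r:carrier R. htp K K \<theta> (%i x. r *[obj K i] x)"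
  and "r:carrier R ==> null K K (%i x. r *[obj K i] x) ==> r = \<zero>"
proof -
 let ?H = "HC K K" let ?\<mu> = "homothety R K K (%i x. x)"
 note \<mu> = homothety_chain_map[OF K] and H = chain_complex_hom[OF K K] and mK = cc_module[OF K]
 note Q = q[unfolded quasi_iso_iff[OF \<mu>]]
 have rep: "EX r:carrier (cycles (ring_cpx R) n). EX b:boundaries ?H n. hom_of K K n \<theta> = b +[obj ?H n] ?\<mu> n r" if "CM K (shift K n) \<theta>" for n \<theta>
  using Q hom_of_cycle[OF that K] by blast
 show "null K (shift K n) \<theta>" if n: "n ~= 0" and t: "CM K (shift K n) \<theta>"
 proof -
  obtain r b where b: "b:boundaries ?H n" "hom_of K K n \<theta> = b +[obj ?H n] ?\<mu> n r" using rep[OF t] by blast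
  have th: "\<theta> i:Hom (obj K i) (obj K (i + n))" for i using cm_hom[OF t, of i] by simp
  have "hom_of K K n \<theta> = b" unfolding b(2) using n bd_closed[OF H b(1)] H by (simp add: homothety_def)
  hence "null K (shift K n) (tw K n (hom_of K K n \<theta>))" using b(1) hom_bd_iff[OF K K hom_of_carrier[OF K K th]] by simp
  thus ?thesis by (rule null_cong) (simp add: tw_hom_of[OF K th])
 qed
 have tw0: "tw K 0 f i x = f i x" for f :: "int => _ => _" and i x by (simp add: tw_def sg_def)
 show "EX r:carrier R. htp K K \<theta> (%i x. r *[obj K i] x)" if t: "CM K K \<theta>"
 proof -
  have t0: "CM K (shift K 0) \<theta>" using t by (simp add: shift_0)
  obtain r b where r: "r:carrier (cycles (ring_cpx R) 0)" and b: "b:boundaries ?H 0" "hom_of K K 0 \<theta> = b +[obj ?H 0] ?\<mu> 0 r" using rep[OF t0] by blast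
  have rr: "r:carrier R" using r by (simp add: ring_cpx_def)
  have bc: "b:El ?H 0" by (rule bd_closed[OF H b(1)])
  have "null K (shift K 0) (tw K 0 b)" using b(1) hom_bd_iff[OF K K bc] by simp
  then obtain s where s: "homotopy K K s" "!!i x. x:El K i ==> b i x = hbd K K s i x" unfolding tw0 shift_0 by (rule nullE) blast
  have "htp K K \<theta> (%i x. r *[obj K i] x)"
  proof (rule htpI[OF s(1)])
   fix i x assume x: "x:El K i"
   have "\<theta> i x = hom_of K K 0 \<theta> i x" using x by (simp add: hom_of_def tw0)
   also have "... = b i x +[obj K i] r *[obj K i] x" unfolding b(2) using x by (simp add: hom_cpx_ops homothety_def)
   finally show "\<theta> i x = r *[obj K i] x +[obj K i] hbd K K s i x"
    using s(2)[OF x] m_comm'[OF mK hbd_closed[OF s(1) K K x] m_smult[OF mK rr x]] by simp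
  qed
  thus ?thesis using rr by blast
 qed
 show "r = \<zero>" if r: "r:carrier R" and n: "null K K (%i x. r *[obj K i] x)"
 proof -
  have rc: "r:carrier (cycles (ring_cpx R) 0)" using r by (simp add: ring_cpx_def)
  have "null K (shift K 0) (tw K 0 (?\<mu> 0 r))" unfolding tw0 shift_0 by (rule null_cong[OF n]) (simp add: homothety_def)
  hence "?\<mu> 0 r:boundaries ?H 0" using hom_bd_iff[OF K K cm_closed[OF \<mu>, of r 0]] rc by simp
  hence "r:boundaries (ring_cpx R) 0" using Q rc by blast
  thus ?thesis by (auto simp: bd_iff ring_cpx_def)
 qed
qed

section \<open>The duality\<close>

text \<open>The tip of a roof has a prescribed carrier type; a copy of \<open>X\<close> on singleton
  lists serves.\<close>

lemma derived_isoI: fixes X :: "('a, 'c) cpx" and Y :: "('a, 'd) cpx"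
 assumes f: "QI X Y f" shows "derived_iso R X Y"
proof -
 define e :: "'c => ('a + 'c + 'd + nat) list" where "e x = [Inr (Inl x)]" for x
 note X = cm_complex(1)[OF qi_cm[OF f]]
 have inj: "inj_on e (El X i)" for i by (rule inj_onI) (simp add: e_def)
 note c = tr_cpx_maps(1)[OF X, of "%i. e", OF inj]
 have "QI (tr_cpx X (%i. e)) X (%i. inv_into (El X i) e)"
  by (rule bij_inverse_quasi_iso[OF c inj]) (auto simp: tr_cpx_def tr_module_simps)
 from this qi_comp[OF this f] show ?thesis unfolding derived_iso_def by blast
qed

text \<open>The changes of resolution are arranged to point in one direction. They compose to a
  single quasi-isomorphism from \<open>F\<close> to \<open>H\<close>, through the completions of
  \<open>V\<close> and Hom(M, U), and then through Hom complexes with target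
  \<open>U\<close>.\<close>

lemma formal_local_duality:
 fixes X D :: "('a, 'v) ucpx"
  and F :: "('a, nat => ('a set \<times> ('a, 'v) univ => 'a) set) cpx"
  and Xdag :: "('a, int => ('a, 'v) univ => ('a, 'v) univ) cpx"
  and GXdag GD :: "('a, (nat \<times> ('a set => ('a, 'v) univ)) set) cpx"
  and H :: "('a, int => (nat \<times> ('a set => ('a, 'v) univ)) set => ('a, 'v) univ) cpx"
 assumes noeth: "noetherian_ring R" and one: "\<one> ~= \<zero>" and \<aa>: "ideal \<aa> R" and \<bb>: "ideal \<bb> R" and X: "Dfb R X"
  and D: "dualizing_complex R D" and Xdag: "RHom R X D Xdag" and GXdag: "RGamma R \<aa> Xdag GXdag" and GD: "RGamma R \<bb> D GD"
  and H: "RHom R GXdag GD H" and F: "formal_local R \<aa> \<bb> X F"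
 shows "derived_iso R F H"
proof -
 note \<aa>c = idealD(1)[OF \<aa>] and \<bb>c = idealD(1)[OF \<bb>]
 have Xc: "CC X" and Dc: "CC D" using X D by (simp_all add: Dfb_def dualizing_complex_def)
 obtain I \<eta> where I: "K_injective R I" "QI D I \<eta>" "QI (ring_cpx R) (HC D I) (homothety R D (I :: ('a, 'v) ucpx) \<eta>)"
  using D unfolding dualizing_complex_def K_injective_resolution_def by blast
 obtain I2 \<eta>2 where I2: "K_injective R I2" "QI D I2 \<eta>2" "Xdag = HC X (I2 :: ('a, 'v) ucpx)"
  using Xdag unfolding RHom_def K_injective_resolution_def by blast
 obtain I3 \<eta>3 where I3: "K_injective R I3" "QI Xdag I3 \<eta>3" "GXdag = Gamma_cpx R \<aa> (I3 :: ('a, 'v) ucpx)"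
  using GXdag unfolding RGamma_def K_injective_resolution_def by blast
 obtain I4 \<eta>4 where I4: "K_injective R I4" "QI D I4 \<eta>4" "GD = Gamma_cpx R \<bb> (I4 :: ('a, 'v) ucpx)"
  using GD unfolding RGamma_def K_injective_resolution_def by blast
 obtain J \<eta>5 where J: "K_injective R J" "QI GD J \<eta>5" "H = HC GXdag (J :: ('a, 'v) ucpx)"
  using H unfolding RHom_def K_injective_resolution_def by blast
 obtain E \<epsilon> P \<pi> where E: "K_injective R E" "QI X E \<epsilon>"
  and P: "K_projective R P" "QI P (Gamma_cpx R \<bb> (E :: ('a, 'v) ucpx)) \<pi>" "F = Lambda_cpx R \<aa> (P :: ('a, 'v) ucpx)"
  using F unfolding formal_local_def RGamma_def LLambda_def K_injective_resolution_def K_projective_resolution_def by blast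
 obtain K :: "('a, 'v) ucpx" and \<kappa> where K: "CC K" "!!i. injective_module R (obj K i)" "!!i. \<kappa> < \<bar>i\<bar> ==> El K i = {0[obj K i]}" "derived_iso R D K"
  using D unfolding dualizing_complex_def finite_injective_dimension_def by blast
 \<comment> \<open>If \<open>'v\<close> had a single element, so would the universe; Hom(D, I) would
   be zero and 1 a boundary in \<open>ring_cpx R\<close>, contradicting \<one> ~= \<zero>. The
   encodings depend on having two values.\<close>
 have "EX v1 v2 :: 'v. v1 ~= v2"
 proof (rule ccontr)
  assume "~ (EX v1 v2 :: 'v. v1 ~= v2)"
  hence eq: "x = y" for x y :: "('a, 'v) univ" by (intro ext) blast
  note hc = qi_cm[OF I(3)]
  note HI = cm_complex(2)[OF hc]
  have o: "\<one>:El (ring_cpx R) 0" by (simp add: ring_cpx_def)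
  have "homothety R D I \<eta> 0 \<one> = 0[obj (HC D I) 0]"
   by (rule hom_cpx_ext[OF cm_closed[OF hc o] m_zero[OF cc_module[OF HI]]]) (rule eq)
  hence "homothety R D I \<eta> 0 \<one>:boundaries (HC D I) 0"
   using submoduleD(2)[OF cc_module[OF HI] submodule_boundaries_obj[OF HI]] by simp
  moreover have "\<one>:carrier (cycles (ring_cpx R) 0)" by (simp add: ring_cpx_def)
  ultimately have "\<one>:boundaries (ring_cpx R) 0" using I(3)[unfolded quasi_iso_iff[OF hc]] by blast
  thus False using one by (auto simp: bd_iff ring_cpx_def)
 qed
 then obtain v1 v2 :: 'v where v: "v1 ~= v2" by blast
 have bK: "baer (obj K i)" for i by (rule baer_injective[OF v K(2)])
 have Kb: "El K i = {0[obj K i]}" if "\<kappa> < i" for i by (rule K(3)) (use that in simp)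
 obtain Z p q where Z: "QI (Z :: ('a, ('a + ('a, 'v) univ + ('a, 'v) univ + nat) list) cpx) D p" "QI Z K q" using K(4) unfolding derived_iso_def by blast
 \<comment> \<open>Every K-injective resolution of \<open>D\<close> is homotopy equivalent to the
   one bounded complex \<open>K\<close>, through the roof \<open>Z\<close>.\<close>
 have cmp: "EX g h. heq I' K g h" if "K_injective R I'" "QI D I' \<eta>'" for I' :: "('a, 'v) ucpx" and \<eta>'
  by (rule K_injective_comparison[OF that(1) qi_comp[OF Z(1) that(2)] Z(2) bK Kb small_univ])
 obtain g h where gh: "heq I K g h" using cmp[OF I(1,2)] by blast
 obtain g2 h2 where gh2: "heq I2 K g2 h2" using cmp[OF I2(1,2)] by blast
 obtain g4 h4 where gh4: "heq I4 K g4 h4" using cmp[OF I4(1,2)] by blast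
 have hom: "QI (ring_cpx R) (HC K K) (homothety R K K (%i x. x))"
  by (rule homothety_transport[OF Dc I(2,3) gh Z(1) bK Kb])
 obtain N where N: "!!i. N < \<bar>i\<bar> ==> zero_homology X i" using X unfolding Dfb_def homologically_bounded_def by blast
 have fgX: "fg_homology X i" for i using fg_homology_intro[OF Xc] X by (simp add: Dfb_def)
 have fgK: "fg_homology K i" for i
  using fg_homology_forward[OF Z(2) fg_homology_backward[OF Z(1) fg_homology_intro[OF Dc]]] D by (simp add: dualizing_complex_def Dfb_def)
 define c where "c = - N"
 have zX: "zero_homology X i" if "i < c" for i by (rule N) (use that in \<open>simp add: c_def\<close>)
 have exL: "EX (L :: ('a, nat => 'a) cpx) f Bs. (ALL i. obj L i = FM (Bs i)) & (ALL i. finite (Bs i)) & (ALL i<c. Bs i = {}) & QI L X f"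
  by (rule free_resolution[OF Xc resolving_finite[OF noeth Xc fgX]]) (rule zX)
 obtain L :: "('a, nat => 'a) cpx" and fL BL where L: "!!i. obj L i = FM (BL i)" "!!i. finite (BL i)" "!!i. i < c ==> BL i = {}" "QI L X fL"
  using exL by (elim exE conjE) (rule that, erule spec, erule spec, blast, assumption)
 note Lc = cm_complex(1)[OF qi_cm[OF L(4)]]
 interpret L: finite_free_source R L K BL by unfold_locales (use Lc K(1) L in auto)
 interpret biduality R L K BL \<kappa> by unfold_locales (use K(3) homothety_elements[OF K(1) hom] in auto)
 let ?M = "HC L K"
 note M = L.M
 have bM: "baer (obj ?M n)" for n by (rule L.baer_hom[OF bK])
 have Mb: "El ?M n = {0[obj ?M n]}" if "\<kappa> - c < n" for n by (rule L.hom_vanish_above[OF L(3) Kb that])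
 have zM: "zero_homology ?M n" if "n < - \<kappa> - N" for n
  by (rule L.zero_homology_hom[OF bK _ _ that]) (erule K(3), rule zero_homology_quasi_iso(1)[OF L(4) N], simp)
 have fgM: "fg_homology ?M n" for n by (rule L.fg_homology_hom[OF noeth fgK L(3) Kb])
 have exT: "EX (T :: ('a, nat => 'a) cpx) f Bs. (ALL i. obj T i = FM (Bs i)) & (ALL i. finite (Bs i)) & (ALL i<(- \<kappa> - N). Bs i = {}) & QI T ?M f"
  by (rule free_resolution[OF M resolving_finite[OF noeth M fgM]]) (rule zM)
 obtain T :: "('a, nat => 'a) cpx" and fT BT where T: "!!i. obj T i = FM (BT i)" "!!i. finite (BT i)" "!!i. i < - \<kappa> - N ==> BT i = {}" "QI T ?M fT"
  using exT by (elim exE conjE) (rule that, erule spec, erule spec, blast, assumption)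
 note Tc = cm_complex(1)[OF qi_cm[OF T(4)]]
 interpret T: finite_free_source R T K BT by unfold_locales (use Tc K(1) T in auto)
 let ?E = "HC T K"
 have Eb: "El ?E n = {0[obj ?E n]}" if "\<kappa> - (- \<kappa> - N) < n" for n by (rule T.hom_vanish_above[OF T(3) Kb that])
 \<comment> \<open>Hom(T, K) is the model of \<open>X\<close> on which torsion is computed: its
   source has a finite basis in each degree, so it is small and torsion passes inside Hom.\<close>
 have LE: "QI L ?E (%n x. prec T fT n (ev n x))" by (rule qi_comp[OF biduality prec_qi_baer[OF T(4) K(1) bK Kb]])
 obtain gE hE where ghE: "heq E ?E gE hE"
  using K_injective_comparison[OF E(1) qi_comp[OF L(4) E(2)] LE T.baer_hom[OF bK] Eb small_hom_free[OF T(1) K(1)]] by blast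
 define U where "U = tors_cpx \<bb> K"
 have Uc: "CC U" unfolding U_def by (rule chain_complex_tors[OF K(1) \<bb>c])
 have bU: "baer (obj U i)" for i unfolding U_def using baer_tors[OF noeth bK \<bb>] by simp
 have Ub': "El U i = {0[obj U i]}" if "\<kappa> < \<bar>i\<bar>" for i
  unfolding U_def using K(3)[OF that] submoduleD(1,2)[OF cc_module[OF K(1)] tors_submodule[OF cc_module[OF K(1)] \<bb>c]] by fastforce
 have Ub: "El U i = {0[obj U i]}" if "\<kappa> < i" for i by (rule Ub') (use that in simp)
 let ?S = "HC T U" and ?Q = "HC ?M U"
 have Ec: "CC E" by (rule cm_complex(2)[OF qi_cm[OF E(2)]])
 obtain gG where gG: "QI (Gamma_cpx R \<bb> E) (tors_cpx \<bb> E) gG" using quasi_iso_tors_Gamma(2)[OF \<bb> Ec] by blast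
 have "QI (tors_cpx \<bb> ?E) ?S (%i x. x)" unfolding U_def by (rule T.quasi_iso_tors_hom[OF \<bb> T(3) Kb])
 from qi_comp[OF qi_comp[OF P(2) gG] qi_comp[OF heq_qi[OF heq_tors[OF ghE \<bb>c]] this]] obtain \<sigma> where PS: "QI P ?S \<sigma>" by blast
 have QS: "QI ?Q ?S (prec T fT)" by (rule prec_qi_baer[OF T(4) Uc bU Ub])
 \<comment> \<open>M_i vanishes for i > \<kappa> - c and U_j for j < -\<kappa>; a nonzero map of
   degree \<open>n\<close> thus needs n \<ge> -\<kappa> - (\<kappa> - c).\<close>
 define c' where "c' = c - 2 * \<kappa>"
 have Qc: "CC ?Q" by (rule chain_complex_hom[OF M Uc])
 have Qb: "El ?Q n = {0[obj ?Q n]}" if n: "n < c'" for n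
 proof -
  have z: "0[obj ?Q n]:El ?Q n" by (rule m_zero[OF cc_module[OF Qc]])
  have "f = 0[obj ?Q n]" if f: "f:El ?Q n" for f
  proof (rule hom_cpx_ext[OF f z])
   fix i x assume x: "x:El ?M i"
   show "f i x = 0[obj ?Q n] i x"
   proof (cases "\<kappa> - c < i")
    case True
    hence "x = 0[obj ?M i]" using Mb x by blast
    thus ?thesis using hom_zero[OF hom_cpx_hom[OF f] cc_module[OF M] cc_module[OF Uc], of i] hom_zero[OF hom_cpx_hom[OF z] cc_module[OF M] cc_module[OF Uc], of i] by simp
   next
    case False
    hence "\<kappa> < \<bar>i + n\<bar>" using n unfolding c'_def by linarith
    from Ub'[OF this] hom_cpx_closed[OF f x] hom_cpx_closed[OF z x] show ?thesis by simp
   qed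
  qed
  thus ?thesis using z by blast
 qed
 have zS: "zero_homology ?S n" if "n < c'" for n
  by (rule zero_homology_quasi_iso(2)[OF QS trivial_zero_homology[OF Qc Qb[OF that]]])
 have Sc: "CC ?S" by (rule chain_complex_hom[OF Tc Uc])
 \<comment> \<open>A free resolution of universe size links \<open>P\<close> to Hom(M, U): it is
   compared with \<open>P\<close> by K-projectivity, and it lifts through Hom(M, U) -> Hom(T,
   U).\<close>
 have exV: "EX (V :: ('a, ('a, 'v) univ => 'a) cpx) f Bs. (ALL i. obj V i = FM (Bs i)) & (ALL i::int. True) & (ALL i<c'. Bs i = {}) & QI V ?S f"
  by (rule free_resolution[OF Sc resolving_any[OF v Sc small_hom_free[OF T(1) Uc]]]) (rule zS)
 obtain V :: "('a, ('a, 'v) univ => 'a) cpx" and fV BV where V: "!!i. obj V i = FM (BV i)" "!!i. i < c' ==> BV i = {}" "QI V ?S fV"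
  using exV by (elim exE conjE) (rule that, erule spec, blast, assumption)
 obtain u where u: "QI V ?Q u" using free_lift_quasi_iso[OF QS V(3) V(1,2)] by blast
 have "small TYPE('v) V" unfolding small_def V(1) using free_module_encoding[OF v] by blast
 from K_projective_comparison[OF P(1) PS V(3) V(1,2) this] obtain gP hP where ghP: "heq P V gP hP" by blast
 note ucm = qi_cm[OF u]
 have Vb: "El V i = {0[obj V i]}" if "i < c'" for i unfolding V(1) V(2)[OF that] by auto
 \<comment> \<open>The cone is acyclic, bounded below and has flat terms, being built from free
   modules and from Hom between injectives.\<close>
 have "pure (cone V ?Q u) n" for n
 proof (rule flat_acyclic_pure[OF noeth chain_complex_cone[OF ucm] acyclic_cone[OF u]])
  show "flat (obj (cone V ?Q u) i)" for i unfolding cone_simps V(1) by (rule flat_dsum[OF flat_free flat_hom_cpx[OF noeth M Uc bU bM]])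
  show "El (cone V ?Q u) i = {0[obj (cone V ?Q u) i]}" if "i < c'" for i
   using Vb[of "i - 1"] Qb[OF that] that by simp
 qed
 note LQ = quasi_iso_Lambda[OF \<aa> u this]
 note F1 = qi_comp[OF heq_qi[OF heq_Lambda[OF \<aa> ghP]] qi_comp[OF LQ quasi_iso_Lambda_hom[OF noeth M Uc bU \<aa>]]]
 have I3M: "QI Xdag ?M (%n f. prec L fL n (postc X g2 n f))"
  unfolding I2(3) by (rule qi_comp[OF heq_postc_qi[OF gh2 Xc] prec_qi_baer[OF L(4) K(1) bK Kb]])
 obtain g3 h3 where gh3: "heq I3 ?M g3 h3"
  using K_injective_comparison[OF I3(1,2) I3M bM Mb small_hom_free[OF L(1) K(1)]] by blast
 have I3c: "CC I3" and I4c: "CC I4" using cm_complex(2)[OF qi_cm[OF I3(2)]] cm_complex(2)[OF qi_cm[OF I4(2)]] .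
 obtain gI where gI: "QI GXdag (tors_cpx \<aa> I3) gI" using quasi_iso_tors_Gamma(2)[OF \<aa> I3c] unfolding I3(3) by blast
 \<comment> \<open>\<open>Xdag\<close> is modelled by \<open>M\<close>, so the torsion parts of
   \<open>I3\<close> and \<open>M\<close> are homotopy equivalent; Hom into \<open>U\<close>
   reverses the maps, which puts them in the direction of the composite.\<close>
 note F2 = qi_comp[OF prec_qi_baer[OF heq_qi[OF heq_tors[OF gh3 \<aa>c]] Uc bU Ub] prec_qi_baer[OF gI Uc bU Ub]]
 have JW: "QI (tors_cpx \<bb> I4) J (%i x. \<eta>5 i (gclass \<bb> (obj I4 i) x))"
  by (rule qi_comp[OF quasi_iso_tors_Gamma(1)[OF \<bb> I4c] J(2)[unfolded I4(3)]])
 have UW: "QI (tors_cpx \<bb> I4) U g4" unfolding U_def by (rule heq_qi[OF heq_tors[OF gh4 \<bb>c]])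
 obtain g5 h5 where gh5: "heq J U g5 h5" using K_injective_comparison[OF J(1) JW UW bU Ub small_univ] by blast
 have GX: "CC GXdag" by (rule cm_complex(1)[OF qi_cm[OF gI]])
 note F3 = heq_postc_qi[OF heq_sym[OF gh5] GX]
 show ?thesis unfolding P(3) J(3) by (rule derived_isoI[OF qi_comp[OF F1 qi_comp[OF F2 F3]]])
qed

end

theorem lemma2p2:
  fixes R :: "('r, 'm) ring_scheme"
    and \<aa> \<bb> :: "'r set"
    and X D :: "('r, 'v) ucpx"
    and F :: "('r, nat \<Rightarrow> ('r set \<times> ('r, 'v) univ \<Rightarrow> 'r) set) cpx"
    and Xdag :: "('r, int \<Rightarrow> ('r, 'v) univ \<Rightarrow> ('r, 'v) univ) cpx"
    and GXdag GD :: "('r, (nat \<times> ('r set \<Rightarrow> ('r, 'v) univ)) set) cpx"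
    and H :: "('r, int \<Rightarrow> (nat \<times> ('r set \<Rightarrow> ('r, 'v) univ)) set \<Rightarrow> ('r, 'v) univ) cpx"
  assumes "cring R" and "noetherian_ring R" and "\<one>\<^bsub>R\<^esub> \<noteq> \<zero>\<^bsub>R\<^esub>"
    and "ideal \<aa> R" and "ideal \<bb> R"
    and "Dfb R X"
    and "normalized_dualizing_complex R D"
    and "RHom R X D Xdag"
    and "RGamma R \<aa> Xdag GXdag"
    and "RGamma R \<bb> D GD"
    and "RHom R GXdag GD H"
    and "formal_local R \<aa> \<bb> X F"
  shows "derived_iso R F H"
proof -
  interpret cring R by (rule assms(1))
  show ?thesis
    by (rule formal_local_duality[OF assms(2-6) _ assms(8-12)]) (use assms(7) in \<open>simp add: normalized_dualizing_complex_def\<close>)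
qed

end
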